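(* Let $T>0$, $d\ge1$, $1<p<\infty$, $\theta\in[0,1]$, and let $b\in L^1((0,T);W^{1,p}(\mathbb{R}^d;\mathbb{R}^d))\cap L^\infty((0,T)\times\mathbb{R}^d;\mathbb{R}^d)$ be a divergence-free velocity field. For each $t\in[0,T]$ let $Y(t,\cdot,\cdot)$ be the backward regular Lagrangian flow of $b$, let $\bar b_t$ be the backward vector field, and let $\{\bar b_t^\varepsilon\}_{\varepsilon>0}$ be an approximating sequence for $\bar b_t$ with constants $\bar C_0,\bar C_1,\bar C_2,\bar C_3,\alpha,\beta$ independent of $t$. For $N\in\mathbb{N}$ let $h=T/N$, $\varepsilon=h^{\frac1{2\beta}}$, and let $\tilde Y^{h,\theta,\varepsilon}$ be the approximate backward flow constructed from $\bar b^\varepsilon_t$ by the $\theta$-method. Then there exist a constant $C=C(d,p,T,\|b\|_{L^\infty_{t,x}},\|\nabla b\|_{L^1_tL^p_x},\bar C_1,\bar C_2)$ and $h_0\in(0,1)$ such that the following holds. Let $u_0\in L^1(\mathbb{R}^d)$, let $$u^h(t,x)=u_0\big(\tilde Y^{h,\theta,\varepsilon}(t,t,x)\big),\qquad u^L(t,x)=u_0\big(X^{-1}(t,\cdot)(x)\big)=u_0(Y(t,t,x)),$$ where $X$ is the regular Lagrangian flow of $b$ (so that $u^L$ is the unique Lagrangian solution of $\partial_tu+b\cdot\nabla u=0$, $u|_{t=0}=u_0$), and let $\{u_0^\delta\}_{\delta>0}$ be any family of smooth, compactly supported functions approximating $u_0$ in $L^1(\mathbb{R}^d)$ as $\delta\to0$.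 Then for every $\delta>0$ there is a constant $C_\delta$, independent of $h$ (and possibly blowing up as $\delta\to0$), such that for all $N$ with $h=T/N\le h_0$ $$\sup_{t\in[0,T]}\|u^h(t,\cdot)-u^L(t,\cdot)\|_{L^1(\mathbb{R}^d)}\le C\left(\|u_0^\delta-u_0\|_{L^1(\mathbb{R}^d)}+\frac{C_\delta}{|\log h|}\right).$$ In particular $u^h$ converges to $u^L$ in $L^\infty((0,T);L^1(\mathbb{R}^d))$ as $h\to0$.
   Context: Notation: $\mathcal{L}^d$ is Lebesgue measure, $\fint$ denotes the average integral; $L^q_tL^s_x$ denotes $L^q((0,T);L^s(\mathbb{R}^d))$. Regular Lagrangian flow: $X:[0,T]\times\mathbb{R}^d\to\mathbb{R}^d$ is the regular Lagrangian flow of a field $b$ if (i) for a.e. $x$ the map $t\mapsto X(t,x)$ is absolutely continuous and $X(t,x)=x+\int_0^tb(\tau,X(\tau,x))\,d\tau$ for all $t\in[0,T]$; (ii) there is $L>0$ independent of $t$ with $\mathcal{L}^d(X(t,\cdot)^{-1}(A))\le L\,\mathcal{L}^d(A)$ for every open $A$. For $b$ as in the claim it exists and is unique (DiPerna–Lions). Backward flow and backward field: for $t\in[0,T]$, $Y(t,\cdot,\cdot)$ is the regular Lagrangian flow (in the variable $s\in[0,t]$) of $$\partial_sY(t,s,x)=-b(t-s,Y(t,s,x)),\qquad Y(t,0,x)=x,$$ so that $X^{-1}(t,\cdot)=Y(t,t,\cdot)$ a.e. The backward vector field is $\bar b_t(s,x)=-b(t-s,x)$ if $s\le t$ and $\bar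 b_t(s,x)=0$ otherwise, $s\in(0,T)$. Approximating sequence: a family $\{c_\varepsilon\}_{\varepsilon>0}$ of velocity fields on $(0,T)\times\mathbb{R}^d$, measurable and smooth in the space variable, is an approximating sequence for a field $c$ with constants $\bar C_0,\bar C_1,\bar C_2,\bar C_3,\alpha,\beta>0$ if for all $\varepsilon$ $$\|c_\varepsilon-c\|_{L^1_tL^1_x}\le\bar C_0\varepsilon^\alpha,\quad \|\nabla c_\varepsilon\|_{L^\infty_tL^\infty_x}\le\frac{\bar C_1}{\varepsilon^\beta},\quad \|\operatorname{div}c_\varepsilon\|_{L^\infty_tL^\infty_x}\le\bar C_2,\quad\|c_\varepsilon\|_{L^\infty_tL^\infty_x}\le\bar C_3.$$ Approximate backward flow: let $h=T/N$, $t_i=ih$, $i=0,\dots,N$. For fixed $t$, set $Y_0^{\theta,\varepsilon}(t,x)=x$ and, given $Y_i^{\theta,\varepsilon}=Y_i^{\theta,\varepsilon}(t,x)$, let $Y_{i+1}^{\theta,\varepsilon}=Y_{i+1}^{\theta,\varepsilon}(t,x)$ solve $$\frac{Y_{i+1}^{\theta,\varepsilon}-Y_i^{\theta,\varepsilon}}{h}=(1-\theta)\fint_{t_i}^{t_{i+1}}\bar b_t^\varepsilon(\tau,Y_i^{\theta,\varepsilon})\,d\tau+\theta\fint_{t_i}^{t_{i+1}}\bar b_t^\varepsilon(\tau,Y_{i+1}^{\theta,\varepsilon})\,d\tau$$ (uniquely solvable when $\theta h\|\nabla\bar b_t^\varepsilon\|_{L^\infty}<1$, which holds for $\varepsilon=h^{1/(2\beta)}$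 and $h$ small). For $s\in[0,t]$ with $s\in[t_i,t_{i+1}]$, $$\tilde Y^{h,\theta,\varepsilon}(t,s,x)=Y_i^{\theta,\varepsilon}(t,x)+\frac{s-t_i}{h}\big(Y_{i+1}^{\theta,\varepsilon}(t,x)-Y_i^{\theta,\varepsilon}(t,x)\big)$$ (the values agree at the nodes). *)

theory Defs
  imports "HOL-Analysis.Analysis" "HOL-Probability.Essential_Supremum"
begin

text \<open>
  The dimension is \<open>d = CARD('n)\<close>. Space-time fields are curried, time first. Only their values at
  times in the open interval \<open>(0,T)\<close> matter.
\<close>

section \<open>Smooth functions and calculus in space\<close>

primrec times_cont_differentiable ::
  "nat \<Rightarrow> ('a::real_normed_vector \<Rightarrow> 'b::real_normed_vector) \<Rightarrow> bool" where
  "times_cont_differentiable 0 f \<longleftrightarrow> continuous_on UNIV f"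
| "times_cont_differentiable (Suc k) f \<longleftrightarrow>
     (\<forall>x. f differentiable (at x)) \<and>
     (\<forall>v. times_cont_differentiable k (\<lambda>x. frechet_derivative f (at x) v))"

definition smooth :: "('a::real_normed_vector \<Rightarrow> 'b::real_normed_vector) \<Rightarrow> bool" where
  "smooth f \<longleftrightarrow> (\<forall>k. times_cont_differentiable k f)"

definition test_function :: "(real^'n \<Rightarrow> real) \<Rightarrow> bool" where
  "test_function \<phi> \<longleftrightarrow> smooth \<phi> \<and> compact (closure {x. \<phi> x \<noteq> 0})"

text \<open>The norm of the type \<open>real^'n^'n\<close>, used for all gradients below, is the Frobenius norm.\<close>

definition jacobian :: "(real^'n \<Rightarrow> real^'n) \<Rightarrow> real^'n \<Rightarrow> real^'n^'n" where
  "jacobian f x = matrix (frechet_derivative f (at x))"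

definition divergence :: "(real^'n \<Rightarrow> real^'n) \<Rightarrow> real^'n \<Rightarrow> real" where
  "divergence f x = trace (jacobian f x)"

section \<open>Lebesgue and Sobolev norms\<close>

definition space_time :: "real \<Rightarrow> (real \<times> (real^'n)) measure" where
  "space_time T = lebesgue_on ({0<..<T} \<times> UNIV)"

definition L1_norm :: "(real^'n \<Rightarrow> 'b::real_normed_vector) \<Rightarrow> ennreal" where
  "L1_norm f = (\<integral>\<^sup>+x. ennreal (norm (f x)) \<partial>lebesgue)"

definition L1L1_norm :: "real \<Rightarrow> (real \<Rightarrow> real^'n \<Rightarrow> 'b::real_normed_vector) \<Rightarrow> ennreal" where
  "L1L1_norm T c = (\<integral>\<^sup>+z. ennreal (norm (c (fst z) (snd z))) \<partial>space_time T)"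

definition Linf_norm :: "real \<Rightarrow> (real \<Rightarrow> real^'n \<Rightarrow> 'b::real_normed_vector) \<Rightarrow> ennreal" where
  "Linf_norm T c = esssup (space_time T) (\<lambda>z. ennreal (norm (c (fst z) (snd z))))"

text \<open>
  The norm of \<open>L\<^sup>\<infinity>((0,T); L\<^sup>1)\<close>. The constant \<^const>\<open>esssup\<close> is \<open>Limsup (ae_filter M)\<close> guarded by a
  measurability test. The guard is dropped here, because the fields approximating the backward
  field for different \<open>t\<close> are unrelated, so \<open>t \<mapsto> \<parallel>w(t)\<parallel>\<close> need not be measurable.
\<close>

definition LinfL1_norm :: "real \<Rightarrow> (real \<Rightarrow> real^'n \<Rightarrow> 'b::real_normed_vector) \<Rightarrow> ennreal" where
  "LinfL1_norm T w = Limsup (ae_filter (lebesgue_on {0<..<T})) (\<lambda>t. L1_norm (w t))"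

definition in_Lp :: "real \<Rightarrow> (real^'n \<Rightarrow> 'b::real_normed_vector) \<Rightarrow> bool" where
  "in_Lp p f \<longleftrightarrow> f \<in> borel_measurable lebesgue \<and> integrable lebesgue (\<lambda>x. norm (f x) powr p)"

definition Lp_norm :: "real \<Rightarrow> (real^'n \<Rightarrow> 'b::real_normed_vector) \<Rightarrow> real" where
  "Lp_norm p f = (LINT x|lebesgue. norm (f x) powr p) powr (1 / p)"

definition in_W1p :: "real \<Rightarrow> (real^'n \<Rightarrow> real^'n) \<Rightarrow> (real^'n \<Rightarrow> real^'n^'n) \<Rightarrow> bool" where
  "in_W1p p f Df \<longleftrightarrow> in_Lp p f \<and> in_Lp p Df \<and>
     (\<forall>\<phi> i j. test_function \<phi> \<longrightarrow>
        (LINT x|lebesgue. f x $ i * frechet_derivative \<phi> (at x) (axis j 1)) =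
        - (LINT x|lebesgue. Df x $ i $ j * \<phi> x))"

text \<open>\<open>b \<in> L\<^sup>1((0,T); W\<^sup>1\<^sup>,\<^sup>p)\<close>, with weak spatial gradient \<open>Db\<close>.\<close>

definition in_L1_W1p ::
  "real \<Rightarrow> real \<Rightarrow> (real \<Rightarrow> real^'n \<Rightarrow> real^'n) \<Rightarrow> (real \<Rightarrow> real^'n \<Rightarrow> real^'n^'n) \<Rightarrow> bool" where
  "in_L1_W1p T p b Db \<longleftrightarrow>
     (\<lambda>z. b (fst z) (snd z)) \<in> borel_measurable (space_time T) \<and>
     (\<lambda>z. Db (fst z) (snd z)) \<in> borel_measurable (space_time T) \<and>
     (AE t in lebesgue_on {0<..<T}. in_W1p p (b t) (Db t)) \<and>
     integrable (lebesgue_on {0<..<T}) (\<lambda>t. Lp_norm p (b t)) \<and>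
     integrable (lebesgue_on {0<..<T}) (\<lambda>t. Lp_norm p (Db t))"

definition L1_Lp_norm ::
  "real \<Rightarrow> real \<Rightarrow> (real \<Rightarrow> real^'n \<Rightarrow> 'b::real_normed_vector) \<Rightarrow> real" where
  "L1_Lp_norm T p f = (LINT t|lebesgue_on {0<..<T}. Lp_norm p (f t))"

text \<open>The distributional divergence of a Sobolev field is the trace of its weak gradient.\<close>

definition divergence_free :: "real \<Rightarrow> (real \<Rightarrow> real^'n \<Rightarrow> real^'n^'n) \<Rightarrow> bool" where
  "divergence_free T Db \<longleftrightarrow> (AE z in space_time T. trace (Db (fst z) (snd z)) = 0)"

section \<open>Regular Lagrangian flows\<close>

definition absolutely_continuous_on :: "real \<Rightarrow> real \<Rightarrow> (real \<Rightarrow> 'b::metric_space) \<Rightarrow> bool" where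
  "absolutely_continuous_on a b f \<longleftrightarrow>
     (\<forall>e>0. \<exists>d>0. \<forall>I :: (real \<times> real) set.
        finite I \<and> (\<forall>(u, v) \<in> I. a \<le> u \<and> u \<le> v \<and> v \<le> b) \<and>
        pairwise (\<lambda>P Q. {fst P<..<snd P} \<inter> {fst Q<..<snd Q} = {}) I \<and>
        (\<Sum>(u, v) \<in> I. v - u) < d
        \<longrightarrow> (\<Sum>(u, v) \<in> I. dist (f u) (f v)) < e)"

text \<open>
  Integrability along trajectories and measurability of \<open>X t\<close> are explicit, because the Bochner
  integral of a non-integrable function and the measure of a non-measurable set are \<open>0\<close> by
  convention.
\<close>

definition regular_lagrangian_flow ::
  "real \<Rightarrow> (real \<Rightarrow> real^'n \<Rightarrow> real^'n) \<Rightarrow> (real \<Rightarrow> real^'n \<Rightarrow> real^'n) \<Rightarrow> bool" where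
  "regular_lagrangian_flow T b X \<longleftrightarrow>
     (AE x in lebesgue.
        absolutely_continuous_on 0 T (\<lambda>t. X t x) \<and>
        (\<forall>t\<in>{0..T}. integrable (lebesgue_on {0..t}) (\<lambda>\<tau>. b \<tau> (X \<tau> x)) \<and>
           X t x = x + (LINT \<tau>|lebesgue_on {0..t}. b \<tau> (X \<tau> x)))) \<and>
     (\<forall>t\<in>{0..T}. X t \<in> borel_measurable lebesgue) \<and>
     (\<exists>L>0. \<forall>t\<in>{0..T}. \<forall>A. open A \<longrightarrow>
        emeasure lebesgue (X t -` A) \<le> ennreal L * emeasure lebesgue A)"

definition backward_field ::
  "(real \<Rightarrow> real^'n \<Rightarrow> real^'n) \<Rightarrow> real \<Rightarrow> real \<Rightarrow> real^'n \<Rightarrow> real^'n" where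
  "backward_field b t s x = (if s \<le> t then - b (t - s) x else 0)"

definition backward_flow ::
  "real \<Rightarrow> (real \<Rightarrow> real^'n \<Rightarrow> real^'n) \<Rightarrow> (real \<Rightarrow> real \<Rightarrow> real^'n \<Rightarrow> real^'n) \<Rightarrow> bool" where
  "backward_flow T b Y \<longleftrightarrow>
     (\<forall>t\<in>{0..T}. regular_lagrangian_flow t (backward_field b t) (Y t))"

section \<open>Approximating sequences and the theta-method\<close>

definition approximating_sequence ::
  "real \<Rightarrow> (real \<Rightarrow> real^'n \<Rightarrow> real^'n) \<Rightarrow> (real \<Rightarrow> real \<Rightarrow> real^'n \<Rightarrow> real^'n) \<Rightarrow>
   real \<Rightarrow> real \<Rightarrow> real \<Rightarrow> real \<Rightarrow> real \<Rightarrow> real \<Rightarrow> bool" where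
  "approximating_sequence T c ce C0 C1 C2 C3 \<alpha> \<beta> \<longleftrightarrow>
     (\<forall>\<epsilon>>0.
        (\<lambda>z. ce \<epsilon> (fst z) (snd z)) \<in> borel_measurable (space_time T) \<and>
        (AE s in lebesgue_on {0<..<T}. smooth (ce \<epsilon> s)) \<and>
        L1L1_norm T (\<lambda>s x. ce \<epsilon> s x - c s x) \<le> ennreal (C0 * \<epsilon> powr \<alpha>) \<and>
        Linf_norm T (\<lambda>s. jacobian (ce \<epsilon> s)) \<le> ennreal (C1 / \<epsilon> powr \<beta>) \<and>
        Linf_norm T (\<lambda>s. divergence (ce \<epsilon> s)) \<le> ennreal C2 \<and>
        Linf_norm T (ce \<epsilon>) \<le> ennreal C3)"

definition step_average ::
  "real \<Rightarrow> (real \<Rightarrow> real^'n \<Rightarrow> real^'n) \<Rightarrow> nat \<Rightarrow> real^'n \<Rightarrow> real^'n" where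
  "step_average h c i y =
     (1 / h) *\<^sub>R (LINT \<tau>|lebesgue_on {real i * h..real (Suc i) * h}. c \<tau> y)"

primrec theta_node ::
  "real \<Rightarrow> real \<Rightarrow> (real \<Rightarrow> real^'n \<Rightarrow> real^'n) \<Rightarrow> real^'n \<Rightarrow> nat \<Rightarrow> real^'n" where
  "theta_node h \<theta> c x 0 = x"
| "theta_node h \<theta> c x (Suc i) =
     (THE y. (1 / h) *\<^sub>R (y - theta_node h \<theta> c x i) =
        (1 - \<theta>) *\<^sub>R step_average h c i (theta_node h \<theta> c x i) + \<theta> *\<^sub>R step_average h c i y)"

text \<open>At \<open>s = N * h\<close> the index is \<open>N\<close> and the (meaningless) node \<open>N + 1\<close> has weight \<open>0\<close>.\<close>

definition theta_flow ::
  "real \<Rightarrow> real \<Rightarrow> (real \<Rightarrow> real^'n \<Rightarrow> real^'n) \<Rightarrow> real \<Rightarrow> real^'n \<Rightarrow> real^'n" where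
  "theta_flow h \<theta> c s x =
     (let i = nat \<lfloor>s / h\<rfloor> in
        theta_node h \<theta> c x i +
        ((s - real i * h) / h) *\<^sub>R (theta_node h \<theta> c x (Suc i) - theta_node h \<theta> c x i))"

text \<open>The argument \<open>be t \<epsilon>\<close> is the \<open>\<epsilon>\<close>-approximation of \<open>backward_field b t\<close>.\<close>

definition approx_solution ::
  "real \<Rightarrow> real \<Rightarrow> (real \<Rightarrow> real \<Rightarrow> real \<Rightarrow> real^'n \<Rightarrow> real^'n) \<Rightarrow> (real^'n \<Rightarrow> real) \<Rightarrow>
   real \<Rightarrow> real \<Rightarrow> real^'n \<Rightarrow> real" where
  "approx_solution \<theta> \<beta> be u0 h t x =
     u0 (theta_flow h \<theta> (be t (h powr (1 / (2 * \<beta>)))) t x)"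

text \<open>\<open>Y t t\<close> is almost everywhere the inverse of the forward flow at time \<open>t\<close>.\<close>

definition lagrangian_solution ::
  "(real \<Rightarrow> real \<Rightarrow> real^'n \<Rightarrow> real^'n) \<Rightarrow> (real^'n \<Rightarrow> real) \<Rightarrow> real \<Rightarrow> real^'n \<Rightarrow> real" where
  "lagrangian_solution Y u0 t x = u0 (Y t t x)"

end

theory Submission
  imports Defs "HOL-Computational_Algebra.Polynomial"
begin

text \<open>
  The scheme is compared with the backward flow \<open>Y\<close> through the functional
  \<open>\<integral>\<^sub>E ln (1 + \<bar>Z - Y\<bar> / \<delta>)\<close> of Crippa and De Lellis, on a set \<open>E\<close> of finite measure. With
  \<open>\<epsilon> = h\<^bsup>1/(2\<beta>)\<^esup>\<close> the regularised field has gradient at most \<open>C\<^sub>1 h\<^bsup>-1/2\<^esup>\<close>, so one step of the theta-method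
  has Jacobian \<open>1 + O(h)\<close>: the divergence contributes \<open>O(h)\<close> and the quadratic terms \<open>h\<^sup>2 \<bar>\<nabla>b\<bar>\<^sup>2 = O(h)\<close>.
  Hence the scheme compresses Lebesgue measure by a factor depending only on \<open>d, T, C\<^sub>1, C\<^sub>2\<close>. A Sobolev
  field satisfies \<open>\<bar>b(x) - b(y)\<bar> \<le> k \<bar>x - y\<bar> (M\<bar>\<nabla>b\<bar>(x) + M\<bar>\<nabla>b\<bar>(y))\<close> off a null set, with \<open>M\<close> the maximal
  function, and \<open>M\<bar>\<nabla>b\<bar>\<close> is integrable along both flows; differentiating the functional in time
  therefore bounds it uniformly in \<open>h\<close> when \<open>\<delta>\<close> is a small power \<open>h\<^bsup>\<omega>\<^esup>\<close>, and the logarithm turns this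
  bound into the rate \<open>1 / \<bar>ln h\<bar>\<close> for test functions. The compression constant of \<open>Y\<close> is unspecified
  a priori; since the scheme converges to \<open>Y\<close> in measure, \<open>Y\<close> inherits the constant of the scheme,
  which is why \<open>C\<close> does not depend on the flow.
\<close>

section \<open>Borel representatives and maps of bounded compression\<close>

text \<open>Two obstacles shape the argument. The approximating fields for different
  \<open>t\<close> are unrelated and need not depend measurably on \<open>t\<close>; so
  \<open>t\<close> is frozen, all constants are chosen before it, and the supremum over
  \<open>t\<close> is taken only at the very end. Second, the hypotheses concern Lebesgue measurable
  functions up to null sets, and composing these with flows makes sense only if preimages of null
  sets are null. Fields and flows are therefore replaced by jointly Borel representatives, and
  bounded compression transports almost-everywhere statements along trajectories. The maximal
  function is controlled by its weak-type bound alone: summing dyadic levels from 1 +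
  ||Db(\<tau>)||_p upwards gives an integral linear in that norm, matching mere integrability in
  time. The pointwise Sobolev inequality is proved for Sobolev functions that are L1 limits of
  Lipschitz functions; the approximating sequence supplies these at almost every time. The stability
  bound contains the compression constant of the flow and is used twice: with the unknown constant
  to prove convergence, then with the inherited one to get the rate.\<close>

abbreviation (input) jointly_borel ::
  "('a::topological_space \<Rightarrow> 'b::topological_space \<Rightarrow> 'c::topological_space) \<Rightarrow> bool" where
  "jointly_borel f \<equiv> (\<lambda>z. f (fst z) (snd z)) \<in> borel_measurable borel"

lemma lebesgue_ex_borel:
  fixes f :: "'a::euclidean_space \<Rightarrow> 'b::euclidean_space"
  assumes f: "f \<in> borel_measurable lebesgue"
  shows "\<exists>g\<in>borel_measurable borel. AE x in lborel. f x = g x"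
proof -
  have "\<exists>g\<in>borel_measurable lborel. AE x in lborel. f x \<bullet> b = g x" for b
    using f by (intro completion_ex_borel_measurable_real) auto
  then obtain g where g: "\<And>b. g b \<in> borel_measurable lborel" "\<And>b. AE x in lborel. f x \<bullet> b = g b x"
    by metis
  have [measurable]: "g b \<in> borel_measurable borel" for b
    using g(1)[of b] by simp
  have ae: "AE x in lborel. \<forall>b\<in>Basis. f x \<bullet> b = g b x"
    using g(2) by (intro AE_finite_allI) auto
  show ?thesis
  proof (rule bexI)
    show "AE x in lborel. f x = (\<Sum>b\<in>Basis. g b x *\<^sub>R b)"
      using ae by eventually_elim (metis (no_types, lifting) euclidean_representation sum.cong)
  qed measurable
qed

lemma lebesgue_on_ex_borel:
  fixes f :: "'a::euclidean_space \<Rightarrow> 'b::euclidean_space"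
  assumes f: "f \<in> borel_measurable (lebesgue_on S)" and S: "S \<in> sets lebesgue"
  shows "\<exists>g\<in>borel_measurable borel. AE x in lborel. x \<in> S \<longrightarrow> f x = g x"
proof -
  have "(\<lambda>x. if x \<in> S then f x else 0) \<in> borel_measurable lebesgue"
    using f S by (simp add: borel_measurable_if)
  from lebesgue_ex_borel[OF this] obtain g where "g \<in> borel_measurable borel"
    "AE x in lborel. (if x \<in> S then f x else 0) = g x" by auto
  then show ?thesis by (intro bexI[of _ g]) (auto elim: eventually_mono)
qed

text \<open>Clause (ii) of a regular Lagrangian flow with the constant made explicit. It is stated
  for open sets, which is the form that the hypotheses give and the form that passes to limits. A
  negative \<open>L\<close> acts as 0.\<close>

definition compressible :: "real \<Rightarrow> ('a::euclidean_space \<Rightarrow> 'a) \<Rightarrow> bool" where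
  "compressible L U \<longleftrightarrow> U \<in> borel_measurable borel \<and>
     (\<forall>A. open A \<longrightarrow> emeasure lborel (U -` A) \<le> ennreal L * emeasure lborel A)"

lemma compressible_measurable: "compressible L U \<Longrightarrow> U \<in> borel_measurable borel"
  by (simp add: compressible_def)

text \<open>Outer regularity extends the bound from open to Borel sets: the excess of an open
  superset can be made so small that even \<open>L\<close> times it stays below
  \<open>e\<close>.\<close>

lemma compressible_emeasure:
  assumes U: "compressible L U" and B: "B \<in> sets borel"
  shows "emeasure lborel (U -` B) \<le> ennreal L * emeasure lborel B"
proof (rule ennreal_le_epsilon)
  fix e :: real assume e: "0 < e"
  note [measurable] = compressible_measurable[OF U] B
  define e' where "e' = e / (\<bar>L\<bar> + 1)"
  have e': "0 < e'" using e by (simp add: e'_def)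
  obtain V where V: "open V" "B \<subseteq> V" "emeasure lborel (V - B) < ennreal e'"
    using outer_regular_lborel[OF B e'] by blast
  have [measurable]: "V \<in> sets borel" using V by auto
  have "emeasure lborel (U -` B) \<le> emeasure lborel (U -` V)"
    using V measurable_sets[OF compressible_measurable[OF U], of V]
    by (intro emeasure_mono) auto
  also have "\<dots> \<le> ennreal L * emeasure lborel V"
    using U V by (simp add: compressible_def)
  also have "emeasure lborel V = emeasure lborel B + emeasure lborel (V - B)"
    using V by (subst plus_emeasure) (auto intro!: arg_cong[where f="emeasure lborel"])
  also have "ennreal L * \<dots> \<le> ennreal L * (emeasure lborel B + ennreal e')"
    using V by (intro mult_left_mono add_left_mono) auto
  also have "\<dots> = ennreal L * emeasure lborel B + ennreal L * ennreal e'"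
    by (simp add: distrib_left)
  also have "ennreal L * ennreal e' \<le> ennreal e"
  proof (cases "L \<ge> 0")
    case True
    have "L * e' \<le> (\<bar>L\<bar> + 1) * e'" using e' by (intro mult_right_mono) auto
    also have "\<dots> = e" by (simp add: e'_def)
    finally show ?thesis using e' True by (simp add: ennreal_mult[symmetric] ennreal_leI)
  next
    case False
    then show ?thesis by (simp add: ennreal_neg)
  qed
  finally show "emeasure lborel (U -` B) \<le> ennreal L * emeasure lborel B + ennreal e"
    by (simp add: add_left_mono)
qed

text \<open>Preimages of null sets are null. This carries almost-everywhere statements about fields
  over to trajectories, and later also through time reversal.\<close>

lemma compressible_AE:
  assumes U: "compressible L U" and P: "AE y in lborel. P y"
  shows "AE x in lborel. P (U x)"
proof -
  obtain N where N: "{y. \<not> P y} \<subseteq> N" "emeasure lborel N = 0" "N \<in> sets lborel"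
    using P by (auto elim: AE_E)
  have "emeasure lborel (U -` N) \<le> ennreal L * emeasure lborel N"
    using N by (intro compressible_emeasure[OF U]) auto
  then have "emeasure lborel (U -` N) = 0" using N by simp
  moreover have "U -` N \<in> sets lborel"
    using measurable_sets[OF compressible_measurable[OF U], of N] N by simp
  ultimately have "AE x in lborel. x \<notin> U -` N"
    by (intro AE_not_in) auto
  then show ?thesis by eventually_elim (use N in auto)
qed

text \<open>The change of variables inequality, by monotone induction over nonnegative Borel
  functions. It stands in for a Jacobian, since flows of Sobolev fields need not be
  differentiable.\<close>

lemma compressible_nn_integral:
  assumes U: "compressible L U" and f: "f \<in> borel_measurable borel"
  shows "(\<integral>\<^sup>+x. f (U x) \<partial>lborel) \<le> ennreal L * (\<integral>\<^sup>+x. f x \<partial>lborel)"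
proof -
  note m[measurable] = compressible_measurable[OF U]
  have f': "f \<in> borel_measurable lborel" using f by simp
  from f' show ?thesis
  proof (induction rule: borel_measurable_induct)
    case (cong f g)
    then show ?case by simp
  next
    case (set A)
    then have "A \<in> sets borel" by simp
    note compressible_emeasure[OF U this]
    moreover have "(\<lambda>x. indicator A (U x) :: ennreal) = indicator (U -` A)"
      by (auto simp: indicator_def)
    moreover have "U -` A \<in> sets borel"
      using measurable_sets[OF m, of A] set by simp
    ultimately show ?case using set by simp
  next
    case (mult u c)
    have [measurable]: "u \<in> borel_measurable borel" using mult by simp
    show ?case using mult.IH
      by (simp add: nn_integral_cmult mult.left_commute mult_left_mono)
  next
    case (add u v)
    have [measurable]: "u \<in> borel_measurable borel" "v \<in> borel_measurable borel" using add by auto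
    show ?case using add.IH
      by (simp add: nn_integral_add distrib_left add_mono)
  next
    case (seq V)
    have [measurable]: "V i \<in> borel_measurable borel" for i using seq by auto
    have "(\<integral>\<^sup>+x. (SUP i. V i) (U x) \<partial>lborel) = (SUP i. \<integral>\<^sup>+x. V i (U x) \<partial>lborel)"
      using seq by (subst nn_integral_monotone_convergence_SUP[symmetric])
        (auto simp: incseq_def le_fun_def image_comp)
    also have "\<dots> \<le> (SUP i. ennreal L * (\<integral>\<^sup>+x. V i x \<partial>lborel))"
      using seq.IH by (intro SUP_mono) auto
    also have "\<dots> = ennreal L * (SUP i. \<integral>\<^sup>+x. V i x \<partial>lborel)"
      by (rule SUP_mult_left_ennreal[symmetric])
    also have "(SUP i. \<integral>\<^sup>+x. V i x \<partial>lborel) = (\<integral>\<^sup>+x. (SUP i. V i x) \<partial>lborel)"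
      using seq by (subst nn_integral_monotone_convergence_SUP) (auto)
    finally show ?case by (simp add: image_comp)
  qed
qed

lemma compressible_mono: "compressible L U \<Longrightarrow> L \<le> M \<Longrightarrow> compressible M U"
  unfolding compressible_def
proof (elim conjE, intro conjI allI impI)
  fix A :: "'a set"
  assume "L \<le> M" "open A"
    and *: "\<forall>A. open A \<longrightarrow> emeasure lborel (U -` A) \<le> ennreal L * emeasure lborel A"
  then have "emeasure lborel (U -` A) \<le> ennreal L * emeasure lborel A" by blast
  also have "\<dots> \<le> ennreal M * emeasure lborel A"
    using \<open>L \<le> M\<close> by (intro mult_right_mono ennreal_leI) auto
  finally show "emeasure lborel (U -` A) \<le> ennreal M * emeasure lborel A" .
qed

lemma compressible_id: "compressible 1 (\<lambda>x. x)"
  by (simp add: compressible_def)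

lemma compressible_comp:
  assumes "compressible L U" "compressible M V" "0 \<le> L" "0 \<le> M"
  shows "compressible (L * M) (\<lambda>x. V (U x))"
  unfolding compressible_def
proof (intro conjI allI impI)
  note [measurable] = compressible_measurable[OF assms(1)] compressible_measurable[OF assms(2)]
  show "(\<lambda>x. V (U x)) \<in> borel_measurable borel" by measurable
  fix A :: "'a set" assume A: "open A"
  have s: "V -` A \<in> sets borel"
    using measurable_sets[OF compressible_measurable[OF assms(2)], of A] A by simp
  have "(\<lambda>x. V (U x)) -` A = U -` (V -` A)" by auto
  then have "emeasure lborel ((\<lambda>x. V (U x)) -` A) \<le> ennreal L * emeasure lborel (V -` A)"
    using compressible_emeasure[OF assms(1) s] by simp
  also have "\<dots> \<le> ennreal L * (ennreal M * emeasure lborel A)"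
    using assms A by (intro mult_left_mono) (auto simp: compressible_def)
  finally show "emeasure lborel ((\<lambda>x. V (U x)) -` A) \<le> ennreal (L * M) * emeasure lborel A"
    using assms by (simp add: ennreal_mult mult.assoc)
qed

section \<open>Joint measurability, exchange of quantifiers and of integrals\<close>

lemma borel_measurable_fst_borel [measurable]:
  "fst \<in> borel_measurable (borel :: ('a::second_countable_topology \<times> 'b::second_countable_topology) measure)"
  and borel_measurable_snd_borel [measurable]:
  "snd \<in> borel_measurable (borel :: ('a \<times> 'b) measure)"
  by (auto intro!: borel_measurable_continuous_onI continuous_intros)

text \<open>The point \<open>y\<close> is approximated by simple functions \<open>q i\<close>. As
  \<open>q i\<close> has finitely many values, \<open>f a (q i y)\<close> is a finite gluing of
  measurable sections, and continuity in \<open>y\<close> gives the limit.\<close>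

lemma caratheodory_borel:
  fixes f :: "'a::euclidean_space \<Rightarrow> 'b::euclidean_space \<Rightarrow> 'c::euclidean_space"
  assumes m: "\<And>y. (\<lambda>a. f a y) \<in> borel_measurable borel"
    and c: "\<And>a. continuous_on UNIV (f a)"
  shows "jointly_borel f"
proof -
  have "(\<lambda>x::'b. x) \<in> borel_measurable borel" by simp
  from borel_measurable_implies_sequence_metric[OF this, of 0]
  obtain q :: "nat \<Rightarrow> 'b \<Rightarrow> 'b" where q: "\<And>i. simple_function borel (q i)"
    "\<And>x. (\<lambda>i. q i x) \<longlonglongrightarrow> x" by auto
  show ?thesis
  proof (rule borel_measurable_LIMSEQ_metric)
    fix i
    have fin: "finite (range (q i))" using q(1)[of i] by (simp add: simple_function_def)
    have qm: "q i \<in> borel_measurable borel"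
      using borel_measurable_simple_function[OF q(1)[of i]] .
    have "(\<lambda>z :: 'a \<times> 'b. q i (snd z)) \<in> borel \<rightarrow>\<^sub>M count_space (range (q i))"
      unfolding measurable_count_space_eq2[OF fin]
    proof (intro conjI ballI)
      fix a assume "a \<in> range (q i)"
      show "(\<lambda>z::'a\<times>'b. q i (snd z)) -` {a} \<inter> space borel \<in> sets borel"
        by (rule measurable_sets[OF measurable_compose[OF borel_measurable_snd_borel qm]]) simp
    qed simp
    moreover have "(\<lambda>z :: 'a \<times> 'b. f (fst z) y) \<in> borel_measurable borel" for y
      by (rule measurable_compose[OF borel_measurable_fst_borel m])
    ultimately show "(\<lambda>z :: 'a \<times> 'b. f (fst z) (q i (snd z))) \<in> borel_measurable borel"
      using measurable_compose_countable'[where f="\<lambda>y (z :: 'a \<times> 'b). f (fst z) y" and g="\<lambda>z. q i (snd z)",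
          OF _ _ countable_finite[OF fin]] by blast
  next
    fix z :: "'a \<times> 'b"
    show "(\<lambda>i. f (fst z) (q i (snd z))) \<longlonglongrightarrow> f (fst z) (snd z)"
      using continuous_on_tendsto_compose[OF c[of "fst z"] q(2)[of "snd z"]] by simp
  qed
qed

text \<open>Continuity in \<open>y\<close> lets countably many sections decide everything: off one
  null set \<open>N\<close> the sections at a countable dense set agree with Borel functions, and
  the value 0 on \<open>N\<close> keeps the modification continuous in \<open>y\<close> for every
  \<open>a\<close>. Measurability is asked on a dense set because a function known up to null sets
  has good sections only at almost every \<open>y\<close>.\<close>

lemma caratheodory_representative:
  fixes f :: "'a::euclidean_space \<Rightarrow> 'b::euclidean_space \<Rightarrow> 'c::euclidean_space"
  assumes m: "\<And>y. y \<in> D \<Longrightarrow> (\<lambda>a. f a y) \<in> borel_measurable lebesgue" and D: "closure D = UNIV"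
    and c: "AE a in lborel. continuous_on UNIV (f a)"
  shows "\<exists>N\<in>null_sets lborel. (\<lambda>z. if fst z \<in> N then 0 else f (fst z) (snd z)) \<in> borel_measurable borel \<and>
    (\<forall>a. a \<notin> N \<longrightarrow> continuous_on UNIV (f a))"
proof -
  obtain D' where D': "countable D'" "D' \<subseteq> D" "D \<subseteq> closure D'"
    using separable[of D] by metis
  have dense: "closure D' = UNIV"
    using D' D by (metis closure_closure closure_mono top.extremum_uniqueI)
  have "\<forall>y\<in>D'. \<exists>g\<in>borel_measurable borel. AE a in lborel. f a y = g a"
    using m D' by (auto intro!: lebesgue_ex_borel)
  then obtain g where g: "\<And>y. y \<in> D' \<Longrightarrow> g y \<in> borel_measurable borel"
    "\<And>y. y \<in> D' \<Longrightarrow> AE a in lborel. f a y = g y a" by metis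
  have "AE a in lborel. continuous_on UNIV (f a) \<and> (\<forall>y\<in>D'. f a y = g y a)"
    using c g D' by (auto simp: AE_ball_countable)
  from AE_E[OF this] obtain N where N: "{a. \<not> (continuous_on UNIV (f a) \<and> (\<forall>y\<in>D'. f a y = g y a))} \<subseteq> N"
    "emeasure lborel N = 0" "N \<in> sets lborel"
    by auto
  have [measurable]: "N \<in> sets borel" using N by simp
  define F where "F a y = (if a \<in> N then 0 else f a y)" for a y
  have cF: "continuous_on UNIV (F a)" for a
  proof (cases "a \<in> N")
    case False
    then have "continuous_on UNIV (f a)" using N by blast
    then show ?thesis using False by (simp add: F_def)
  qed (simp add: F_def)
  have mF: "(\<lambda>a. F a y) \<in> borel_measurable borel" if "y \<in> D'" for y
  proof -
    have [measurable]: "g y \<in> borel_measurable borel" using g that by auto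
    have "(\<lambda>a. F a y) = (\<lambda>a. if a \<in> N then 0 else g y a)"
      using N that unfolding F_def by fastforce
    then show ?thesis by simp
  qed
  have "(\<lambda>a. F a y) \<in> borel_measurable borel" for y
  proof -
    have "y \<in> closure D'" using dense by simp
    then obtain s where s: "\<And>n::nat. s n \<in> D'" "s \<longlonglongrightarrow> y" by (auto simp: closure_sequential)
    show ?thesis
    proof (rule borel_measurable_LIMSEQ_metric)
      show "(\<lambda>a. F a (s n)) \<in> borel_measurable borel" for n using mF s by auto
      show "(\<lambda>n. F a (s n)) \<longlonglongrightarrow> F a y" for a
        using cF[of a] s by (intro continuous_on_tendsto_compose[of UNIV "F a"]) auto
    qed
  qed
  from caratheodory_borel[OF this cF]
  have "jointly_borel F" .
  moreover have "N \<in> null_sets lborel" using N by auto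
  ultimately show ?thesis unfolding F_def using N by (intro bexI[of _ N]) blast+
qed

lemma AE_lborel_pairD:
  fixes P :: "'a::euclidean_space \<Rightarrow> 'b::euclidean_space \<Rightarrow> bool"
  assumes "AE z in lborel. P (fst z) (snd z)"
  shows "AE a in lborel. AE b in lborel. P a b"
proof -
  have "AE z in lborel \<Otimes>\<^sub>M lborel. P (fst z) (snd z)"
    unfolding lborel_prod by (rule assms)
  from lborel_pair.AE_pair[OF this] show ?thesis by simp
qed

lemma AE_lborel_pairI:
  fixes P :: "'a::euclidean_space \<Rightarrow> 'b::euclidean_space \<Rightarrow> bool"
  assumes m: "Measurable.pred borel (\<lambda>z. P (fst z) (snd z))"
    and "AE a in lborel. AE b in lborel. P a b"
  shows "AE z in lborel. P (fst z) (snd z)"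
proof -
  have m': "Measurable.pred (lborel \<Otimes>\<^sub>M lborel) (\<lambda>z. P (fst z) (snd z))"
    using m by (simp add: lborel_prod)
  have "{z\<in>space (lborel \<Otimes>\<^sub>M lborel). P (fst z) (snd z)} \<in> sets (lborel \<Otimes>\<^sub>M lborel)"
    using m' by measurable
  from lborel_pair.AE_pair_measure[OF this] assms(2)
  have "AE z in lborel \<Otimes>\<^sub>M lborel. P (fst z) (snd z)" by simp
  then show ?thesis unfolding lborel_prod .
qed

lemma AE_lborel_swap:
  fixes P :: "'a::euclidean_space \<Rightarrow> 'b::euclidean_space \<Rightarrow> bool"
  assumes m: "Measurable.pred borel (\<lambda>z. P (fst z) (snd z))"
    and ae: "AE a in lborel. AE b in lborel. P a b"
  shows "AE b in lborel. AE a in lborel. P a b"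
proof -
  have m': "Measurable.pred (lborel \<Otimes>\<^sub>M lborel) (\<lambda>z. P (fst z) (snd z))"
    using m by (simp add: lborel_prod)
  have "{z\<in>space (lborel \<Otimes>\<^sub>M lborel). P (fst z) (snd z)} \<in> sets (lborel \<Otimes>\<^sub>M lborel)"
    using m' by measurable
  from lborel_pair.AE_commute[OF this] ae show ?thesis by simp
qed

text \<open>\<open>P\<close> itself may fail to be measurable; the quantifiers are exchanged for
  membership in a Borel null set that contains all its failures.\<close>

lemma AE_lborel_pairD2:
  fixes P :: "'a::euclidean_space \<Rightarrow> 'b::euclidean_space \<Rightarrow> bool"
  assumes "AE z in lborel. P (fst z) (snd z)"
  shows "AE b in lborel. AE a in lborel. P a b"
proof -
  obtain N where N: "{z. \<not> P (fst z) (snd z)} \<subseteq> N" "emeasure lborel N = 0" "N \<in> sets lborel"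
    using assms by (auto elim: AE_E)
  have ae: "AE z in lborel. z \<notin> N" using N by (intro AE_not_in) auto
  have [measurable]: "N \<in> sets borel" using N by simp
  have "AE b in lborel. AE a in lborel. (a, b) \<notin> N"
  proof (rule AE_lborel_swap)
    show "AE a in lborel. AE b in lborel. (a, b) \<notin> N"
      using ae by (intro AE_lborel_pairD) simp
  qed simp
  moreover have "P a b" if "(a, b) \<notin> N" for a b using N that by force
  ultimately show ?thesis by (auto elim!: eventually_mono)
qed

lemma nn_integral_lborel_Tonelli:
  fixes f :: "'a::euclidean_space \<Rightarrow> 'b::euclidean_space \<Rightarrow> ennreal"
  assumes "jointly_borel f"
  shows "(\<integral>\<^sup>+b. (\<integral>\<^sup>+a. f a b \<partial>lborel) \<partial>lborel) = (\<integral>\<^sup>+a. (\<integral>\<^sup>+b. f a b \<partial>lborel) \<partial>lborel)"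
    and "(\<integral>\<^sup>+a. (\<integral>\<^sup>+b. f a b \<partial>lborel) \<partial>lborel) = (\<integral>\<^sup>+z. f (fst z) (snd z) \<partial>lborel)"
proof -
  have m: "(\<lambda>z. f (fst z) (snd z)) \<in> borel_measurable (lborel \<Otimes>\<^sub>M lborel)"
    using assms by (simp add: lborel_prod)
  show "(\<integral>\<^sup>+b. (\<integral>\<^sup>+a. f a b \<partial>lborel) \<partial>lborel) = (\<integral>\<^sup>+a. (\<integral>\<^sup>+b. f a b \<partial>lborel) \<partial>lborel)"
    using lborel_pair.Fubini[OF m] by simp
  show "(\<integral>\<^sup>+a. (\<integral>\<^sup>+b. f a b \<partial>lborel) \<partial>lborel) = (\<integral>\<^sup>+z. f (fst z) (snd z) \<partial>lborel)"
    using lborel.nn_integral_fst[OF m] by (simp add: lborel_prod)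
qed

lemma borel_sections:
  fixes f :: "'a::euclidean_space \<times> 'b::euclidean_space \<Rightarrow> 'c::topological_space"
  assumes [measurable]: "f \<in> borel_measurable borel"
  shows "(\<lambda>a. f (a, b)) \<in> borel_measurable borel" "(\<lambda>b. f (a, b)) \<in> borel_measurable borel"
  by (auto intro!: measurable_compose[OF _ assms] borel_measurable_Pair)

text \<open>Tonelli brings the space integral inside, where the compression of each
  \<open>V \<tau>\<close> applies separately. Errors of a field measured along trajectories are thus
  bounded by their plain L1 norm in time and space.\<close>

lemma nn_integral_along_family:
  fixes V :: "real \<Rightarrow> 'a::euclidean_space \<Rightarrow> 'a" and f :: "real \<Rightarrow> 'a \<Rightarrow> ennreal"
  assumes V: "jointly_borel V"
    and L: "\<And>\<tau>. \<tau> \<in> I \<Longrightarrow> compressible L (V \<tau>)"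
    and f: "jointly_borel f" and I: "I \<in> sets borel"
  shows "(\<integral>\<^sup>+x. (\<integral>\<^sup>+\<tau>\<in>I. f \<tau> (V \<tau> x) \<partial>lborel) \<partial>lborel) \<le> ennreal L * (\<integral>\<^sup>+\<tau>\<in>I. (\<integral>\<^sup>+y. f \<tau> y \<partial>lborel) \<partial>lborel)"
proof -
  note [measurable] = V I
  have fV: "(\<lambda>z. f (fst z) (V (fst z) (snd z))) \<in> borel_measurable borel"
    using measurable_compose[OF borel_measurable_Pair[OF borel_measurable_fst_borel V] f] by simp
  have fs: "f \<tau> \<in> borel_measurable borel" for \<tau>
    using borel_sections(2)[OF f, of \<tau>] by simp
  have "(\<lambda>z. f (fst z) (snd z)) \<in> borel_measurable (lborel \<Otimes>\<^sub>M lborel)"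
    using f by (simp add: lborel_prod)
  then have fi: "(\<lambda>\<tau>. \<integral>\<^sup>+y. f \<tau> y \<partial>lborel) \<in> borel_measurable lborel"
    using lborel.borel_measurable_nn_integral_fst[of "\<lambda>z. f (fst z) (snd z)" lborel] by simp
  have "(\<integral>\<^sup>+x. (\<integral>\<^sup>+\<tau>\<in>I. f \<tau> (V \<tau> x) \<partial>lborel) \<partial>lborel) = (\<integral>\<^sup>+\<tau>. (\<integral>\<^sup>+x. f \<tau> (V \<tau> x) * indicator I \<tau> \<partial>lborel) \<partial>lborel)"
  proof (rule nn_integral_lborel_Tonelli)
    have "(\<lambda>z :: real \<times> 'a. indicator I (fst z) :: ennreal) \<in> borel_measurable borel"
      by (rule measurable_compose[OF borel_measurable_fst_borel]) simp
    then show "(\<lambda>z. f (fst z) (V (fst z) (snd z)) * indicator I (fst z)) \<in> borel_measurable borel"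
      using fV by simp
  qed
  also have "\<dots> \<le> (\<integral>\<^sup>+\<tau>. ennreal L * ((\<integral>\<^sup>+y. f \<tau> y \<partial>lborel) * indicator I \<tau>) \<partial>lborel)"
  proof (rule nn_integral_mono)
    fix \<tau> show "(\<integral>\<^sup>+x. f \<tau> (V \<tau> x) * indicator I \<tau> \<partial>lborel) \<le> ennreal L * ((\<integral>\<^sup>+y. f \<tau> y \<partial>lborel) * indicator I \<tau>)"
      using compressible_nn_integral[OF L fs, of \<tau> \<tau>] by (cases "\<tau> \<in> I") auto
  qed
  also have "\<dots> = ennreal L * (\<integral>\<^sup>+\<tau>\<in>I. (\<integral>\<^sup>+y. f \<tau> y \<partial>lborel) \<partial>lborel)"
    using fi I by (intro nn_integral_cmult) simp
  finally show ?thesis .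
qed

section \<open>The maximal function\<close>

text \<open>The rational radii make measurability evident and cost only a factor \<open>2\<^sup>d\<close>.\<close>

definition maximal_function :: "('a::euclidean_space \<Rightarrow> ennreal) \<Rightarrow> 'a \<Rightarrow> ennreal" where
  "maximal_function f x =
     (SUP r\<in>{r\<in>\<rat>. 0 < r}. (\<integral>\<^sup>+y\<in>cball x r. f y \<partial>lborel) / emeasure lborel (cball x r))"

abbreviation (input) maximal_norm :: "('a::euclidean_space \<Rightarrow> 'b::real_normed_vector) \<Rightarrow> 'a \<Rightarrow> ennreal" where
  "maximal_norm f \<equiv> maximal_function (\<lambda>w. ennreal (norm (f w)))"

lemma cball_integral_le_maximal:
  fixes f :: "'a::euclidean_space \<Rightarrow> ennreal"
  assumes r: "0 < r"
  shows "(\<integral>\<^sup>+y\<in>cball x r. f y \<partial>lborel)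
    \<le> ennreal (2 ^ DIM('a) * (unit_ball_vol DIM('a) * r ^ DIM('a))) * maximal_function f x"
proof -
  obtain q where q: "q \<in> \<rat>" "r < q" "q < 2 * r" using Rats_dense_in_real[of r "2 * r"] r by auto
  define B where "B = emeasure lborel (cball x q)"
  have B: "B = ennreal (unit_ball_vol DIM('a) * q ^ DIM('a))"
    unfolding B_def using q r by (subst emeasure_cball) auto
  then have B0: "B \<noteq> 0" "B \<noteq> top" using q r by (auto simp: ennreal_eq_0_iff not_le)
  have "(\<integral>\<^sup>+y\<in>cball x r. f y \<partial>lborel) \<le> (\<integral>\<^sup>+y\<in>cball x q. f y \<partial>lborel)"
    using q by (intro nn_integral_mono) (auto simp: indicator_def)
  also have "\<dots> = (\<integral>\<^sup>+y\<in>cball x q. f y \<partial>lborel) / B * B"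
    using B0 by (simp add: ennreal_divide_times ennreal_divide_self less_top)
  also have "\<dots> \<le> maximal_function f x * B"
    unfolding maximal_function_def B_def using q r
    by (intro mult_right_mono SUP_upper) auto
  also have "\<dots> \<le> maximal_function f x * ennreal (2 ^ DIM('a) * (unit_ball_vol DIM('a) * r ^ DIM('a)))"
  proof (rule mult_left_mono)
    have "q ^ DIM('a) \<le> (2 * r) ^ DIM('a)" using q r by (intro power_mono) auto
    then have "unit_ball_vol DIM('a) * q ^ DIM('a) \<le> unit_ball_vol DIM('a) * (2 * r) ^ DIM('a)"
      by (intro mult_left_mono) auto
    then show "B \<le> ennreal (2 ^ DIM('a) * (unit_ball_vol DIM('a) * r ^ DIM('a)))"
      unfolding B by (intro ennreal_leI) (simp add: power_mult_distrib mult_ac)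
  qed simp
  finally show ?thesis by (simp add: mult.commute)
qed

text \<open>The indicator of the moving ball is the indicator of a closed set in the product space,
  so each average is a section integral of a jointly Borel function; the supremum runs over
  countably many radii.\<close>

lemma maximal_function_measurable_family:
  fixes f :: "'b::euclidean_space \<Rightarrow> 'a::euclidean_space \<Rightarrow> ennreal"
  assumes f: "jointly_borel f"
  shows "(\<lambda>z. maximal_function (f (fst z)) (snd z)) \<in> borel_measurable borel"
  unfolding maximal_function_def
proof (rule borel_measurable_SUP)
  show "countable {r \<in> \<rat>. 0 < (r::real)}"
    by (rule countable_subset[OF _ countable_rat]) auto
  fix r :: real assume r: "r \<in> {r \<in> \<rat>. 0 < r}"
  define F where "F w = f (fst (fst w)) (snd w) * indicator {p. dist (fst p) (snd p) \<le> r} (snd (fst w), snd w)"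
    for w :: "('b \<times> 'a) \<times> 'a"
  have m1: "(\<lambda>w :: ('b \<times> 'a) \<times> 'a. (fst (fst w), snd w)) \<in> borel_measurable borel"
    by (intro borel_measurable_continuous_onI continuous_intros)
  have m2: "(\<lambda>w :: ('b \<times> 'a) \<times> 'a. (snd (fst w), snd w)) \<in> borel_measurable borel"
    by (intro borel_measurable_continuous_onI continuous_intros)
  have "closed {p :: 'a \<times> 'a. dist (fst p) (snd p) \<le> r}"
    by (intro closed_Collect_le continuous_intros)
  then have m3: "(indicator {p :: 'a \<times> 'a. dist (fst p) (snd p) \<le> r} :: _ \<Rightarrow> ennreal) \<in> borel_measurable borel"
    by simp
  have "F \<in> borel_measurable borel"
    unfolding F_def using measurable_compose[OF m1 f] measurable_compose[OF m2 m3] by simp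
  then have "F \<in> borel_measurable (lborel \<Otimes>\<^sub>M lborel)" unfolding lborel_prod by simp
  from lborel.borel_measurable_nn_integral_fst[OF this]
  have "(\<lambda>z. \<integral>\<^sup>+y. F (z, y) \<partial>lborel) \<in> borel_measurable borel" by simp
  moreover have "(\<lambda>z. (\<integral>\<^sup>+y\<in>cball (snd z) r. f (fst z) y \<partial>lborel) / emeasure lborel (cball (snd z) r))
     = (\<lambda>z. (\<integral>\<^sup>+y. F (z, y) \<partial>lborel) / ennreal (unit_ball_vol DIM('a) * r ^ DIM('a)))"
    using r by (intro ext arg_cong2[where f="(/)"] nn_integral_cong)
      (auto simp: F_def indicator_def emeasure_cball)
  ultimately show "(\<lambda>z. (\<integral>\<^sup>+y\<in>cball (snd z) r. f (fst z) y \<partial>lborel) / emeasure lborel (cball (snd z) r))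
     \<in> borel_measurable borel"
    by simp
qed

lemma maximal_function_measurable:
  fixes f :: "'a::euclidean_space \<Rightarrow> ennreal"
  assumes f: "f \<in> borel_measurable borel"
  shows "maximal_function f \<in> borel_measurable borel"
proof -
  have "(\<lambda>z :: real \<times> 'a. f (snd z)) \<in> borel_measurable borel"
    by (rule measurable_compose[OF borel_measurable_snd_borel f])
  from maximal_function_measurable_family[of "\<lambda>_. f", OF this]
  have "(\<lambda>z :: real \<times> 'a. maximal_function f (snd z)) \<in> borel_measurable borel" .
  from borel_sections(2)[OF this] show ?thesis by simp
qed

lemma maximal_function_cong_AE:
  assumes "AE y in lborel. f y = g y"
  shows "maximal_function f x = maximal_function g x"
  unfolding maximal_function_def
  by (intro SUP_cong refl arg_cong2[where f="(/)"] nn_integral_cong_AE)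
    (use assms in \<open>auto elim: eventually_mono\<close>)

section \<open>Weak-type bound and its transport by compressible maps\<close>

lemma powr_split_le:
  assumes "0 \<le> a" "0 < m" "1 < p"
  shows "a \<le> m + m powr (1 - p) * a powr (p::real)"
proof (cases "a \<le> m")
  case True then show ?thesis by (simp add: add_increasing2)
next
  case False
  then have a: "0 < a" "m < a" using assms by auto
  have "a = a powr (1 - p) * a powr p" using a by (simp add: powr_add[symmetric])
  also have "\<dots> \<le> m powr (1 - p) * a powr p"
    using a assms by (intro mult_right_mono powr_mono2') auto
  finally show ?thesis using assms by linarith
qed

text \<open>The function is split at height \<open>m = l / 2\<close>. The part below contributes at
  most half of the assumed integral, so the part above, which is dominated by
  \<open>m powr (1 - p)\<close> times the p-th power, has to carry the other half.\<close>

lemma nn_integral_powr_ball_lower: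
  fixes g :: "'a::euclidean_space \<Rightarrow> real"
  assumes g: "g \<in> borel_measurable borel" "\<And>y. 0 \<le> g y" and l: "0 < l" and p: "1 < p" and B: "B \<in> sets borel"
    and b: "emeasure lborel B = ennreal b" "0 \<le> b"
    and big: "ennreal l * ennreal b < (\<integral>\<^sup>+y\<in>B. ennreal (g y) \<partial>lborel)"
  shows "ennreal b \<le> ennreal ((2 / l) powr p) * (\<integral>\<^sup>+y\<in>B. ennreal (g y powr p) \<partial>lborel)"
proof (cases "(\<integral>\<^sup>+y\<in>B. ennreal (g y powr p) \<partial>lborel) = top")
  case True
  then show ?thesis using l by (simp add: ennreal_mult_top)
next
  case False
  note [measurable] = g(1) B
  obtain J where J: "(\<integral>\<^sup>+y\<in>B. ennreal (g y powr p) \<partial>lborel) = ennreal J" "0 \<le> J"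
    using False by (cases "\<integral>\<^sup>+y\<in>B. ennreal (g y powr p) \<partial>lborel") auto
  define m where "m = l / 2"
  have m: "0 < m" using l by (simp add: m_def)
  have "(\<integral>\<^sup>+y\<in>B. ennreal (g y) \<partial>lborel) \<le> (\<integral>\<^sup>+y. ennreal m * indicator B y
      + ennreal (m powr (1 - p)) * (ennreal (g y powr p) * indicator B y) \<partial>lborel)"
  proof (rule nn_integral_mono)
    fix y
    have "ennreal (g y) \<le> ennreal m + ennreal (m powr (1 - p)) * ennreal (g y powr p)"
      using powr_split_le[OF g(2)[of y] m p] m g(2)[of y]
      by (simp add: ennreal_mult[symmetric] ennreal_plus[symmetric] ennreal_leI del: ennreal_plus)
    then show "ennreal (g y) * indicator B y \<le> ennreal m * indicator B y
      + ennreal (m powr (1 - p)) * (ennreal (g y powr p) * indicator B y)"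
      by (cases "y \<in> B") auto
  qed
  also have "\<dots> = ennreal m * ennreal b + ennreal (m powr (1 - p)) * ennreal J"
    using b J by (simp add: nn_integral_add nn_integral_cmult nn_integral_cmult_indicator)
  also have "\<dots> = ennreal (m * b + m powr (1 - p) * J)"
    using m b J by (simp add: ennreal_mult)
  finally have "ennreal (l * b) < ennreal (m * b + m powr (1 - p) * J)"
    using big l b by (simp add: ennreal_mult)
  then have "l * b < m * b + m powr (1 - p) * J"
    using l b by (simp add: ennreal_less_iff)
  then have "m * b \<le> m powr (1 - p) * J" by (simp add: m_def field_simps)
  then have "b \<le> m powr (1 - p) / m * J" using m by (simp add: field_simps)
  also have "m powr (1 - p) / m = (2 / l) powr p"
    using l by (simp add: m_def powr_diff powr_divide field_simps)
  finally show ?thesis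
    unfolding J using J by (simp add: ennreal_mult[symmetric] ennreal_leI)
qed

text \<open>Every point of the superlevel set is the centre of a ball on which the mean exceeds
  \<open>l\<close>, and such a ball has volume at most \<open>(2 / l) powr p\<close> times the
  integral of \<open>g powr p\<close> over it. A disjoint Vitali subfamily covers after enlargement
  by 5, which gives \<open>5 ^ DIM('a)\<close>. The exponent \<open>p\<close> is treated directly,
  without interpolation.\<close>

lemma maximal_function_weak_type:
  fixes g :: "'a::euclidean_space \<Rightarrow> real"
  assumes g: "g \<in> borel_measurable borel" "\<And>y. 0 \<le> g y" and l: "0 < l" and p: "1 < p"
    and fin: "(\<integral>\<^sup>+y. ennreal (g y powr p) \<partial>lborel) < top"
  shows "emeasure lborel {x. ennreal l < maximal_function (\<lambda>y. ennreal (g y)) x}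
    \<le> ennreal (5 ^ DIM('a) * (2 / l) powr p) * (\<integral>\<^sup>+y. ennreal (g y powr p) \<partial>lborel)"
proof -
  note [measurable] = g(1)
  define S where "S = {x. ennreal l < maximal_function (\<lambda>y. ennreal (g y)) x}"
  define bv where "bv r = unit_ball_vol DIM('a) * r ^ DIM('a)" for r :: real
  obtain I where I: "(\<integral>\<^sup>+y. ennreal (g y powr p) \<partial>lborel) = ennreal I" "0 \<le> I"
    using fin by (cases "\<integral>\<^sup>+y. ennreal (g y powr p) \<partial>lborel") auto
  have em: "emeasure lborel (cball x r) = ennreal (bv r)" if "0 \<le> r" for x :: 'a and r
    unfolding bv_def using that by (rule emeasure_cball)
  have bv0: "0 \<le> bv r" if "0 \<le> r" for r using that by (simp add: bv_def)
  have "\<exists>r>0. ennreal (bv r) \<le> ennreal ((2 / l) powr p) * (\<integral>\<^sup>+y\<in>cball x r. ennreal (g y powr p) \<partial>lborel)"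
    if "x \<in> S" for x
  proof -
    obtain r where r: "0 < r" "ennreal l < (\<integral>\<^sup>+y\<in>cball x r. ennreal (g y) \<partial>lborel) / emeasure lborel (cball x r)"
      using \<open>x \<in> S\<close> unfolding S_def maximal_function_def less_SUP_iff mem_Collect_eq by blast
    have bp: "0 < bv r" using r by (simp add: bv_def)
    have "ennreal l * ennreal (bv r) < (\<integral>\<^sup>+y\<in>cball x r. ennreal (g y) \<partial>lborel)"
    proof (rule ccontr)
      assume "\<not> ?thesis"
      then have "(\<integral>\<^sup>+y\<in>cball x r. ennreal (g y) \<partial>lborel) \<le> ennreal (bv r) * ennreal l"
        by (simp add: not_less mult.commute)
      then have "(\<integral>\<^sup>+y\<in>cball x r. ennreal (g y) \<partial>lborel) / ennreal (bv r) \<le> ennreal l"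
        using bp by (intro divide_le_posI_ennreal) auto
      then show False using r em[of r x] by simp
    qed
    from nn_integral_powr_ball_lower[OF g l p _ em _ this] r bp
    show ?thesis by (intro exI[of _ r]) auto
  qed
  then obtain r where r: "\<And>x. x \<in> S \<Longrightarrow> 0 < r x"
    "\<And>x. x \<in> S \<Longrightarrow> ennreal (bv (r x)) \<le> ennreal ((2 / l) powr p) * (\<integral>\<^sup>+y\<in>cball x (r x). ennreal (g y powr p) \<partial>lborel)"
    by metis
  \<comment> \<open>The Vitali covering asks for bounded radii. The volume of a selected ball is
    bounded through the finite total integral, and a radius above 1 is at most its own power with
    the dimension as exponent.\<close>
  define K where "K = max 1 ((2 / l) powr p * I / unit_ball_vol DIM('a))"
  have rK: "r x \<le> K" if x: "x \<in> S" for x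
  proof (cases "r x \<le> 1")
    case False
    have "ennreal (bv (r x)) \<le> ennreal ((2 / l) powr p) * (\<integral>\<^sup>+y. ennreal (g y powr p) \<partial>lborel)"
      by (intro order_trans[OF r(2)[OF x]] mult_left_mono nn_integral_mono) (auto simp: indicator_def)
    then have "bv (r x) \<le> (2 / l) powr p * I"
      unfolding I using I(2) by (simp add: ennreal_mult[symmetric])
    moreover have "r x ^ 1 \<le> r x ^ DIM('a)"
      using False DIM_positive[where 'a='a] by (intro power_increasing) auto
    ultimately have "unit_ball_vol DIM('a) * r x \<le> (2 / l) powr p * I"
      unfolding bv_def by (smt (verit) mult_left_mono power_one_right unit_ball_vol_nonneg of_nat_0_le_iff)
    then have "r x \<le> (2 / l) powr p * I / unit_ball_vol DIM('a)"
      by (simp add: field_simps)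
    then show ?thesis by (simp add: K_def)
  qed (simp add: K_def)
  have cov: "S \<subseteq> (\<Union>x\<in>S. cball x (r x))"
  proof
    fix x assume "x \<in> S" then show "x \<in> (\<Union>x\<in>S. cball x (r x))"
      using r(1)[of x] by (intro UN_I[of x]) auto
  qed
  obtain C where C: "countable C" "C \<subseteq> S" "pairwise (\<lambda>i j. disjnt (cball i (r i)) (cball j (r j))) C"
     "S \<subseteq> (\<Union>i\<in>C. cball i (5 * r i))"
  proof (rule Vitali_covering_lemma_cballs[OF cov, of K])
    show "0 < r i \<and> r i \<le> K" if "i \<in> S" for i using r(1) rK that by blast
  qed (rule that)
  have "emeasure lborel S \<le> emeasure lborel (\<Union>i\<in>C. cball i (5 * r i))"
    using C by (intro emeasure_mono) (auto intro: sets.countable_UN')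
  also have "\<dots> = (\<integral>\<^sup>+y. indicator (\<Union>i\<in>C. cball i (5 * r i)) y \<partial>lborel)"
    using C by (intro nn_integral_indicator[symmetric]) (auto intro: sets.countable_UN')
  \<comment> \<open>The sum over the subfamily is written as an integral over
    \<open>count_space C\<close>, so that it can be exchanged with the integral over space.\<close>
  also have "\<dots> \<le> (\<integral>\<^sup>+y. \<integral>\<^sup>+i. indicator (cball i (5 * r i)) y \<partial>count_space C \<partial>lborel)"
  proof (rule nn_integral_mono)
    fix y :: 'a
    show "indicator (\<Union>i\<in>C. cball i (5 * r i)) y \<le> (\<integral>\<^sup>+i. (indicator (cball i (5 * r i)) y :: ennreal) \<partial>count_space C)"
    proof (cases "y \<in> (\<Union>i\<in>C. cball i (5 * r i))")
      case True
      then obtain i where i: "i \<in> C" "y \<in> cball i (5 * r i)" by blast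
      have "(1 :: ennreal) = (\<integral>\<^sup>+j. indicator {i} j \<partial>count_space C)"
        using i by (subst nn_integral_indicator) auto
      also have "\<dots> \<le> (\<integral>\<^sup>+j. indicator (cball j (5 * r j)) y \<partial>count_space C)"
        using i by (intro nn_integral_mono) (auto simp: indicator_def)
      finally show ?thesis using True by simp
    qed simp
  qed
  also have "\<dots> = (\<integral>\<^sup>+i. \<integral>\<^sup>+y. indicator (cball i (5 * r i)) y \<partial>lborel \<partial>count_space C)"
    using C by (intro nn_integral_count_space_nn_integral borel_measurable_indicator) auto
  also have "\<dots> = (\<integral>\<^sup>+i. ennreal (5 ^ DIM('a)) * ennreal (bv (r i)) \<partial>count_space C)"
  proof (rule nn_integral_cong)
    fix i assume "i \<in> space (count_space C)"
    then have "i \<in> S" using C by auto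
    then have "0 \<le> r i" using r(1)[of i] by simp
    then show "(\<integral>\<^sup>+y. indicator (cball i (5 * r i)) y \<partial>lborel) = ennreal (5 ^ DIM('a)) * ennreal (bv (r i))"
      using em[of "5 * r i" i] bv0 by (simp add: ennreal_mult[symmetric] bv_def power_mult_distrib mult_ac)
  qed
  also have "\<dots> \<le> (\<integral>\<^sup>+i. ennreal (5 ^ DIM('a) * (2 / l) powr p) *
      (\<integral>\<^sup>+y\<in>cball i (r i). ennreal (g y powr p) \<partial>lborel) \<partial>count_space C)"
  proof (rule nn_integral_mono)
    fix i assume "i \<in> space (count_space C)"
    then have "i \<in> S" using C by auto
    from mult_left_mono[OF r(2)[OF this], of "ennreal (5 ^ DIM('a))"]
    show "ennreal (5 ^ DIM('a)) * ennreal (bv (r i)) \<le> ennreal (5 ^ DIM('a) * (2 / l) powr p) *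
      (\<integral>\<^sup>+y\<in>cball i (r i). ennreal (g y powr p) \<partial>lborel)"
      by (simp add: ennreal_mult mult.assoc)
  qed
  also have "\<dots> = ennreal (5 ^ DIM('a) * (2 / l) powr p) *
      (\<integral>\<^sup>+i. (\<integral>\<^sup>+y. ennreal (g y powr p) * indicator (cball i (r i)) y \<partial>lborel) \<partial>count_space C)"
    by (intro nn_integral_cmult) auto
  also have "(\<integral>\<^sup>+i. (\<integral>\<^sup>+y. ennreal (g y powr p) * indicator (cball i (r i)) y \<partial>lborel) \<partial>count_space C)
      = (\<integral>\<^sup>+y. (\<integral>\<^sup>+i. ennreal (g y powr p) * indicator (cball i (r i)) y \<partial>count_space C) \<partial>lborel)"
  proof (intro nn_integral_count_space_nn_integral[symmetric] C)
    have "(\<lambda>y. ennreal (g y powr p) * indicator (cball i s) y) \<in> borel_measurable borel" for i s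
    proof (rule borel_measurable_times_ennreal)
      show "(\<lambda>y. ennreal (g y powr p)) \<in> borel_measurable borel" by measurable
      show "(indicator (cball i s) :: 'a \<Rightarrow> ennreal) \<in> borel_measurable borel"
        by (rule borel_measurable_indicator) simp
    qed
    then show "(\<lambda>y. ennreal (g y powr p) * indicator (cball i (r i)) y) \<in> borel_measurable lborel" for i
      by simp
  qed
  \<comment> \<open>The balls of the subfamily are disjoint, so at most one term of the inner sum
    survives at each \<open>y\<close>.\<close>
  also have "\<dots> \<le> (\<integral>\<^sup>+y. ennreal (g y powr p) \<partial>lborel)"
  proof (rule nn_integral_mono)
    fix y :: 'a
    show "(\<integral>\<^sup>+i. ennreal (g y powr p) * indicator (cball i (r i)) y \<partial>count_space C) \<le> ennreal (g y powr p)"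
    proof (cases "\<exists>i\<in>C. y \<in> cball i (r i)")
      case True
      then obtain i where i: "i \<in> C" "y \<in> cball i (r i)" by blast
      have uniq: "j = i" if "j \<in> C" "y \<in> cball j (r j)" for j
        using C(3) i that unfolding pairwise_def disjnt_def by blast
      have "(\<integral>\<^sup>+j. ennreal (g y powr p) * indicator (cball j (r j)) y \<partial>count_space C)
        = (\<integral>\<^sup>+j. ennreal (g y powr p) * indicator {i} j \<partial>count_space C)"
      proof (rule nn_integral_cong)
        fix j assume "j \<in> space (count_space C)"
        then have j: "j \<in> C" by simp
        show "ennreal (g y powr p) * indicator (cball j (r j)) y = ennreal (g y powr p) * indicator {i} j"
        proof (cases "j = i")
          case True
          show ?thesis unfolding True using i(2) by simp
        next
          case False
          then have "y \<notin> cball j (r j)" using uniq j by blast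
          then show ?thesis using False by simp
        qed
      qed
      also have "\<dots> = ennreal (g y powr p)"
        using i by (subst nn_integral_cmult_indicator) auto
      finally show ?thesis by simp
    next
      case False
      then have "(\<integral>\<^sup>+j. ennreal (g y powr p) * indicator (cball j (r j)) y \<partial>count_space C) = (\<integral>\<^sup>+j. 0 \<partial>count_space C)"
        by (intro nn_integral_cong) (auto simp: indicator_def)
      then show ?thesis by simp
    qed
  qed
  finally show ?thesis unfolding S_def by (simp add: mult_left_mono)
qed

text \<open>A dyadic layer cake: each exceeded level \<open>2 ^ k * l\<close> pays for the doubling
  from it to the next one. The induction concerns truncations of \<open>m\<close>, so that
  \<open>m = top\<close> is covered.\<close>

lemma ennreal_dyadic_layers:
  assumes l: "0 < l"
  shows "(m::ennreal) \<le> ennreal l + (\<Sum>k. ennreal (2 ^ k * l) * (if ennreal (2 ^ k * l) < m then 1 else 0))"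
    (is "m \<le> ennreal l + suminf ?f")
proof -
  have 1: "min m (ennreal (2 ^ n * l)) \<le> ennreal l + (\<Sum>k<n. ?f k)" for n
  proof (induction n)
    case 0 then show ?case by simp
  next
    case (Suc n)
    show ?case
    proof (cases "ennreal (2 ^ n * l) < m")
      case True
      have "min m (ennreal (2 ^ Suc n * l)) \<le> ennreal (2 ^ n * l) + ennreal (2 ^ n * l)"
        using l by (simp add: ennreal_plus[symmetric] min.coboundedI2 del: ennreal_plus)
      also have "\<dots> \<le> (ennreal l + (\<Sum>k<n. ?f k)) + ?f n"
        using Suc.IH True by (intro add_mono) auto
      finally show ?thesis by (simp add: add.assoc)
    next
      case False
      then have "min m (ennreal (2 ^ Suc n * l)) \<le> min m (ennreal (2 ^ n * l))" by simp
      also note Suc.IH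
      also have "ennreal l + (\<Sum>k<n. ?f k) \<le> ennreal l + (\<Sum>k<Suc n. ?f k)"
        using False by simp
      finally show ?thesis .
    qed
  qed
  have 2: "min m (ennreal (2 ^ n * l)) \<le> ennreal l + suminf ?f" for n
    by (rule order_trans[OF 1 add_left_mono[OF sum_le_suminf]]) auto
  show ?thesis
  proof (rule ccontr)
    assume "\<not> ?thesis"
    then have lt: "ennreal l + suminf ?f < m" by (simp add: not_le)
    then obtain s where s: "ennreal l + suminf ?f = ennreal s" "0 \<le> s"
      by (cases "ennreal l + suminf ?f") auto
    obtain n where "s / l < 2 ^ n" using real_arch_pow[of 2 "s / l"] by auto
    then have "ennreal s < ennreal (2 ^ n * l)" using l s by (simp add: field_simps ennreal_less_iff)
    then have "ennreal s < min m (ennreal (2 ^ n * l))" using lt s by simp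
    then show False using leD[OF 2[of n]] s by metis
  qed
qed

text \<open>The weak-type bounds at the levels \<open>2 ^ k * l\<close> form a geometric series with
  ratio \<open>2 powr (1 - p) < 1\<close>; values below \<open>l\<close> are paid for by the measure
  of \<open>E\<close>. Only measures of superlevel sets enter, and these survive composition with
  \<open>U\<close> up to the factor \<open>L\<close>. The level \<open>l\<close> stays free, to be
  tuned to the norm of the gradient.\<close>

lemma maximal_function_transport:
  fixes g :: "'a::euclidean_space \<Rightarrow> real" and U :: "'a \<Rightarrow> 'a"
  assumes U: "compressible L U" "0 \<le> L"
    and g: "g \<in> borel_measurable borel" "\<And>y. 0 \<le> g y" and l: "0 < l" and p: "1 < p"
    and fin: "(\<integral>\<^sup>+y. ennreal (g y powr p) \<partial>lborel) < top" and E: "E \<in> sets borel"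
  shows "(\<integral>\<^sup>+x\<in>E. maximal_function (\<lambda>y. ennreal (g y)) (U x) \<partial>lborel) \<le>
     ennreal l * emeasure lborel E +
     ennreal (L * 5 ^ DIM('a) * 2 powr p * l powr (1 - p) / (1 - 2 powr (1 - p))) * (\<integral>\<^sup>+y. ennreal (g y powr p) \<partial>lborel)"
proof -
  define M where "M = maximal_function (\<lambda>y. ennreal (g y))"
  define I where "I = (\<integral>\<^sup>+y. ennreal (g y powr p) \<partial>lborel)"
  have mM: "M \<in> borel_measurable borel"
    unfolding M_def using g(1) by (intro maximal_function_measurable) simp
  define A where "A k = {y. ennreal (2 ^ k * l) < M y}" for k :: nat
  have mA: "A k \<in> sets borel" for k
    using mM unfolding A_def by (simp add: borel_measurable_iff_greater)
  have mUA: "U -` A k \<in> sets borel" for k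
    using measurable_sets[OF compressible_measurable[OF U(1)] mA[of k]] by simp
  have eA: "emeasure lborel (U -` A k) \<le> ennreal (L * (5 ^ DIM('a) * (2 / (2 ^ k * l)) powr p)) * I" for k
  proof -
    have "emeasure lborel (U -` A k) \<le> ennreal L * emeasure lborel (A k)"
      by (rule compressible_emeasure[OF U(1) mA])
    also have "\<dots> \<le> ennreal L * (ennreal (5 ^ DIM('a) * (2 / (2 ^ k * l)) powr p) * I)"
      unfolding A_def M_def I_def using l
      by (intro mult_left_mono maximal_function_weak_type g p fin) auto
    finally show ?thesis using U(2) by (simp add: ennreal_mult mult.assoc)
  qed
  define q where "q = 2 powr (1 - p)"
  have q: "0 < q" "q < 1" unfolding q_def using p by (auto simp: powr_less_one)
  define c where "c = L * 5 ^ DIM('a) * 2 powr p * l powr (1 - p)"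
  have c: "0 \<le> c" using U by (simp add: c_def)
  have "(\<integral>\<^sup>+x\<in>E. M (U x) \<partial>lborel) \<le>
     (\<integral>\<^sup>+x. ennreal l * indicator E x + (\<Sum>k. ennreal (2 ^ k * l) * indicator (U -` A k) x) \<partial>lborel)"
  proof (rule nn_integral_mono)
    fix x
    have "M (U x) \<le> ennreal l + (\<Sum>k. ennreal (2 ^ k * l) * indicator (U -` A k) x)"
      using ennreal_dyadic_layers[OF l, of "M (U x)"] by (simp add: A_def indicator_def of_bool_def)
    then show "M (U x) * indicator E x \<le> ennreal l * indicator E x + (\<Sum>k. ennreal (2 ^ k * l) * indicator (U -` A k) x)"
      by (cases "x \<in> E") auto
  qed
  also have "\<dots> = ennreal l * emeasure lborel E + (\<Sum>k. ennreal (2 ^ k * l) * emeasure lborel (U -` A k))"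
    using E mUA by (simp add: nn_integral_add nn_integral_suminf nn_integral_cmult_indicator)
  also have "(\<Sum>k. ennreal (2 ^ k * l) * emeasure lborel (U -` A k)) \<le> (\<Sum>k. ennreal (c * q ^ k) * I)"
  proof (intro suminf_le allI summableI)
    fix k :: nat
    have "ennreal (2 ^ k * l) * emeasure lborel (U -` A k) \<le>
       ennreal (2 ^ k * l) * (ennreal (L * (5 ^ DIM('a) * (2 / (2 ^ k * l)) powr p)) * I)"
      by (intro mult_left_mono eA) simp
    also have "\<dots> = ennreal ((2 ^ k * l) * (L * (5 ^ DIM('a) * (2 / (2 ^ k * l)) powr p))) * I"
      using l U by (simp add: ennreal_mult mult.assoc)
    also have "(2 ^ k * l) * (L * (5 ^ DIM('a) * (2 / (2 ^ k * l)) powr p)) = c * q ^ k"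
    proof -
      define v where "v = 2 ^ k * l"
      have v: "0 < v" using l by (simp add: v_def)
      have "v * (2 / v) powr p = 2 powr p * v powr (1 - p)"
        using v by (simp add: powr_divide powr_diff)
      also have "v powr (1 - p) = l powr (1 - p) * q ^ k"
        using l by (simp add: v_def powr_mult q_def powr_powr powr_realpow[symmetric] mult_ac)
      finally show ?thesis by (simp add: v_def[symmetric] c_def)
    qed
    finally show "ennreal (2 ^ k * l) * emeasure lborel (U -` A k) \<le> ennreal (c * q ^ k) * I" .
  qed
  also have "(\<Sum>k. ennreal (c * q ^ k) * I) = ennreal (c / (1 - q)) * I"
  proof -
    have "(\<lambda>k. c * q ^ k) sums (c * (1 / (1 - q)))"
      using q by (intro sums_mult geometric_sums) auto
    then have "(\<Sum>k. ennreal (c * q ^ k)) = ennreal (c / (1 - q))"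
      using c q by (intro suminf_ennreal_eq) auto
    then show ?thesis by simp
  qed
  finally show ?thesis unfolding M_def I_def c_def q_def by (simp add: add_left_mono)
qed

section \<open>Mollifiers\<close>

lemma times_cont_differentiable_SucD:
  "times_cont_differentiable (Suc k) f \<Longrightarrow> times_cont_differentiable k f"
proof (induction k arbitrary: f)
  case 0
  then show ?case
    by (auto intro!: continuous_at_imp_continuous_on differentiable_imp_continuous_within)
next
  case (Suc k)
  from Suc.prems have 1: "\<forall>x. f differentiable (at x)"
    "\<forall>v. times_cont_differentiable (Suc k) (\<lambda>x. frechet_derivative f (at x) v)"
    unfolding times_cont_differentiable.simps(2)[of "Suc k" f] by auto
  with Suc.IH show ?case by (simp only: times_cont_differentiable.simps(2)[of k f]) blast
qed

lemma times_cont_differentiable_const: "times_cont_differentiable k (\<lambda>x. c)"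
  by (induction k arbitrary: c) (auto simp: frechet_derivative_const)

lemma times_cont_differentiable_add:
  "times_cont_differentiable k f \<Longrightarrow> times_cont_differentiable k g
    \<Longrightarrow> times_cont_differentiable k (\<lambda>x. f x + g x)"
proof (induction k arbitrary: f g)
  case 0 then show ?case by (auto intro: continuous_on_add)
next
  case (Suc k)
  then have d: "\<And>x. f differentiable (at x)" "\<And>x. g differentiable (at x)" by auto
  have "frechet_derivative (\<lambda>x. f x + g x) (at x) v
      = frechet_derivative f (at x) v + frechet_derivative g (at x) v" for x v
  proof -
    have "((\<lambda>x. f x + g x) has_derivative
       (\<lambda>v. frechet_derivative f (at x) v + frechet_derivative g (at x) v)) (at x)"
      using d by (intro has_derivative_add) (auto simp: frechet_derivative_works[symmetric])
    from frechet_derivative_at[OF this] show ?thesis by metis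
  qed
  then show ?case using Suc d by (auto intro: differentiable_add)
qed

text \<open>The product rule yields products of one function with the derivative of the other, so
  both functions are also needed at the lower order \<open>k\<close>.\<close>

lemma times_cont_differentiable_mult:
  fixes f g :: "'a::real_normed_vector \<Rightarrow> real"
  shows "times_cont_differentiable k f \<Longrightarrow> times_cont_differentiable k g
    \<Longrightarrow> times_cont_differentiable k (\<lambda>x. f x * g x)"
proof (induction k arbitrary: f g)
  case 0 then show ?case by (auto intro: continuous_on_mult)
next
  case (Suc k)
  then have d: "\<And>x. f differentiable (at x)" "\<And>x. g differentiable (at x)" by auto
  have eq: "frechet_derivative (\<lambda>x. f x * g x) (at x) v
      = f x * frechet_derivative g (at x) v + frechet_derivative f (at x) v * g x" for x v
  proof -
    have "((\<lambda>x. f x * g x) has_derivative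
       (\<lambda>v. f x * frechet_derivative g (at x) v + frechet_derivative f (at x) v * g x)) (at x)"
      using d by (intro has_derivative_mult) (auto simp: frechet_derivative_works[symmetric])
    from frechet_derivative_at[OF this] show ?thesis by metis
  qed
  have "times_cont_differentiable k f" "times_cont_differentiable k g"
    using Suc.prems by (blast dest: times_cont_differentiable_SucD)+
  with Suc show ?case by (auto simp: eq intro!: times_cont_differentiable_add differentiable_mult)
qed

lemma times_cont_differentiable_prod:
  fixes f :: "'i \<Rightarrow> 'a::real_normed_vector \<Rightarrow> real"
  assumes "finite I" "\<And>i. i \<in> I \<Longrightarrow> times_cont_differentiable k (f i)"
  shows "times_cont_differentiable k (\<lambda>x. \<Prod>i\<in>I. f i x)"
  using assms
  by (induction I rule: finite_induct)
    (auto intro: times_cont_differentiable_const times_cont_differentiable_mult)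

lemma times_cont_differentiable_affine:
  fixes f :: "'a::real_normed_vector \<Rightarrow> real"
  shows "times_cont_differentiable k f \<Longrightarrow> times_cont_differentiable k (\<lambda>x. a * f (c *\<^sub>R (x - y)))"
proof (induction k arbitrary: f a)
  case 0
  then show ?case
    by (auto intro!: continuous_intros intro: continuous_on_compose2[of UNIV f])
next
  case (Suc k)
  then have d: "\<And>x. f differentiable (at x)" by auto
  have hd: "((\<lambda>x. a * f (c *\<^sub>R (x - y))) has_derivative
     (\<lambda>v. (a * c) * frechet_derivative f (at (c *\<^sub>R (x - y))) v)) (at x)" for x
  proof -
    have f: "(f has_derivative frechet_derivative f (at (c *\<^sub>R (x - y)))) (at (c *\<^sub>R (x - y)))"
      using d frechet_derivative_works by blast
    have "((\<lambda>x. c *\<^sub>R (x - y)) has_derivative (\<lambda>v. c *\<^sub>R v)) (at x)"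
      by (auto intro!: derivative_eq_intros)
    from has_derivative_compose[OF this f]
    have "((\<lambda>x. f (c *\<^sub>R (x - y))) has_derivative (\<lambda>v. frechet_derivative f (at (c *\<^sub>R (x - y))) (c *\<^sub>R v))) (at x)" .
    from has_derivative_mult_right[OF this, of a]
    show ?thesis
      using linear_scale[OF has_derivative_linear[OF f]] by (simp add: mult.assoc)
  qed
  have eq: "frechet_derivative (\<lambda>x. a * f (c *\<^sub>R (x - y))) (at x) v
      = (a * c) * frechet_derivative f (at (c *\<^sub>R (x - y))) v" for x v
    using frechet_derivative_at[OF hd[of x]] by metis
  have "(\<lambda>x. a * f (c *\<^sub>R (x - y))) differentiable (at x)" for x
    using hd unfolding differentiable_def by blast
  moreover have "times_cont_differentiable k (\<lambda>x. (a * c) * frechet_derivative f (at (c *\<^sub>R (x - y))) v)" for v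
    using Suc.prems by (intro Suc.IH[of "\<lambda>x. frechet_derivative f (at x) v"]) simp
  ultimately show ?case by (simp only: times_cont_differentiable.simps eq) blast
qed

text \<open>\<open>D\<close> is a whole chain of derivatives and the factor \<open>a\<close> is
  arbitrary: differentiation in a direction \<open>v\<close> only moves \<open>n\<close> to
  \<open>Suc n\<close> and multiplies \<open>a\<close> by \<open>l v\<close>, so the statement
  reproduces itself in the induction.\<close>

lemma times_cont_differentiable_real_compose:
  fixes l :: "'a::real_normed_vector \<Rightarrow> real"
  assumes D: "\<And>n x. (D n has_real_derivative D (Suc n) x) (at x)" and l: "bounded_linear l"
  shows "times_cont_differentiable k (\<lambda>x. a * D n (c + l x))"
proof (induction k arbitrary: n a)
  case 0
  have "continuous_on UNIV (D n)"
    by (intro continuous_at_imp_continuous_on ballI DERIV_isCont[OF D])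
  then have "continuous_on UNIV (\<lambda>x. D n (c + l x))"
    by (rule continuous_on_compose2)
      (auto intro!: continuous_intros linear_continuous_on[OF l])
  then show ?case by (auto intro: continuous_intros)
next
  case (Suc k)
  have hd: "((\<lambda>x. a * D n (c + l x)) has_derivative (\<lambda>v. (a * l v) * D (Suc n) (c + l x))) (at x)" for x
  proof -
    have "((\<lambda>x. c + l x) has_derivative l) (at x)"
      using bounded_linear_imp_has_derivative[OF l] by (auto intro!: derivative_eq_intros)
    from has_derivative_compose[OF this D[of n "c + l x", unfolded has_field_derivative_def]]
    have "((\<lambda>x. D n (c + l x)) has_derivative (\<lambda>v. D (Suc n) (c + l x) * l v)) (at x)" .
    from has_derivative_mult_right[OF this, of a] show ?thesis by (simp add: mult_ac)
  qed
  have eq: "frechet_derivative (\<lambda>x. a * D n (c + l x)) (at x) v = (a * l v) * D (Suc n) (c + l x)" for x v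
    using frechet_derivative_at[OF hd[of x]] by metis
  show ?case
    unfolding times_cont_differentiable.simps eq
    using Suc hd unfolding differentiable_def by blast
qed

section \<open>A smooth bump function from exp(-1/x)\<close>

fun flat_poly :: "nat \<Rightarrow> real poly" where
  "flat_poly 0 = 1"
| "flat_poly (Suc n) = [:0, 0, 1:] * (flat_poly n - pderiv (flat_poly n))"

text \<open>The n-th derivative of exp(-1/x), extended by 0 to the left. The recursion of
  \<open>flat_poly\<close> comes from differentiating P(1/x) exp(-1/x), which yields x^(-2) (P -
  P')(1/x) exp(-1/x).\<close>

definition flat :: "nat \<Rightarrow> real \<Rightarrow> real" where
  "flat n x = (if x \<le> 0 then 0 else poly (flat_poly n) (1 / x) * exp (- (1 / x)))"

lemma poly_times_exp_tendsto_0: "((\<lambda>y. poly p y * exp (- y :: real)) \<longlongrightarrow> 0) at_top"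
proof -
  have "((\<lambda>y. coeff p i * (y ^ i / exp y)) \<longlongrightarrow> coeff p i * 0) at_top" for i
    by (intro tendsto_mult_left tendsto_power_div_exp_0)
  then have "((\<lambda>y. \<Sum>i\<le>degree p. coeff p i * (y ^ i / exp y)) \<longlongrightarrow> (\<Sum>i\<le>degree p. coeff p i * 0)) at_top"
    by (rule tendsto_sum)
  moreover have "poly p y * exp (- y) = (\<Sum>i\<le>degree p. coeff p i * (y ^ i / exp y))" for y :: real
    by (simp add: poly_altdef exp_minus sum_distrib_right divide_inverse mult.assoc)
  ultimately show ?thesis by simp
qed

text \<open>Only the origin is delicate: from the right the difference quotient is again a
  polynomial in 1/x times exp(-1/x), which tends to 0.\<close>

lemma flat_has_derivative: "(flat n has_real_derivative flat (Suc n) x) (at x)"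
proof -
  consider "x < 0" | "x = 0" | "0 < x" by linarith
  then show ?thesis
  proof cases
    case 1
    have "((\<lambda>_. 0) has_real_derivative 0) (at x)" by simp
    then have "(flat n has_real_derivative 0) (at x)"
      by (rule has_field_derivative_transform_within_open[of _ _ _ "{..<0}"]) (use 1 in \<open>auto simp: flat_def\<close>)
    then show ?thesis using 1 by (simp add: flat_def)
  next
    case 3
    have "((\<lambda>x. poly (flat_poly n) (1 / x) * exp (- (1 / x))) has_real_derivative
       (poly (pderiv (flat_poly n)) (1 / x) * (- 1 / x\<^sup>2)) * exp (- (1 / x)) +
        (exp (- (1 / x)) * (1 / x\<^sup>2)) * poly (flat_poly n) (1 / x)) (at x)"
      using 3 by (auto intro!: derivative_eq_intros poly_DERIV simp: power2_eq_square)
    also have "(poly (pderiv (flat_poly n)) (1 / x) * (- 1 / x\<^sup>2)) * exp (- (1 / x)) +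
        (exp (- (1 / x)) * (1 / x\<^sup>2)) * poly (flat_poly n) (1 / x) = flat (Suc n) x"
      using 3 by (simp add: flat_def field_simps power2_eq_square)
    finally show ?thesis
      by (rule has_field_derivative_transform_within_open[of _ _ _ "{0<..}"]) (use 3 in \<open>auto simp: flat_def\<close>)
  next
    case 2
    have "((\<lambda>h. flat n h / h) \<longlongrightarrow> 0) (at_left 0)"
    proof (rule Lim_transform_eventually[of "\<lambda>_. 0"])
      show "\<forall>\<^sub>F h in at_left 0. 0 = flat n h / h"
        by (auto simp: eventually_at_filter flat_def)
    qed simp
    moreover have "((\<lambda>h. flat n h / h) \<longlongrightarrow> 0) (at_right 0)"
    proof (rule Lim_transform_eventually)
      show "((\<lambda>h. poly ([:0, 1:] * flat_poly n) (inverse h) * exp (- inverse h)) \<longlongrightarrow> 0) (at_right 0)"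
        by (rule filterlim_compose[OF poly_times_exp_tendsto_0 filterlim_inverse_at_top_right])
      show "\<forall>\<^sub>F h in at_right 0. poly ([:0, 1:] * flat_poly n) (inverse h) * exp (- inverse h) = flat n h / h"
        by (auto simp: eventually_at_filter flat_def field_simps)
    qed
    ultimately have "((\<lambda>h. flat n h / h) \<longlongrightarrow> 0) (at 0)"
      by (rule filterlim_split_at)
    then show ?thesis
      using 2 by (simp add: has_field_derivative_iff flat_def)
  qed
qed

lemma flat_pos: "0 < flat 0 x \<longleftrightarrow> 0 < x"
  by (simp add: flat_def)

lemma flat_nonneg: "0 \<le> flat 0 x"
  by (simp add: flat_def)

lemma smooth_continuous: "smooth f \<Longrightarrow> continuous_on UNIV f"
  unfolding smooth_def by (drule spec[of _ 0]) simp

lemma smooth_differentiable: "smooth f \<Longrightarrow> f differentiable (at x)"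
  unfolding smooth_def by (drule spec[of _ 1]) simp

lemma smooth_frechet_continuous: "smooth f \<Longrightarrow> continuous_on UNIV (\<lambda>x. frechet_derivative f (at x) v)"
  unfolding smooth_def by (drule spec[of _ 1]) simp

lemma smooth_affine:
  fixes f :: "'a::real_normed_vector \<Rightarrow> real"
  shows "smooth f \<Longrightarrow> smooth (\<lambda>x. a * f (c *\<^sub>R (x - y)))"
  by (simp add: smooth_def times_cont_differentiable_affine)

text \<open>A product of one-dimensional bumps over the coordinates. With
  \<open>c = CARD('n)\<close> a nonzero value forces every coordinate to be at most 1 / c in
  modulus, so the l1 norm, and with it the Euclidean norm, is at most 1.\<close>

lemma smooth_bump_exists:
  "\<exists>R :: real^'n \<Rightarrow> real. smooth R \<and> (\<forall>x. 0 \<le> R x) \<and> (\<forall>x. 1 < norm x \<longrightarrow> R x = 0) \<and> 0 < R 0"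
proof -
  define c where "c = real CARD('n)"
  have c: "0 < c" by (simp add: c_def)
  define R where "R x = (\<Prod>i\<in>UNIV. flat 0 (1 + c * x $ i) * flat 0 (1 - c * x $ i))" for x :: "real^'n"
  have sm: "times_cont_differentiable k (\<lambda>x :: real^'n. flat 0 (1 + s * x $ i))" for k s i
  proof -
    have "bounded_linear (\<lambda>x :: real^'n. s * x $ i)"
      by (intro bounded_linear_mult_right[THEN bounded_linear_compose] bounded_linear_vec_nth)
    from times_cont_differentiable_real_compose[of flat, OF flat_has_derivative this, of k 1 0 1]
    show ?thesis by simp
  qed
  have "smooth R"
    unfolding smooth_def R_def
    using sm[of _ c] sm[of _ "- c"]
    by (intro allI times_cont_differentiable_prod times_cont_differentiable_mult) auto
  moreover have "R x = 0" if x: "1 < norm x" for x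
  proof (rule ccontr)
    assume "R x \<noteq> 0"
    then have "flat 0 (1 + c * x $ i) \<noteq> 0 \<and> flat 0 (1 - c * x $ i) \<noteq> 0" for i
      by (auto simp: R_def)
    then have "0 < 1 + c * x $ i \<and> 0 < 1 - c * x $ i" for i
      using flat_nonneg flat_pos by (metis order_le_less)
    then have "c * \<bar>x $ i\<bar> \<le> 1" for i
      by (smt (verit) c mult_minus_right)
    then have "(\<Sum>i\<in>UNIV. c * \<bar>x $ i\<bar>) \<le> (\<Sum>i\<in>(UNIV::'n set). 1)"
      by (intro sum_mono) auto
    then have "c * (\<Sum>i\<in>UNIV. \<bar>x $ i\<bar>) \<le> c"
      by (simp add: sum_distrib_left c_def)
    then have "(\<Sum>i\<in>UNIV. \<bar>x $ i\<bar>) \<le> 1" using c by simp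
    then show False using norm_le_l1_cart[of x] x by linarith
  qed
  moreover have "0 < R 0" by (auto simp: R_def flat_def intro!: prod_pos)
  moreover have "0 \<le> R x" for x by (auto simp: R_def flat_nonneg intro!: prod_nonneg)
  ultimately show ?thesis by blast
qed

lemma mollifier_exists:
  "\<exists>R :: real^'n \<Rightarrow> real. smooth R \<and> (\<forall>x. 0 \<le> R x) \<and> (\<forall>x. 1 < norm x \<longrightarrow> R x = 0) \<and>
     (\<integral>\<^sup>+x. ennreal (R x) \<partial>lborel) = 1 \<and> (\<exists>K. \<forall>x. R x \<le> K)"
proof -
  obtain R :: "real^'n \<Rightarrow> real" where R: "smooth R" "\<And>x. 0 \<le> R x" "\<And>x. 1 < norm x \<Longrightarrow> R x = 0" "0 < R 0"
    using smooth_bump_exists by blast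
  have cont: "continuous_on UNIV R" by (rule smooth_continuous[OF R(1)])
  have m: "R \<in> borel_measurable borel" by (rule borel_measurable_continuous_onI[OF cont])
  have "compact (R ` cball 0 1)"
    by (rule compact_continuous_image[OF continuous_on_subset[OF cont]]) auto
  then obtain K where K: "\<And>x. x \<in> cball 0 1 \<Longrightarrow> norm (R x) \<le> K"
    by (meson compact_imp_bounded bounded_pos imageI)
  have bd: "R x \<le> K" for x
  proof (cases "norm x \<le> 1")
    case True then show ?thesis using K[of x] by auto
  next
    case False
    then show ?thesis using R(3)[of x] K[of 0] by auto
  qed
  have K0: "0 \<le> K" using K[of 0] norm_ge_zero[of "R 0"] by (auto intro: order_trans)
  define J where "J = (\<integral>\<^sup>+x. ennreal (R x) \<partial>lborel)"
  have "J \<le> (\<integral>\<^sup>+x. ennreal K * indicator (cball (0::real^'n) 1) x \<partial>lborel)"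
    unfolding J_def
  proof (rule nn_integral_mono)
    fix x :: "real^'n" show "ennreal (R x) \<le> ennreal K * indicator (cball 0 1) x"
      using bd[of x] R(3)[of x] by (cases "norm x \<le> 1") (auto intro: ennreal_leI)
  qed
  also have "\<dots> = ennreal K * emeasure lborel (cball (0::real^'n) 1)"
    by (intro nn_integral_cmult_indicator) auto
  also have "\<dots> < top"
    using emeasure_lborel_cball_finite[of "0::real^'n" 1] by (simp add: ennreal_mult_less_top)
  finally have Jf: "J < top" .
  \<comment> \<open>The set where \<open>R\<close> is positive is open and contains 0, hence is not
    negligible.\<close>
  have J0: "J \<noteq> 0"
  proof
    assume "J = 0"
    then have "emeasure lborel {x \<in> space lborel. ennreal (R x) \<noteq> 0} = 0"
      unfolding J_def using m by (subst (asm) nn_integral_0_iff) simp_all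
    moreover have "{x \<in> space lborel. ennreal (R x) \<noteq> 0} = {x. 0 < R x}"
      by (auto simp: ennreal_eq_0_iff not_le)
    ultimately have "{x. 0 < R x} \<in> null_sets lborel"
      using m by (intro null_setsI) simp_all
    then have "{x. 0 < R x} \<in> null_sets lebesgue" by (rule null_sets_completionI)
    then have "negligible {x. 0 < R x}" by (simp add: negligible_iff_null_sets)
    moreover have "open {x. 0 < R x}"
      using cont by (intro open_Collect_less) auto
    ultimately show False using open_not_negligible[of "{x. 0 < R x}"] R(4) by auto
  qed
  obtain j where j: "J = ennreal j" "0 < j"
    using Jf J0 by (cases J) (auto simp: order_le_less)
  define S where "S x = (1 / j) * R (1 *\<^sub>R (x - 0))" for x
  have "smooth S" unfolding S_def by (rule smooth_affine[OF R(1)])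
  moreover have "(\<integral>\<^sup>+x. ennreal (S x) \<partial>lborel) = 1"
  proof -
    have "(\<integral>\<^sup>+x. ennreal (S x) \<partial>lborel) = ennreal (1 / j) * J"
      unfolding S_def J_def using R(2) j m by (subst nn_integral_cmult[symmetric]) (auto simp: ennreal_mult[symmetric])
    also have "\<dots> = 1" using j by (simp add: ennreal_mult[symmetric])
    finally show ?thesis .
  qed
  moreover have "S x \<le> K / j" for x unfolding S_def using bd[of x] j by (simp add: divide_right_mono)
  ultimately show ?thesis using R j by (intro exI[of _ S]) (auto simp: S_def)
qed

section \<open>Pointwise difference quotients of Sobolev functions\<close>

lemma cball_borel_measurable [measurable]: "cball x r \<in> sets (borel :: 'a::euclidean_space measure)"
  by (rule borel_closed[OF closed_cball])

lemma nn_integral_affine: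
  fixes f :: "'a::euclidean_space \<Rightarrow> ennreal"
  assumes f: "f \<in> borel_measurable borel" and c: "c \<noteq> 0"
  shows "(\<integral>\<^sup>+x. f x \<partial>lborel) = ennreal (\<bar>c\<bar> ^ DIM('a)) * (\<integral>\<^sup>+x. f (t + c *\<^sub>R x) \<partial>lborel)"
proof -
  have m: "(\<lambda>x::'a. t + c *\<^sub>R x) \<in> borel_measurable borel"
    by (intro borel_measurable_continuous_onI continuous_intros)
  have "(\<integral>\<^sup>+x. f x \<partial>lborel) = (\<integral>\<^sup>+x. f x \<partial>density (distr lborel borel (\<lambda>x. t + c *\<^sub>R x)) (\<lambda>_. \<bar>c\<bar> ^ DIM('a)))"
    using lborel_affine[OF c, of t] by simp
  also have "\<dots> = (\<integral>\<^sup>+x. ennreal (\<bar>c\<bar> ^ DIM('a)) * f x \<partial>distr lborel borel (\<lambda>x. t + c *\<^sub>R x))"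
    using f by (subst nn_integral_density) simp_all
  also have "\<dots> = (\<integral>\<^sup>+x. ennreal (\<bar>c\<bar> ^ DIM('a)) * f (t + c *\<^sub>R x) \<partial>lborel)"
    using f m by (subst nn_integral_distr) simp_all
  also have "\<dots> = ennreal (\<bar>c\<bar> ^ DIM('a)) * (\<integral>\<^sup>+x. f (t + c *\<^sub>R x) \<partial>lborel)"
    using measurable_compose[OF m f] by (intro nn_integral_cmult) simp
  finally show ?thesis .
qed

lemma nn_integral_reflect_translate:
  fixes f :: "'a::euclidean_space \<Rightarrow> ennreal"
  assumes f: "f \<in> borel_measurable borel"
  shows "(\<integral>\<^sup>+x. f (x - y) \<partial>lborel) = (\<integral>\<^sup>+x. f x \<partial>lborel)" "(\<integral>\<^sup>+x. f (y - x) \<partial>lborel) = (\<integral>\<^sup>+x. f x \<partial>lborel)"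
  using nn_integral_affine[OF f, of 1 "- y"] nn_integral_affine[OF f, of "- 1" y] by simp_all

lemma ennreal_norm_integral_le:
  "ennreal (norm (integral\<^sup>L M f)) \<le> (\<integral>\<^sup>+x. ennreal (norm (f x)) \<partial>M)"
  using integral_norm_bound_ennreal[of M f] by (cases "integrable M f") (auto simp: not_integrable_integral_eq)

section \<open>Mollification of locally integrable functions\<close>

definition locally_integrable :: "('a::euclidean_space \<Rightarrow> 'b::euclidean_space) \<Rightarrow> bool" where
  "locally_integrable u \<longleftrightarrow> u \<in> borel_measurable borel \<and>
     (\<forall>r. (\<integral>\<^sup>+w\<in>cball 0 r. ennreal (norm (u w)) \<partial>lborel) < top)"

lemma locally_integrable_dominates:
  fixes f :: "'a::euclidean_space \<Rightarrow> 'c::euclidean_space"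
  assumes u: "locally_integrable u" and f: "f \<in> borel_measurable borel"
    and C: "0 \<le> C" and le: "\<And>w. norm (f w) \<le> C * norm (u w)" and z: "\<And>w. r < norm w \<Longrightarrow> f w = 0"
  shows "integrable lborel f"
proof (rule integrableI_bounded)
  show "f \<in> borel_measurable lborel" using f by simp
  have mu: "u \<in> borel_measurable borel" using u by (simp add: locally_integrable_def)
  have "(\<integral>\<^sup>+w. ennreal (norm (f w)) \<partial>lborel) \<le> (\<integral>\<^sup>+w. ennreal C * (ennreal (norm (u w)) * indicator (cball 0 r) w) \<partial>lborel)"
  proof (rule nn_integral_mono)
    fix w show "ennreal (norm (f w)) \<le> ennreal C * (ennreal (norm (u w)) * indicator (cball 0 r) w)"
      using le[of w] z[of w] C by (cases "norm w \<le> r") (auto simp: ennreal_mult[symmetric] intro: ennreal_leI)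
  qed
  also have "\<dots> = ennreal C * (\<integral>\<^sup>+w\<in>cball 0 r. ennreal (norm (u w)) \<partial>lborel)"
    using mu by (intro nn_integral_cmult) simp
  also have "\<dots> < top"
    using u by (auto simp: locally_integrable_def ennreal_mult_less_top)
  finally show "(\<integral>\<^sup>+w. ennreal (norm (f w)) \<partial>lborel) < \<infinity>" by simp
qed

text \<open>A kernel at scale \<open>\<eta>\<close> whose height is tied to the volume of its
  support by \<open>K\<close>. One \<open>K\<close> serves all scales, which keeps the comparison
  with the maximal function uniform in \<open>\<eta>\<close>.\<close>

definition mollifier :: "real \<Rightarrow> real \<Rightarrow> ('a::euclidean_space \<Rightarrow> real) \<Rightarrow> bool" where
  "mollifier K \<eta> k \<longleftrightarrow> smooth k \<and> (\<forall>x. 0 \<le> k x \<and> k x \<le> K / \<eta> ^ DIM('a)) \<and>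
     (\<forall>x. \<eta> < norm x \<longrightarrow> k x = 0) \<and> (\<integral>\<^sup>+x. ennreal (k x) \<partial>lborel) = 1"

lemma mollifiers_exist:
  "\<exists>K>0. \<forall>\<eta>>0. \<exists>k :: real^'n \<Rightarrow> real. mollifier K \<eta> k"
proof -
  obtain R :: "real^'n \<Rightarrow> real" and K where R: "smooth R" "\<And>x. 0 \<le> R x" "\<And>x. 1 < norm x \<Longrightarrow> R x = 0"
    "(\<integral>\<^sup>+x. ennreal (R x) \<partial>lborel) = 1" "\<And>x. R x \<le> K"
    using mollifier_exists by blast
  have "\<exists>k :: real^'n \<Rightarrow> real. mollifier (max 1 K) \<eta> k" if \<eta>: "0 < \<eta>" for \<eta>
  proof -
    define k where "k x = (1 / \<eta> ^ DIM(real^'n)) * R ((1 / \<eta>) *\<^sub>R (x - 0))" for x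
    have sk: "smooth k" unfolding k_def by (rule smooth_affine[OF R(1)])
    have mk: "k \<in> borel_measurable borel" by (rule borel_measurable_continuous_onI[OF smooth_continuous[OF sk]])
    have mR: "R \<in> borel_measurable borel" by (rule borel_measurable_continuous_onI[OF smooth_continuous[OF R(1)]])
    have "(\<integral>\<^sup>+x. ennreal (k x) \<partial>lborel) = ennreal (\<bar>\<eta>\<bar> ^ DIM(real^'n)) * (\<integral>\<^sup>+x. ennreal (k (0 + \<eta> *\<^sub>R x)) \<partial>lborel)"
      using mk \<eta> by (intro nn_integral_affine) simp_all
    also have "(\<lambda>x. ennreal (k (0 + \<eta> *\<^sub>R x))) = (\<lambda>x. ennreal (1 / \<eta> ^ DIM(real^'n)) * ennreal (R x))"
      using \<eta> R(2) by (simp add: k_def ennreal_mult[symmetric])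
    also have "(\<integral>\<^sup>+x. ennreal (1 / \<eta> ^ DIM(real^'n)) * ennreal (R x) \<partial>lborel) = ennreal (1 / \<eta> ^ DIM(real^'n))"
      using R(4) mR by (subst nn_integral_cmult) simp_all
    also have "ennreal (\<bar>\<eta>\<bar> ^ DIM(real^'n)) * \<dots> = 1"
      using \<eta> by (simp add: ennreal_mult[symmetric])
    finally have int: "(\<integral>\<^sup>+x. ennreal (k x) \<partial>lborel) = 1" .
    have "k x \<le> max 1 K / \<eta> ^ DIM(real^'n)" for x
      using R(5)[of "(1 / \<eta>) *\<^sub>R (x - 0)"] \<eta> unfolding k_def
      by (simp add: divide_right_mono max.coboundedI2)
    moreover have "k x = 0" if "\<eta> < norm x" for x
      unfolding k_def using \<eta> that by (subst R(3)) (simp_all add: field_simps)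
    ultimately show ?thesis
      unfolding mollifier_def using sk int R(2) \<eta> by (intro exI[of _ k]) (auto simp: k_def)
  qed
  then show ?thesis by (intro exI[of _ "max 1 K"]) auto
qed

lemma mollifier_measurable: "mollifier K \<eta> k \<Longrightarrow> k \<in> borel_measurable borel"
  unfolding mollifier_def by (blast intro: borel_measurable_continuous_onI smooth_continuous)

lemma measurable_shift:
  fixes k :: "'a::euclidean_space \<Rightarrow> 'b::topological_space"
  assumes k: "k \<in> borel_measurable borel"
  shows "(\<lambda>w. k (w - y)) \<in> borel_measurable borel" "(\<lambda>y. k (w - y)) \<in> borel_measurable borel"
    "(\<lambda>z. k (snd z - fst z)) \<in> borel_measurable borel" "(\<lambda>z. k (fst z - snd z)) \<in> borel_measurable borel"
  by (rule measurable_compose[OF _ k], intro borel_measurable_continuous_onI continuous_intros)+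

lemma frechet_derivative_zero_outside:
  fixes k :: "'a::euclidean_space \<Rightarrow> real"
  assumes "\<And>x. \<eta> < norm x \<Longrightarrow> k x = 0" "\<eta> < norm x"
  shows "frechet_derivative k (at x) v = 0"
proof -
  have "((\<lambda>_. 0 :: real) has_derivative (\<lambda>_. 0)) (at x)" by simp
  then have "(k has_derivative (\<lambda>_. 0)) (at x)"
  proof (rule has_derivative_transform_within_open)
    show "open {x::'a. \<eta> < norm x}" by (intro open_Collect_less continuous_intros)
  qed (use assms in auto)
  from frechet_derivative_at[OF this] show ?thesis by metis
qed

lemma mollifier_derivative_bounded:
  assumes k: "mollifier K \<eta> k"
  shows "\<exists>M\<ge>0. \<forall>x. \<bar>frechet_derivative k (at x) v\<bar> \<le> M"
proof -
  have c: "continuous_on UNIV (\<lambda>x. frechet_derivative k (at x) v)"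
    using k unfolding mollifier_def by (blast intro: smooth_frechet_continuous)
  have "compact ((\<lambda>x. frechet_derivative k (at x) v) ` cball 0 \<eta>)"
    by (rule compact_continuous_image[OF continuous_on_subset[OF c]]) auto
  from compact_imp_bounded[OF this] obtain M where
    "0 < M" "\<forall>y\<in>(\<lambda>x. frechet_derivative k (at x) v) ` cball 0 \<eta>. norm y \<le> M"
    unfolding bounded_pos by (elim exE conjE)
  then have M: "0 < M" "\<And>x. x \<in> cball 0 \<eta> \<Longrightarrow> norm (frechet_derivative k (at x) v) \<le> M"
    by simp_all
  have "\<bar>frechet_derivative k (at x) v\<bar> \<le> M" for x
  proof (cases "norm x \<le> \<eta>")
    case True then show ?thesis using M(2)[of x] by simp
  next
    case False
    then have "frechet_derivative k (at x) v = 0"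
      using k by (intro frechet_derivative_zero_outside[of \<eta>]) (auto simp: mollifier_def)
    then show ?thesis using M(1) by simp
  qed
  then show ?thesis using M(1) by (intro exI[of _ M]) auto
qed

lemma mollifier_test_function:
  fixes k :: "real^'n \<Rightarrow> real"
  assumes k: "mollifier K \<eta> k"
  shows "test_function (\<lambda>w. k (w - y))"
  unfolding test_function_def
proof
  show "smooth (\<lambda>w. k (w - y))"
    using smooth_affine[of k 1 1 y] k by (simp add: mollifier_def)
  have "{w. k (w - y) \<noteq> 0} \<subseteq> cball y \<eta>"
    using k by (auto simp: mollifier_def dist_norm norm_minus_commute not_less[symmetric])
  then show "compact (closure {w. k (w - y) \<noteq> 0})"
    by (meson bounded_cball bounded_subset compact_closure)
qed

lemma mollifier_shift_derivative:
  assumes k: "mollifier K \<eta> k"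
  shows "((\<lambda>w. k (w - y)) has_derivative frechet_derivative k (at (w - y))) (at w)"
proof -
  have f: "(k has_derivative frechet_derivative k (at (w - y))) (at (w - y))"
    using k frechet_derivative_works smooth_differentiable unfolding mollifier_def by blast
  have "((\<lambda>w. w - y) has_derivative (\<lambda>v. v)) (at w)" by (auto intro!: derivative_eq_intros)
  from has_derivative_compose[OF this f] show ?thesis .
qed

lemma mollify_integrable:
  fixes u :: "'a::euclidean_space \<Rightarrow> real"
  assumes u: "locally_integrable u" and f: "f \<in> borel_measurable borel" "\<And>x. \<bar>f x\<bar> \<le> M" "\<And>x. \<eta> < norm x \<Longrightarrow> f x = 0"
  shows "integrable lborel (\<lambda>w. f (w - y) * u w)"
proof (rule locally_integrable_dominates[OF u])
  have mu: "u \<in> borel_measurable borel" using u by (simp add: locally_integrable_def)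
  show "(\<lambda>w. f (w - y) * u w) \<in> borel_measurable borel"
    using measurable_shift(1)[OF f(1), of y] mu by simp
  show "0 \<le> M" using f(2)[of 0] by linarith
  show "norm (f (w - y) * u w) \<le> M * norm (u w)" for w
    using f(2)[of "w - y"] by (simp add: abs_mult mult_right_mono)
  show "f (w - y) * u w = 0" if "\<eta> + norm y < norm w" for w
    using f(3)[of "w - y"] norm_triangle_ineq2[of w y] that by simp
qed

text \<open>The kernel is taken at \<open>w - y\<close> instead of \<open>y - w\<close>, so that in
  the integration variable it is a translated test function and the weak derivative applies to it at
  once.\<close>

definition mollify :: "('a::euclidean_space \<Rightarrow> real) \<Rightarrow> ('a \<Rightarrow> real) \<Rightarrow> 'a \<Rightarrow> real" where
  "mollify k u y = (LINT w|lborel. k (w - y) * u w)"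

definition mollify_nn :: "('a::euclidean_space \<Rightarrow> real) \<Rightarrow> ('a \<Rightarrow> ennreal) \<Rightarrow> 'a \<Rightarrow> ennreal" where
  "mollify_nn k g y = (\<integral>\<^sup>+w. ennreal (k (w - y)) * g w \<partial>lborel)"

lemma mollify_nn_measurable:
  fixes g :: "'a::euclidean_space \<Rightarrow> ennreal"
  assumes k: "k \<in> borel_measurable borel" and g: "g \<in> borel_measurable borel"
  shows "mollify_nn k g \<in> borel_measurable borel"
proof -
  have "(\<lambda>z. ennreal (k (snd z - fst z)) * g (snd z)) \<in> borel_measurable (lborel \<Otimes>\<^sub>M lborel)"
    unfolding lborel_prod measurable_lborel2
    by (intro borel_measurable_times_ennreal measurable_compose[OF measurable_shift(3)[OF k] measurable_ennreal]
      measurable_compose[OF borel_measurable_snd_borel g])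
  from lborel.borel_measurable_nn_integral_fst[OF this] show ?thesis
    unfolding mollify_nn_def[abs_def] by simp
qed

lemma mollify_measurable:
  fixes u :: "'a::euclidean_space \<Rightarrow> real"
  assumes k: "k \<in> borel_measurable borel" and g: "u \<in> borel_measurable borel"
  shows "mollify k u \<in> borel_measurable borel"
proof -
  have "(\<lambda>z. k (snd z - fst z) * u (snd z)) \<in> borel_measurable (lborel \<Otimes>\<^sub>M lborel)"
    unfolding lborel_prod measurable_lborel2
    by (intro borel_measurable_times measurable_shift(3)[OF k] measurable_compose[OF borel_measurable_snd_borel g])
  then have "case_prod (\<lambda>y w. k (w - y) * u w) \<in> borel_measurable (lborel \<Otimes>\<^sub>M lborel)"
    by (simp add: case_prod_beta')
  from lborel.borel_measurable_lebesgue_integral[OF this] show ?thesis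
    unfolding mollify_def[abs_def] by simp
qed

text \<open>The fundamental theorem of calculus along the segment from \<open>y\<close> to
  \<open>y + z\<close> is applied to the kernel, not to \<open>mollify k u\<close>. Fubini then
  leaves, for each parameter \<open>s\<close>, an integral of \<open>u\<close> against a derivative
  of the kernel, which the weak derivative turns into an average of \<open>v\<close>. In the
  application \<open>v\<close> is one row of the gradient and \<open>g\<close> the norm of the whole
  matrix.\<close>

lemma mollify_difference:
  fixes u :: "real^'n \<Rightarrow> real" and v :: "real^'n \<Rightarrow> real^'n" and z :: "real^'n"
  assumes k: "mollifier K \<eta> k" and u: "locally_integrable u" and v: "locally_integrable v"
    and weak: "\<And>\<phi> j. test_function \<phi> \<Longrightarrow>
      (LINT w|lborel. u w * frechet_derivative \<phi> (at w) (axis j 1)) = - (LINT w|lborel. v w $ j * \<phi> w)"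
    and gm: "g \<in> borel_measurable borel" and g: "\<And>w. norm (v w) \<le> g w"
  shows "ennreal \<bar>mollify k u (y + z) - mollify k u y\<bar> \<le>
    ennreal (norm z) * (\<integral>\<^sup>+s\<in>{0..1}. mollify_nn k (\<lambda>w. ennreal (g w)) (y + s *\<^sub>R z) \<partial>lborel)"
proof -
  define dk where "dk x w = frechet_derivative k (at x) w" for x w
  have mk: "k \<in> borel_measurable borel" by (rule mollifier_measurable[OF k])
  have kb: "\<bar>k x\<bar> \<le> K / \<eta> ^ DIM(real^'n)" for x using k by (auto simp: mollifier_def)
  have kz: "k x = 0" if "\<eta> < norm x" for x using k that by (auto simp: mollifier_def)
  have mu: "u \<in> borel_measurable borel" using u by (simp add: locally_integrable_def)
  have mv: "v \<in> borel_measurable borel" using v by (simp add: locally_integrable_def)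
  have dkc: "continuous_on UNIV (\<lambda>x. dk x w)" for w
    unfolding dk_def using k smooth_frechet_continuous unfolding mollifier_def by blast
  have dkm: "(\<lambda>x. dk x w) \<in> borel_measurable borel" for w
    by (rule borel_measurable_continuous_onI[OF dkc])
  have dkz: "dk x w = 0" if "\<eta> < norm x" for x w
    unfolding dk_def using kz that by (rule frechet_derivative_zero_outside)
  obtain M where M: "0 \<le> M" "\<And>x. \<bar>dk x z\<bar> \<le> M"
    using mollifier_derivative_bounded[OF k, of z] unfolding dk_def by blast
  have dint: "integrable lborel (\<lambda>w. dk (w - q) a * u w)" for q a
  proof -
    obtain M where "\<And>x. \<bar>dk x a\<bar> \<le> M"
      using mollifier_derivative_bounded[OF k, of a] unfolding dk_def by blast
    from mollify_integrable[OF u dkm this dkz] show ?thesis .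
  qed
  have vint: "integrable lborel (\<lambda>w. k (w - q) * (v w \<bullet> a))" for q a
  proof (rule locally_integrable_dominates[OF v])
    show "(\<lambda>w. k (w - q) * (v w \<bullet> a)) \<in> borel_measurable borel"
      using measurable_shift(1)[OF mk, of q] mv by simp
    show "0 \<le> K / \<eta> ^ DIM(real^'n) * norm a"
      by (rule mult_nonneg_nonneg[OF order_trans[OF abs_ge_zero kb[of 0]] norm_ge_zero])
    show "norm (k (w - q) * (v w \<bullet> a)) \<le> K / \<eta> ^ DIM(real^'n) * norm a * norm (v w)" for w
    proof -
      have "norm (k (w - q) * (v w \<bullet> a)) \<le> (K / \<eta> ^ DIM(real^'n)) * (norm (v w) * norm a)"
        using kb[of "w - q"] Cauchy_Schwarz_ineq2[of "v w" a] kb[of 0]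
        unfolding norm_mult by (intro mult_mono) auto
      then show ?thesis by (simp add: mult_ac)
    qed
    show "k (w - q) * (v w \<bullet> a) = 0" if "\<eta> + norm q < norm w" for w
      using kz[of "w - q"] norm_triangle_ineq2[of w q] that by simp
  qed
  \<comment> \<open>The weak derivative is given for coordinate directions; linearity of the
    derivative of \<open>k\<close> extends it to the direction \<open>z\<close>.\<close>
  have byparts: "(LINT w|lborel. dk (w - q) z * u w) = - (LINT w|lborel. k (w - q) * (v w \<bullet> z))" for q
  proof -
    have dphi: "frechet_derivative (\<lambda>w. k (w - q)) (at w) a = dk (w - q) a" for w a
      unfolding dk_def using frechet_derivative_at[OF mollifier_shift_derivative[OF k, of q w]] by metis
    have lin: "linear (dk x)" for x
      using k smooth_differentiable linear_frechet_derivative unfolding mollifier_def dk_def[abs_def] by blast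
    have dsum: "dk x z = (\<Sum>j\<in>UNIV. z $ j * dk x (axis j 1))" for x
    proof -
      have "dk x z = dk x (\<Sum>j\<in>UNIV. z $ j *\<^sub>R axis j 1)"
        using basis_expansion[of z] by (simp add: scalar_mult_eq_scaleR)
      also have "\<dots> = (\<Sum>j\<in>UNIV. z $ j * dk x (axis j 1))"
        by (simp add: linear_sum[OF lin] linear_scale[OF lin])
      finally show ?thesis .
    qed
    have "(LINT w|lborel. dk (w - q) z * u w) = (LINT w|lborel. (\<Sum>j\<in>UNIV. z $ j * (dk (w - q) (axis j 1) * u w)))"
      by (simp add: dsum[of "_ - q"] sum_distrib_right mult.assoc)
    also have "\<dots> = (\<Sum>j\<in>UNIV. LINT w|lborel. z $ j * (dk (w - q) (axis j 1) * u w))"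
      using dint by (intro Bochner_Integration.integral_sum integrable_mult_right) auto
    also have "\<dots> = (\<Sum>j\<in>UNIV. z $ j * - (LINT w|lborel. v w $ j * k (w - q)))"
      using weak[OF mollifier_test_function[OF k, of q]] by (simp add: dphi mult.commute)
    also have "\<dots> = - (\<Sum>j\<in>UNIV. LINT w|lborel. z $ j * (v w $ j * k (w - q)))"
      by (simp add: sum_negf)
    also have "(\<Sum>j\<in>UNIV. LINT w|lborel. z $ j * (v w $ j * k (w - q)))
       = (LINT w|lborel. (\<Sum>j\<in>UNIV. z $ j * (v w $ j * k (w - q))))"
    proof (intro Bochner_Integration.integral_sum[symmetric] integrable_mult_right)
      fix j show "integrable lborel (\<lambda>w. v w $ j * k (w - q))"
        using vint[of q "axis j 1"] by (simp add: inner_axis mult.commute)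
    qed
    also have "\<dots> = (LINT w|lborel. k (w - q) * (v w \<bullet> z))"
      by (intro Bochner_Integration.integral_cong) (simp_all add: inner_vec_def sum_distrib_left mult_ac)
    finally show ?thesis .
  qed
  \<comment> \<open>The integrand on parameter times space. It is integrable on the product because
    the kernels for all \<open>s\<close> in the unit interval live in a common ball, of radius
    \<open>\<eta> + norm y + norm z\<close>.\<close>
  define H where "H s w = indicator {0..1} s * (dk (w - (y + s *\<^sub>R z)) z * u w)" for s :: real and w
  have Hm: "case_prod H \<in> borel_measurable (lborel \<Otimes>\<^sub>M lborel)"
  proof -
    have 1: "(\<lambda>p :: real \<times> (real^'n). dk (snd p - (y + fst p *\<^sub>R z)) z) \<in> borel_measurable borel"
      by (intro measurable_compose[OF _ dkm] borel_measurable_continuous_onI continuous_intros)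
    have 2: "(\<lambda>p :: real \<times> (real^'n). indicator {0..1} (fst p) :: real) \<in> borel_measurable borel"
      by (rule measurable_compose[OF borel_measurable_fst_borel]) simp
    show ?thesis
      unfolding lborel_prod measurable_lborel2 H_def case_prod_beta'
      by (intro borel_measurable_times 1 2 measurable_compose[OF borel_measurable_snd_borel mu])
  qed
  define r where "r = \<eta> + norm y + norm z"
  have Hb: "norm (H s w) \<le> M * indicator {0..1} s * (norm (u w) * indicator (cball 0 r) w)" for s w
  proof (cases "s \<in> {0..1} \<and> norm w \<le> r")
    case True
    then show ?thesis using M(2)[of "w - (y + s *\<^sub>R z)"] by (simp add: H_def abs_mult mult_right_mono)
  next
    case False
    have "dk (w - (y + s *\<^sub>R z)) z = 0" if "s \<in> {0..1}" "r < norm w"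
    proof (rule dkz)
      have "norm (y + s *\<^sub>R z) \<le> norm y + s * norm z"
        using norm_triangle_ineq[of y "s *\<^sub>R z"] that by simp
      also have "s * norm z \<le> 1 * norm z" using that by (intro mult_right_mono) auto
      finally show "\<eta> < norm (w - (y + s *\<^sub>R z))"
        using norm_triangle_ineq2[of w "y + s *\<^sub>R z"] that unfolding r_def by linarith
    qed
    then show ?thesis using False M(1) by (auto simp: H_def indicator_def)
  qed
  have Hint: "integrable (lborel \<Otimes>\<^sub>M lborel) (case_prod H)"
  proof (rule integrableI_bounded[OF Hm])
    have fm: "(\<lambda>p. ennreal (norm (H (fst p) (snd p)))) \<in> borel_measurable borel"
      using Hm unfolding lborel_prod case_prod_beta' by simp
    have "(\<integral>\<^sup>+p. ennreal (norm (case_prod H p)) \<partial>(lborel \<Otimes>\<^sub>M lborel)) = (\<integral>\<^sup>+s. \<integral>\<^sup>+w. ennreal (norm (H s w)) \<partial>lborel \<partial>lborel)"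
      using nn_integral_lborel_Tonelli(2)[OF fm] by (simp add: lborel_prod case_prod_beta')
    also have "\<dots> \<le> (\<integral>\<^sup>+s. ennreal M * (\<integral>\<^sup>+w\<in>cball 0 r. ennreal (norm (u w)) \<partial>lborel) * indicator {0..1::real} s \<partial>lborel)"
    proof (rule nn_integral_mono)
      fix s :: real
      have "(\<integral>\<^sup>+w. ennreal (norm (H s w)) \<partial>lborel) \<le> (\<integral>\<^sup>+w. (ennreal M * indicator {0..1} s) * (ennreal (norm (u w)) * indicator (cball 0 r) w) \<partial>lborel)"
      proof (rule nn_integral_mono)
        fix w
        have "ennreal (norm (H s w)) \<le> ennreal (M * indicator {0..1} s * (norm (u w) * indicator (cball 0 r) w))"
          by (rule ennreal_leI[OF Hb])
        also have "\<dots> = (ennreal M * indicator {0..1} s) * (ennreal (norm (u w)) * indicator (cball 0 r) w)"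
          using M(1) by (simp add: indicator_def ennreal_mult)
        finally show "ennreal (norm (H s w)) \<le> (ennreal M * indicator {0..1} s) * (ennreal (norm (u w)) * indicator (cball 0 r) w)" .
      qed
      also have "\<dots> = (ennreal M * indicator {0..1} s) * (\<integral>\<^sup>+w\<in>cball 0 r. ennreal (norm (u w)) \<partial>lborel)"
        using mu by (intro nn_integral_cmult) simp
      finally show "(\<integral>\<^sup>+w. ennreal (norm (H s w)) \<partial>lborel) \<le> ennreal M * (\<integral>\<^sup>+w\<in>cball 0 r. ennreal (norm (u w)) \<partial>lborel) * indicator {0..1} s"
        by (simp add: mult_ac)
    qed
    also have "\<dots> = ennreal M * (\<integral>\<^sup>+w\<in>cball 0 r. ennreal (norm (u w)) \<partial>lborel)"
      by (subst nn_integral_cmult_indicator) simp_all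
    also have "\<dots> < \<infinity>"
      using u by (auto simp: locally_integrable_def ennreal_mult_less_top)
    finally show "(\<integral>\<^sup>+p. ennreal (norm (case_prod H p)) \<partial>(lborel \<Otimes>\<^sub>M lborel)) < \<infinity>" .
  qed
  have inner_s: "(LINT s|lborel. H s w) = (k (w - y) - k (w - (y + z))) * u w" for w
  proof -
    have der: "((\<lambda>s. - k (w - (y + s *\<^sub>R z))) has_real_derivative dk (w - (y + s *\<^sub>R z)) z) (at s)" for s
    proof -
      have kd: "(k has_derivative dk (w - (y + s *\<^sub>R z))) (at (w - (y + s *\<^sub>R z)))"
        using k frechet_derivative_works smooth_differentiable unfolding mollifier_def dk_def[abs_def] by blast
      have "((\<lambda>s. w - (y + s *\<^sub>R z)) has_derivative (\<lambda>h. - (h *\<^sub>R z))) (at s)"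
        by (auto intro!: derivative_eq_intros)
      from has_derivative_minus[OF has_derivative_compose[OF this kd]]
      have "((\<lambda>s. - k (w - (y + s *\<^sub>R z))) has_derivative (\<lambda>h. - dk (w - (y + s *\<^sub>R z)) (- (h *\<^sub>R z)))) (at s)" .
      moreover have "(\<lambda>h. - dk (w - (y + s *\<^sub>R z)) (- (h *\<^sub>R z))) = (*) (dk (w - (y + s *\<^sub>R z)) z)"
        using linear_scale[OF has_derivative_linear[OF kd], of _ z] linear_neg[OF has_derivative_linear[OF kd]]
        by (auto simp: mult.commute)
      ultimately show ?thesis by (simp add: has_field_derivative_def)
    qed
    have "(LINT s|lborel. dk (w - (y + s *\<^sub>R z)) z * indicator {0..1} s) = - k (w - (y + 1 *\<^sub>R z)) - - k (w - (y + 0 *\<^sub>R z))"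
    proof (rule integral_FTC_Icc_real)
      fix s :: real
      show "isCont (\<lambda>s. dk (w - (y + s *\<^sub>R z)) z) s"
        by (rule continuous_on_interior[OF continuous_on_compose2[OF dkc], of UNIV])
          (auto intro!: continuous_intros)
    qed (use der in auto)
    moreover have "(LINT s|lborel. H s w) = (LINT s|lborel. dk (w - (y + s *\<^sub>R z)) z * indicator {0..1} s) * u w"
      by (simp add: H_def mult_ac flip: integral_mult_right_zero)
    ultimately show ?thesis by simp
  qed
  have kint: "integrable lborel (\<lambda>w. k (w - q) * u w)" for q
    by (rule mollify_integrable[OF u mk kb kz])
  have "mollify k u (y + z) - mollify k u y = (LINT w|lborel. k (w - (y + z)) * u w - k (w - y) * u w)"
    unfolding mollify_def using kint by (simp add: Bochner_Integration.integral_diff)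
  also have "\<dots> = (LINT w|lborel. - (LINT s|lborel. H s w))"
    by (simp add: inner_s left_diff_distrib)
  also have "\<dots> = - (LINT s|lborel. (LINT w|lborel. H s w))"
    using lborel_pair.Fubini_integral[OF Hint] by simp
  finally have "ennreal \<bar>mollify k u (y + z) - mollify k u y\<bar> = ennreal (norm (LINT s|lborel. (LINT w|lborel. H s w)))"
    by simp
  also have "\<dots> \<le> (\<integral>\<^sup>+s. ennreal (norm (LINT w|lborel. H s w)) \<partial>lborel)"
    by (rule ennreal_norm_integral_le)
  also have "\<dots> \<le> (\<integral>\<^sup>+s. ennreal (norm z) * (mollify_nn k (\<lambda>w. ennreal (g w)) (y + s *\<^sub>R z) * indicator {0..1} s) \<partial>lborel)"
  proof (rule nn_integral_mono)
    fix s :: real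
    have "(LINT w|lborel. H s w) = indicator {0..1} s * - (LINT w|lborel. k (w - (y + s *\<^sub>R z)) * (v w \<bullet> z))"
      unfolding H_def using byparts by simp
    then have "ennreal (norm (LINT w|lborel. H s w)) = indicator {0..1} s * ennreal (norm (LINT w|lborel. k (w - (y + s *\<^sub>R z)) * (v w \<bullet> z)))"
      by (simp add: abs_mult indicator_def)
    also have "\<dots> \<le> indicator {0..1} s * (\<integral>\<^sup>+w. ennreal (norm (k (w - (y + s *\<^sub>R z)) * (v w \<bullet> z))) \<partial>lborel)"
      by (intro mult_left_mono ennreal_norm_integral_le) simp
    also have "\<dots> \<le> indicator {0..1} s * (\<integral>\<^sup>+w. ennreal (norm z) * (ennreal (k (w - (y + s *\<^sub>R z))) * ennreal (g w)) \<partial>lborel)"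
    proof (intro mult_left_mono nn_integral_mono)
      fix w
      have k0: "0 \<le> k (w - (y + s *\<^sub>R z))" using k by (simp add: mollifier_def)
      have g0: "0 \<le> g w" using g[of w] norm_ge_zero order_trans by blast
      have "\<bar>v w \<bullet> z\<bar> \<le> g w * norm z"
        using Cauchy_Schwarz_ineq2[of "v w" z] mult_right_mono[OF g[of w], of "norm z"] by simp
      then have "norm (k (w - (y + s *\<^sub>R z)) * (v w \<bullet> z)) \<le> norm z * (k (w - (y + s *\<^sub>R z)) * g w)"
        using mult_left_mono[OF _ k0] k0 by (fastforce simp: abs_mult mult_ac)
      then show "ennreal (norm (k (w - (y + s *\<^sub>R z)) * (v w \<bullet> z))) \<le> ennreal (norm z) * (ennreal (k (w - (y + s *\<^sub>R z))) * ennreal (g w))"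
        using k0 g0 by (simp add: ennreal_mult[symmetric] ennreal_leI)
    qed simp
    also have "\<dots> \<le> indicator {0..1} s * (ennreal (norm z) * mollify_nn k (\<lambda>w. ennreal (g w)) (y + s *\<^sub>R z))"
    proof (intro mult_left_mono)
      show "(\<integral>\<^sup>+w. ennreal (norm z) * (ennreal (k (w - (y + s *\<^sub>R z))) * ennreal (g w)) \<partial>lborel)
        \<le> ennreal (norm z) * mollify_nn k (\<lambda>w. ennreal (g w)) (y + s *\<^sub>R z)"
        unfolding mollify_nn_def using measurable_shift(1)[OF mk] gm
        by (subst nn_integral_cmult) simp_all
    qed simp
    finally show "ennreal (norm (LINT w|lborel. H s w)) \<le> ennreal (norm z) * (mollify_nn k (\<lambda>w. ennreal (g w)) (y + s *\<^sub>R z) * indicator {0..1} s)"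
      by (simp add: mult_ac)
  qed
  also have "\<dots> = ennreal (norm z) * (\<integral>\<^sup>+s\<in>{0..1}. mollify_nn k (\<lambda>w. ennreal (g w)) (y + s *\<^sub>R z) \<partial>lborel)"
  proof (rule nn_integral_cmult)
    have "(\<lambda>s. y + s *\<^sub>R z) \<in> borel_measurable (borel :: real measure)"
      by (intro borel_measurable_continuous_onI continuous_intros)
    from measurable_compose[OF this mollify_nn_measurable[OF mk]]
    show "(\<lambda>s. mollify_nn k (\<lambda>w. ennreal (g w)) (y + s *\<^sub>R z) * indicator {0..1} s) \<in> borel_measurable lborel"
      using gm by simp
  qed
  finally show ?thesis .
qed

lemma AE_lborel_null_set:
  assumes "AE x in lborel. P x"
  shows "\<exists>N\<in>null_sets lborel. \<forall>x. x \<notin> N \<longrightarrow> P x"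
proof -
  obtain N where "{x \<in> space lborel. \<not> P x} \<subseteq> N" "emeasure lborel N = 0" "N \<in> sets lborel"
    using AE_E[OF assms] by metis
  then show ?thesis by (intro bexI[of _ N]) auto
qed

lemma measurable_snd_shift_family:
  fixes h :: "'a::euclidean_space \<Rightarrow> 'b::topological_space"
  assumes h: "h \<in> borel_measurable borel"
  shows "(\<lambda>p :: real \<times> 'a. h (x + fst p *\<^sub>R snd p)) \<in> borel_measurable borel"
  by (rule measurable_compose[OF _ h], intro borel_measurable_continuous_onI continuous_intros)

lemma nn_integral_mollifier_shift:
  assumes k: "mollifier K \<eta> k"
  shows "(\<integral>\<^sup>+w. ennreal (k (w - y)) \<partial>lborel) = 1" "(\<integral>\<^sup>+y. ennreal (k (w - y)) \<partial>lborel) = 1"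
proof -
  have m: "(\<lambda>x. ennreal (k x)) \<in> borel_measurable borel" using mollifier_measurable[OF k] by simp
  have 1: "(\<integral>\<^sup>+x. ennreal (k x) \<partial>lborel) = 1" using k by (simp add: mollifier_def)
  show "(\<integral>\<^sup>+w. ennreal (k (w - y)) \<partial>lborel) = 1" "(\<integral>\<^sup>+y. ennreal (k (w - y)) \<partial>lborel) = 1"
    using nn_integral_reflect_translate[OF m] 1 by simp_all
qed

lemma mollify_nn_joint_measurable:
  fixes g :: "'a::euclidean_space \<Rightarrow> ennreal" and q :: "'a \<Rightarrow> ennreal"
  assumes k: "mollifier K \<eta> k" and g: "g \<in> borel_measurable borel" and q: "q \<in> borel_measurable borel"
  shows "(\<lambda>z. ennreal (k (snd z - fst z)) * g (snd z) * q (fst z)) \<in> borel_measurable borel"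
  by (intro borel_measurable_times_ennreal measurable_compose[OF measurable_shift(3)[OF mollifier_measurable[OF k]] measurable_ennreal]
      measurable_compose[OF borel_measurable_snd_borel g] measurable_compose[OF borel_measurable_fst_borel q])

lemma nn_integral_mollify_nn:
  fixes g :: "'a::euclidean_space \<Rightarrow> ennreal"
  assumes k: "mollifier K \<eta> k" and g: "g \<in> borel_measurable borel"
  shows "(\<integral>\<^sup>+y. mollify_nn k g y \<partial>lborel) = (\<integral>\<^sup>+w. g w \<partial>lborel)"
proof -
  have mk: "k \<in> borel_measurable borel" by (rule mollifier_measurable[OF k])
  have "(\<integral>\<^sup>+y. mollify_nn k g y \<partial>lborel) = (\<integral>\<^sup>+y. (\<integral>\<^sup>+w. ennreal (k (w - y)) * g w * 1 \<partial>lborel) \<partial>lborel)"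
    by (simp add: mollify_nn_def)
  also have "\<dots> = (\<integral>\<^sup>+w. (\<integral>\<^sup>+y. ennreal (k (w - y)) * g w * 1 \<partial>lborel) \<partial>lborel)"
    by (rule nn_integral_lborel_Tonelli(1)[symmetric, OF mollify_nn_joint_measurable[OF k g]]) simp
  also have "\<dots> = (\<integral>\<^sup>+w. g w \<partial>lborel)"
    using measurable_shift(2)[OF mk]
    by (intro nn_integral_cong) (simp add: nn_integral_multc nn_integral_mollifier_shift[OF k])
  finally show ?thesis .
qed

text \<open>Mollification moves mass by at most \<open>\<eta>\<close>. For
  \<open>\<eta> \<le> r\<close> all mass seen in the ball of radius \<open>r\<close> comes from the
  ball of radius \<open>2 * r\<close>, and the kernel has mass one. For \<open>\<eta> > r\<close>
  the mollified value is bounded pointwise by the height of the kernel times the mass in a ball of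
  radius \<open>2 * \<eta>\<close>. Both bounds are free of \<open>\<eta>\<close>.\<close>

lemma maximal_function_mollify:
  fixes g :: "'a::euclidean_space \<Rightarrow> ennreal"
  assumes k: "mollifier K \<eta> k" and K: "0 < K" and \<eta>: "0 < \<eta>" and g: "g \<in> borel_measurable borel" and r: "0 < r"
  shows "(\<integral>\<^sup>+y\<in>cball x r. mollify_nn k g y \<partial>lborel) \<le>
    ennreal (4 ^ DIM('a) * (1 + K * unit_ball_vol DIM('a)) * (unit_ball_vol DIM('a) * r ^ DIM('a))) * maximal_function g x"
proof -
  define \<omega> where "\<omega> = unit_ball_vol (real DIM('a))"
  have \<omega>: "0 < \<omega>" by (simp add: \<omega>_def)
  define G where "G = maximal_function g x"
  have mk: "k \<in> borel_measurable borel" by (rule mollifier_measurable[OF k])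
  have kz: "k v = 0" if "\<eta> < norm v" for v using k that by (auto simp: mollifier_def)
  have bnd: "(\<integral>\<^sup>+y\<in>cball x (2 * s). g y \<partial>lborel) \<le> ennreal (4 ^ DIM('a) * (\<omega> * s ^ DIM('a))) * G" if "0 < s" for s
  proof -
    have "(\<integral>\<^sup>+y\<in>cball x (2 * s). g y \<partial>lborel) \<le> ennreal (2 ^ DIM('a) * (\<omega> * (2 * s) ^ DIM('a))) * G"
      unfolding G_def \<omega>_def using that by (intro cball_integral_le_maximal) simp
    also have "2 ^ DIM('a) * (\<omega> * (2 * s) ^ DIM('a)) = (2 * 2) ^ DIM('a) * (\<omega> * s ^ DIM('a))"
      unfolding power_mult_distrib by (simp add: mult_ac)
    finally show ?thesis by simp
  qed
  show ?thesis
  proof (cases "\<eta> \<le> r")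
    case True
    have "(\<integral>\<^sup>+y\<in>cball x r. mollify_nn k g y \<partial>lborel)
       = (\<integral>\<^sup>+y. (\<integral>\<^sup>+w. ennreal (k (w - y)) * g w * indicator (cball x r) y \<partial>lborel) \<partial>lborel)"
      unfolding mollify_nn_def using measurable_shift(1)[OF mk] g
      by (intro nn_integral_cong) (simp add: nn_integral_multc)
    also have "\<dots> = (\<integral>\<^sup>+w. (\<integral>\<^sup>+y. ennreal (k (w - y)) * g w * indicator (cball x r) y \<partial>lborel) \<partial>lborel)"
      by (rule nn_integral_lborel_Tonelli(1)[symmetric, OF mollify_nn_joint_measurable[OF k g]])
        (rule borel_measurable_indicator, simp)
    also have "\<dots> \<le> (\<integral>\<^sup>+w. (\<integral>\<^sup>+y. ennreal (k (w - y)) * (g w * indicator (cball x (2 * r)) w) \<partial>lborel) \<partial>lborel)"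
    proof (intro nn_integral_mono)
      fix w y
      have "k (w - y) = 0" if "y \<in> cball x r" "w \<notin> cball x (2 * r)"
      proof (rule kz)
        have "dist x w \<le> dist x y + dist y w" by (rule dist_triangle)
        then show "\<eta> < norm (w - y)" using that True by (simp add: dist_norm norm_minus_commute)
      qed
      then show "ennreal (k (w - y)) * g w * indicator (cball x r) y \<le> ennreal (k (w - y)) * (g w * indicator (cball x (2 * r)) w)"
        by (cases "y \<in> cball x r"; cases "w \<in> cball x (2 * r)") auto
    qed
    also have "\<dots> = (\<integral>\<^sup>+w\<in>cball x (2 * r). g w \<partial>lborel)"
      using measurable_shift(2)[OF mk]
      by (intro nn_integral_cong) (simp add: nn_integral_multc nn_integral_mollifier_shift[OF k])
    also have "\<dots> \<le> ennreal (4 ^ DIM('a) * (\<omega> * r ^ DIM('a))) * G" by (rule bnd[OF r])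
    also have "\<dots> \<le> ennreal (4 ^ DIM('a) * (1 + K * \<omega>) * (\<omega> * r ^ DIM('a))) * G"
    proof (rule mult_right_mono[OF ennreal_leI])
      have "1 * (4 ^ DIM('a) * (\<omega> * r ^ DIM('a))) \<le> (1 + K * \<omega>) * (4 ^ DIM('a) * (\<omega> * r ^ DIM('a)))"
        using K \<omega> r by (intro mult_right_mono) simp_all
      then show "4 ^ DIM('a) * (\<omega> * r ^ DIM('a)) \<le> 4 ^ DIM('a) * (1 + K * \<omega>) * (\<omega> * r ^ DIM('a))"
        by (simp add: mult_ac)
    qed simp
    finally show ?thesis unfolding G_def \<omega>_def .
  next
    case False
    then have r\<eta>: "r < \<eta>" by simp
    have pt: "mollify_nn k g y \<le> ennreal (K * 4 ^ DIM('a) * \<omega>) * G" if y: "y \<in> cball x r" for y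
    proof -
      have "mollify_nn k g y \<le> (\<integral>\<^sup>+w. ennreal (K / \<eta> ^ DIM('a)) * (g w * indicator (cball x (2 * \<eta>)) w) \<partial>lborel)"
        unfolding mollify_nn_def
      proof (rule nn_integral_mono)
        fix w
        have le: "k (w - y) \<le> K / \<eta> ^ DIM('a)" using k by (simp add: mollifier_def)
        have "k (w - y) = 0" if "w \<notin> cball x (2 * \<eta>)"
        proof (rule kz)
          have "dist x w \<le> dist x y + dist y w" by (rule dist_triangle)
          then show "\<eta> < norm (w - y)" using that y r\<eta> by (simp add: dist_norm norm_minus_commute)
        qed
        then show "ennreal (k (w - y)) * g w \<le> ennreal (K / \<eta> ^ DIM('a)) * (g w * indicator (cball x (2 * \<eta>)) w)"
          using le by (cases "w \<in> cball x (2 * \<eta>)") (auto intro!: mult_right_mono ennreal_leI)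
      qed
      also have "\<dots> = ennreal (K / \<eta> ^ DIM('a)) * (\<integral>\<^sup>+w\<in>cball x (2 * \<eta>). g w \<partial>lborel)"
        using g by (intro nn_integral_cmult) simp
      also have "\<dots> \<le> ennreal (K / \<eta> ^ DIM('a)) * (ennreal (4 ^ DIM('a) * (\<omega> * \<eta> ^ DIM('a))) * G)"
        by (intro mult_left_mono bnd \<eta>) simp
      also have "\<dots> = ennreal (K * 4 ^ DIM('a) * \<omega>) * G"
        using K \<eta> \<omega> by (simp add: mult.assoc[symmetric] ennreal_mult[symmetric])
      finally show ?thesis .
    qed
    have "(\<integral>\<^sup>+y\<in>cball x r. mollify_nn k g y \<partial>lborel) \<le> (\<integral>\<^sup>+y. ennreal (K * 4 ^ DIM('a) * \<omega>) * G * indicator (cball x r) y \<partial>lborel)"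
    proof (rule nn_integral_mono)
      fix y show "mollify_nn k g y * indicator (cball x r) y \<le> ennreal (K * 4 ^ DIM('a) * \<omega>) * G * indicator (cball x r) y"
        using pt[of y] by (cases "y \<in> cball x r") simp_all
    qed
    also have "\<dots> = ennreal (K * 4 ^ DIM('a) * \<omega>) * G * ennreal (\<omega> * r ^ DIM('a))"
      using r by (subst nn_integral_cmult_indicator) (simp_all add: emeasure_cball \<omega>_def)
    also have "\<dots> = ennreal (K * 4 ^ DIM('a) * \<omega> * (\<omega> * r ^ DIM('a))) * G"
      using K \<omega> r by (simp add: ennreal_mult mult_ac)
    also have "\<dots> \<le> ennreal (4 ^ DIM('a) * (1 + K * \<omega>) * (\<omega> * r ^ DIM('a))) * G"
    proof (rule mult_right_mono[OF ennreal_leI])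
      have "K * 4 ^ DIM('a) * \<omega> \<le> 4 ^ DIM('a) * (1 + K * \<omega>)" by (simp add: algebra_simps)
      then show "K * 4 ^ DIM('a) * \<omega> * (\<omega> * r ^ DIM('a)) \<le> 4 ^ DIM('a) * (1 + K * \<omega>) * (\<omega> * r ^ DIM('a))"
        using \<omega> r by (intro mult_right_mono) simp_all
    qed simp
    finally show ?thesis unfolding G_def \<omega>_def .
  qed
qed

context
  fixes k :: "real^'n \<Rightarrow> real" and K \<eta> :: real and u :: "real^'n \<Rightarrow> real" and v :: "real^'n \<Rightarrow> real^'n" and g :: "real^'n \<Rightarrow> real"
  assumes k: "mollifier K \<eta> k" and K: "0 < K" and \<eta>: "0 < \<eta>" and u: "locally_integrable u" and v: "locally_integrable v"
    and weak: "\<And>\<phi> j. test_function \<phi> \<Longrightarrow>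
      (LINT w|lborel. u w * frechet_derivative \<phi> (at w) (axis j 1)) = - (LINT w|lborel. v w $ j * \<phi> w)"
    and gm: "g \<in> borel_measurable borel" and g: "\<And>w. norm (v w) \<le> g w"
begin

text \<open>After Tonelli, the dilation by \<open>s\<close> maps the ball of radius \<open>r\<close>
  to the ball of radius \<open>s * r\<close>; its Jacobian cancels against the volume of the smaller
  ball in the bound by the maximal function. The length of the segment contributes the factor
  \<open>r\<close>.\<close>

lemma mollify_mean_difference:
  assumes r: "0 < r"
  shows "(\<integral>\<^sup>+z\<in>cball 0 r. ennreal \<bar>mollify k u (x + z) - mollify k u x\<bar> \<partial>lborel) \<le>
    ennreal (r * (4 ^ DIM(real^'n) * (1 + K * unit_ball_vol DIM(real^'n)) * (unit_ball_vol DIM(real^'n) * r ^ DIM(real^'n))))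
     * maximal_function (\<lambda>w. ennreal (g w)) x"
proof -
  define kg where "kg = mollify_nn k (\<lambda>w. ennreal (g w))"
  define C where "C = 4 ^ DIM(real^'n) * (1 + K * unit_ball_vol DIM(real^'n)) * unit_ball_vol DIM(real^'n)"
  define G where "G = maximal_function (\<lambda>w. ennreal (g w)) x"
  have C0: "0 \<le> C" using K by (simp add: C_def)
  have gm': "(\<lambda>w. ennreal (g w)) \<in> borel_measurable borel" using gm by simp
  have mkg: "kg \<in> borel_measurable borel"
    unfolding kg_def by (rule mollify_nn_measurable[OF mollifier_measurable[OF k] gm'])
  have avg: "(\<integral>\<^sup>+y\<in>cball x s. kg y \<partial>lborel) \<le> ennreal (C * s ^ DIM(real^'n)) * G" if "0 < s" for s
    using maximal_function_mollify[OF k K \<eta> gm' that, of x] unfolding kg_def C_def G_def by (simp add: mult.assoc)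
  have step1: "(\<integral>\<^sup>+z\<in>cball 0 r. ennreal \<bar>mollify k u (x + z) - mollify k u x\<bar> \<partial>lborel)
     \<le> (\<integral>\<^sup>+z. ennreal r * (\<integral>\<^sup>+s. kg (x + s *\<^sub>R z) * indicator {0..1} s * indicator (cball 0 r) z \<partial>lborel) \<partial>lborel)"
  proof (rule nn_integral_mono)
    fix z :: "real^'n"
    show "ennreal \<bar>mollify k u (x + z) - mollify k u x\<bar> * indicator (cball 0 r) z
     \<le> ennreal r * (\<integral>\<^sup>+s. kg (x + s *\<^sub>R z) * indicator {0..1} s * indicator (cball 0 r) z \<partial>lborel)"
    proof (cases "z \<in> cball 0 r")
      case True
      have "ennreal \<bar>mollify k u (x + z) - mollify k u x\<bar> \<le> ennreal (norm z) * (\<integral>\<^sup>+s\<in>{0..1}. kg (x + s *\<^sub>R z) \<partial>lborel)"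
        unfolding kg_def by (rule mollify_difference[OF k u v weak gm g])
      also have "\<dots> \<le> ennreal r * (\<integral>\<^sup>+s\<in>{0..1}. kg (x + s *\<^sub>R z) \<partial>lborel)"
        using True by (intro mult_right_mono ennreal_leI) simp_all
      finally show ?thesis using True by simp
    qed simp
  qed
  have step2: "(\<integral>\<^sup>+z. ennreal r * (\<integral>\<^sup>+s. kg (x + s *\<^sub>R z) * indicator {0..1} s * indicator (cball 0 r) z \<partial>lborel) \<partial>lborel)
      = ennreal r * (\<integral>\<^sup>+z. (\<integral>\<^sup>+s. kg (x + s *\<^sub>R z) * indicator {0..1} s * indicator (cball 0 r) z \<partial>lborel) \<partial>lborel)"
    and step3: "(\<integral>\<^sup>+z. (\<integral>\<^sup>+s. kg (x + s *\<^sub>R z) * indicator {0..1} s * indicator (cball 0 r) z \<partial>lborel) \<partial>lborel)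
      = (\<integral>\<^sup>+s. (\<integral>\<^sup>+z. kg (x + s *\<^sub>R z) * indicator {0..1} s * indicator (cball 0 r) z \<partial>lborel) \<partial>lborel)"
  proof -
    have i1: "(\<lambda>p :: real \<times> (real^'n). indicator {0..1} (fst p) :: ennreal) \<in> borel_measurable borel"
      by (rule measurable_compose[OF borel_measurable_fst_borel]) simp
    have i2: "(\<lambda>p :: real \<times> (real^'n). indicator (cball 0 r) (snd p) :: ennreal) \<in> borel_measurable borel"
      by (rule measurable_compose[OF borel_measurable_snd_borel borel_measurable_indicator]) simp
    have m: "(\<lambda>p :: real \<times> (real^'n). kg (x + fst p *\<^sub>R snd p) * indicator {0..1} (fst p) * indicator (cball 0 r) (snd p)) \<in> borel_measurable borel"
      by (intro borel_measurable_times_ennreal i1 i2 measurable_snd_shift_family mkg)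
    then show "(\<integral>\<^sup>+z. (\<integral>\<^sup>+s. kg (x + s *\<^sub>R z) * indicator {0..1} s * indicator (cball 0 r) z \<partial>lborel) \<partial>lborel)
      = (\<integral>\<^sup>+s. (\<integral>\<^sup>+z. kg (x + s *\<^sub>R z) * indicator {0..1} s * indicator (cball 0 r) z \<partial>lborel) \<partial>lborel)"
      by (rule nn_integral_lborel_Tonelli(1))
    have "(\<lambda>p :: (real^'n) \<times> real. (snd p, fst p)) \<in> borel_measurable borel"
      by (intro borel_measurable_continuous_onI continuous_intros)
    from measurable_compose[OF this m]
    have "(\<lambda>p :: (real^'n) \<times> real. kg (x + snd p *\<^sub>R fst p) * indicator {0..1} (snd p) * indicator (cball 0 r) (fst p)) \<in> borel_measurable (lborel \<Otimes>\<^sub>M lborel)"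
      unfolding lborel_prod measurable_lborel2 by simp
    from lborel.borel_measurable_nn_integral_fst[OF this]
    show "(\<integral>\<^sup>+z. ennreal r * (\<integral>\<^sup>+s. kg (x + s *\<^sub>R z) * indicator {0..1} s * indicator (cball 0 r) z \<partial>lborel) \<partial>lborel)
      = ennreal r * (\<integral>\<^sup>+z. (\<integral>\<^sup>+s. kg (x + s *\<^sub>R z) * indicator {0..1} s * indicator (cball 0 r) z \<partial>lborel) \<partial>lborel)"
      by (intro nn_integral_cmult) simp
  qed
  have "(\<integral>\<^sup>+s. (\<integral>\<^sup>+z. kg (x + s *\<^sub>R z) * indicator {0..1} s * indicator (cball 0 r) z \<partial>lborel) \<partial>lborel)
     \<le> (\<integral>\<^sup>+s. ennreal (C * r ^ DIM(real^'n)) * G * indicator {0..1::real} s \<partial>lborel)"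
  proof (rule nn_integral_mono_AE)
    \<comment> \<open>The dilation degenerates at \<open>s = 0\<close>, a null set of
      parameters.\<close>
    have "AE s in lborel. s \<noteq> (0::real)" by (rule AE_lborel_singleton)
    then show "AE s in lborel. (\<integral>\<^sup>+z. kg (x + s *\<^sub>R z) * indicator {0..1} s * indicator (cball 0 r) z \<partial>lborel)
       \<le> ennreal (C * r ^ DIM(real^'n)) * G * indicator {0..1::real} s"
    proof eventually_elim
      case (elim s)
      show ?case
      proof (cases "s \<in> {0..1}")
        case True
        then have s: "0 < s" using elim by auto
        have mm: "(\<lambda>y. kg y * indicator (cball x (s * r)) y) \<in> borel_measurable borel"
          by (intro borel_measurable_times_ennreal mkg borel_measurable_indicator) simp
        have "ennreal (s ^ DIM(real^'n)) * (\<integral>\<^sup>+z. kg (x + s *\<^sub>R z) * indicator (cball 0 r) z \<partial>lborel)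
          = ennreal (\<bar>s\<bar> ^ DIM(real^'n)) * (\<integral>\<^sup>+z. kg (x + s *\<^sub>R z) * indicator (cball x (s * r)) (x + s *\<^sub>R z) \<partial>lborel)"
          using s by (intro arg_cong2[where f="(*)"] nn_integral_cong) (simp_all add: indicator_def dist_norm)
        also have "\<dots> = (\<integral>\<^sup>+y\<in>cball x (s * r). kg y \<partial>lborel)"
          using s by (intro nn_integral_affine[OF mm, symmetric]) simp
        also have "\<dots> \<le> ennreal (C * (s * r) ^ DIM(real^'n)) * G" using s r by (intro avg) simp
        also have "\<dots> = ennreal (s ^ DIM(real^'n)) * (ennreal (C * r ^ DIM(real^'n)) * G)"
          using s r C0 by (simp add: power_mult_distrib ennreal_mult mult_ac)
        finally have "(\<integral>\<^sup>+z. kg (x + s *\<^sub>R z) * indicator (cball 0 r) z \<partial>lborel) \<le> ennreal (C * r ^ DIM(real^'n)) * G"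
          using s by (subst (asm) ennreal_mult_le_mult_iff) simp_all
        then show ?thesis using True by simp
      qed simp
    qed
  qed
  also have "\<dots> = ennreal (C * r ^ DIM(real^'n)) * G"
    by (subst nn_integral_cmult_indicator) simp_all
  finally have step4: "(\<integral>\<^sup>+s. (\<integral>\<^sup>+z. kg (x + s *\<^sub>R z) * indicator {0..1} s * indicator (cball 0 r) z \<partial>lborel) \<partial>lborel)
     \<le> ennreal (C * r ^ DIM(real^'n)) * G" .
  have "(\<integral>\<^sup>+z\<in>cball 0 r. ennreal \<bar>mollify k u (x + z) - mollify k u x\<bar> \<partial>lborel) \<le> ennreal r * (ennreal (C * r ^ DIM(real^'n)) * G)"
    by (rule order_trans[OF step1[unfolded step2 step3] mult_left_mono[OF step4]]) simp
  also have "\<dots> = ennreal (r * (C * r ^ DIM(real^'n))) * G"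
    using r C0 by (simp only: ennreal_mult[of r "C * r ^ DIM(real^'n)"] mult.assoc less_imp_le mult_nonneg_nonneg zero_le_power)
  finally show ?thesis unfolding C_def G_def by (simp only: mult.assoc)
qed

text \<open>Both values are compared with those on the ball of radius \<open>r / 2\<close> about the
  midpoint, which lies in the balls of radius \<open>r\<close> about \<open>x\<close> and about
  \<open>y\<close>. Averaging over the smaller ball costs the volume ratio 2^d, which turns the 4^d
  of the mean estimate into 8^d.\<close>

lemma mollify_pointwise_difference:
  shows "ennreal \<bar>mollify k u x - mollify k u y\<bar> \<le>
    ennreal (8 ^ DIM(real^'n) * (1 + K * unit_ball_vol DIM(real^'n)) * norm (x - y))
     * (maximal_function (\<lambda>w. ennreal (g w)) x + maximal_function (\<lambda>w. ennreal (g w)) y)"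
proof (cases "x = y")
  case False
  define r where "r = norm (x - y)"
  have r: "0 < r" using False by (simp add: r_def)
  define \<omega> where "\<omega> = unit_ball_vol (real DIM(real^'n))"
  have \<omega>: "0 < \<omega>" by (simp add: \<omega>_def)
  define F where "F = mollify k u"
  define G where "G = maximal_function (\<lambda>w. ennreal (g w))"
  define C where "C = 4 ^ DIM(real^'n) * (1 + K * \<omega>)"
  have C0: "0 \<le> C" using K \<omega> by (simp add: C_def)
  have mu: "u \<in> borel_measurable borel" using u by (simp add: locally_integrable_def)
  have mF: "F \<in> borel_measurable borel"
    unfolding F_def by (rule mollify_measurable[OF mollifier_measurable[OF k] mu])
  have mFd: "(\<lambda>w. ennreal \<bar>F w - F q\<bar>) \<in> borel_measurable borel" for q using mF by simp
  have ball: "(\<integral>\<^sup>+w\<in>cball q r. ennreal \<bar>F w - F q\<bar> \<partial>lborel) \<le> ennreal (r * (C * (\<omega> * r ^ DIM(real^'n)))) * G q" for q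
  proof -
    have m: "(\<lambda>w. ennreal \<bar>F w - F q\<bar> * indicator (cball q r) w) \<in> borel_measurable borel"
      by (intro borel_measurable_times_ennreal mFd borel_measurable_indicator) simp
    have "(\<integral>\<^sup>+w\<in>cball q r. ennreal \<bar>F w - F q\<bar> \<partial>lborel)
      = (\<integral>\<^sup>+z\<in>cball 0 r. ennreal \<bar>F (q + z) - F q\<bar> \<partial>lborel)"
      using nn_integral_affine[OF m, of 1 q] by (simp add: indicator_def dist_norm)
    then show ?thesis
      using mollify_mean_difference[OF r, of q] unfolding F_def G_def C_def \<omega>_def by simp
  qed
  define m where "m = (1 / 2) *\<^sub>R (x + y)"
  have sub: "cball m (r / 2) \<subseteq> cball x r" "cball m (r / 2) \<subseteq> cball y r"
  proof -
    have "x - m = (1 / 2) *\<^sub>R (x - y)" "y - m = (1 / 2) *\<^sub>R (y - x)"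
      unfolding m_def by (simp_all add: algebra_simps flip: scaleR_add_left)
    then have "dist x m = r / 2" "dist y m = r / 2" by (simp_all add: dist_norm r_def norm_minus_commute)
    then have "dist x t \<le> r \<and> dist y t \<le> r" if "t \<in> cball m (r / 2)" for t
      using that dist_triangle[of x t m] dist_triangle[of y t m] by simp
    then show "cball m (r / 2) \<subseteq> cball x r" "cball m (r / 2) \<subseteq> cball y r" by auto
  qed
  have "ennreal \<bar>F x - F y\<bar> * ennreal (\<omega> * (r / 2) ^ DIM(real^'n)) = (\<integral>\<^sup>+w. ennreal \<bar>F x - F y\<bar> * indicator (cball m (r / 2)) w \<partial>lborel)"
    using r by (subst nn_integral_cmult_indicator) (simp_all add: emeasure_cball \<omega>_def)
  also have "\<dots> \<le> (\<integral>\<^sup>+w. ennreal \<bar>F w - F x\<bar> * indicator (cball x r) w + ennreal \<bar>F w - F y\<bar> * indicator (cball y r) w \<partial>lborel)"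
  proof (rule nn_integral_mono)
    fix w
    have "ennreal \<bar>F x - F y\<bar> \<le> ennreal \<bar>F w - F x\<bar> + ennreal \<bar>F w - F y\<bar>"
      by (simp add: ennreal_plus[symmetric] del: ennreal_plus)
    then show "ennreal \<bar>F x - F y\<bar> * indicator (cball m (r / 2)) w
      \<le> ennreal \<bar>F w - F x\<bar> * indicator (cball x r) w + ennreal \<bar>F w - F y\<bar> * indicator (cball y r) w"
      using sub[THEN subsetD, of w] by (cases "w \<in> cball m (r / 2)") simp_all
  qed
  also have "\<dots> = (\<integral>\<^sup>+w\<in>cball x r. ennreal \<bar>F w - F x\<bar> \<partial>lborel) + (\<integral>\<^sup>+w\<in>cball y r. ennreal \<bar>F w - F y\<bar> \<partial>lborel)"
  proof (rule nn_integral_add)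
    show "(\<lambda>w. ennreal \<bar>F w - F q\<bar> * indicator (cball q r) w) \<in> borel_measurable lborel" for q
      unfolding measurable_lborel2 by (intro borel_measurable_times_ennreal mFd borel_measurable_indicator) simp
    then show "(\<lambda>w. ennreal \<bar>F w - F y\<bar> * indicator (cball y r) w) \<in> borel_measurable lborel" .
  qed
  also have "\<dots> \<le> ennreal (r * (C * (\<omega> * r ^ DIM(real^'n)))) * G x + ennreal (r * (C * (\<omega> * r ^ DIM(real^'n)))) * G y"
    by (intro add_mono ball)
  also have "\<dots> = ennreal (\<omega> * (r / 2) ^ DIM(real^'n)) * (ennreal (2 ^ DIM(real^'n) * C * r) * (G x + G y))"
  proof -
    have e1: "r * (C * (\<omega> * r ^ DIM(real^'n))) = (\<omega> * (r / 2) ^ DIM(real^'n)) * (2 ^ DIM(real^'n) * C * r)"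
      by (simp add: power_divide)
    have e2: "ennreal ((\<omega> * (r / 2) ^ DIM(real^'n)) * (2 ^ DIM(real^'n) * C * r))
      = ennreal (\<omega> * (r / 2) ^ DIM(real^'n)) * ennreal (2 ^ DIM(real^'n) * C * r)"
      using r \<omega> C0 by (intro ennreal_mult) simp_all
    show ?thesis unfolding e1 e2 by (simp only: distrib_left mult.assoc)
  qed
  finally have "ennreal (\<omega> * (r / 2) ^ DIM(real^'n)) * ennreal \<bar>F x - F y\<bar>
      \<le> ennreal (\<omega> * (r / 2) ^ DIM(real^'n)) * (ennreal (2 ^ DIM(real^'n) * C * r) * (G x + G y))"
    by (simp only: mult.commute)
  then have "ennreal \<bar>F x - F y\<bar> \<le> ennreal (2 ^ DIM(real^'n) * C * r) * (G x + G y)"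
    using r \<omega> by (subst (asm) ennreal_mult_le_mult_iff) simp_all
  moreover have "2 ^ DIM(real^'n) * C * r = 8 ^ DIM(real^'n) * (1 + K * \<omega>) * r"
    unfolding C_def by (simp flip: mult.assoc power_mult_distrib)
  ultimately show ?thesis unfolding F_def G_def r_def \<omega>_def by (simp only:)
qed simp

end

text \<open>Comparison with a Lipschitz \<open>\<phi>\<close>: the difference
  \<open>u - \<phi>\<close> enters once directly and once mollified, with the same mass, and
  \<open>\<phi>\<close> itself moves by at most \<open>M * \<eta>\<close> within the range of the
  kernel.\<close>

lemma mollify_error:
  fixes u \<phi> :: "'a::euclidean_space \<Rightarrow> real"
  assumes k: "mollifier K \<eta> k" and u: "locally_integrable u" and \<eta>: "0 < \<eta>"
    and \<phi>: "\<And>x y. \<bar>\<phi> x - \<phi> y\<bar> \<le> M * norm (x - y)" and \<phi>m: "\<phi> \<in> borel_measurable borel" and M: "0 \<le> M"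
  shows "(\<integral>\<^sup>+x\<in>cball 0 r. ennreal \<bar>mollify k u x - u x\<bar> \<partial>lborel) \<le>
     2 * (\<integral>\<^sup>+x. ennreal \<bar>u x - \<phi> x\<bar> \<partial>lborel) + ennreal (M * \<eta>) * emeasure lborel (cball (0::'a) r)"
proof -
  have mk: "k \<in> borel_measurable borel" by (rule mollifier_measurable[OF k])
  have mu: "u \<in> borel_measurable borel" using u by (simp add: locally_integrable_def)
  have k0: "0 \<le> k x" for x using k by (simp add: mollifier_def)
  have kz: "k x = 0" if "\<eta> < norm x" for x using k that by (simp add: mollifier_def)
  have kb: "\<bar>k x\<bar> \<le> K / \<eta> ^ DIM('a)" for x using k by (auto simp: mollifier_def)
  define e where "e x = ennreal \<bar>u x - \<phi> x\<bar>" for x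
  have me: "e \<in> borel_measurable borel" unfolding e_def using mu \<phi>m by simp
  have mm: "mollify_nn k e \<in> borel_measurable borel" by (rule mollify_nn_measurable[OF mk me])
  have pt: "ennreal \<bar>mollify k u x - u x\<bar> \<le> mollify_nn k e x + (ennreal (M * \<eta>) + e x)" for x
  proof -
    have kint: "integrable lborel (\<lambda>w. k (w - x))"
      using nn_integral_mollifier_shift(1)[OF k, of x] measurable_shift(1)[OF mk, of x] k0
      by (intro integrableI_bounded) simp_all
    have one: "(LINT w|lborel. k (w - x)) = 1"
      using nn_integral_mollifier_shift(1)[OF k, of x] measurable_shift(1)[OF mk, of x] k0
      by (subst integral_eq_nn_integral) simp_all
    have uint: "integrable lborel (\<lambda>w. k (w - x) * u w)"
      by (rule mollify_integrable[OF u mk kb kz])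
    have "mollify k u x - u x = (LINT w|lborel. k (w - x) * u w) - (LINT w|lborel. k (w - x) * u x)"
      using one by (simp add: mollify_def)
    also have "\<dots> = (LINT w|lborel. k (w - x) * u w - k (w - x) * u x)"
      using uint kint by (intro Bochner_Integration.integral_diff[symmetric]) simp_all
    finally have "ennreal \<bar>mollify k u x - u x\<bar> \<le> (\<integral>\<^sup>+w. ennreal (norm (k (w - x) * u w - k (w - x) * u x)) \<partial>lborel)"
      using ennreal_norm_integral_le[of lborel "\<lambda>w. k (w - x) * u w - k (w - x) * u x"] by simp
    also have "\<dots> \<le> (\<integral>\<^sup>+w. ennreal (k (w - x)) * e w + ennreal (k (w - x)) * (ennreal (M * \<eta>) + e x) \<partial>lborel)"
    proof (rule nn_integral_mono)
      fix w
      show "ennreal (norm (k (w - x) * u w - k (w - x) * u x)) \<le> ennreal (k (w - x)) * e w + ennreal (k (w - x)) * (ennreal (M * \<eta>) + e x)"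
      proof (cases "norm (w - x) \<le> \<eta>")
        case True
        have "\<bar>\<phi> w - \<phi> x\<bar> \<le> M * \<eta>"
          using \<phi>[of w x] mult_left_mono[OF True M] by linarith
        then have "\<bar>u w - u x\<bar> \<le> \<bar>u w - \<phi> w\<bar> + (M * \<eta> + \<bar>u x - \<phi> x\<bar>)" by linarith
        then have "k (w - x) * \<bar>u w - u x\<bar> \<le> k (w - x) * (\<bar>u w - \<phi> w\<bar> + (M * \<eta> + \<bar>u x - \<phi> x\<bar>))"
          by (rule mult_left_mono[OF _ k0])
        also have "k (w - x) * \<bar>u w - u x\<bar> = norm (k (w - x) * u w - k (w - x) * u x)"
          using k0[of "w - x"] by (simp add: abs_mult flip: right_diff_distrib)
        finally have "ennreal (norm (k (w - x) * u w - k (w - x) * u x)) \<le> ennreal (k (w - x) * (\<bar>u w - \<phi> w\<bar> + (M * \<eta> + \<bar>u x - \<phi> x\<bar>)))"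
          by (rule ennreal_leI)
        also have "\<dots> = ennreal (k (w - x)) * (e w + (ennreal (M * \<eta>) + e x))"
          unfolding e_def using k0[of "w - x"] M \<eta>
          by (simp add: ennreal_mult)
        finally show ?thesis by (simp add: distrib_left)
      next
        case False
        then show ?thesis by (simp add: kz)
      qed
    qed
    also have "\<dots> = mollify_nn k e x + (ennreal (M * \<eta>) + e x)"
      unfolding mollify_nn_def using measurable_shift(1)[OF mk, of x] me
      by (simp add: nn_integral_add nn_integral_multc nn_integral_mollifier_shift(1)[OF k])
    finally show ?thesis .
  qed
  have "(\<integral>\<^sup>+x\<in>cball 0 r. ennreal \<bar>mollify k u x - u x\<bar> \<partial>lborel) \<le>
     (\<integral>\<^sup>+x. mollify_nn k e x + (ennreal (M * \<eta>) * indicator (cball 0 r) x + e x) \<partial>lborel)"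
  proof (rule nn_integral_mono)
    fix x show "ennreal \<bar>mollify k u x - u x\<bar> * indicator (cball 0 r) x \<le> mollify_nn k e x + (ennreal (M * \<eta>) * indicator (cball 0 r) x + e x)"
      using pt[of x] by (cases "x \<in> cball 0 r") simp_all
  qed
  also have "\<dots> = (\<integral>\<^sup>+x. mollify_nn k e x \<partial>lborel) + (ennreal (M * \<eta>) * emeasure lborel (cball (0::'a) r) + (\<integral>\<^sup>+x. e x \<partial>lborel))"
    using mm me by (simp add: nn_integral_add nn_integral_cmult_indicator)
  also have "(\<integral>\<^sup>+x. mollify_nn k e x \<partial>lborel) = (\<integral>\<^sup>+x. e x \<partial>lborel)"
    by (rule nn_integral_mollify_nn[OF k me])
  finally show ?thesis unfolding e_def by (simp add: mult_2 add_ac)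
qed

text \<open>The bound for mollifications does not see the scale, so it survives the limit. The
  Lipschitz approximations give convergence in L1 on each ball, hence almost everywhere along a
  subsequence depending on the ball; any two given points lie in a common ball of integer radius, so
  countably many subsequences suffice.\<close>

lemma hajlasz_scalar:
  fixes u :: "real^'n \<Rightarrow> real" and v :: "real^'n \<Rightarrow> real^'n" and g :: "real^'n \<Rightarrow> real"
  assumes K: "0 < K" and kex: "\<And>\<eta>. 0 < \<eta> \<Longrightarrow> \<exists>k :: real^'n \<Rightarrow> real. mollifier K \<eta> k"
    and u: "locally_integrable u" and v: "locally_integrable v"
    and weak: "\<And>\<phi> j. test_function \<phi> \<Longrightarrow>
      (LINT w|lborel. u w * frechet_derivative \<phi> (at w) (axis j 1)) = - (LINT w|lborel. v w $ j * \<phi> w)"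
    and gm: "g \<in> borel_measurable borel" and g: "\<And>w. norm (v w) \<le> g w"
    and approx: "\<And>e. 0 < e \<Longrightarrow> \<exists>\<phi> M. 0 \<le> M \<and> (\<forall>x y. \<bar>\<phi> x - \<phi> y\<bar> \<le> M * norm (x - y)) \<and>
       \<phi> \<in> borel_measurable borel \<and> (\<integral>\<^sup>+x. ennreal \<bar>u x - \<phi> x\<bar> \<partial>lborel) \<le> ennreal e"
  shows "\<exists>N\<in>null_sets lborel. \<forall>x y. x \<notin> N \<longrightarrow> y \<notin> N \<longrightarrow> ennreal \<bar>u x - u y\<bar> \<le>
    ennreal (8 ^ DIM(real^'n) * (1 + K * unit_ball_vol DIM(real^'n)) * norm (x - y))
     * (maximal_function (\<lambda>w. ennreal (g w)) x + maximal_function (\<lambda>w. ennreal (g w)) y)"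
proof -
  have mu: "u \<in> borel_measurable borel" using u by (simp add: locally_integrable_def)
  have "\<forall>n. \<exists>k :: real^'n \<Rightarrow> real. mollifier K (1 / real (Suc n)) k" using kex by simp
  then obtain k :: "nat \<Rightarrow> real^'n \<Rightarrow> real" where k: "\<And>n. mollifier K (1 / real (Suc n)) (k n)" by metis
  define F where "F n = mollify (k n) u" for n
  have mF: "F n \<in> borel_measurable borel" for n
    unfolding F_def by (rule mollify_measurable[OF mollifier_measurable[OF k] mu])
  define D where "D R n x = indicator (cball 0 (real R)) x * (F n x - u x)" for R n x
  have mD: "D R n \<in> borel_measurable borel" for R n
    unfolding D_def by (intro borel_measurable_times borel_measurable_indicator borel_measurable_diff mF mu) simp
  have nD: "(\<integral>\<^sup>+x. ennreal (norm (D R n x)) \<partial>lborel) = (\<integral>\<^sup>+x\<in>cball 0 (real R). ennreal \<bar>F n x - u x\<bar> \<partial>lborel)" for R n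
    by (intro nn_integral_cong) (simp add: D_def indicator_def)
  have est: "(\<integral>\<^sup>+x. ennreal (norm (D R n x)) \<partial>lborel) \<le> 2 * ennreal e + ennreal (M * (1 / real (Suc n))) * emeasure lborel (cball (0::real^'n) R)"
    if "0 \<le> M" "\<forall>x y. \<bar>\<phi> x - \<phi> y\<bar> \<le> M * norm (x - y)" "\<phi> \<in> borel_measurable borel"
      "(\<integral>\<^sup>+x. ennreal \<bar>u x - \<phi> x\<bar> \<partial>lborel) \<le> ennreal e" for R n e M \<phi>
  proof -
    have "(\<integral>\<^sup>+x. ennreal (norm (D R n x)) \<partial>lborel) \<le>
      2 * (\<integral>\<^sup>+x. ennreal \<bar>u x - \<phi> x\<bar> \<partial>lborel) + ennreal (M * (1 / real (Suc n))) * emeasure lborel (cball (0::real^'n) R)"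
      unfolding nD F_def using that by (intro mollify_error[OF k u]) simp_all
    also have "\<dots> \<le> 2 * ennreal e + ennreal (M * (1 / real (Suc n))) * emeasure lborel (cball (0::real^'n) R)"
      using that by (intro add_right_mono mult_left_mono) simp_all
    finally show ?thesis .
  qed
  have lim: "(\<lambda>n. (\<integral>\<^sup>+x. ennreal (norm (D R n x)) \<partial>lborel)) \<longlonglongrightarrow> 0" for R
  proof (rule tendsto_zero_ennreal)
    fix e :: real assume e: "0 < e"
    obtain \<phi> M where \<phi>: "0 \<le> M" "\<forall>x y. \<bar>\<phi> x - \<phi> y\<bar> \<le> M * norm (x - y)" "\<phi> \<in> borel_measurable borel"
      "(\<integral>\<^sup>+x. ennreal \<bar>u x - \<phi> x\<bar> \<partial>lborel) \<le> ennreal (e / 4)"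
      using approx[of "e / 4"] e by auto
    define b where "b = measure lborel (cball (0::real^'n) R)"
    have b: "emeasure lborel (cball (0::real^'n) R) = ennreal b" "0 \<le> b"
      unfolding b_def using emeasure_lborel_cball_finite[of "0::real^'n" R]
      by (simp_all add: emeasure_eq_ennreal_measure less_top)
    have lim0: "(\<lambda>n. M * (1 / real (Suc n)) * b) \<longlonglongrightarrow> M * 0 * b"
      by (intro tendsto_intros LIMSEQ_Suc[OF lim_1_over_n])
    have "M * 0 * b < e / 2" using e by simp
    from order_tendstoD(2)[OF lim0 this]
    have "\<forall>\<^sub>F n in sequentially. M * (1 / real (Suc n)) * b < e / 2" .
    then show "\<forall>\<^sub>F n in sequentially. (\<integral>\<^sup>+x. ennreal (norm (D R n x)) \<partial>lborel) < ennreal e"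
    proof eventually_elim
      case (elim n)
      have "(\<integral>\<^sup>+x. ennreal (norm (D R n x)) \<partial>lborel) \<le> 2 * ennreal (e / 4) + ennreal (M * (1 / real (Suc n))) * ennreal b"
        using est[OF \<phi>, of R n] unfolding b(1) .
      also have "\<dots> = ennreal (e / 2 + M * (1 / real (Suc n)) * b)"
      proof -
        have "2 * ennreal (e / 4) = ennreal (e / 2)"
          using e by (simp add: mult_2 ennreal_plus[symmetric] del: ennreal_plus)
        moreover have "ennreal (M * (1 / real (Suc n))) * ennreal b = ennreal (M * (1 / real (Suc n)) * b)"
          using \<phi>(1) b by (intro ennreal_mult[symmetric]) simp_all
        ultimately show ?thesis using \<phi>(1) b e by (subst ennreal_plus) simp_all
      qed
      also have "\<dots> < ennreal e" using elim e by (intro ennreal_lessI) linarith+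
      finally show ?case .
    qed
  qed
  have intD: "integrable lborel (D R n)" for R n
  proof (rule integrableI_bounded)
    show "D R n \<in> borel_measurable lborel" using mD by simp
    obtain \<phi> M where \<phi>: "0 \<le> M" "\<forall>x y. \<bar>\<phi> x - \<phi> y\<bar> \<le> M * norm (x - y)" "\<phi> \<in> borel_measurable borel"
      "(\<integral>\<^sup>+x. ennreal \<bar>u x - \<phi> x\<bar> \<partial>lborel) \<le> ennreal 1"
      using approx[of 1] by auto
    have "2 * ennreal 1 + ennreal (M * (1 / real (Suc n))) * emeasure lborel (cball (0::real^'n) R) < \<infinity>"
      using emeasure_lborel_cball_finite[of "0::real^'n" R] by (simp add: ennreal_mult_less_top)
    then show "(\<integral>\<^sup>+x. ennreal (norm (D R n x)) \<partial>lborel) < \<infinity>"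
      using est[OF \<phi>] by (rule le_less_trans[rotated])
  qed
  have "\<exists>s::nat \<Rightarrow> nat. strict_mono s \<and> (AE x in lborel. (\<lambda>n. D R (s n) x) \<longlonglongrightarrow> 0)" for R
  proof (rule tendsto_L1_AE_subseq[OF intD])
    have "(LINT x|lborel. norm (D R n x)) = enn2real (\<integral>\<^sup>+x. ennreal (norm (D R n x)) \<partial>lborel)" for n
      using mD[of R n] by (intro integral_eq_nn_integral) simp_all
    moreover have "(\<lambda>n. enn2real (\<integral>\<^sup>+x. ennreal (norm (D R n x)) \<partial>lborel)) \<longlonglongrightarrow> enn2real 0"
      using lim[of R] by (intro tendsto_enn2real) simp_all
    ultimately show "(\<lambda>n. LINT x|lborel. norm (D R n x)) \<longlonglongrightarrow> 0" by simp
  qed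
  then obtain s where s: "\<And>R. AE x in lborel. (\<lambda>n. D R (s R n) x) \<longlonglongrightarrow> 0" by metis
  have "AE x in lborel. \<forall>R. (\<lambda>n. D R (s R n) x) \<longlonglongrightarrow> 0"
    unfolding AE_all_countable using s by blast
  from AE_E[OF this] obtain N where N: "{x. \<not> (\<forall>R. (\<lambda>n. D R (s R n) x) \<longlonglongrightarrow> 0)} \<subseteq> N"
    "emeasure lborel N = 0" "N \<in> sets lborel" by auto
  show ?thesis
  proof (intro bexI[of _ N] allI impI)
    show "N \<in> null_sets lborel" using N by auto
    fix x y assume xy: "x \<notin> N" "y \<notin> N"
    obtain R :: nat where R: "max (norm x) (norm y) \<le> real R" using real_arch_simple by blast
    have lim: "(\<lambda>n. F (s R n) q) \<longlonglongrightarrow> u q" if q: "q \<notin> N" "norm q \<le> real R" for q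
    proof -
      have "(\<lambda>n. D R (s R n) q) \<longlonglongrightarrow> 0" using N(1) q(1) by blast
      then have "(\<lambda>n. F (s R n) q - u q) \<longlonglongrightarrow> 0" using q(2) by (simp add: D_def)
      then show ?thesis by (rule LIM_zero_cancel)
    qed
    have "(\<lambda>n. ennreal \<bar>F (s R n) x - F (s R n) y\<bar>) \<longlonglongrightarrow> ennreal \<bar>u x - u y\<bar>"
      using xy R by (intro tendsto_ennrealI tendsto_rabs tendsto_diff lim) simp_all
    then show "ennreal \<bar>u x - u y\<bar> \<le>
      ennreal (8 ^ DIM(real^'n) * (1 + K * unit_ball_vol DIM(real^'n)) * norm (x - y))
      * (maximal_function (\<lambda>w. ennreal (g w)) x + maximal_function (\<lambda>w. ennreal (g w)) y)"
    proof (rule LIMSEQ_le_const2, intro exI allI impI)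
      fix n
      show "ennreal \<bar>F (s R n) x - F (s R n) y\<bar> \<le>
        ennreal (8 ^ DIM(real^'n) * (1 + K * unit_ball_vol DIM(real^'n)) * norm (x - y))
        * (maximal_function (\<lambda>w. ennreal (g w)) x + maximal_function (\<lambda>w. ennreal (g w)) y)"
        unfolding F_def by (rule mollify_pointwise_difference[OF k K _ u v weak gm g]) simp_all
    qed
  qed
qed

section \<open>The pointwise inequality for Sobolev vector fields\<close>

lemma in_Lp_locally_integrable:
  fixes f f' :: "real^'n \<Rightarrow> 'b::euclidean_space"
  assumes f: "in_Lp p f" and p: "1 < p" and f': "f' \<in> borel_measurable borel" "AE x in lborel. f x = f' x"
  shows "locally_integrable f'" "(\<integral>\<^sup>+x. ennreal (norm (f' x) powr p) \<partial>lborel) = ennreal (LINT x|lebesgue. norm (f x) powr p)"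
proof -
  have int: "integrable lebesgue (\<lambda>x. norm (f x) powr p)" using f by (simp add: in_Lp_def)
  have "(\<integral>\<^sup>+x. ennreal (norm (f' x) powr p) \<partial>lborel) = (\<integral>\<^sup>+x. ennreal (norm (f x) powr p) \<partial>lborel)"
    using f'(2) by (intro nn_integral_cong_AE) (auto elim: eventually_mono)
  also have "\<dots> = (\<integral>\<^sup>+x. ennreal (norm (f x) powr p) \<partial>lebesgue)"
    by (rule nn_integral_completion[symmetric])
  also have "\<dots> = ennreal (LINT x|lebesgue. norm (f x) powr p)"
    using int by (intro nn_integral_eq_integral) simp_all
  finally show fp: "(\<integral>\<^sup>+x. ennreal (norm (f' x) powr p) \<partial>lborel) = ennreal (LINT x|lebesgue. norm (f x) powr p)" .
  show "locally_integrable f'"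
    unfolding locally_integrable_def
  proof (intro conjI allI f')
    fix r :: real
    have "(\<integral>\<^sup>+w\<in>cball 0 r. ennreal (norm (f' w)) \<partial>lborel) \<le>
      (\<integral>\<^sup>+w. indicator (cball 0 r) w + ennreal (norm (f' w) powr p) \<partial>lborel)"
    proof (rule nn_integral_mono)
      fix w
      have "ennreal (norm (f' w)) \<le> 1 + ennreal (norm (f' w) powr p)"
        using ennreal_leI[OF powr_split_le[of "norm (f' w)" 1 p]] p by simp
      then show "ennreal (norm (f' w)) * indicator (cball 0 r) w \<le> indicator (cball 0 r) w + ennreal (norm (f' w) powr p)"
        by (cases "w \<in> cball 0 r") simp_all
    qed
    also have "\<dots> = emeasure lborel (cball (0::real^'n) r) + (\<integral>\<^sup>+w. ennreal (norm (f' w) powr p) \<partial>lborel)"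
      using f'(1) by (subst nn_integral_add) simp_all
    also have "\<dots> < top"
      using fp emeasure_lborel_cball_finite[of "0::real^'n" r] by simp
    finally show "(\<integral>\<^sup>+w\<in>cball 0 r. ennreal (norm (f' w)) \<partial>lborel) < top" .
  qed
qed

lemma test_function_continuous:
  assumes "test_function \<phi>"
  shows "continuous_on UNIV \<phi>" "continuous_on UNIV (\<lambda>w. frechet_derivative \<phi> (at w) v)"
  using assms smooth_continuous smooth_frechet_continuous unfolding test_function_def by blast+

lemma integral_lebesgue_representative:
  fixes f f' :: "'a::euclidean_space \<Rightarrow> real"
  assumes f: "f \<in> borel_measurable lebesgue" and f': "f' \<in> borel_measurable borel" "AE x in lborel. f x = f' x"
  shows "(LINT x|lebesgue. f x) = (LINT x|lborel. f' x)"
proof -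
  have "(LINT x|lebesgue. f x) = (LINT x|lebesgue. f' x)"
    using f f' by (intro integral_cong_AE) (auto intro: AE_completion measurable_completion)
  also have "\<dots> = (LINT x|lborel. f' x)" using f' by (intro integral_completion) simp
  finally show ?thesis .
qed

text \<open>The regularised fields have this relation to the given field at almost every time. Only
  the difference with \<open>\<phi>\<close> has to be integrable, since a field in Lp need not
  be.\<close>

abbreviation (input) lipschitz_L1_limit :: "('a::euclidean_space \<Rightarrow> 'b::euclidean_space) \<Rightarrow> bool" where
  "lipschitz_L1_limit f \<equiv> \<forall>e>0. \<exists>\<phi> M. 0 \<le> M \<and> (\<forall>x y. norm (\<phi> x - \<phi> y) \<le> M * norm (x - y)) \<and>
     \<phi> \<in> borel_measurable borel \<and> (\<integral>\<^sup>+x. ennreal (norm (f x - \<phi> x)) \<partial>lborel) \<le> ennreal e"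

abbreviation (input) hajlasz_bound ::
  "real \<Rightarrow> ('a::euclidean_space \<Rightarrow> 'b::euclidean_space) \<Rightarrow> ('a \<Rightarrow> ennreal) \<Rightarrow> bool" where
  "hajlasz_bound k f g \<equiv> \<exists>N\<in>null_sets lborel. \<forall>x y. x \<notin> N \<longrightarrow> y \<notin> N \<longrightarrow>
     ennreal (norm (f x - f y)) \<le> ennreal (k * norm (x - y)) * (g x + g y)"

text \<open>The scalar estimate is applied to each component, with a row of the gradient as weak
  derivative and the norm of the full matrix as majorant; summation over components gives the factor
  \<open>CARD('n)\<close>. The constant is quantified before \<open>p\<close> and \<open>f\<close>,
  so that one value serves all times.\<close>

lemma hajlasz:
  "\<exists>K>0. \<forall>p (f :: real^'n \<Rightarrow> real^'n) Df. 1 < p \<longrightarrow> in_W1p p f Df \<longrightarrow>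
    lipschitz_L1_limit f \<longrightarrow> hajlasz_bound K f (maximal_norm Df)"
proof -
  obtain K where K: "0 < K" "\<And>\<eta>. 0 < \<eta> \<Longrightarrow> \<exists>k :: real^'n \<Rightarrow> real. mollifier K \<eta> k"
    using mollifiers_exist by blast
  define C where "C = 8 ^ DIM(real^'n) * (1 + K * unit_ball_vol DIM(real^'n))"
  have C: "0 < C" unfolding C_def using K(1) by (intro mult_pos_pos add_pos_nonneg) simp_all
  show ?thesis
  proof (intro exI[of _ "real CARD('n) * C"] conjI allI impI)
    show "0 < real CARD('n) * C" using C by simp
    fix p and f :: "real^'n \<Rightarrow> real^'n" and Df
    assume p: "1 < p" and W: "in_W1p p f Df" and approx: "lipschitz_L1_limit f"
    have fL: "in_Lp p f" and DL: "in_Lp p Df" using W by (auto simp: in_W1p_def)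
    have fm: "f \<in> borel_measurable lebesgue" and Dm: "Df \<in> borel_measurable lebesgue"
      using fL DL by (auto simp: in_Lp_def)
    obtain f' where f': "f' \<in> borel_measurable borel" "AE x in lborel. f x = f' x"
      using lebesgue_ex_borel[OF fm] by blast
    obtain D' where D': "D' \<in> borel_measurable borel" "AE x in lborel. Df x = D' x"
      using lebesgue_ex_borel[OF Dm] by blast
    define G where "G = maximal_norm D'"
    have locf: "locally_integrable f'" by (rule in_Lp_locally_integrable(1)[OF fL p f'])
    have locD: "locally_integrable D'" by (rule in_Lp_locally_integrable(1)[OF DL p D'])
    have loc_comp: "locally_integrable (\<lambda>x. h x $ i)" if "locally_integrable h" for h :: "real^'n \<Rightarrow> 'c::euclidean_space^'n" and i
      unfolding locally_integrable_def
    proof (intro conjI allI)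
      have hm: "h \<in> borel_measurable borel" using that by (simp add: locally_integrable_def)
      show "(\<lambda>x. h x $ i) \<in> borel_measurable borel"
        by (rule measurable_compose[OF hm]) (intro borel_measurable_continuous_onI continuous_intros)
      fix r
      have "(\<integral>\<^sup>+w\<in>cball 0 r. ennreal (norm (h w $ i)) \<partial>lborel) \<le> (\<integral>\<^sup>+w\<in>cball 0 r. ennreal (norm (h w)) \<partial>lborel)"
        by (intro nn_integral_mono mult_right_mono ennreal_leI Finite_Cartesian_Product.norm_nth_le) simp_all
      also have "\<dots> < top" using that by (simp add: locally_integrable_def)
      finally show "(\<integral>\<^sup>+w\<in>cball 0 r. ennreal (norm (h w $ i)) \<partial>lborel) < top" .
    qed
    have "\<exists>N\<in>null_sets lborel. \<forall>x y. x \<notin> N \<longrightarrow> y \<notin> N \<longrightarrow> ennreal \<bar>f' x $ i - f' y $ i\<bar> \<le>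
      ennreal (C * norm (x - y)) * (G x + G y)" for i
      unfolding C_def G_def
    proof (rule hajlasz_scalar[OF K loc_comp[OF locf] loc_comp[OF locD]])
      show "(\<lambda>w. norm (D' w)) \<in> borel_measurable borel" using D' by simp
      show "norm (D' w $ i) \<le> norm (D' w)" for w by (rule Finite_Cartesian_Product.norm_nth_le)
      fix \<phi> :: "real^'n \<Rightarrow> real" and j assume \<phi>: "test_function \<phi>"
      have mc: "\<phi> \<in> borel_measurable borel" "(\<lambda>w. frechet_derivative \<phi> (at w) (axis j 1)) \<in> borel_measurable borel"
        using test_function_continuous[OF \<phi>] by (auto intro: borel_measurable_continuous_onI)
      have comp: "(\<lambda>x. x $ i) \<in> borel_measurable (borel :: ('c::euclidean_space^'n) measure)" for i
        by (intro borel_measurable_continuous_onI continuous_intros)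
      have 1: "(LINT w|lebesgue. f w $ i * frechet_derivative \<phi> (at w) (axis j 1)) = (LINT w|lborel. f' w $ i * frechet_derivative \<phi> (at w) (axis j 1))"
      proof (rule integral_lebesgue_representative)
        show "(\<lambda>w. f w $ i * frechet_derivative \<phi> (at w) (axis j 1)) \<in> borel_measurable lebesgue"
          using mc by (intro borel_measurable_times measurable_compose[OF fm comp] measurable_completion) simp
        show "(\<lambda>w. f' w $ i * frechet_derivative \<phi> (at w) (axis j 1)) \<in> borel_measurable borel"
          using mc by (intro borel_measurable_times measurable_compose[OF f'(1) comp]) simp
        show "AE w in lborel. f w $ i * frechet_derivative \<phi> (at w) (axis j 1) = f' w $ i * frechet_derivative \<phi> (at w) (axis j 1)"
          using f'(2) by eventually_elim simp
      qed
      have 2: "(LINT w|lebesgue. Df w $ i $ j * \<phi> w) = (LINT w|lborel. D' w $ i $ j * \<phi> w)"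
      proof (rule integral_lebesgue_representative)
        show "(\<lambda>w. Df w $ i $ j * \<phi> w) \<in> borel_measurable lebesgue"
          using mc by (intro borel_measurable_times measurable_compose[OF measurable_compose[OF Dm comp] comp] measurable_completion) simp
        show "(\<lambda>w. D' w $ i $ j * \<phi> w) \<in> borel_measurable borel"
          using mc by (intro borel_measurable_times measurable_compose[OF measurable_compose[OF D'(1) comp] comp]) simp
        show "AE w in lborel. Df w $ i $ j * \<phi> w = D' w $ i $ j * \<phi> w"
          using D'(2) by eventually_elim simp
      qed
      show "(LINT w|lborel. f' w $ i * frechet_derivative \<phi> (at w) (axis j 1)) = - (LINT w|lborel. D' w $ i $ j * \<phi> w)"
        using W \<phi> unfolding in_W1p_def 1[symmetric] 2[symmetric] by blast
    next
      fix e :: real assume "0 < e"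
      then obtain \<phi> M where \<phi>: "0 \<le> M" "\<forall>x y. norm (\<phi> x - \<phi> y) \<le> M * norm (x - y)"
       "\<phi> \<in> borel_measurable borel" "(\<integral>\<^sup>+x. ennreal (norm (f x - \<phi> x)) \<partial>lborel) \<le> ennreal e" using approx by blast
      show "\<exists>\<phi> M. 0 \<le> M \<and> (\<forall>x y. \<bar>\<phi> x - \<phi> y\<bar> \<le> M * norm (x - y)) \<and> \<phi> \<in> borel_measurable borel \<and>
         (\<integral>\<^sup>+x. ennreal \<bar>f' x $ i - \<phi> x\<bar> \<partial>lborel) \<le> ennreal e"
      proof (intro exI[of _ "\<lambda>x. \<phi> x $ i"] exI[of _ M] conjI allI \<phi>(1))
        fix x y
        have "\<bar>\<phi> x $ i - \<phi> y $ i\<bar> \<le> norm (\<phi> x - \<phi> y)"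
          using component_le_norm_cart[of "\<phi> x - \<phi> y" i] by simp
        then show "\<bar>\<phi> x $ i - \<phi> y $ i\<bar> \<le> M * norm (x - y)" using \<phi>(2) order_trans by blast
      next
        show "(\<lambda>x. \<phi> x $ i) \<in> borel_measurable borel"
          by (rule measurable_compose[OF \<phi>(3)]) (intro borel_measurable_continuous_onI continuous_intros)
        have "(\<integral>\<^sup>+x. ennreal \<bar>f' x $ i - \<phi> x $ i\<bar> \<partial>lborel) \<le> (\<integral>\<^sup>+x. ennreal (norm (f x - \<phi> x)) \<partial>lborel)"
        proof (rule nn_integral_mono_AE)
          show "AE x in lborel. ennreal \<bar>f' x $ i - \<phi> x $ i\<bar> \<le> ennreal (norm (f x - \<phi> x))"
            using f'(2)
          proof eventually_elim
            case (elim x)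
            show ?case using component_le_norm_cart[of "f' x - \<phi> x" i] unfolding elim by (intro ennreal_leI) simp
          qed
        qed
        then show "(\<integral>\<^sup>+x. ennreal \<bar>f' x $ i - \<phi> x $ i\<bar> \<partial>lborel) \<le> ennreal e" using \<phi>(4) by (rule order_trans)
      qed
    qed
    then have "\<forall>i. \<exists>N. N \<in> null_sets lborel \<and> (\<forall>x y. x \<notin> N \<longrightarrow> y \<notin> N \<longrightarrow> ennreal \<bar>f' x $ i - f' y $ i\<bar> \<le>
      ennreal (C * norm (x - y)) * (G x + G y))" unfolding Bex_def by (rule allI)
    from choice[OF this] obtain N where N': "\<forall>i. N i \<in> null_sets lborel \<and> (\<forall>x y. x \<notin> N i \<longrightarrow> y \<notin> N i \<longrightarrow>
      ennreal \<bar>f' x $ i - f' y $ i\<bar> \<le> ennreal (C * norm (x - y)) * (G x + G y))" by (rule exE)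
    have N: "N i \<in> null_sets lborel" "x \<notin> N i \<Longrightarrow> y \<notin> N i \<Longrightarrow>
      ennreal \<bar>f' x $ i - f' y $ i\<bar> \<le> ennreal (C * norm (x - y)) * (G x + G y)" for i x y
      using N'[rule_format, of i] by simp_all
    obtain N0 where N0: "N0 \<in> null_sets lborel" "\<forall>x. x \<notin> N0 \<longrightarrow> f x = f' x"
      using AE_lborel_null_set[OF f'(2)] by (elim bexE)
    have Geq: "maximal_norm Df = G"
      unfolding G_def using D'(2) by (intro ext maximal_function_cong_AE) (auto elim: eventually_mono)
    show "\<exists>N\<in>null_sets lborel. \<forall>x y. x \<notin> N \<longrightarrow> y \<notin> N \<longrightarrow> ennreal (norm (f x - f y)) \<le>
      ennreal (real CARD('n) * C * norm (x - y)) * (maximal_norm Df x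
         + maximal_norm Df y)"
      unfolding Geq
    proof (intro bexI[of _ "N0 \<union> (\<Union>i. N i)"] allI impI)
      show "N0 \<union> (\<Union>i. N i) \<in> null_sets lborel"
        using N0(1) N(1) by (intro null_sets.Un null_sets_UN') (auto intro: countable_finite)
      fix x y assume "x \<notin> N0 \<union> (\<Union>i. N i)" "y \<notin> N0 \<union> (\<Union>i. N i)"
      then have xy: "f x = f' x" "f y = f' y" "\<And>i. x \<notin> N i" "\<And>i. y \<notin> N i" using N0(2) by auto
      have "ennreal (norm (f' x - f' y)) \<le> ennreal (\<Sum>i\<in>UNIV. \<bar>f' x $ i - f' y $ i\<bar>)"
        using norm_le_l1_cart[of "f' x - f' y"] by (intro ennreal_leI) simp
      also have "\<dots> = (\<Sum>i\<in>UNIV. ennreal \<bar>f' x $ i - f' y $ i\<bar>)" by (simp add: sum_ennreal)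
      also have "\<dots> \<le> (\<Sum>i\<in>(UNIV::'n set). ennreal (C * norm (x - y)) * (G x + G y))"
        using xy by (intro sum_mono N(2)) simp_all
      also have "\<dots> = ennreal (real CARD('n)) * (ennreal (C * norm (x - y)) * (G x + G y))"
        by (simp add: ennreal_of_nat_eq_real_of_nat)
      also have "\<dots> = ennreal (real CARD('n) * C * norm (x - y)) * (G x + G y)"
        using C by (simp add: ennreal_mult mult.assoc)
      finally show "ennreal (norm (f x - f y)) \<le> ennreal (real CARD('n) * C * norm (x - y)) * (G x + G y)"
        by (simp only: xy(1,2))
    qed
  qed
qed

section \<open>Compression by one step of the theta-method\<close>

lemma lipschitz_derivative_bound:
  fixes f :: "'a::real_normed_vector \<Rightarrow> 'b::real_normed_vector"
  assumes D: "(f has_derivative D) (at x)" and f: "\<And>y z. norm (f y - f z) \<le> q * norm (y - z)"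
  shows "norm (D v) \<le> q * norm v"
proof (cases "v = 0")
  case True
  then show ?thesis using linear_0[OF has_derivative_linear[OF D]] by simp
next
  case False
  have "norm (D v) \<le> q * norm v + e" if e: "0 < e" for e
  proof -
    define e' where "e' = e / norm v"
    have e': "0 < e'" using e False by (simp add: e'_def)
    obtain d where d: "0 < d" "\<And>y. norm (y - x) < d \<Longrightarrow> norm (f y - f x - D (y - x)) \<le> e' * norm (y - x)"
      using D e' unfolding has_derivative_at_alt by blast
    define t where "t = d / (2 * norm v)"
    have t: "0 < t" using d False by (simp add: t_def)
    have tv: "norm (t *\<^sub>R v) < d" using d False t by (simp add: t_def)
    have "norm (D (t *\<^sub>R v)) \<le> norm (f (x + t *\<^sub>R v) - f x) + norm (f (x + t *\<^sub>R v) - f x - D (t *\<^sub>R v))"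
      using norm_triangle_ineq4[of "f (x + t *\<^sub>R v) - f x" "f (x + t *\<^sub>R v) - f x - D (t *\<^sub>R v)"] by simp
    also have "\<dots> \<le> q * norm (t *\<^sub>R v) + e' * norm (t *\<^sub>R v)"
      using f[of "x + t *\<^sub>R v" x] d(2)[of "x + t *\<^sub>R v"] tv by (intro add_mono) simp_all
    finally have "t * norm (D v) \<le> t * ((q + e') * norm v)"
      using t by (simp add: linear_scale[OF has_derivative_linear[OF D]] algebra_simps)
    then have "norm (D v) \<le> (q + e') * norm v" using t by simp
    then show ?thesis using False by (simp add: e'_def distrib_right)
  qed
  then show ?thesis by (rule field_le_epsilon)
qed

lemma lipschitz_continuous_on:
  fixes f :: "'a::real_normed_vector \<Rightarrow> 'b::real_normed_vector"
  assumes "\<And>x y. norm (f x - f y) \<le> C * norm (x - y)" "0 \<le> C"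
  shows "continuous_on UNIV f"
proof -
  have "C-lipschitz_on UNIV f" using assms by (intro lipschitz_onI) (auto simp: dist_norm)
  then show ?thesis by (rule lipschitz_on_continuous_on)
qed

text \<open>The inverse at \<open>y\<close> is the fixed point of the contraction sending
  \<open>x\<close> to \<open>y - f x\<close>; it is 2-Lipschitz because
  \<open>q \<le> 1 / 2\<close>. The contraction bound passes to the derivative of \<open>f\<close>,
  so the derivative of the sum is injective, hence invertible in finite dimension, and together with
  the continuity of \<open>g\<close> this makes \<open>g\<close> differentiable whenever
  \<open>f\<close> is.\<close>

lemma id_plus_contraction_inverse:
  fixes f :: "'a::euclidean_space \<Rightarrow> 'a"
  assumes f: "\<And>y z. norm (f y - f z) \<le> q * norm (y - z)" and q: "0 \<le> q" "q \<le> 1 / 2"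
  shows "\<exists>g. (\<forall>y. g y + f (g y) = y) \<and> (\<forall>x. g (x + f x) = x) \<and>
    (\<forall>y z. norm (g y - g z) \<le> 2 * norm (y - z)) \<and>
    (\<forall>f'. (\<forall>x. (f has_derivative f' x) (at x)) \<longrightarrow> (\<forall>y. \<exists>D. (g has_derivative D) (at y) \<and>
        D \<circ> (\<lambda>v. v + f' (g y) v) = id))"
proof -
  have ex: "\<exists>!x. y - f x = x" for y
    using f q by (intro banach_fix_type[of q]) (auto simp: dist_norm norm_minus_commute)
  define g where "g y = (THE x. y - f x = x)" for y
  have g1: "y - f (g y) = g y" for y unfolding g_def by (rule theI'[OF ex])
  have 1: "g y + f (g y) = y" for y by (rule diff_eq_eq[THEN iffD1, OF g1[of y], symmetric])
  have 2: "g (x + f x) = x" for x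
    unfolding g_def
  proof (rule the_equality)
    show x: "x + f x - f x = x" by simp
    show "z = x" if "x + f x - f z = z" for z
      using ex[of "x + f x"] that x by blast
  qed
  have 3: "norm (g y - g z) \<le> 2 * norm (y - z)" for y z
  proof -
    have "g y - g z = (y - z) - (f (g y) - f (g z))" using g1[of y] g1[of z] by (simp add: algebra_simps)
    then have "norm (g y - g z) \<le> norm (y - z) + norm (f (g y) - f (g z))"
      by (metis norm_triangle_ineq4)
    also have "norm (f (g y) - f (g z)) \<le> 1 / 2 * norm (g y - g z)"
      by (rule order_trans[OF f mult_right_mono]) (use q in auto)
    finally show ?thesis by simp
  qed
  have 4: "\<exists>D. (g has_derivative D) (at y) \<and> D \<circ> (\<lambda>v. v + f' (g y) v) = id"
    if f': "\<And>x. (f has_derivative f' x) (at x)" for y f'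
  proof -
    define L where "L v = v + f' (g y) v" for v
    have lin: "linear L" unfolding L_def[abs_def]
      using has_derivative_linear[OF f'[of "g y"]] by (intro linear_compose_add linear_id[unfolded id_def]) auto
    have inj: "inj L"
    proof (rule linear_injective_on_subspace_0[OF lin subspace_UNIV, THEN iffD2], intro ballI impI)
      fix v assume "L v = 0"
      then have "v = - f' (g y) v" unfolding L_def by (simp add: eq_neg_iff_add_eq_0)
      then have "norm v = norm (f' (g y) v)" by (metis norm_minus_cancel)
      moreover have "norm (f' (g y) v) \<le> q * norm v" by (rule lipschitz_derivative_bound[OF f' f])
      moreover have "q * norm v \<le> 1 / 2 * norm v" using q by (intro mult_right_mono) auto
      ultimately have "norm v \<le> 0" by linarith
      then show "v = 0" by simp
    qed
    obtain D where D: "linear D" "D \<circ> L = id" using linear_injective_left_inverse[OF lin inj] by blast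
    have "(g has_derivative D) (at y)"
    proof (rule has_derivative_inverse_basic[where f="\<lambda>x. x + f x" and T=UNIV])
      show "((\<lambda>x. x + f x) has_derivative L) (at (g y))"
        unfolding L_def[abs_def] by (intro has_derivative_add has_derivative_ident f')
      show "bounded_linear D" using D(1) by (simp add: linear_conv_bounded_linear)
      have "continuous_on UNIV g" by (rule lipschitz_continuous_on[OF 3]) simp
      then show "continuous (at y) g" by (simp add: continuous_on_eq_continuous_at)
    qed (use D 1 in auto)
    then show ?thesis using D(2) unfolding L_def[abs_def] by blast
  qed
  show ?thesis
  proof (rule exI[of _ g], intro conjI allI impI)
    fix f' y assume "\<forall>x. (f has_derivative f' x) (at x)"
    then show "\<exists>D. (g has_derivative D) (at y) \<and> D \<circ> (\<lambda>v. v + f' (g y) v) = id" by (intro 4) blast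
  qed (rule 1 2 3)+
qed

section \<open>Determinants near the identity\<close>

lemma det_bound:
  fixes A :: "real^'n^'n"
  assumes "\<And>i j. \<bar>A $ i $ j\<bar> \<le> b"
  shows "\<bar>det A\<bar> \<le> fact CARD('n) * b ^ CARD('n)"
proof -
  have fin: "finite {p. p permutes (UNIV :: 'n set)}" by (rule finite_permutations) simp
  have b: "0 \<le> b" using assms[of undefined undefined] by linarith
  have "\<bar>det A\<bar> \<le> (\<Sum>p | p permutes (UNIV :: 'n set). \<bar>of_int (sign p) * (\<Prod>i\<in>UNIV. A $ i $ p i)\<bar>)"
    unfolding det_def by (rule sum_abs)
  also have "\<dots> \<le> (\<Sum>p | p permutes (UNIV :: 'n set). b ^ CARD('n))"
  proof (rule sum_mono)
    fix p :: "'n \<Rightarrow> 'n"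
    have "\<bar>of_int (sign p) * (\<Prod>i\<in>UNIV. A $ i $ p i)\<bar> = (\<Prod>i\<in>UNIV. \<bar>A $ i $ p i\<bar>)"
      by (simp add: abs_mult abs_prod sign_def)
    also have "\<dots> \<le> (\<Prod>i\<in>(UNIV::'n set). b)" using assms by (intro prod_mono) auto
    finally show "\<bar>of_int (sign p) * (\<Prod>i\<in>UNIV. A $ i $ p i)\<bar> \<le> b ^ CARD('n)" by simp
  qed
  also have "\<dots> = fact CARD('n) * b ^ CARD('n)"
    by (simp add: card_permutations[OF refl])
  finally show ?thesis .
qed

text \<open>An additional factor creates the cross term \<open>x j * (P - 1)\<close>. By induction
  \<open>P - 1\<close> is of first order, so the cross term is of second order and costs at most
  twice the current bound; base 4 leaves room for this.\<close>

lemma prod_one_plus_expansion: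
  fixes x :: "'i \<Rightarrow> real"
  assumes "finite S" "\<And>i. i \<in> S \<Longrightarrow> \<bar>x i\<bar> \<le> a" "0 \<le> a" "a \<le> 1"
  shows "\<bar>(\<Prod>i\<in>S. 1 + x i) - 1 - (\<Sum>i\<in>S. x i)\<bar> \<le> 4 ^ card S * a\<^sup>2"
  using assms(1,2)
proof (induction S rule: finite_induct)
  case empty
  then show ?case using assms by simp
next
  case (insert j S)
  define P where "P = (\<Prod>i\<in>S. 1 + x i)"
  define s where "s = (\<Sum>i\<in>S. x i)"
  define n where "n = card S"
  have IH: "\<bar>P - 1 - s\<bar> \<le> 4 ^ n * a\<^sup>2" using insert unfolding P_def s_def n_def by simp
  have "\<bar>s\<bar> \<le> (\<Sum>i\<in>S. \<bar>x i\<bar>)" unfolding s_def by (rule sum_abs)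
  also have "\<dots> \<le> (\<Sum>i\<in>S. a)" using insert by (intro sum_mono) auto
  finally have s: "\<bar>s\<bar> \<le> real n * a" by (simp add: n_def)
  have n4: "real n \<le> 4 ^ n"
    using of_nat_less_two_power[of n, where 'a=real] power_mono[of 2 "4::real" n] by linarith
  have aa: "a\<^sup>2 \<le> a" using assms by (simp add: power2_eq_square mult_left_le_one_le)
  have "\<bar>P - 1\<bar> \<le> 4 ^ n * a\<^sup>2 + real n * a" using IH s by linarith
  also have "\<dots> \<le> 4 ^ n * a + 4 ^ n * a"
    using aa n4 assms by (intro add_mono mult_left_mono mult_right_mono) auto
  finally have P1: "\<bar>P - 1\<bar> \<le> 2 * 4 ^ n * a" by (simp add: mult_ac)
  have "\<bar>x j * (P - 1)\<bar> \<le> a * (2 * 4 ^ n * a)"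
    unfolding abs_mult using P1 insert assms by (intro mult_mono) auto
  also have "\<dots> = 2 * 4 ^ n * a\<^sup>2" by (simp add: power2_eq_square)
  finally have xj: "\<bar>x j * (P - 1)\<bar> \<le> 2 * 4 ^ n * a\<^sup>2" .
  have "(\<Prod>i\<in>insert j S. 1 + x i) - 1 - (\<Sum>i\<in>insert j S. x i) = (P - 1 - s) + x j * (P - 1)"
    using insert by (simp add: P_def s_def algebra_simps)
  then have "\<bar>(\<Prod>i\<in>insert j S. 1 + x i) - 1 - (\<Sum>i\<in>insert j S. x i)\<bar> \<le> 4 ^ n * a\<^sup>2 + 2 * 4 ^ n * a\<^sup>2"
    using IH xj by linarith
  also have "\<dots> \<le> 4 ^ Suc n * a\<^sup>2" by simp
  finally show ?case using insert by (simp add: n_def)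
qed

text \<open>Two bounds in one constant: the first summand bounds the determinant of a matrix with
  entries at most 2, and the sum bounds the second-order remainder of det(1 + A).\<close>

definition det_const :: "'n::finite itself \<Rightarrow> real" where
  "det_const _ = fact CARD('n) * 2 ^ CARD('n) + 4 ^ CARD('n)"

lemma det_const_pos: "0 < det_const TYPE('n::finite)"
  by (simp add: det_const_def add_pos_pos)

text \<open>In the Leibniz formula the identity contributes the product of the diagonal entries,
  with linear part \<open>trace A\<close>. Every other permutation has at least two off-diagonal
  factors and is of order a^2.\<close>

lemma det_one_plus_expansion:
  fixes A :: "real^'n^'n"
  assumes A: "\<And>i j. \<bar>A $ i $ j\<bar> \<le> a" and a: "0 \<le> a" "a \<le> 1"
  shows "\<bar>det (mat 1 + A) - 1 - trace A\<bar> \<le> det_const TYPE('n) * a\<^sup>2"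
proof -
  define M where "M = mat 1 + A"
  have fin: "finite {p. p permutes (UNIV :: 'n set)}" by (rule finite_permutations) simp
  have Mij: "M $ i $ j = (if i = j then 1 else 0) + A $ i $ j" for i j by (simp add: M_def mat_def)
  have M2: "\<bar>M $ i $ j\<bar> \<le> 2" for i j
  proof -
    have "M $ i $ j = 1 + A $ i $ j \<or> M $ i $ j = A $ i $ j" by (simp add: Mij)
    then show ?thesis using A[of i j] a by (elim disjE) linarith+
  qed
  have off: "\<bar>M $ i $ j\<bar> \<le> a" if "i \<noteq> j" for i j using A[of i j] that by (simp add: Mij)
  define t where "t p = of_int (sign p) * (\<Prod>i\<in>UNIV. M $ i $ p i)" for p :: "'n \<Rightarrow> 'n"
  have tb: "\<bar>t p\<bar> \<le> 2 ^ CARD('n) * a\<^sup>2" if p: "p permutes UNIV" "p \<noteq> id" for p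
  proof -
    obtain i where i: "p i \<noteq> i" using p(2) by (auto simp: fun_eq_iff)
    \<comment> \<open>By injectivity the image of a moved index is moved as well; it provides the
      second off-diagonal factor.\<close>
    define j where "j = p i"
    have j: "p j \<noteq> j" using i permutes_inj[OF p(1)] by (auto simp: j_def inj_eq)
    have ij: "i \<noteq> j" using i by (simp add: j_def)
    have "\<bar>t p\<bar> = (\<Prod>k\<in>UNIV. \<bar>M $ k $ p k\<bar>)" by (simp add: t_def abs_mult abs_prod sign_def)
    also have "\<dots> = \<bar>M $ i $ p i\<bar> * (\<bar>M $ j $ p j\<bar> * (\<Prod>k\<in>UNIV - {i} - {j}. \<bar>M $ k $ p k\<bar>))"
      using ij by (subst prod.remove[of UNIV i], simp, simp, subst prod.remove[of "UNIV - {i}" j]) auto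
    also have "\<dots> \<le> a * (a * (\<Prod>k\<in>UNIV - {i} - {j}. 2))"
      using off[of i "p i"] off[of j "p j"] i j a M2
      by (intro mult_mono prod_mono mult_nonneg_nonneg prod_nonneg) auto
    also have "\<dots> \<le> a * (a * 2 ^ CARD('n))"
      unfolding prod_constant using a by (intro mult_left_mono power_increasing card_mono) auto
    finally show ?thesis by (simp add: power2_eq_square mult_ac)
  qed
  have "det M = (\<Sum>p | p permutes (UNIV :: 'n set). t p)" by (simp add: det_def t_def)
  also have "\<dots> = t id + (\<Sum>p\<in>{p. p permutes (UNIV :: 'n set)} - {id}. t p)"
    using fin by (subst sum.remove[of _ id]) (auto simp: permutes_id)
  also have "t id = (\<Prod>i\<in>UNIV. 1 + A $ i $ i)" by (simp add: t_def Mij)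
  finally have "det M - 1 - trace A = ((\<Prod>i\<in>UNIV. 1 + A $ i $ i) - 1 - (\<Sum>i\<in>UNIV. A $ i $ i))
      + (\<Sum>p\<in>{p. p permutes (UNIV :: 'n set)} - {id}. t p)" by (simp add: trace_def id_def)
  moreover have "\<bar>(\<Prod>i\<in>(UNIV::'n set). 1 + A $ i $ i) - 1 - (\<Sum>i\<in>UNIV. A $ i $ i)\<bar> \<le> 4 ^ CARD('n) * a\<^sup>2"
    using A a by (intro prod_one_plus_expansion) auto
  moreover have "\<bar>\<Sum>p\<in>{p. p permutes (UNIV :: 'n set)} - {id}. t p\<bar> \<le> fact CARD('n) * (2 ^ CARD('n) * a\<^sup>2)"
  proof -
    have "\<bar>\<Sum>p\<in>{p. p permutes (UNIV :: 'n set)} - {id}. t p\<bar> \<le> (\<Sum>p\<in>{p. p permutes (UNIV :: 'n set)} - {id}. \<bar>t p\<bar>)"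
      by (rule sum_abs)
    also have "\<dots> \<le> (\<Sum>p\<in>{p. p permutes (UNIV :: 'n set)} - {id}. 2 ^ CARD('n) * a\<^sup>2)"
      using tb by (intro sum_mono) auto
    also have "\<dots> \<le> (\<Sum>p | p permutes (UNIV :: 'n set). 2 ^ CARD('n) * a\<^sup>2)"
      using fin by (intro sum_mono2) auto
    also have "\<dots> = fact CARD('n) * (2 ^ CARD('n) * a\<^sup>2)" by (simp add: card_permutations[OF refl])
    finally show ?thesis .
  qed
  ultimately show ?thesis unfolding M_def det_const_def by (simp add: distrib_right)
qed

lemma matrix_entry_bound:
  fixes D :: "real^'n \<Rightarrow> real^'n"
  assumes "\<And>v. norm (D v) \<le> b * norm v"
  shows "\<bar>matrix D $ i $ j\<bar> \<le> b"
proof -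
  have "\<bar>matrix D $ i $ j\<bar> \<le> norm (D (axis j 1))"
    unfolding matrix_def using component_le_norm_cart[of "D (axis j 1)" i] by simp
  also have "\<dots> \<le> b" using assms[of "axis j 1"] by simp
  finally show ?thesis .
qed

text \<open>The change of variables theorems of the library require a well-ordered index type.\<close>

lemma emeasure_differentiable_image_le:
  fixes g :: "real^'m::{finite,wellorder} \<Rightarrow> real^'m::_"
  assumes der: "\<And>x. (g has_derivative g' x) (at x)" and B: "\<And>x. \<bar>det (matrix (g' x))\<bar> \<le> B" "0 < B"
    and A: "open A" and gA: "g ` A \<in> sets borel"
  shows "emeasure lborel (g ` A) \<le> ennreal B * emeasure lborel A"
proof (cases "emeasure lborel A = \<infinity>")
  case True
  then show ?thesis using B by (simp add: ennreal_mult_top)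
next
  case False
  have Al: "A \<in> lmeasurable"
    using A False by (intro fmeasurableI) (auto simp: less_top)
  have der': "(g has_derivative g' x) (at x within A)" for x
    using der by (rule has_derivative_at_withinI)
  have int: "(\<lambda>x. \<bar>det (matrix (g' x))\<bar>) integrable_on A"
  proof (rule measurable_bounded_by_integrable_imp_integrable)
    show "(\<lambda>x. \<bar>det (matrix (g' x))\<bar>) \<in> borel_measurable (lebesgue_on A)"
      using Al der' by (intro borel_measurable_abs borel_measurable_det_Jacobian) auto
    show "(\<lambda>x. B) integrable_on A" using Al by (rule integrable_on_const)
  qed (use B Al in auto)
  have m: "g ` A \<in> lmeasurable" "measure lebesgue (g ` A) \<le> B * measure lebesgue A"
    using measurable_bounded_differentiable_image[OF Al der' int B(1)]
      measure_bounded_differentiable_image[OF Al der' int B(1)] by auto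
  have "emeasure lborel (g ` A) = emeasure lebesgue (g ` A)" using gA by simp
  also have "\<dots> = ennreal (measure lebesgue (g ` A))" using m by (simp add: emeasure_eq_measure2)
  also have "\<dots> \<le> ennreal (B * measure lebesgue A)" using m by (simp add: ennreal_leI)
  also have "\<dots> = ennreal B * emeasure lebesgue A"
    using B Al by (simp add: ennreal_mult emeasure_eq_measure2)
  also have "emeasure lebesgue A = emeasure lborel A" using A by simp
  finally show ?thesis .
qed

text \<open>The preimage under \<open>U\<close> is the image under \<open>V\<close>, and the measure
  of an image is controlled by the determinant of the derivative.\<close>

lemma compressible_of_inverse:
  fixes U V :: "real^'m::{finite,wellorder} \<Rightarrow> real^'m::_"
  assumes UV: "\<And>x. V (U x) = x" "\<And>y. U (V y) = y" and U: "continuous_on UNIV U"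
    and V: "\<And>x. \<exists>D. (V has_derivative D) (at x) \<and> \<bar>det (matrix D)\<bar> \<le> B" and B: "0 < B"
  shows "compressible B U"
  unfolding compressible_def
proof (intro conjI allI impI)
  show "U \<in> borel_measurable borel" by (rule borel_measurable_continuous_onI[OF U])
  fix A :: "(real^'m::_) set" assume A: "open A"
  have eq: "U -` A = V ` A"
  proof
    show "U -` A \<subseteq> V ` A" using UV(1) by (auto intro!: image_eqI[where f=V])
    show "V ` A \<subseteq> U -` A" using UV(2) by auto
  qed
  have "open (U -` A)" using A U by (rule open_vimage)
  then have VA: "V ` A \<in> sets borel" unfolding eq by simp
  from choice[OF allI, OF V] obtain D where D: "\<forall>x. (V has_derivative D x) (at x) \<and> \<bar>det (matrix (D x))\<bar> \<le> B" by (rule exE)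
  show "emeasure lborel (U -` A) \<le> ennreal B * emeasure lborel A"
    unfolding eq using D by (intro emeasure_differentiable_image_le[of V D] B A VA) auto
qed

lemma matrix_id_plus:
  fixes f :: "real^'n \<Rightarrow> real^'n"
  shows "matrix (\<lambda>v. v + f v) = mat 1 + matrix f"
  by (simp add: matrix_def mat_def vec_eq_iff axis_def)

lemma det_perturbation:
  fixes D f' :: "real^'n \<Rightarrow> real^'n"
  assumes f': "\<And>v. f' v = s *\<^sub>R D v" and s: "\<bar>s\<bar> \<le> h" and D: "\<And>v. norm (D v) \<le> K * norm v" and K: "0 \<le> K"
    and hK: "h * K \<le> 1" and tr: "\<bar>trace (matrix D)\<bar> \<le> c"
  shows "\<bar>det (matrix (\<lambda>v. v + f' v)) - 1\<bar> \<le> h * c + det_const TYPE('n) * (h * K)\<^sup>2"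
proof -
  have h: "0 \<le> h" using s by linarith
  have c: "0 \<le> c" using tr by linarith
  have nf: "norm (f' v) \<le> (h * K) * norm v" for v
  proof -
    have "norm (f' v) \<le> h * (K * norm v)"
      unfolding f' norm_scaleR using s D[of v] h by (intro mult_mono) auto
    then show ?thesis by (simp add: mult.assoc)
  qed
  have "\<bar>det (mat 1 + matrix f') - 1 - trace (matrix f')\<bar> \<le> det_const TYPE('n) * (h * K)\<^sup>2"
    using matrix_entry_bound[OF nf] h K hK by (intro det_one_plus_expansion) auto
  moreover have "trace (matrix f') = s * trace (matrix D)"
    by (simp add: trace_def matrix_def f' sum_distrib_left)
  moreover have "\<bar>s * trace (matrix D)\<bar> \<le> h * c" unfolding abs_mult using s tr h by (intro mult_mono) auto
  ultimately show ?thesis unfolding matrix_id_plus by linarith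
qed

lemma det_left_inverse:
  fixes D L :: "real^'n \<Rightarrow> real^'n"
  assumes "linear D" "linear L" "D \<circ> L = id"
  shows "det (matrix D) * det (matrix L) = 1"
proof -
  have "det (matrix (D \<circ> L)) = det (matrix D) * det (matrix L)"
    by (subst matrix_compose[OF assms(2,1)]) (rule det_mul)
  then show ?thesis using assms(3) by (simp add: matrix_id_mat_1)
qed

text \<open>The implicit equation separates its unknowns: with P = id - h \<theta> F and Q = id + h
  (1 - \<theta>) F it reads P y = Q x.\<close>

lemma theta_step_equation:
  fixes x y a b :: "'a::real_vector"
  assumes h: "0 < (h::real)"
  shows "(1 / h) *\<^sub>R (y - x) = (1 - \<theta>) *\<^sub>R a + \<theta> *\<^sub>R b \<longleftrightarrow> y + (- (h * \<theta>)) *\<^sub>R b = x + (h * (1 - \<theta>)) *\<^sub>R a"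
proof -
  have "(1 / h) *\<^sub>R (y - x) = (1 - \<theta>) *\<^sub>R a + \<theta> *\<^sub>R b \<longleftrightarrow>
     h *\<^sub>R ((1 / h) *\<^sub>R (y - x)) = h *\<^sub>R ((1 - \<theta>) *\<^sub>R a + \<theta> *\<^sub>R b)"
    using h by (subst real_vector.scale_cancel_left) simp
  also have "\<dots> \<longleftrightarrow> y - x = (h * (1 - \<theta>)) *\<^sub>R a + (h * \<theta>) *\<^sub>R b"
    using h by (simp add: scaleR_add_right)
  also have "\<dots> \<longleftrightarrow> y + (- (h * \<theta>)) *\<^sub>R b = x + (h * (1 - \<theta>)) *\<^sub>R a"
  proof -
    have "y - x = A + B \<longleftrightarrow> y + - B = x + A" for A B :: 'a by (auto simp: algebra_simps)
    then show ?thesis by (simp only: scaleR_minus_left)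
  qed
  finally show ?thesis .
qed

text \<open>An equivalence instead of an implication: it contains solvability and uniqueness, so
  that the definite description in \<open>theta_node\<close> evaluates to
  \<open>\<Psi>\<close>.\<close>

definition theta_step :: "real \<Rightarrow> real \<Rightarrow> ('a::real_vector \<Rightarrow> 'a) \<Rightarrow> ('a \<Rightarrow> 'a) \<Rightarrow> bool" where
  "theta_step h \<theta> F \<Psi> \<longleftrightarrow>
     (\<forall>x y. (1 / h) *\<^sub>R (y - x) = (1 - \<theta>) *\<^sub>R F x + \<theta> *\<^sub>R F y \<longleftrightarrow> y = \<Psi> x)"

text \<open>The inverse of the step is P followed by the inverse of Q, with determinant det DP / det
  DQ. Both determinants lie within \<kappa> of 1, so the quotient is at most (1 + \<kappa>) / (1 -
  \<kappa>), and this is at most 1 + 4 \<kappa> for \<kappa> up to 1/2. Full steps are iterated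
  about T / h times and need a factor close to 1; a partial step occurs just once, in the
  interpolation, where a fixed constant is enough.\<close>

lemma theta_step_compressible_wellorder:
  fixes F :: "real^'m::{finite,wellorder} \<Rightarrow> real^'m::_"
  assumes h: "0 < h" and \<theta>: "0 \<le> \<theta>" "\<theta> \<le> 1" and K: "0 \<le> K" "h * K \<le> 1 / 8"
    and F: "\<And>y z. norm (F y - F z) \<le> K * norm (y - z)"
    and DF: "\<And>x. (F has_derivative DF x) (at x)" and tr: "\<And>x. \<bar>trace (matrix (DF x))\<bar> \<le> c"
    and \<kappa>: "\<kappa> = h * c + det_const TYPE('m) * (h * K)\<^sup>2" "\<kappa> \<le> 1 / 2"
  shows "\<exists>\<Psi>. theta_step h \<theta> F \<Psi> \<and> continuous_on UNIV \<Psi> \<and> compressible (1 + 4 * \<kappa>) \<Psi> \<and>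
     (\<forall>l\<in>{0..1}. compressible (det_const TYPE('m)) (\<lambda>x. x + l *\<^sub>R (\<Psi> x - x)))"
proof -
  have c: "0 \<le> c" using tr[of undefined] by linarith
  have \<kappa>0: "0 \<le> \<kappa>" unfolding \<kappa>(1) using h c det_const_pos[where 'n='m] by (intro add_nonneg_nonneg mult_nonneg_nonneg) auto
  define fP where "fP y = (- (h * \<theta>)) *\<^sub>R F y" for y
  define fQ where "fQ y = (h * (1 - \<theta>)) *\<^sub>R F y" for y
  have sP: "\<bar>- (h * \<theta>)\<bar> \<le> h" and sQ: "\<bar>h * (1 - \<theta>)\<bar> \<le> h"
    using h \<theta> by (auto simp: abs_mult mult_left_le)
  have lipscale: "norm (s *\<^sub>R F y - s *\<^sub>R F z) \<le> (h * K) * norm (y - z)" if "\<bar>s\<bar> \<le> h" for s y z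
  proof -
    have "norm (s *\<^sub>R F y - s *\<^sub>R F z) = \<bar>s\<bar> * norm (F y - F z)" by (simp flip: scaleR_diff_right)
    also have "\<dots> \<le> h * (K * norm (y - z))" using that F[of y z] h by (intro mult_mono) auto
    finally show ?thesis by (simp add: mult.assoc)
  qed
  have q: "0 \<le> h * K" "h * K \<le> 1 / 2" using h K by auto
  from id_plus_contraction_inverse[of fP, OF lipscale[OF sP, folded fP_def] q] obtain gP
    where gP: "(\<forall>y. gP y + fP (gP y) = y) \<and> (\<forall>x. gP (x + fP x) = x) \<and>
    (\<forall>y z. norm (gP y - gP z) \<le> 2 * norm (y - z)) \<and>
    (\<forall>f'. (\<forall>x. (fP has_derivative f' x) (at x)) \<longrightarrow> (\<forall>y. \<exists>D. (gP has_derivative D) (at y) \<and>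
        D \<circ> (\<lambda>v. v + f' (gP y) v) = id))" by (rule exE)
  note gP1 = gP[THEN conjunct1, rule_format] and gP2 = gP[THEN conjunct2, THEN conjunct1, rule_format]
    and gP3 = gP[THEN conjunct2, THEN conjunct2, THEN conjunct1, rule_format]
    and gP4 = gP[THEN conjunct2, THEN conjunct2, THEN conjunct2, rule_format]
  from id_plus_contraction_inverse[of fQ, OF lipscale[OF sQ, folded fQ_def] q] obtain gQ
    where gQ: "(\<forall>y. gQ y + fQ (gQ y) = y) \<and> (\<forall>x. gQ (x + fQ x) = x) \<and>
    (\<forall>y z. norm (gQ y - gQ z) \<le> 2 * norm (y - z)) \<and>
    (\<forall>f'. (\<forall>x. (fQ has_derivative f' x) (at x)) \<longrightarrow> (\<forall>y. \<exists>D. (gQ has_derivative D) (at y) \<and>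
        D \<circ> (\<lambda>v. v + f' (gQ y) v) = id))" by (rule exE)
  note gQ1 = gQ[THEN conjunct1, rule_format] and gQ2 = gQ[THEN conjunct2, THEN conjunct1, rule_format]
    and gQ3 = gQ[THEN conjunct2, THEN conjunct2, THEN conjunct1, rule_format]
    and gQ4 = gQ[THEN conjunct2, THEN conjunct2, THEN conjunct2, rule_format]
  define P where "P y = y + fP y" for y
  define Q where "Q y = y + fQ y" for y
  define \<Psi> where "\<Psi> x = gP (Q x)" for x
  define V where "V y = gQ (P y)" for y
  define fP' where "fP' x v = (- (h * \<theta>)) *\<^sub>R DF x v" for x v
  define fQ' where "fQ' x v = (h * (1 - \<theta>)) *\<^sub>R DF x v" for x v
  have dP: "(fP has_derivative fP' x) (at x)" and dQ: "(fQ has_derivative fQ' x) (at x)" for x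
    unfolding fP_def[abs_def] fP'_def[abs_def] fQ_def[abs_def] fQ'_def[abs_def] by (intro has_derivative_scaleR_right DF)+
  have dPP: "(P has_derivative (\<lambda>v. v + fP' x v)) (at x)" and dQQ: "(Q has_derivative (\<lambda>v. v + fQ' x v)) (at x)" for x
    unfolding P_def[abs_def] Q_def[abs_def] by (intro has_derivative_add has_derivative_ident dP dQ)+
  have DFb: "norm (DF x v) \<le> K * norm v" for x v by (rule lipschitz_derivative_bound[OF DF F])
  have hK1: "h * K \<le> 1" using K by simp
  have step: "theta_step h \<theta> F \<Psi>"
    unfolding theta_step_def theta_step_equation[OF h]
  proof (intro allI)
    fix x y
    have "y + (- (h * \<theta>)) *\<^sub>R F y = x + (h * (1 - \<theta>)) *\<^sub>R F x \<longleftrightarrow> P y = Q x"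
      unfolding P_def Q_def fP_def fQ_def by simp
    also have "\<dots> \<longleftrightarrow> y = \<Psi> x"
      unfolding \<Psi>_def P_def using gP1[of "Q x"] gP2[of y] by metis
    finally show "(y + (- (h * \<theta>)) *\<^sub>R F y = x + (h * (1 - \<theta>)) *\<^sub>R F x) = (y = \<Psi> x)" .
  qed
  have lQ: "norm (Q y - Q z) \<le> 3 / 2 * norm (y - z)" for y z
  proof -
    have "norm (Q y - Q z) \<le> norm (y - z) + norm (fQ y - fQ z)"
      unfolding Q_def by (metis add_diff_add norm_triangle_ineq)
    also have "norm (fQ y - fQ z) \<le> h * K * norm (y - z)" unfolding fQ_def by (rule lipscale[OF sQ])
    also have "h * K * norm (y - z) \<le> 1 / 2 * norm (y - z)" using q by (intro mult_right_mono) auto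
    finally show ?thesis by simp
  qed
  have l\<Psi>: "norm (\<Psi> y - \<Psi> z) \<le> 3 * norm (y - z)" for y z
    unfolding \<Psi>_def using gP3[of "Q y" "Q z"] lQ[of y z] by linarith
  have c\<Psi>: "continuous_on UNIV \<Psi>" by (rule lipschitz_continuous_on[OF l\<Psi>]) simp
  have comp1: "compressible (1 + 4 * \<kappa>) \<Psi>"
  proof (rule compressible_of_inverse[OF _ _ c\<Psi>])
    show "V (\<Psi> x) = x" for x unfolding V_def \<Psi>_def P_def gP1 Q_def by (rule gQ2)
    show "\<Psi> (V y) = y" for y unfolding V_def \<Psi>_def Q_def gQ1 P_def by (rule gP2)
    show "0 < 1 + 4 * \<kappa>" using \<kappa>0 by simp
    fix y
    obtain D where D: "(gQ has_derivative D) (at (P y))" "D \<circ> (\<lambda>v. v + fQ' (gQ (P y)) v) = id"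
      using gQ4[OF dQ] by blast
    have dV: "(V has_derivative (\<lambda>v. D (v + fP' y v))) (at y)"
      unfolding V_def[abs_def] by (rule has_derivative_compose[OF dPP D(1)])
    have linD: "linear D" by (rule has_derivative_linear[OF D(1)])
    have linQ: "linear (\<lambda>v. v + fQ' x v)" and linP: "linear (\<lambda>v. v + fP' x v)" for x
      using has_derivative_linear[OF dQQ] has_derivative_linear[OF dPP] by auto
    define dp where "dp = det (matrix (\<lambda>v. v + fP' y v))"
    define dq where "dq = det (matrix (\<lambda>v. v + fQ' (gQ (P y)) v))"
    have "matrix (\<lambda>v. D (v + fP' y v)) = matrix D ** matrix (\<lambda>v. v + fP' y v)"
      using matrix_compose[OF linP linD] by (simp add: o_def)
    then have "det (matrix (\<lambda>v. D (v + fP' y v))) = det (matrix D) * dp"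
      by (simp add: det_mul dp_def)
    moreover have "det (matrix D) * dq = 1" unfolding dq_def by (rule det_left_inverse[OF linD linQ D(2)])
    moreover have dp: "\<bar>dp - 1\<bar> \<le> \<kappa>" unfolding dp_def \<kappa>(1)
      by (rule det_perturbation[where D="DF y" and f'="fP' y", OF _ sP DFb K(1) hK1 tr]) (simp add: fP'_def)
    moreover have dq: "\<bar>dq - 1\<bar> \<le> \<kappa>" unfolding dq_def \<kappa>(1)
      by (rule det_perturbation[where D="DF (gQ (P y))" and f'="fQ' (gQ (P y))", OF _ sQ DFb K(1) hK1 tr]) (simp add: fQ'_def)
    ultimately have "\<bar>det (matrix (\<lambda>v. D (v + fP' y v)))\<bar> * \<bar>dq\<bar> = \<bar>dp\<bar>"
      by (metis abs_mult mult.commute mult.left_commute mult_1)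
    moreover have "\<bar>dp\<bar> \<le> 1 + \<kappa>" "1 - \<kappa> \<le> \<bar>dq\<bar>" using dp dq by linarith+
    moreover have "1 + \<kappa> \<le> (1 + 4 * \<kappa>) * (1 - \<kappa>)"
      using mult_right_mono[OF \<kappa>(2) \<kappa>0] by (simp add: algebra_simps)
    moreover have "(1 + 4 * \<kappa>) * (1 - \<kappa>) \<le> (1 + 4 * \<kappa>) * \<bar>dq\<bar>"
      using calculation(3) \<kappa>0 by (intro mult_left_mono) auto
    ultimately have "\<bar>det (matrix (\<lambda>v. D (v + fP' y v)))\<bar> * \<bar>dq\<bar> \<le> (1 + 4 * \<kappa>) * \<bar>dq\<bar>" by linarith
    moreover have "0 < \<bar>dq\<bar>" using dq \<kappa>(2) by linarith
    ultimately have "\<bar>det (matrix (\<lambda>v. D (v + fP' y v)))\<bar> \<le> 1 + 4 * \<kappa>" by (rule mult_right_le_imp_le)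
    then show "\<exists>D. (V has_derivative D) (at y) \<and> \<bar>det (matrix D)\<bar> \<le> 1 + 4 * \<kappa>" using dV by blast
  qed
  \<comment> \<open>\<open>\<Psi>\<close> is 3-Lipschitz, so its displacement has Lipschitz constant
    at most h (K + 3 K), which is at most 1/2. The inverse of the partial step is then 2-Lipschitz,
    and this bounds its determinant by d! 2^d.\<close>
  have comp2: "compressible (det_const TYPE('m)) (\<lambda>x. x + l *\<^sub>R (\<Psi> x - x))" if l: "l \<in> {0..1}" for l
  proof -
    define f where "f x = l *\<^sub>R (\<Psi> x - x)" for x
    have eq: "\<Psi> x - x = h *\<^sub>R ((1 - \<theta>) *\<^sub>R F x + \<theta> *\<^sub>R F (\<Psi> x))" for x
    proof -
      have "(1 / h) *\<^sub>R (\<Psi> x - x) = (1 - \<theta>) *\<^sub>R F x + \<theta> *\<^sub>R F (\<Psi> x)" using step unfolding theta_step_def by blast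
      then have "h *\<^sub>R ((1 / h) *\<^sub>R (\<Psi> x - x)) = h *\<^sub>R ((1 - \<theta>) *\<^sub>R F x + \<theta> *\<^sub>R F (\<Psi> x))" by simp
      then show ?thesis using h by simp
    qed
    have lf: "norm (f y - f z) \<le> (1 / 2) * norm (y - z)" for y z
    proof -
      have "norm (f y - f z) = l * norm (h *\<^sub>R ((1 - \<theta>) *\<^sub>R (F y - F z) + \<theta> *\<^sub>R (F (\<Psi> y) - F (\<Psi> z))))"
      proof -
        have "norm (f y - f z) = l * norm ((\<Psi> y - y) - (\<Psi> z - z))"
          unfolding f_def using l by (simp flip: scaleR_diff_right)
        also have "(\<Psi> y - y) - (\<Psi> z - z) = h *\<^sub>R ((1 - \<theta>) *\<^sub>R (F y - F z) + \<theta> *\<^sub>R (F (\<Psi> y) - F (\<Psi> z)))"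
          unfolding eq by (simp add: algebra_simps)
        finally show ?thesis .
      qed
      also have "\<dots> \<le> 1 * norm (h *\<^sub>R ((1 - \<theta>) *\<^sub>R (F y - F z) + \<theta> *\<^sub>R (F (\<Psi> y) - F (\<Psi> z))))"
        using l by (intro mult_right_mono) auto
      also have "\<dots> = h * norm ((1 - \<theta>) *\<^sub>R (F y - F z) + \<theta> *\<^sub>R (F (\<Psi> y) - F (\<Psi> z)))"
        using h by (simp only: mult_1 norm_scaleR abs_of_pos)
      also have "\<dots> \<le> h * (norm ((1 - \<theta>) *\<^sub>R (F y - F z)) + norm (\<theta> *\<^sub>R (F (\<Psi> y) - F (\<Psi> z))))"
        using h by (intro mult_left_mono norm_triangle_ineq less_imp_le)
      also have "\<dots> \<le> h * (K * norm (y - z) + K * (3 * norm (y - z)))"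
      proof (intro mult_left_mono add_mono)
        have "norm ((1 - \<theta>) *\<^sub>R (F y - F z)) \<le> 1 * (K * norm (y - z))"
          unfolding norm_scaleR using \<theta> F[of y z] by (intro mult_mono) auto
        then show "norm ((1 - \<theta>) *\<^sub>R (F y - F z)) \<le> K * norm (y - z)" by simp
        have "norm (F (\<Psi> y) - F (\<Psi> z)) \<le> K * (3 * norm (y - z))"
          by (rule order_trans[OF F mult_left_mono[OF l\<Psi> K(1)]])
        then have "norm (\<theta> *\<^sub>R (F (\<Psi> y) - F (\<Psi> z))) \<le> 1 * (K * (3 * norm (y - z)))"
          unfolding norm_scaleR using \<theta> by (intro mult_mono) auto
        then show "norm (\<theta> *\<^sub>R (F (\<Psi> y) - F (\<Psi> z))) \<le> K * (3 * norm (y - z))" by simp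
      qed (use h in auto)
      also have "\<dots> = (4 * (h * K)) * norm (y - z)" by (simp add: algebra_simps)
      also have "\<dots> \<le> (1 / 2) * norm (y - z)" using K(2) by (intro mult_right_mono) auto
      finally show ?thesis .
    qed
    have "\<exists>D. (f has_derivative D) (at x)" for x
    proof -
      obtain D where D: "(gP has_derivative D) (at (Q x))" using gP4[OF dP] by blast
      have "(\<Psi> has_derivative (\<lambda>v. D (v + fQ' x v))) (at x)"
        unfolding \<Psi>_def[abs_def] by (rule has_derivative_compose[OF dQQ D])
      then have "(f has_derivative (\<lambda>v. l *\<^sub>R (D (v + fQ' x v) - v))) (at x)"
        unfolding f_def[abs_def] by (intro has_derivative_scaleR_right has_derivative_diff has_derivative_ident)
      then show ?thesis by blast
    qed
    then obtain f' where f': "\<And>x. (f has_derivative f' x) (at x)" by metis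
    have "(0::real) \<le> 1 / 2" "(1::real) / 2 \<le> 1 / 2" by simp_all
    from id_plus_contraction_inverse[of f, OF lf this] obtain g
    where g: "(\<forall>y. g y + f (g y) = y) \<and> (\<forall>x. g (x + f x) = x) \<and>
    (\<forall>y z. norm (g y - g z) \<le> 2 * norm (y - z)) \<and>
    (\<forall>f'. (\<forall>x. (f has_derivative f' x) (at x)) \<longrightarrow> (\<forall>y. \<exists>D. (g has_derivative D) (at y) \<and>
        D \<circ> (\<lambda>v. v + f' (g y) v) = id))" by (rule exE)
    note g1 = g[THEN conjunct1, rule_format] and g2 = g[THEN conjunct2, THEN conjunct1, rule_format]
      and g3 = g[THEN conjunct2, THEN conjunct2, THEN conjunct1, rule_format]
      and g4 = g[THEN conjunct2, THEN conjunct2, THEN conjunct2, rule_format]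
    have cf: "continuous_on UNIV f" by (rule lipschitz_continuous_on[OF lf]) simp
    have "compressible (det_const TYPE('m)) (\<lambda>x. x + f x)"
    proof (rule compressible_of_inverse[OF g2 g1])
      show "continuous_on UNIV (\<lambda>x. x + f x)" by (intro continuous_intros cf)
      show "0 < det_const TYPE('m)" by (rule det_const_pos)
      fix y
      obtain D where D: "(g has_derivative D) (at y)" using g4[OF f'] by blast
      have "\<bar>det (matrix D)\<bar> \<le> fact CARD('m) * 2 ^ CARD('m)"
        by (intro det_bound matrix_entry_bound lipschitz_derivative_bound[OF D g3])
      also have "\<dots> \<le> det_const TYPE('m)" by (simp add: det_const_def)
      finally show "\<exists>D. (g has_derivative D) (at y) \<and> \<bar>det (matrix D)\<bar> \<le> det_const TYPE('m)" using D by blast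
    qed
    then show ?thesis unfolding f_def .
  qed
  show ?thesis using step c\<Psi> comp1 comp2 by blast
qed

text \<open>A well-ordered copy of the finite index type, so that the previous lemma applies to it.\<close>

typedef ('n::finite) idx = "{..<CARD('n)} :: nat set"
  by (rule exI[of _ 0]) simp

instance idx :: (finite) finite
proof
  have "(UNIV :: 'a idx set) = Abs_idx ` {..<CARD('a)}"
    by (metis type_definition.Abs_image type_definition_idx)
  then show "finite (UNIV :: 'a idx set)" by (metis finite_imageI finite_lessThan)
qed

instantiation idx :: (finite) wellorder
begin

definition less_eq_idx :: "'a idx \<Rightarrow> 'a idx \<Rightarrow> bool" where "less_eq_idx x y \<longleftrightarrow> Rep_idx x \<le> Rep_idx y"
definition less_idx :: "'a idx \<Rightarrow> 'a idx \<Rightarrow> bool" where "less_idx x y \<longleftrightarrow> Rep_idx x < Rep_idx y"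

instance
proof
  fix x y z :: "'a idx"
  show "(x < y) = (x \<le> y \<and> \<not> y \<le> x)" by (auto simp: less_eq_idx_def less_idx_def)
  show "x \<le> x" by (simp add: less_eq_idx_def)
  show "x \<le> y \<Longrightarrow> y \<le> z \<Longrightarrow> x \<le> z" by (simp add: less_eq_idx_def)
  show "x \<le> y \<Longrightarrow> y \<le> x \<Longrightarrow> x = y" by (simp add: less_eq_idx_def Rep_idx_inject)
  show "x \<le> y \<or> y \<le> x" by (auto simp: less_eq_idx_def)
next
  fix P :: "'a idx \<Rightarrow> bool" and a :: "'a idx"
  assume step: "\<And>x. (\<And>y. y < x \<Longrightarrow> P y) \<Longrightarrow> P x"
  show "P a"
  proof (induction "Rep_idx a" arbitrary: a rule: less_induct)
    case less
    show ?case by (rule step) (simp add: less_idx_def less)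
  qed
qed

end

section \<open>Relabelling of coordinates\<close>

lemma card_idx: "CARD('n::finite idx) = CARD('n)"
  using type_definition.card[OF type_definition_idx] by simp

definition reindex :: "'n::finite idx \<Rightarrow> 'n" where
  "reindex = (SOME f. bij f)"

lemma bij_reindex: "bij (reindex :: 'n::finite idx \<Rightarrow> 'n)"
proof -
  have "\<exists>f :: 'n idx \<Rightarrow> 'n. bij_betw f UNIV UNIV"
    by (rule finite_same_card_bij) (simp_all add: card_idx)
  then show ?thesis unfolding reindex_def by (rule someI_ex)
qed

definition to_idx :: "real^'n \<Rightarrow> real^('n::finite idx)" where
  "to_idx x = (\<chi> i. x $ reindex i)"

definition of_idx :: "real^('n::finite idx) \<Rightarrow> real^'n" where
  "of_idx y = (\<chi> j. y $ inv reindex j)"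

lemma reindex_inv:
  fixes i :: "'n::finite idx"
  shows "reindex (inv reindex j) = (j :: 'n)" "inv reindex (reindex i) = i"
  using bij_reindex[where 'n='n] by (simp_all add: bij_def surj_f_inv_f inv_f_f)

lemma of_to_idx: "of_idx (to_idx x) = x" and to_of_idx: "to_idx (of_idx y) = y"
  by (simp_all add: of_idx_def to_idx_def vec_eq_iff reindex_inv)

lemma linear_to_idx: "linear to_idx" and linear_of_idx: "linear of_idx"
  by (auto intro!: linearI simp: to_idx_def of_idx_def vec_eq_iff)

lemma norm_to_idx: "norm (to_idx x) = norm x"
proof -
  have "(\<Sum>i\<in>UNIV. (x $ reindex i)\<^sup>2) = (\<Sum>j\<in>UNIV. (x $ j)\<^sup>2)"
    using sum.reindex_bij_betw[OF bij_reindex[unfolded bij_def[symmetric]], of "\<lambda>j. (x $ j)\<^sup>2"] by simp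
  then show ?thesis by (simp add: norm_vec_def L2_set_def to_idx_def)
qed

lemma norm_of_idx: "norm (of_idx y) = norm y"
  using norm_to_idx[of "of_idx y"] by (simp add: to_of_idx)

lemma bounded_linear_idx: "bounded_linear to_idx" "bounded_linear of_idx"
  using linear_to_idx linear_of_idx by (simp_all add: linear_conv_bounded_linear)

lemma continuous_idx: "continuous_on UNIV to_idx" "continuous_on UNIV of_idx"
  by (rule linear_continuous_on, rule bounded_linear_idx)+

lemma prod_Basis_cart:
  fixes f :: "real^'n \<Rightarrow> real"
  shows "(\<Prod>b\<in>Basis. f b) = (\<Prod>i\<in>UNIV. f (axis i 1))"
  by (simp add: Basis_vec_def UNION_singleton_eq_range prod.reindex axis_eq_axis inj_on_def)

text \<open>Lebesgue measure is determined by its values on boxes, and relabelling coordinates only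
  permutes the factors of their volume.\<close>

lemma distr_to_idx: "distr lborel borel to_idx = (lborel :: (real^('n::finite idx)) measure)"
proof (rule lborel_eqI[symmetric])
  fix l u :: "real^('n idx)"
  assume lu: "\<And>b. b \<in> Basis \<Longrightarrow> l \<bullet> b \<le> u \<bullet> b"
  have le: "l $ i \<le> u $ i" for i
    using lu[of "axis i 1"] by (simp add: inner_axis)
  have m: "to_idx \<in> borel_measurable (lborel :: (real^'n) measure)"
    using borel_measurable_continuous_onI[OF continuous_idx(1)] by simp
  have "emeasure (distr lborel borel to_idx) (box l u) = emeasure lborel ((to_idx :: real^'n \<Rightarrow> _) -` box l u)"
    using m by (subst emeasure_distr) simp_all
  also have "(to_idx :: real^'n \<Rightarrow> _) -` box l u = box (of_idx l) (of_idx u)"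
  proof -
    have "(\<forall>i. l $ i < x $ reindex i \<and> x $ reindex i < u $ i) \<longleftrightarrow> (\<forall>j. l $ inv reindex j < x $ j \<and> x $ j < u $ inv reindex j)" for x :: "real^'n"
      by (metis reindex_inv)
    then show ?thesis by (auto simp: mem_box_cart to_idx_def of_idx_def)
  qed
  also have "emeasure lborel (box (of_idx l) (of_idx u)) = ennreal (\<Prod>b\<in>Basis. (of_idx u - of_idx l) \<bullet> b)"
    using le by (intro emeasure_lborel_box) (auto simp: Basis_vec_def inner_axis of_idx_def)
  also have "(\<Prod>b\<in>Basis. (of_idx u - of_idx l) \<bullet> b) = (\<Prod>j\<in>UNIV. u $ inv reindex j - l $ inv reindex j)"
    by (simp add: prod_Basis_cart inner_axis of_idx_def)
  also have "\<dots> = (\<Prod>i\<in>UNIV. u $ i - l $ i)"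
    using prod.reindex_bij_betw[OF bij_imp_bij_inv[OF bij_reindex], of "\<lambda>i. u $ i - l $ i"] by simp
  also have "\<dots> = (\<Prod>b\<in>Basis. (u - l) \<bullet> b)"
    by (simp add: prod_Basis_cart inner_axis)
  finally show "emeasure (distr lborel borel to_idx) (box l u) = ennreal (\<Prod>b\<in>Basis. (u - l) \<bullet> b)" .
qed simp

lemma emeasure_vimage_to_idx:
  assumes "B \<in> sets borel"
  shows "emeasure lborel (to_idx -` B) = emeasure lborel B"
proof -
  have m: "to_idx \<in> borel_measurable (lborel :: (real^'n) measure)"
    using borel_measurable_continuous_onI[OF continuous_idx(1)] by simp
  have "emeasure lborel B = emeasure (distr lborel borel to_idx) B" by (simp add: distr_to_idx)
  also have "\<dots> = emeasure lborel (to_idx -` B)" using m assms by (subst emeasure_distr) simp_all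
  finally show ?thesis by simp
qed

lemma compressible_of_idx:
  fixes U :: "real^('n::finite idx) \<Rightarrow> real^('n idx)"
  assumes U: "compressible L U"
  shows "compressible L (\<lambda>x. of_idx (U (to_idx x)))"
  unfolding compressible_def
proof (intro conjI allI impI)
  have m1: "to_idx \<in> borel_measurable borel" "of_idx \<in> borel_measurable borel"
    using continuous_idx by (auto intro: borel_measurable_continuous_onI)
  show "(\<lambda>x. of_idx (U (to_idx x))) \<in> borel_measurable borel"
    by (intro measurable_compose[OF _ m1(2)] measurable_compose[OF m1(1)] compressible_measurable[OF U])
  fix A :: "(real^'n) set" assume A: "open A"
  have oA: "open (of_idx -` A)" using A continuous_idx(2) by (rule open_vimage)
  have bA: "U -` (of_idx -` A) \<in> sets borel"
    using measurable_sets[OF compressible_measurable[OF U], of "of_idx -` A"] oA by simp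
  have "(\<lambda>x. of_idx (U (to_idx x))) -` A = to_idx -` (U -` (of_idx -` A))" by auto
  then have "emeasure lborel ((\<lambda>x. of_idx (U (to_idx x))) -` A) = emeasure lborel (U -` (of_idx -` A))"
    using emeasure_vimage_to_idx[OF bA] by simp
  also have "\<dots> \<le> ennreal L * emeasure lborel (of_idx -` A)"
    using U oA by (simp add: compressible_def)
  also have "emeasure lborel (of_idx -` A) = emeasure lborel (to_idx -` (of_idx -` A))"
    using oA by (intro emeasure_vimage_to_idx[symmetric]) simp
  also have "to_idx -` (of_idx -` A) = A" by (auto simp: of_to_idx)
  finally show "emeasure lborel ((\<lambda>x. of_idx (U (to_idx x))) -` A) \<le> ennreal L * emeasure lborel A" .
qed

lemma trace_conj_idx:
  fixes D :: "real^'n \<Rightarrow> real^'n"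
  shows "trace (matrix (\<lambda>v. to_idx (D (of_idx v)))) = trace (matrix D)"
proof -
  have ax: "of_idx (axis i 1) = axis (reindex i) 1" for i
    by (auto simp: of_idx_def axis_def vec_eq_iff reindex_inv)
  have "trace (matrix (\<lambda>v. to_idx (D (of_idx v)))) = (\<Sum>i\<in>UNIV. D (axis (reindex i) 1) $ reindex i)"
    by (simp add: trace_def matrix_def ax to_idx_def)
  also have "\<dots> = (\<Sum>j\<in>UNIV. D (axis j 1) $ j)"
    using sum.reindex_bij_betw[OF bij_reindex, of "\<lambda>j. D (axis j 1) $ j"] by simp
  finally show ?thesis by (simp add: trace_def matrix_def)
qed

lemma det_const_idx: "det_const TYPE('n::finite idx) = det_const TYPE('n)"
  by (simp add: det_const_def card_idx)

text \<open>The step commutes with the relabelling of coordinates, which is an isometry and leaves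
  Lipschitz constants, traces and volumes unchanged.\<close>

lemma theta_step_compressible:
  fixes F :: "real^'n \<Rightarrow> real^'n"
  assumes h: "0 < h" and \<theta>: "0 \<le> \<theta>" "\<theta> \<le> 1" and K: "0 \<le> K" "h * K \<le> 1 / 8"
    and F: "\<And>y z. norm (F y - F z) \<le> K * norm (y - z)"
    and DF: "\<And>x. (F has_derivative DF x) (at x)" and tr: "\<And>x. \<bar>trace (matrix (DF x))\<bar> \<le> c"
    and \<kappa>: "\<kappa> = h * c + det_const TYPE('n) * (h * K)\<^sup>2" "\<kappa> \<le> 1 / 2"
  shows "\<exists>\<Psi>. theta_step h \<theta> F \<Psi> \<and> continuous_on UNIV \<Psi> \<and> compressible (1 + 4 * \<kappa>) \<Psi> \<and>
     (\<forall>l\<in>{0..1}. compressible (det_const TYPE('n)) (\<lambda>x. x + l *\<^sub>R (\<Psi> x - x)))"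
proof -
  define F' where "F' y = to_idx (F (of_idx y))" for y
  define DF' where "DF' y v = to_idx (DF (of_idx y) (of_idx v))" for y v
  have lt: "to_idx (a - b) = to_idx a - to_idx b" "to_idx (a + b) = to_idx a + to_idx b" "to_idx (s *\<^sub>R a) = s *\<^sub>R to_idx a"
    for a b :: "real^'n" and s by (simp_all add: linear_diff[OF linear_to_idx] linear_add[OF linear_to_idx] linear_scale[OF linear_to_idx])
  have lo: "of_idx (a - b) = of_idx a - of_idx b" "of_idx (a + b) = of_idx a + of_idx b" "of_idx (s *\<^sub>R a) = s *\<^sub>R of_idx a"
    for a b :: "real^('n idx)" and s by (simp_all add: linear_diff[OF linear_of_idx] linear_add[OF linear_of_idx] linear_scale[OF linear_of_idx])
  have "norm (F' y - F' z) \<le> K * norm (y - z)" for y z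
  proof -
    have "norm (F' y - F' z) = norm (F (of_idx y) - F (of_idx z))"
      unfolding F'_def by (simp add: norm_to_idx flip: lt(1))
    also have "\<dots> \<le> K * norm (of_idx y - of_idx z)" by (rule F)
    also have "norm (of_idx y - of_idx z) = norm (y - z)" by (simp add: norm_of_idx flip: lo(1))
    finally show ?thesis .
  qed
  moreover have "(F' has_derivative DF' x) (at x)" for x
    unfolding F'_def[abs_def] DF'_def[abs_def]
    by (rule has_derivative_compose[OF has_derivative_compose[OF bounded_linear_imp_has_derivative[OF bounded_linear_idx(2)] DF]
        bounded_linear_imp_has_derivative[OF bounded_linear_idx(1)]])
  moreover have "\<bar>trace (matrix (DF' x))\<bar> \<le> c" for x
    unfolding DF'_def[abs_def] trace_conj_idx by (rule tr)
  moreover have "\<kappa> = h * c + det_const TYPE('n idx) * (h * K)\<^sup>2" using \<kappa>(1) by (simp add: det_const_idx)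
  ultimately obtain \<Psi>' where \<Psi>': "theta_step h \<theta> F' \<Psi>'" "continuous_on UNIV \<Psi>'" "compressible (1 + 4 * \<kappa>) \<Psi>'"
     "\<forall>l\<in>{0..1}. compressible (det_const TYPE('n idx)) (\<lambda>x. x + l *\<^sub>R (\<Psi>' x - x))"
    using theta_step_compressible_wellorder[OF h \<theta> K _ _ _ _ \<kappa>(2), of F' DF' c] by blast
  define \<Psi> where "\<Psi> x = of_idx (\<Psi>' (to_idx x))" for x
  have "theta_step h \<theta> F \<Psi>"
    unfolding theta_step_def
  proof (intro allI)
    fix x y
    have inj: "a = b \<longleftrightarrow> to_idx a = to_idx b" for a b :: "real^'n" by (metis of_to_idx)
    have "(1 / h) *\<^sub>R (y - x) = (1 - \<theta>) *\<^sub>R F x + \<theta> *\<^sub>R F y \<longleftrightarrow>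
      (1 / h) *\<^sub>R (to_idx y - to_idx x) = (1 - \<theta>) *\<^sub>R F' (to_idx x) + \<theta> *\<^sub>R F' (to_idx y)"
      by (subst inj) (simp only: lt F'_def of_to_idx)
    also have "\<dots> \<longleftrightarrow> to_idx y = \<Psi>' (to_idx x)" using \<Psi>'(1) unfolding theta_step_def by blast
    also have "\<dots> \<longleftrightarrow> y = \<Psi> x" unfolding \<Psi>_def by (metis of_to_idx to_of_idx)
    finally show "(1 / h) *\<^sub>R (y - x) = (1 - \<theta>) *\<^sub>R F x + \<theta> *\<^sub>R F y \<longleftrightarrow> y = \<Psi> x" .
  qed
  moreover have "continuous_on UNIV \<Psi>" unfolding \<Psi>_def[abs_def]
    by (rule continuous_on_compose2[OF continuous_idx(2) continuous_on_compose2[OF \<Psi>'(2) continuous_idx(1)]]) auto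
  moreover have "compressible (1 + 4 * \<kappa>) \<Psi>" unfolding \<Psi>_def[abs_def] by (rule compressible_of_idx[OF \<Psi>'(3)])
  moreover have "compressible (det_const TYPE('n)) (\<lambda>x. x + l *\<^sub>R (\<Psi> x - x))" if "l \<in> {0..1}" for l
    using compressible_of_idx[OF \<Psi>'(4)[rule_format, OF that]] unfolding \<Psi>_def
    by (simp add: lo of_to_idx det_const_idx)
  ultimately show ?thesis by blast
qed

section \<open>Regularised fields and their step averages\<close>

lemma AE_space_time_iff:
  "(AE z in space_time T. P z) \<longleftrightarrow> (AE z in (lborel :: (real \<times> (real^'n)) measure). fst z \<in> {0<..<T} \<longrightarrow> P z)"
proof -
  have o: "open ({0<..<T} \<times> (UNIV :: (real^'n) set))" by (intro open_Times) auto
  have "(AE z in space_time T. P z) \<longleftrightarrow> (AE z in (lebesgue :: (real \<times> (real^'n)) measure). z \<in> {0<..<T} \<times> UNIV \<longrightarrow> P z)"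
    unfolding space_time_def using o by (intro AE_restrict_space_iff) (simp add: borel_open)
  also have "\<dots> \<longleftrightarrow> (AE z in (lborel :: (real \<times> (real^'n)) measure). z \<in> {0<..<T} \<times> UNIV \<longrightarrow> P z)"
    by (rule AE_completion_iff)
  finally show ?thesis by (simp add: mem_Times_iff)
qed

lemma AE_lebesgue_on_iff:
  assumes "S \<in> sets lebesgue"
  shows "(AE t in lebesgue_on S. P t) \<longleftrightarrow> (AE t in lborel. t \<in> S \<longrightarrow> P t)"
proof -
  have "(AE t in lebesgue_on S. P t) \<longleftrightarrow> (AE t in lebesgue. t \<in> S \<longrightarrow> P t)"
    using assms by (intro AE_restrict_space_iff) simp
  also have "\<dots> \<longleftrightarrow> (AE t in lborel. t \<in> S \<longrightarrow> P t)" by (rule AE_completion_iff)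
  finally show ?thesis .
qed

lemma AE_lborel_dense:
  assumes "AE x in lborel. P (x :: 'a::euclidean_space)"
  shows "closure {x. P x} = UNIV"
proof -
  have "AE x in lebesgue. x \<in> closure {x. P x}"
    unfolding AE_completion_iff using assms
    by eventually_elim (simp add: closure_subset[THEN subsetD])
  then have "x \<in> closure {x. P x}" for x by (rule mem_closed_if_AE_lebesgue[OF closed_closure])
  then show ?thesis by auto
qed

text \<open>Sets of full measure are dense, so a closed condition valid almost everywhere is valid
  everywhere. This removes null sets in space wherever the field is smooth.\<close>

lemma AE_lborel_closed:
  assumes "closed {x. P x}" "AE x in lborel. P (x :: 'a::euclidean_space)"
  shows "P x"
  using AE_lborel_dense[OF assms(2)] closure_closed[OF assms(1)] by auto

lemma borel_measurable_lebesgue_AE: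
  fixes f g :: "'a::euclidean_space \<Rightarrow> 'b::topological_space"
  assumes g: "g \<in> borel_measurable borel" and eq: "AE x in lborel. f x = g x"
  shows "f \<in> borel_measurable lebesgue"
proof -
  obtain N where N: "N \<in> null_sets lborel" "\<forall>x. x \<notin> N \<longrightarrow> f x = g x"
    using AE_lborel_null_set[OF eq] by (elim bexE)
  have NL: "N \<in> null_sets lebesgue" by (rule null_sets_completionI[OF N(1)])
  show ?thesis
  proof (rule measurableI)
    fix B :: "'b set" assume B: "B \<in> sets borel"
    have 1: "g -` B \<in> sets lebesgue"
      using measurable_sets[OF g B] by simp
    have 2: "f -` B \<inter> N \<in> sets lebesgue"
      using null_sets_completion_subset[OF _ NL, of "f -` B \<inter> N"] by auto
    have eq: "f -` B \<inter> space lebesgue = (g -` B - N) \<union> (f -` B \<inter> N)" using N(2) by auto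
    show "f -` B \<inter> space lebesgue \<in> sets lebesgue"
      unfolding eq by (intro sets.Un sets.Diff 1 2 null_setsD2[OF NL])
  qed simp
qed

text \<open>All bounds hold at every time and every point, and the field is jointly Borel, so that
  it can be evaluated along the scheme without exceptional sets.\<close>

definition nice_field :: "real \<Rightarrow> real \<Rightarrow> real \<Rightarrow> (real \<Rightarrow> real^'n \<Rightarrow> real^'n) \<Rightarrow> bool" where
  "nice_field K M c a \<longleftrightarrow> jointly_borel a \<and>
     (\<forall>\<tau> y z. norm (a \<tau> y - a \<tau> z) \<le> K * norm (y - z)) \<and> (\<forall>\<tau> y. norm (a \<tau> y) \<le> M) \<and>
     (\<forall>\<tau> y. a \<tau> differentiable (at y)) \<and> (\<forall>\<tau> y. \<bar>divergence (a \<tau>) y\<bar> \<le> c)"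

lemma norm_matrix_vector_mult_le:
  fixes A :: "real^'n^'m"
  shows "norm (A *v x) \<le> norm A * norm x"
proof -
  have "norm (A *v x) = L2_set (\<lambda>i. norm ((A *v x) $ i)) UNIV" by (simp add: norm_vec_def)
  also have "\<dots> \<le> L2_set (\<lambda>i. norm (A $ i) * norm x) UNIV"
  proof (rule L2_set_mono)
    fix i
    have "(A *v x) $ i = A $ i \<bullet> x" by (simp add: matrix_vector_mult_def inner_vec_def)
    then show "norm ((A *v x) $ i) \<le> norm (A $ i) * norm x"
      using Cauchy_Schwarz_ineq2[of "A $ i" x] by simp
  qed simp
  also have "\<dots> = norm A * norm x" by (simp add: norm_vec_def flip: L2_set_left_distrib)
  finally show ?thesis .
qed

lemma smooth_vec_jacobian_continuous:
  fixes f :: "real^'n \<Rightarrow> real^'n"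
  assumes "smooth f"
  shows "continuous_on UNIV (jacobian f)" "continuous_on UNIV (divergence f)"
proof -
  have c: "continuous_on UNIV (\<lambda>x. frechet_derivative f (at x) (axis j 1) $ i)" for i j
    using smooth_frechet_continuous[OF assms] by (intro continuous_intros)
  then show "continuous_on UNIV (jacobian f)"
    unfolding jacobian_def[abs_def] matrix_def by (intro continuous_on_vec_lambda)
  show "continuous_on UNIV (divergence f)"
    unfolding divergence_def[abs_def] trace_def jacobian_def matrix_def using c by (auto intro: continuous_on_sum)
qed

text \<open>The operator norm is at most the Frobenius norm, and the mean value inequality does the
  rest.\<close>

lemma jacobian_bound_lipschitz:
  fixes f :: "real^'n \<Rightarrow> real^'n"
  assumes f: "\<And>x. f differentiable (at x)" and K: "\<And>x. norm (jacobian f x) \<le> K"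
  shows "norm (f y - f z) \<le> K * norm (y - z)"
proof (rule differentiable_bound[OF convex_UNIV])
  fix x
  have d: "(f has_derivative frechet_derivative f (at x)) (at x)" using f frechet_derivative_works by blast
  then show "(f has_derivative frechet_derivative f (at x)) (at x within UNIV)" by simp
  have lin: "linear (frechet_derivative f (at x))" by (rule has_derivative_linear[OF d])
  show "onorm (frechet_derivative f (at x)) \<le> K"
  proof (rule onorm_bound)
    show "0 \<le> K" using order_trans[OF norm_ge_zero K] .
    fix v
    have "frechet_derivative f (at x) v = jacobian f x *v v"
      unfolding jacobian_def by (rule matrix_works[symmetric]) (use lin in \<open>simp add: linear_def scalar_mult_eq_scaleR[abs_def]\<close>)
    then show "norm (frechet_derivative f (at x) v) \<le> K * norm v"
      using norm_matrix_vector_mult_le[of "jacobian f x" v] mult_right_mono[OF K[of x], of "norm v"] by simp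
  qed
qed simp_all

lemma Linf_norm_AE:
  fixes c :: "real \<Rightarrow> real^'n \<Rightarrow> 'b::real_normed_vector"
  assumes "Linf_norm T c \<le> ennreal K" "0 \<le> K"
  shows "AE \<tau> in lborel. AE y in lborel. \<tau> \<in> {0<..<T} \<longrightarrow> norm (c \<tau> y) \<le> K"
proof -
  have "AE z in space_time T. ennreal (norm (c (fst z) (snd z))) \<le> ennreal K"
    using esssup_AE[of "\<lambda>z. ennreal (norm (c (fst z) (snd z)))" "space_time T"] assms(1)
    unfolding Linf_norm_def by (auto elim!: eventually_mono intro: order_trans)
  then have "AE z in lborel. fst z \<in> {0<..<T} \<longrightarrow> norm (c (fst z) (snd z)) \<le> K"
    unfolding AE_space_time_iff using assms(2) by simp
  from AE_lborel_pairD[of "\<lambda>\<tau> y. \<tau> \<in> {0<..<T} \<longrightarrow> norm (c \<tau> y) \<le> K", OF this] show ?thesis .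
qed

text \<open>The field is kept at good times and set to zero at all others. The exceptional set
  concerns time alone: at a fixed time smoothness in space turns essential bounds into bounds at
  every point. Hence, for almost every time, old and new field agree at all \<open>y\<close>, which
  is what makes the nodes of the scheme the same for both.\<close>

lemma nice_representative:
  fixes f :: "real \<Rightarrow> real^'n \<Rightarrow> real^'n"
  assumes m: "(\<lambda>z. f (fst z) (snd z)) \<in> borel_measurable (space_time T)"
    and sm: "AE s in lebesgue_on {0<..<T}. smooth (f s)"
    and K: "Linf_norm T (\<lambda>s. jacobian (f s)) \<le> ennreal K" "0 \<le> K"
    and c: "Linf_norm T (\<lambda>s. divergence (f s)) \<le> ennreal c" "0 \<le> c"
    and M: "Linf_norm T f \<le> ennreal M" "0 \<le> M"
  shows "\<exists>a. nice_field K M c a \<and> (AE \<tau> in lborel. \<tau> \<in> {0<..<T} \<longrightarrow> (\<forall>y. f \<tau> y = a \<tau> y))"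
proof -
  have oS: "open ({0<..<T} \<times> (UNIV :: (real^'n) set))" by (intro open_Times) auto
  then have S: "{0<..<T} \<times> (UNIV :: (real^'n) set) \<in> sets lebesgue" by (simp add: borel_open)
  obtain g where g: "g \<in> borel_measurable borel"
    "AE z in lborel. z \<in> {0<..<T} \<times> UNIV \<longrightarrow> f (fst z) (snd z) = g z"
    using lebesgue_on_ex_borel[OF m[unfolded space_time_def] S] by (elim bexE)
  have "AE y in lborel. AE \<tau> in lborel. \<tau> \<in> {0<..<T} \<longrightarrow> f \<tau> y = g (\<tau>, y)"
    by (rule AE_lborel_pairD2[of "\<lambda>\<tau> y. \<tau> \<in> {0<..<T} \<longrightarrow> f \<tau> y = g (\<tau>, y)"]) (use g(2) in \<open>simp add: mem_Times_iff\<close>)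
  \<comment> \<open>The time section at almost every \<open>y\<close> agrees almost everywhere with
    a Borel function; such \<open>y\<close> are dense, as \<open>caratheodory_representative\<close>
    requires.\<close>
  note dense = AE_lborel_dense[OF this]
  define good where "good \<tau> \<longleftrightarrow> \<tau> \<in> {0<..<T} \<and> smooth (f \<tau>) \<and> (\<forall>y. norm (jacobian (f \<tau>) y) \<le> K) \<and>
     (\<forall>y. \<bar>divergence (f \<tau>) y\<bar> \<le> c) \<and> (\<forall>y. norm (f \<tau> y) \<le> M)" for \<tau>
  have "AE \<tau> in lborel. \<tau> \<in> {0<..<T} \<longrightarrow> smooth (f \<tau>)"
    using sm by (subst (asm) AE_lebesgue_on_iff) simp_all
  then have gd: "AE \<tau> in lborel. \<tau> \<in> {0<..<T} \<longrightarrow> good \<tau>"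
    using Linf_norm_AE[OF K] Linf_norm_AE[OF c] Linf_norm_AE[OF M]
  proof eventually_elim
    case (elim \<tau>)
    show ?case
    proof
      assume \<tau>: "\<tau> \<in> {0<..<T}"
      then have s: "smooth (f \<tau>)" using elim by simp
      have cl: "closed {y. norm (jacobian (f \<tau>) y) \<le> K}" "closed {y. norm (divergence (f \<tau>) y) \<le> c}" "closed {y. norm (f \<tau> y) \<le> M}"
        using smooth_vec_jacobian_continuous[OF s] smooth_continuous[OF s]
        by (auto intro!: closed_Collect_le continuous_on_norm continuous_on_rabs continuous_on_const)
      have "norm (jacobian (f \<tau>) y) \<le> K" for y
        by (rule AE_lborel_closed[OF cl(1)]) (use elim(2) \<tau> in simp)
      moreover have "norm (divergence (f \<tau>) y) \<le> c" for y
        by (rule AE_lborel_closed[OF cl(2)]) (use elim(3) \<tau> in simp)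
      moreover have "norm (f \<tau> y) \<le> M" for y
        by (rule AE_lborel_closed[OF cl(3)]) (use elim(4) \<tau> in simp)
      ultimately show "good \<tau>" unfolding good_def using s \<tau> by simp
    qed
  qed
  define F where "F \<tau> y = (if good \<tau> then f \<tau> y else 0)" for \<tau> y
  have mF: "(\<lambda>\<tau>. F \<tau> y) \<in> borel_measurable lebesgue" if "y \<in> {y. AE \<tau> in lborel. \<tau> \<in> {0<..<T} \<longrightarrow> f \<tau> y = g (\<tau>, y)}" for y
  proof (rule borel_measurable_lebesgue_AE)
    have "(\<lambda>\<tau>. g (\<tau>, y)) \<in> borel_measurable borel" by (rule borel_sections(1)[OF g(1)])
    then show "(\<lambda>\<tau>. if \<tau> \<in> {0<..<T} then g (\<tau>, y) else 0) \<in> borel_measurable borel"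
      by (intro measurable_If_set) simp_all
    have "AE \<tau> in lborel. \<tau> \<in> {0<..<T} \<longrightarrow> f \<tau> y = g (\<tau>, y)" using that by simp
    then show "AE \<tau> in lborel. F \<tau> y = (if \<tau> \<in> {0<..<T} then g (\<tau>, y) else 0)"
      using gd by eventually_elim (auto simp: F_def good_def)
  qed
  have cF: "continuous_on UNIV (F \<tau>)" for \<tau>
  proof (cases "good \<tau>")
    case True
    then have "F \<tau> = f \<tau>" "smooth (f \<tau>)" by (auto simp: F_def) (simp add: good_def)
    then show ?thesis by (simp add: smooth_continuous)
  next
    case False
    then have "F \<tau> = (\<lambda>_. 0)" by (auto simp: F_def)
    then show ?thesis by simp
  qed
  obtain N where N: "N \<in> null_sets lborel" "(\<lambda>z. if fst z \<in> N then 0 else F (fst z) (snd z)) \<in> borel_measurable borel"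
    using caratheodory_representative[of _ F, OF mF dense] cF by auto
  define a where "a \<tau> y = (if \<tau> \<in> N then 0 else F \<tau> y)" for \<tau> y
  have cases: "a \<tau> = (\<lambda>_. 0) \<or> (good \<tau> \<and> a \<tau> = f \<tau>)" for \<tau>
    unfolding a_def[abs_def] F_def[abs_def] by (cases "\<tau> \<in> N"; cases "good \<tau>") simp_all
  have z: "divergence (\<lambda>_ :: real^'n. 0 :: real^'n) y = 0" for y :: "real^'n"
    by (simp add: divergence_def jacobian_def matrix_def trace_def frechet_derivative_const)
  have "nice_field K M c a"
    unfolding nice_field_def
  proof (intro conjI allI)
    show "jointly_borel a" unfolding a_def by (rule N(2))
    fix \<tau> y
    show "norm (a \<tau> y - a \<tau> z) \<le> K * norm (y - z)" for z
      using cases[of \<tau>]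
    proof
      assume g: "good \<tau> \<and> a \<tau> = f \<tau>"
      then show ?thesis
        using jacobian_bound_lipschitz[of "f \<tau>" K y z] smooth_differentiable[of "f \<tau>"] by (auto simp: good_def)
    qed (use K in simp)
    show "norm (a \<tau> y) \<le> M" using cases[of \<tau>] M by (auto simp: good_def)
    show "a \<tau> differentiable (at y)" using cases[of \<tau>] smooth_differentiable[of "f \<tau>"] by (auto simp: good_def)
    show "\<bar>divergence (a \<tau>) y\<bar> \<le> c" using cases[of \<tau>] c z[of y] by (auto simp: good_def)
  qed
  moreover have "AE \<tau> in lborel. \<tau> \<notin> N" using N(1) by (rule AE_not_in)
  then have "AE \<tau> in lborel. \<tau> \<in> {0<..<T} \<longrightarrow> (\<forall>y. f \<tau> y = a \<tau> y)"
    using gd by eventually_elim (auto simp: a_def F_def)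
  ultimately show ?thesis by blast
qed

section \<open>Averages over one time step\<close>

definition time_average :: "real \<Rightarrow> (real \<Rightarrow> real^'n \<Rightarrow> real^'n) \<Rightarrow> nat \<Rightarrow> real^'n \<Rightarrow> real^'n" where
  "time_average h a i y = (1 / h) *\<^sub>R (LINT \<tau>|lborel. indicator {real i * h..real (Suc i) * h} \<tau> *\<^sub>R a \<tau> y)"

text \<open>The step lies in the closed interval from 0 to \<open>T\<close>, while the fields are
  compared on the open one; the end points are null. After this the scheme can be studied with the
  Borel field.\<close>

lemma step_average_eq_time_average:
  assumes a: "nice_field K M c a" and h: "0 < h" and i: "real (Suc i) * h \<le> T"
    and eq: "AE \<tau> in lborel. \<tau> \<in> {0<..<T} \<longrightarrow> (\<forall>y. f \<tau> y = a \<tau> y)"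
  shows "step_average h f i y = time_average h a i y"
proof -
  let ?I = "{real i * h..real (Suc i) * h}"
  have am: "(\<lambda>\<tau>. a \<tau> y) \<in> borel_measurable borel"
    using borel_sections(1)[of "\<lambda>z. a (fst z) (snd z)" y] a by (simp add: nice_field_def)
  have ga: "(\<lambda>\<tau>. indicator ?I \<tau> *\<^sub>R a \<tau> y) \<in> borel_measurable borel"
    using am by (intro borel_measurable_scaleR borel_measurable_indicator) simp_all
  have "AE \<tau> in lborel. \<tau> \<noteq> 0" "AE \<tau> in lborel. \<tau> \<noteq> T" by (rule AE_lborel_singleton)+
  then have ae: "AE \<tau> in lborel. indicator ?I \<tau> *\<^sub>R f \<tau> y = indicator ?I \<tau> *\<^sub>R a \<tau> y"
    using eq
  proof eventually_elim
    case (elim \<tau>)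
    have "0 \<le> real i * h" using h by simp
    then have "\<tau> \<in> ?I \<Longrightarrow> \<tau> \<in> {0<..<T}" using elim i by auto
    then show ?case using elim by (cases "\<tau> \<in> ?I") auto
  qed
  have fm: "(\<lambda>\<tau>. indicator ?I \<tau> *\<^sub>R f \<tau> y) \<in> borel_measurable lebesgue"
    by (rule borel_measurable_lebesgue_AE[OF ga ae])
  have "(LINT \<tau>|lebesgue_on ?I. f \<tau> y) = (LINT \<tau>|lebesgue. indicator ?I \<tau> *\<^sub>R f \<tau> y)"
    by (rule integral_restrict_space) simp
  also have "\<dots> = (LINT \<tau>|lebesgue. indicator ?I \<tau> *\<^sub>R a \<tau> y)"
  proof (rule integral_cong_AE[OF fm])
    show "(\<lambda>\<tau>. indicator ?I \<tau> *\<^sub>R a \<tau> y) \<in> borel_measurable lebesgue"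
      by (rule measurable_completion) (use ga in simp)
  qed (use ae in \<open>simp only: AE_completion_iff\<close>)
  also have "\<dots> = (LINT \<tau>|lborel. indicator ?I \<tau> *\<^sub>R a \<tau> y)"
    using ga by (intro integral_completion) simp
  finally show ?thesis by (simp add: step_average_def time_average_def)
qed

context
  fixes a :: "real \<Rightarrow> real^'n \<Rightarrow> real^'n" and K M c h :: real and i :: nat
  assumes a: "nice_field K M c a" and h: "0 < h" and K: "0 \<le> K" and M: "0 \<le> M"
begin

abbreviation (input) "I \<equiv> {real i * h..real (Suc i) * h}"

lemma nice_field_section: "(\<lambda>\<tau>. a \<tau> y) \<in> borel_measurable borel"
  using borel_sections(1)[of "\<lambda>z. a (fst z) (snd z)" y] a by (simp add: nice_field_def)

lemma emeasure_step_interval: "emeasure lborel I = ennreal h"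
  using h by (subst emeasure_lborel_Icc) (simp_all add: algebra_simps)

lemma integrable_step_bounded:
  fixes f :: "real \<Rightarrow> 'b::euclidean_space"
  assumes f: "f \<in> borel_measurable borel" and b: "\<And>\<tau>. norm (f \<tau>) \<le> B"
  shows "integrable lborel (\<lambda>\<tau>. indicator I \<tau> *\<^sub>R f \<tau>)" "norm (LINT \<tau>|lborel. indicator I \<tau> *\<^sub>R f \<tau>) \<le> h * B"
proof -
  have ind: "integrable lborel (indicator I :: real \<Rightarrow> real)" "(LINT \<tau>|lborel. indicator I \<tau>) = h"
    using emeasure_step_interval h by (simp_all add: measure_def less_top[symmetric])
  have B: "0 \<le> B" using order_trans[OF norm_ge_zero b] .
  show int: "integrable lborel (\<lambda>\<tau>. indicator I \<tau> *\<^sub>R f \<tau>)"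
  proof (rule Bochner_Integration.integrable_bound)
    show "integrable lborel (\<lambda>\<tau>. B * indicator I \<tau>)" by (rule integrable_mult_right[OF ind(1)])
    show "(\<lambda>\<tau>. indicator I \<tau> *\<^sub>R f \<tau>) \<in> borel_measurable lborel"
      using f by (intro borel_measurable_scaleR borel_measurable_indicator) simp_all
    show "AE \<tau> in lborel. norm (indicator I \<tau> *\<^sub>R f \<tau>) \<le> norm (B * indicator I \<tau>)"
      using b B by (intro AE_I2) (simp add: indicator_def)
  qed
  have "norm (LINT \<tau>|lborel. indicator I \<tau> *\<^sub>R f \<tau>) \<le> (LINT \<tau>|lborel. B * indicator I \<tau>)"
  proof (rule Bochner_Integration.integral_norm_bound_integral[OF int])
    show "integrable lborel (\<lambda>\<tau>. B * indicator I \<tau>)" by (rule integrable_mult_right[OF ind(1)])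
    show "norm (indicator I \<tau> *\<^sub>R f \<tau>) \<le> B * indicator I \<tau>" for \<tau> using b B by (simp add: indicator_def)
  qed
  also have "\<dots> = h * B" using ind(2) by simp
  finally show "norm (LINT \<tau>|lborel. indicator I \<tau> *\<^sub>R f \<tau>) \<le> h * B" .
qed

lemma time_average_bounded: "norm (time_average h a i y) \<le> M"
proof -
  have "norm (LINT \<tau>|lborel. indicator I \<tau> *\<^sub>R a \<tau> y) \<le> h * M"
    using a by (intro integrable_step_bounded nice_field_section) (simp add: nice_field_def)
  then show ?thesis using h by (simp add: time_average_def field_simps)
qed

lemma time_average_diff:
  "time_average h a i y - time_average h a i z = (1 / h) *\<^sub>R (LINT \<tau>|lborel. indicator I \<tau> *\<^sub>R (a \<tau> y - a \<tau> z))"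
proof -
  have int: "integrable lborel (\<lambda>\<tau>. indicator I \<tau> *\<^sub>R a \<tau> y)" for y
    by (rule integrable_step_bounded(1)[OF nice_field_section, of _ M]) (use a in \<open>simp add: nice_field_def\<close>)
  have "(LINT \<tau>|lborel. indicator I \<tau> *\<^sub>R (a \<tau> y - a \<tau> z)) = (LINT \<tau>|lborel. indicator I \<tau> *\<^sub>R a \<tau> y) - (LINT \<tau>|lborel. indicator I \<tau> *\<^sub>R a \<tau> z)"
    unfolding scaleR_diff_right by (rule Bochner_Integration.integral_diff[OF int int])
  then show ?thesis by (simp only: time_average_def scaleR_diff_right)
qed

lemma time_average_lipschitz: "norm (time_average h a i y - time_average h a i z) \<le> K * norm (y - z)"
proof -
  have "norm (LINT \<tau>|lborel. indicator I \<tau> *\<^sub>R (a \<tau> y - a \<tau> z)) \<le> h * (K * norm (y - z))"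
    using a nice_field_section by (intro integrable_step_bounded borel_measurable_diff) (simp_all add: nice_field_def)
  then show ?thesis using h by (simp add: time_average_diff field_simps)
qed

text \<open>Differentiation under the integral by dominated convergence along sequences: the
  normalised remainders are bounded by \<open>2 * K\<close>. The trace of the derivative is the time
  average of the divergence and inherits its bound.\<close>

lemma time_average_derivative:
  "\<exists>D. (time_average h a i has_derivative D) (at y) \<and> \<bar>trace (matrix D)\<bar> \<le> c"
proof -
  define Da where "Da \<tau> = frechet_derivative (a \<tau>) (at y)" for \<tau>
  have dA: "(a \<tau> has_derivative Da \<tau>) (at y)" for \<tau>
    unfolding Da_def using a by (intro frechet_derivative_works[THEN iffD1]) (simp add: nice_field_def)
  have lin: "linear (Da \<tau>)" for \<tau> by (rule has_derivative_linear[OF dA])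
  have lip: "norm (a \<tau> y - a \<tau> z) \<le> K * norm (y - z)" for \<tau> y z using a by (simp add: nice_field_def)
  have Db: "norm (Da \<tau> v) \<le> K * norm v" for \<tau> v by (rule lipschitz_derivative_bound[OF dA lip])
  have quot: "(\<lambda>n. (1 / norm (X n - y)) *\<^sub>R (a \<tau> (X n) - a \<tau> y - Da \<tau> (X n - y))) \<longlonglongrightarrow> 0"
    if X: "X \<longlonglongrightarrow> y" "\<forall>n. X n \<noteq> y" for X :: "nat \<Rightarrow> real^'n" and \<tau>
  proof -
    have "((\<lambda>z. (1 / norm (z - y)) *\<^sub>R (a \<tau> z - a \<tau> y - Da \<tau> (z - y))) \<longlongrightarrow> 0) (at y)"
      using dA[of \<tau>] unfolding has_derivative_def
      by (simp add: tendsto_norm_zero_iff divide_inverse_commute flip: scaleR_conv_of_real)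
    then show ?thesis using X by (simp add: tendsto_at_iff_sequentially o_def)
  qed
  \<comment> \<open>A directional derivative is the limit of difference quotients with steps 1 / (n
    + 1), each of which is measurable in time.\<close>
  have Dm: "(\<lambda>\<tau>. Da \<tau> v) \<in> borel_measurable borel" for v
  proof (cases "v = 0")
    case True then show ?thesis using linear_0[OF lin] by simp
  next
    case False
    show ?thesis
    proof (rule borel_measurable_LIMSEQ_metric)
      fix n show "(\<lambda>\<tau>. real (Suc n) *\<^sub>R (a \<tau> (y + (1 / real (Suc n)) *\<^sub>R v) - a \<tau> y)) \<in> borel_measurable borel"
        by (intro borel_measurable_scaleR borel_measurable_diff nice_field_section) simp
    next
      fix \<tau>
      define X where "X n = y + (1 / real (Suc n)) *\<^sub>R v" for n
      have "(\<lambda>n. y + (1 / real (Suc n)) *\<^sub>R v) \<longlonglongrightarrow> y + 0 *\<^sub>R v"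
        by (intro tendsto_intros LIMSEQ_Suc[OF lim_1_over_n])
      then have X: "X \<longlonglongrightarrow> y" by (simp add: X_def[abs_def])
      have Xn: "\<forall>n. X n \<noteq> y" using False by (simp add: X_def)
      have "(\<lambda>n. norm v *\<^sub>R ((1 / norm (X n - y)) *\<^sub>R (a \<tau> (X n) - a \<tau> y - Da \<tau> (X n - y)))) \<longlonglongrightarrow> norm v *\<^sub>R 0"
        by (intro tendsto_scaleR tendsto_const quot[OF X Xn])
      moreover have "norm v *\<^sub>R ((1 / norm (X n - y)) *\<^sub>R (a \<tau> (X n) - a \<tau> y - Da \<tau> (X n - y)))
         = real (Suc n) *\<^sub>R (a \<tau> (X n) - a \<tau> y) - Da \<tau> v" for n
      proof -
        have "norm (X n - y) = norm v / real (Suc n)" by (simp add: X_def)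
        have 1: "norm v * (1 / norm (X n - y)) = real (Suc n)"
          unfolding \<open>norm (X n - y) = norm v / real (Suc n)\<close> using False by simp
        have "Da \<tau> (X n - y) = (1 / real (Suc n)) *\<^sub>R Da \<tau> v" by (simp only: X_def add_diff_cancel_left' linear_scale[OF lin])
        then have 2: "real (Suc n) *\<^sub>R Da \<tau> (X n - y) = Da \<tau> v" by simp
        show ?thesis unfolding scaleR_scaleR 1 by (simp only: scaleR_diff_right 2)
      qed
      ultimately have "(\<lambda>n. real (Suc n) *\<^sub>R (a \<tau> (X n) - a \<tau> y) - Da \<tau> v) \<longlonglongrightarrow> 0" by simp
      then show "(\<lambda>n. real (Suc n) *\<^sub>R (a \<tau> (y + (1 / real (Suc n)) *\<^sub>R v) - a \<tau> y)) \<longlonglongrightarrow> Da \<tau> v"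
        unfolding X_def by (rule LIM_zero_cancel)
    qed
  qed
  have Dint: "integrable lborel (\<lambda>\<tau>. indicator I \<tau> *\<^sub>R Da \<tau> v)" for v
    by (rule integrable_step_bounded(1)[OF Dm Db])
  have aint: "integrable lborel (\<lambda>\<tau>. indicator I \<tau> *\<^sub>R a \<tau> y)" for y
    by (rule integrable_step_bounded(1)[OF nice_field_section, of _ M]) (use a in \<open>simp add: nice_field_def\<close>)
  define D where "D v = (1 / h) *\<^sub>R (LINT \<tau>|lborel. indicator I \<tau> *\<^sub>R Da \<tau> v)" for v
  have linD: "linear D"
  proof (rule linearI)
    fix u v show "D (u + v) = D u + D v"
      using Dint by (simp add: D_def linear_add[OF lin] scaleR_add_right)
  next
    fix r v
    have "(LINT \<tau>|lborel. indicator I \<tau> *\<^sub>R Da \<tau> (r *\<^sub>R v)) = r *\<^sub>R (LINT \<tau>|lborel. indicator I \<tau> *\<^sub>R Da \<tau> v)"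
    proof -
      have "(LINT \<tau>|lborel. indicator I \<tau> *\<^sub>R Da \<tau> (r *\<^sub>R v)) = (LINT \<tau>|lborel. r *\<^sub>R (indicator I \<tau> *\<^sub>R Da \<tau> v))"
        by (simp only: linear_scale[OF lin] scaleR_left_commute)
      then show ?thesis by (simp only: integral_scaleR_right)
    qed
    then show "D (r *\<^sub>R v) = r *\<^sub>R D v" by (simp add: D_def scaleR_left_commute)
  qed
  have "((\<lambda>z. (1 / norm (z - y)) *\<^sub>R (time_average h a i z - time_average h a i y - D (z - y))) \<longlongrightarrow> 0) (at y)"
    unfolding tendsto_at_iff_sequentially o_def
  proof (intro allI impI)
    fix X :: "nat \<Rightarrow> real^'n" assume Xn: "\<forall>n. X n \<in> UNIV - {y}" and X: "X \<longlonglongrightarrow> y"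
    define q where "q n \<tau> = (1 / norm (X n - y)) *\<^sub>R (a \<tau> (X n) - a \<tau> y - Da \<tau> (X n - y))" for n \<tau>
    have qm: "q n \<in> borel_measurable borel" for n
      unfolding q_def[abs_def] by (intro borel_measurable_scaleR borel_measurable_diff nice_field_section Dm) simp
    have qb: "norm (q n \<tau>) \<le> 2 * K" for n \<tau>
    proof -
      have pos: "0 < norm (X n - y)" using Xn by simp
      have "norm (a \<tau> (X n) - a \<tau> y - Da \<tau> (X n - y)) \<le> K * norm (X n - y) + K * norm (X n - y)"
        using norm_triangle_ineq4[of "a \<tau> (X n) - a \<tau> y" "Da \<tau> (X n - y)"] lip[of \<tau> "X n" y] Db[of \<tau> "X n - y"] by linarith
      then show ?thesis using pos by (simp add: q_def divide_le_eq)
    qed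
    have "(\<lambda>n. LINT \<tau>|lborel. indicator I \<tau> *\<^sub>R q n \<tau>) \<longlonglongrightarrow> (LINT \<tau>|(lborel :: real measure). 0 :: real^'n)"
    proof (rule integral_dominated_convergence[where w="\<lambda>\<tau>. 2 * K * indicator I \<tau>"])
      show "(\<lambda>\<tau>. indicator I \<tau> *\<^sub>R q n \<tau>) \<in> borel_measurable lborel" for n
        using qm by (intro borel_measurable_scaleR borel_measurable_indicator) simp_all
      show "integrable lborel (\<lambda>\<tau>. 2 * K * indicator I \<tau>)"
        using emeasure_step_interval h by (intro integrable_mult_right) (simp add: less_top[symmetric])
      have "(\<lambda>n. q n \<tau>) \<longlonglongrightarrow> 0" for \<tau> unfolding q_def using Xn by (intro quot[OF X]) simp
      then have "(\<lambda>n. indicator I \<tau> *\<^sub>R q n \<tau>) \<longlonglongrightarrow> indicator I \<tau> *\<^sub>R 0" for \<tau>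
        by (intro tendsto_scaleR tendsto_const)
      then show "AE \<tau> in lborel. (\<lambda>n. indicator I \<tau> *\<^sub>R q n \<tau>) \<longlonglongrightarrow> 0" by simp
      show "AE \<tau> in lborel. norm (indicator I \<tau> *\<^sub>R q n \<tau>) \<le> 2 * K * indicator I \<tau>" for n
        using qb by (intro AE_I2) (simp add: indicator_def)
    qed simp
    then have "(\<lambda>n. (1 / h) *\<^sub>R (LINT \<tau>|lborel. indicator I \<tau> *\<^sub>R q n \<tau>)) \<longlonglongrightarrow> (1 / h) *\<^sub>R 0"
      by (intro tendsto_scaleR tendsto_const) simp
    moreover have "(1 / h) *\<^sub>R (LINT \<tau>|lborel. indicator I \<tau> *\<^sub>R q n \<tau>) =
       (1 / norm (X n - y)) *\<^sub>R (time_average h a i (X n) - time_average h a i y - D (X n - y))" for n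
    proof -
      define A1 where "A1 = (LINT \<tau>|lborel. indicator I \<tau> *\<^sub>R a \<tau> (X n))"
      define A2 where "A2 = (LINT \<tau>|lborel. indicator I \<tau> *\<^sub>R a \<tau> y)"
      define A3 where "A3 = (LINT \<tau>|lborel. indicator I \<tau> *\<^sub>R Da \<tau> (X n - y))"
      have "(LINT \<tau>|lborel. indicator I \<tau> *\<^sub>R q n \<tau>) = (LINT \<tau>|lborel. (1 / norm (X n - y)) *\<^sub>R
        (indicator I \<tau> *\<^sub>R a \<tau> (X n) - indicator I \<tau> *\<^sub>R a \<tau> y - indicator I \<tau> *\<^sub>R Da \<tau> (X n - y)))"
        by (intro Bochner_Integration.integral_cong refl) (simp only: q_def scaleR_diff_right scaleR_left_commute)
      also have "\<dots> = (1 / norm (X n - y)) *\<^sub>R (A1 - A2 - A3)"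
        unfolding A1_def A2_def A3_def using aint Dint by (simp add: Bochner_Integration.integrable_diff)
      finally have 1: "(LINT \<tau>|lborel. indicator I \<tau> *\<^sub>R q n \<tau>) = (1 / norm (X n - y)) *\<^sub>R (A1 - A2 - A3)" .
      show ?thesis unfolding 1 time_average_def D_def A1_def[symmetric] A2_def[symmetric] A3_def[symmetric]
        by (simp only: scaleR_diff_right scaleR_left_commute)
    qed
    ultimately show "(\<lambda>n. (1 / norm (X n - y)) *\<^sub>R (time_average h a i (X n) - time_average h a i y - D (X n - y))) \<longlonglongrightarrow> 0"
      by simp
  qed
  then have "((\<lambda>z. (1 / norm (z - y)) *\<^sub>R (time_average h a i z - (time_average h a i y + D (z - y)))) \<longlongrightarrow> 0) (at y)"
    by (simp only: diff_diff_eq)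
  moreover have "bounded_linear D" using linD by (simp only: linear_conv_bounded_linear)
  ultimately have "(time_average h a i has_derivative D) (at y)"
    unfolding has_derivative_within by blast
  moreover have "\<bar>trace (matrix D)\<bar> \<le> c"
  proof -
    have "trace (matrix D) = (1 / h) * (\<Sum>j\<in>UNIV. (LINT \<tau>|lborel. indicator I \<tau> *\<^sub>R Da \<tau> (axis j 1)) $ j)"
      by (simp add: trace_def matrix_def D_def sum_distrib_left)
    also have "(\<Sum>j\<in>UNIV. (LINT \<tau>|lborel. indicator I \<tau> *\<^sub>R Da \<tau> (axis j 1)) $ j)
      = (\<Sum>j\<in>UNIV. (LINT \<tau>|lborel. (indicator I \<tau> *\<^sub>R Da \<tau> (axis j 1)) $ j))"
      using Dint by (intro sum.cong refl integral_bounded_linear[OF bounded_linear_vec_nth, symmetric])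
    also have "\<dots> = (LINT \<tau>|lborel. (\<Sum>j\<in>UNIV. (indicator I \<tau> *\<^sub>R Da \<tau> (axis j 1)) $ j))"
      using Dint by (intro Bochner_Integration.integral_sum[symmetric] integrable_bounded_linear[OF bounded_linear_vec_nth])
    also have "\<dots> = (LINT \<tau>|lborel. indicator I \<tau> *\<^sub>R divergence (a \<tau>) y)"
      by (intro Bochner_Integration.integral_cong refl)
        (simp add: divergence_def jacobian_def trace_def matrix_def Da_def sum_distrib_left)
    finally have eq: "trace (matrix D) = (1 / h) * (LINT \<tau>|lborel. indicator I \<tau> *\<^sub>R divergence (a \<tau>) y)" .
    have dm: "(\<lambda>\<tau>. divergence (a \<tau>) y) \<in> borel_measurable borel"
    proof -
      have "(\<lambda>\<tau>. \<Sum>j\<in>UNIV. Da \<tau> (axis j 1) $ j) \<in> borel_measurable borel"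
        by (intro borel_measurable_sum measurable_compose[OF Dm]) (intro borel_measurable_continuous_onI continuous_intros)
      then show ?thesis by (simp add: divergence_def jacobian_def trace_def matrix_def Da_def)
    qed
    have "norm (LINT \<tau>|lborel. indicator I \<tau> *\<^sub>R divergence (a \<tau>) y) \<le> h * c"
      by (rule integrable_step_bounded(2)[OF dm]) (use a in \<open>simp add: nice_field_def\<close>)
    then show ?thesis unfolding eq using h by (simp add: abs_mult field_simps)
  qed
  ultimately show ?thesis by blast
qed

end

section \<open>The theta-method as a perturbed flow\<close>

lemma integral_Icc_split:
  fixes v :: "real \<Rightarrow> 'b::euclidean_space"
  assumes v: "integrable lborel (\<lambda>\<tau>. indicator {a..b} \<tau> *\<^sub>R v \<tau>)" and r: "a \<le> r" "r \<le> b"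
  shows "integrable lborel (\<lambda>\<tau>. indicator {a..r} \<tau> *\<^sub>R v \<tau>)" "integrable lborel (\<lambda>\<tau>. indicator {r..b} \<tau> *\<^sub>R v \<tau>)"
    "(LINT \<tau>|lborel. indicator {a..b} \<tau> *\<^sub>R v \<tau>) = (LINT \<tau>|lborel. indicator {a..r} \<tau> *\<^sub>R v \<tau>) + (LINT \<tau>|lborel. indicator {r..b} \<tau> *\<^sub>R v \<tau>)"
proof -
  have sub: "integrable lborel (\<lambda>\<tau>. indicator J \<tau> *\<^sub>R v \<tau>)" if "J \<subseteq> {a..b}" "J \<in> sets borel" for J
  proof -
    have "integrable lborel (\<lambda>\<tau>. indicator J \<tau> *\<^sub>R (indicator {a..b} \<tau> *\<^sub>R v \<tau>))"
      by (rule integrable_mult_indicator[OF _ v]) (use that(2) in simp)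
    moreover have "(\<lambda>\<tau>. indicator J \<tau> *\<^sub>R (indicator {a..b} \<tau> *\<^sub>R v \<tau>)) = (\<lambda>\<tau>. indicator J \<tau> *\<^sub>R v \<tau>)"
      using that(1) by (auto simp: indicator_def fun_eq_iff)
    ultimately show ?thesis by simp
  qed
  show 1: "integrable lborel (\<lambda>\<tau>. indicator {a..r} \<tau> *\<^sub>R v \<tau>)" and 2: "integrable lborel (\<lambda>\<tau>. indicator {r..b} \<tau> *\<^sub>R v \<tau>)"
    using r by (auto intro!: sub)
  have "AE \<tau> in lborel. \<tau> \<noteq> r" by (rule AE_lborel_singleton)
  then have "AE \<tau> in lborel. indicator {a..b} \<tau> *\<^sub>R v \<tau> = indicator {a..r} \<tau> *\<^sub>R v \<tau> + indicator {r..b} \<tau> *\<^sub>R v \<tau>"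
    by eventually_elim (use r in \<open>auto simp: indicator_def\<close>)
  then have "(LINT \<tau>|lborel. indicator {a..b} \<tau> *\<^sub>R v \<tau>) = (LINT \<tau>|lborel. indicator {a..r} \<tau> *\<^sub>R v \<tau> + indicator {r..b} \<tau> *\<^sub>R v \<tau>)"
    using v 1 2 by (intro integral_cong_AE) (auto intro: borel_measurable_integrable)
  then show "(LINT \<tau>|lborel. indicator {a..b} \<tau> *\<^sub>R v \<tau>) = (LINT \<tau>|lborel. indicator {a..r} \<tau> *\<^sub>R v \<tau>) + (LINT \<tau>|lborel. indicator {r..b} \<tau> *\<^sub>R v \<tau>)"
    using Bochner_Integration.integral_add[OF 1 2] by simp
qed

lemma integral_Icc_bounded:
  fixes v :: "real \<Rightarrow> 'b::euclidean_space"
  assumes v: "v \<in> borel_measurable borel" "\<And>\<tau>. norm (v \<tau>) \<le> M" and ab: "a \<le> b"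
  shows "integrable lborel (\<lambda>\<tau>. indicator {a..b} \<tau> *\<^sub>R v \<tau>)" "norm (LINT \<tau>|lborel. indicator {a..b} \<tau> *\<^sub>R v \<tau>) \<le> M * (b - a)"
proof -
  have M: "0 \<le> M" using order_trans[OF norm_ge_zero v(2)] .
  have ind: "integrable lborel (indicator {a..b} :: real \<Rightarrow> real)" "(LINT \<tau>|lborel. indicator {a..b} \<tau>) = b - a"
    using ab by (simp_all add: measure_def less_top[symmetric])
  have b: "norm (indicator {a..b} \<tau> *\<^sub>R v \<tau>) \<le> M * indicator {a..b} \<tau>" for \<tau> using v M by (simp add: indicator_def)
  show int: "integrable lborel (\<lambda>\<tau>. indicator {a..b} \<tau> *\<^sub>R v \<tau>)"
  proof (rule Bochner_Integration.integrable_bound)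
    show "integrable lborel (\<lambda>\<tau>. M * indicator {a..b} \<tau>)" by (rule integrable_mult_right[OF ind(1)])
    show "(\<lambda>\<tau>. indicator {a..b} \<tau> *\<^sub>R v \<tau>) \<in> borel_measurable lborel"
      using v by (intro borel_measurable_scaleR borel_measurable_indicator) simp_all
    show "AE \<tau> in lborel. norm (indicator {a..b} \<tau> *\<^sub>R v \<tau>) \<le> norm (M * indicator {a..b} \<tau>)"
      using b M by (intro AE_I2) (simp add: abs_mult)
  qed
  have "norm (LINT \<tau>|lborel. indicator {a..b} \<tau> *\<^sub>R v \<tau>) \<le> (LINT \<tau>|lborel. M * indicator {a..b} \<tau>)"
    by (rule Bochner_Integration.integral_norm_bound_integral[OF int integrable_mult_right[OF ind(1)] b])
  then show "norm (LINT \<tau>|lborel. indicator {a..b} \<tau> *\<^sub>R v \<tau>) \<le> M * (b - a)" using ind(2) by simp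
qed

lemma det_const_ge_1: "1 \<le> det_const TYPE('n::finite)"
proof -
  have "(1::real) \<le> fact CARD('n) * 2 ^ CARD('n)" by (metis fact_ge_1 mult_mono' mult_1 one_le_power one_le_numeral zero_le_one)
  then show ?thesis by (simp add: det_const_def add_increasing2)
qed

lemma step_index:
  assumes h: "0 < h" and \<tau>: "0 \<le> (\<tau>::real)"
  shows "real (nat \<lfloor>\<tau> / h\<rfloor>) * h \<le> \<tau>" "\<tau> < real (Suc (nat \<lfloor>\<tau> / h\<rfloor>)) * h"
    "real i * h \<le> \<tau> \<Longrightarrow> \<tau> < real (Suc i) * h \<Longrightarrow> nat \<lfloor>\<tau> / h\<rfloor> = i"
proof -
  have f: "0 \<le> \<lfloor>\<tau> / h\<rfloor>" using h \<tau> by simp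
  have r: "real (nat \<lfloor>\<tau> / h\<rfloor>) = of_int \<lfloor>\<tau> / h\<rfloor>" using f by simp
  have "of_int \<lfloor>\<tau> / h\<rfloor> \<le> \<tau> / h" by (rule of_int_floor_le)
  then show "real (nat \<lfloor>\<tau> / h\<rfloor>) * h \<le> \<tau>" using h unfolding r by (simp add: le_divide_eq)
  have "\<tau> / h < of_int \<lfloor>\<tau> / h\<rfloor> + 1" by (rule floor_correct[THEN conjunct2, simplified])
  then show "\<tau> < real (Suc (nat \<lfloor>\<tau> / h\<rfloor>)) * h" using h unfolding of_nat_Suc r by (simp add: divide_less_eq add.commute)
  assume "real i * h \<le> \<tau>" "\<tau> < real (Suc i) * h"
  then have "real i \<le> \<tau> / h" "\<tau> / h < real i + 1" using h by (simp_all add: le_divide_eq divide_less_eq add.commute)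
  then have "\<lfloor>\<tau> / h\<rfloor> = int i" by (intro floor_unique) simp_all
  then show "nat \<lfloor>\<tau> / h\<rfloor> = i" by simp
qed

section \<open>Position and velocity of the scheme\<close>

context
  fixes f a :: "real \<Rightarrow> real^'n \<Rightarrow> real^'n" and K M c h \<theta> T \<kappa> :: real and N :: nat
  assumes a: "nice_field K M c a" and h: "0 < h" and Nh: "real N * h = T" and K: "0 \<le> K" "h * K \<le> 1 / 8" and M: "0 \<le> M"
    and \<theta>: "0 \<le> \<theta>" "\<theta> \<le> 1"
    and eq: "AE \<tau> in lborel. \<tau> \<in> {0<..<T} \<longrightarrow> (\<forall>y. f \<tau> y = a \<tau> y)"
    and \<kappa>: "\<kappa> = h * c + det_const TYPE('n) * (h * K)\<^sup>2" "\<kappa> \<le> 1 / 2"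
begin

abbreviation (input) "node i x \<equiv> theta_node h \<theta> f x i"

lemma kappa_nonneg: "0 \<le> \<kappa>"
proof -
  have "0 \<le> c" using a abs_ge_zero order_trans unfolding nice_field_def by blast
  then show ?thesis unfolding \<kappa>(1) using h det_const_pos[where 'n='n] by (intro add_nonneg_nonneg mult_nonneg_nonneg) auto
qed

lemma theta_node_step:
  assumes i: "i < N"
  shows "\<exists>\<Psi>. (\<forall>x. node (Suc i) x = \<Psi> (node i x)) \<and> compressible (1 + 4 * \<kappa>) \<Psi> \<and>
    (\<forall>l\<in>{0..1}. compressible (det_const TYPE('n)) (\<lambda>x. x + l *\<^sub>R (\<Psi> x - x))) \<and>
    (\<forall>x. (1 / h) *\<^sub>R (\<Psi> x - x) = (1 - \<theta>) *\<^sub>R time_average h a i x + \<theta> *\<^sub>R time_average h a i (\<Psi> x))"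
proof -
  have "\<exists>D. \<forall>x. (time_average h a i has_derivative D x) (at x) \<and> \<bar>trace (matrix (D x))\<bar> \<le> c"
    by (rule choice) (intro allI time_average_derivative[OF a h K(1) M])
  then obtain D where D: "\<forall>x. (time_average h a i has_derivative D x) (at x) \<and> \<bar>trace (matrix (D x))\<bar> \<le> c" by (rule exE)
  have "\<exists>\<Psi>. theta_step h \<theta> (time_average h a i) \<Psi> \<and> continuous_on UNIV \<Psi> \<and> compressible (1 + 4 * \<kappa>) \<Psi> \<and>
     (\<forall>l\<in>{0..1}. compressible (det_const TYPE('n)) (\<lambda>x. x + l *\<^sub>R (\<Psi> x - x)))"
    by (rule theta_step_compressible[where DF=D, OF h \<theta> K time_average_lipschitz[OF a h K(1) M] _ _ \<kappa>]) (use D in blast)+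
  then obtain \<Psi> where \<Psi>: "theta_step h \<theta> (time_average h a i) \<Psi>" "continuous_on UNIV \<Psi>" "compressible (1 + 4 * \<kappa>) \<Psi>"
     "\<forall>l\<in>{0..1}. compressible (det_const TYPE('n)) (\<lambda>x. x + l *\<^sub>R (\<Psi> x - x))" by (elim exE conjE)
  have iT: "real (Suc i) * h \<le> T"
    unfolding Nh[symmetric] using i h by (intro mult_right_mono) simp_all
  have "node (Suc i) x = \<Psi> (node i x)" for x
    using \<Psi>(1) by (simp add: step_average_eq_time_average[OF a h iT eq] theta_step_def)
  moreover have "(1 / h) *\<^sub>R (\<Psi> x - x) = (1 - \<theta>) *\<^sub>R time_average h a i x + \<theta> *\<^sub>R time_average h a i (\<Psi> x)" for x
    using \<Psi>(1) unfolding theta_step_def by blast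
  ultimately show ?thesis using \<Psi>(3,4) by (intro exI[of _ \<Psi>] conjI allI) blast+
qed

lemma node_compressible: "i \<le> N \<Longrightarrow> compressible ((1 + 4 * \<kappa>) ^ i) (node i)"
proof (induction i)
  case 0
  then show ?case using compressible_id by simp
next
  case (Suc i)
  then have i: "i < N" by simp
  obtain \<Psi> where \<Psi>: "\<forall>x. node (Suc i) x = \<Psi> (node i x)" "compressible (1 + 4 * \<kappa>) \<Psi>"
    using theta_node_step[OF i] by (elim exE conjE)
  have "compressible ((1 + 4 * \<kappa>) ^ i * (1 + 4 * \<kappa>)) (\<lambda>x. \<Psi> (node i x))"
    using Suc \<Psi> kappa_nonneg by (intro compressible_comp) simp_all
  then show ?case by (simp only: \<Psi>(1)[rule_format, symmetric] power_Suc2)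
qed

lemma node_step_average:
  assumes i: "i < N"
  shows "node (Suc i) x - node i x = h *\<^sub>R ((1 - \<theta>) *\<^sub>R time_average h a i (node i x) + \<theta> *\<^sub>R time_average h a i (node (Suc i) x))"
proof -
  obtain \<Psi> where \<Psi>: "\<forall>x. node (Suc i) x = \<Psi> (node i x)"
    "\<forall>x. (1 / h) *\<^sub>R (\<Psi> x - x) = (1 - \<theta>) *\<^sub>R time_average h a i x + \<theta> *\<^sub>R time_average h a i (\<Psi> x)"
    using theta_node_step[OF i] by (elim exE conjE)
  have "h *\<^sub>R ((1 / h) *\<^sub>R (node (Suc i) x - node i x)) = h *\<^sub>R ((1 - \<theta>) *\<^sub>R time_average h a i (node i x) + \<theta> *\<^sub>R time_average h a i (node (Suc i) x))"
    using \<Psi>(2)[rule_format, of "node i x"] by (simp only: \<Psi>(1)[rule_format])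
  then show ?thesis using h by simp
qed

lemma convex_combination_norm_le:
  fixes u v :: "real^'n"
  assumes "norm u \<le> B" "norm v \<le> B"
  shows "norm ((1 - \<theta>) *\<^sub>R u + \<theta> *\<^sub>R v) \<le> B"
proof -
  have "norm ((1 - \<theta>) *\<^sub>R u + \<theta> *\<^sub>R v) \<le> (1 - \<theta>) * norm u + \<theta> * norm v"
    using norm_triangle_ineq[of "(1 - \<theta>) *\<^sub>R u" "\<theta> *\<^sub>R v"] \<theta> by simp
  also have "\<dots> \<le> (1 - \<theta>) * B + \<theta> * B" using assms \<theta> by (intro add_mono mult_left_mono) simp_all
  finally show ?thesis by (simp add: algebra_simps)
qed

lemma node_step_norm:
  assumes i: "i < N"
  shows "norm (node (Suc i) x - node i x) \<le> M * h"
proof -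
  have "norm (node (Suc i) x - node i x) =
     h * norm ((1 - \<theta>) *\<^sub>R time_average h a i (node i x) + \<theta> *\<^sub>R time_average h a i (node (Suc i) x))"
    unfolding node_step_average[OF i] using h by (simp only: norm_scaleR abs_of_pos)
  also have "\<dots> \<le> h * M"
    using h by (intro mult_left_mono convex_combination_norm_le time_average_bounded[OF a h K(1) M] less_imp_le)
  finally show ?thesis by (simp only: mult.commute)
qed

text \<open>Capped at \<open>N\<close>, so that the node in use is a controlled one also at the
  final time and beyond.\<close>

definition "index \<tau> = min N (nat \<lfloor>\<tau> / h\<rfloor>)"
definition "scheme_position \<tau> x = node (index \<tau>) x"
text \<open>Its integral over a step is exactly the increment of the nodes, while at each time it is
  close to the field at the current node. This exhibits the scheme as a trajectory of the
  regularised field with a small velocity error. The cap at \<open>N\<close> in the second node acts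
  only from the final time on.\<close>

definition "scheme_velocity \<tau> x = (1 - \<theta>) *\<^sub>R a \<tau> (node (index \<tau>) x) + \<theta> *\<^sub>R a \<tau> (node (min N (Suc (index \<tau>))) x)"

lemma index_measurable: "index \<in> borel \<rightarrow>\<^sub>M count_space UNIV"
  unfolding index_def[abs_def] by measurable

lemma node_index_measurable: "(\<lambda>z. node (min N (g (fst z))) (snd z)) \<in> borel_measurable borel"
  if g: "g \<in> borel \<rightarrow>\<^sub>M count_space UNIV" for g :: "real \<Rightarrow> nat"
proof -
  have "(\<lambda>z :: real \<times> (real^'n). node (min N i) (snd z)) \<in> borel_measurable borel" for i
    by (rule measurable_compose[OF borel_measurable_snd_borel compressible_measurable[OF node_compressible]]) simp
  from measurable_compose_countable[OF this measurable_compose[OF borel_measurable_fst_borel g]]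
  show ?thesis .
qed

lemma nice_field_along_measurable: "(\<lambda>z. a (fst z) (g z)) \<in> borel_measurable borel"
  if g: "g \<in> borel_measurable borel" for g :: "real \<times> (real^'n) \<Rightarrow> real^'n"
proof -
  have am: "jointly_borel a" using a by (simp add: nice_field_def)
  from measurable_compose[OF borel_measurable_Pair[OF borel_measurable_fst_borel g] am] show ?thesis by simp
qed

lemma scheme_position_measurable: "jointly_borel scheme_position"
  using node_index_measurable[OF index_measurable] unfolding scheme_position_def index_def by simp

lemma scheme_velocity_measurable: "jointly_borel scheme_velocity"
proof -
  have 1: "(\<lambda>z. node (index (fst z)) (snd z)) \<in> borel_measurable borel"
    using node_index_measurable[OF index_measurable] unfolding index_def by simp
  have 2: "(\<lambda>z. node (min N (Suc (index (fst z)))) (snd z)) \<in> borel_measurable borel"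
    using node_index_measurable[OF measurable_compose[OF index_measurable, of Suc]] by simp
  show ?thesis unfolding scheme_velocity_def
    by (intro borel_measurable_add borel_measurable_scaleR borel_measurable_const nice_field_along_measurable 1 2)
qed

lemma scheme_position_compressible: "compressible ((1 + 4 * \<kappa>) ^ N) (scheme_position \<tau>)"
  unfolding scheme_position_def[abs_def]
  by (rule compressible_mono[OF node_compressible power_increasing]) (use kappa_nonneg in \<open>auto simp: index_def\<close>)

lemma scheme_velocity_norm: "norm (scheme_velocity \<tau> x) \<le> M"
  unfolding scheme_velocity_def using a by (intro convex_combination_norm_le) (auto simp: nice_field_def)

lemma index_in_interval:
  assumes "real i * h \<le> \<tau>" "\<tau> < real (Suc i) * h" "i < N"
  shows "index \<tau> = i"
proof -
  have "0 \<le> \<tau>" using assms(1) h by (meson mult_nonneg_nonneg of_nat_0_le_iff order_trans less_imp_le)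
  then show ?thesis using step_index(3)[OF h _ assms(1,2)] assms(3) by (simp add: index_def)
qed

lemma index_less: "\<tau> \<in> {0..<T} \<Longrightarrow> index \<tau> < N \<and> index \<tau> = nat \<lfloor>\<tau> / h\<rfloor>"
proof -
  assume \<tau>: "\<tau> \<in> {0..<T}"
  then have "real (nat \<lfloor>\<tau> / h\<rfloor>) * h < real N * h"
    using step_index(1)[OF h, of \<tau>] Nh by auto
  then have "nat \<lfloor>\<tau> / h\<rfloor> < N" using h by simp
  then show ?thesis by (simp add: index_def)
qed

text \<open>Only the implicit part deviates: it evaluates the field at the next node, at most
  \<open>M * h\<close> away.\<close>

lemma scheme_velocity_close:
  assumes "\<tau> \<in> {0..<T}"
  shows "norm (scheme_velocity \<tau> x - a \<tau> (scheme_position \<tau> x)) \<le> K * (M * h)"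
proof -
  define i where "i = index \<tau>"
  have i: "i < N" using index_less[OF assms] by (simp add: i_def)
  have "scheme_velocity \<tau> x - a \<tau> (scheme_position \<tau> x) = \<theta> *\<^sub>R (a \<tau> (node (Suc i) x) - a \<tau> (node i x))"
    using i by (simp add: scheme_velocity_def scheme_position_def i_def[symmetric] min_absorb2 algebra_simps del: theta_node.simps)
  also have "norm \<dots> \<le> 1 * (K * (M * h))"
    unfolding norm_scaleR
  proof (rule mult_mono)
    have "norm (a \<tau> (node (Suc i) x) - a \<tau> (node i x)) \<le> K * norm (node (Suc i) x - node i x)"
      using a unfolding nice_field_def by blast
    also have "\<dots> \<le> K * (M * h)" by (intro mult_left_mono node_step_norm i K)
    finally show "norm (a \<tau> (node (Suc i) x) - a \<tau> (node i x)) \<le> K * (M * h)" .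
  qed (use \<theta> in auto)
  finally show ?thesis by simp
qed

lemma scheme_velocity_section: "(\<lambda>\<tau>. scheme_velocity \<tau> x) \<in> borel_measurable borel"
  using borel_sections(1)[OF scheme_velocity_measurable, of x] by simp

lemma scheme_velocity_step_integral:
  assumes i: "i < N"
  shows "(LINT \<tau>|lborel. indicator {real i * h..real (Suc i) * h} \<tau> *\<^sub>R scheme_velocity \<tau> x) = node (Suc i) x - node i x"
proof -
  let ?I = "{real i * h..real (Suc i) * h}"
  have int: "integrable lborel (\<lambda>\<tau>. indicator ?I \<tau> *\<^sub>R a \<tau> y)" for y
    by (rule integrable_step_bounded(1)[OF a h K(1) M nice_field_section[OF a h K(1) M], of _ M]) (use a in \<open>simp add: nice_field_def\<close>)
  have av: "(LINT \<tau>|lborel. indicator ?I \<tau> *\<^sub>R a \<tau> y) = h *\<^sub>R time_average h a i y" for y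
    using h by (simp add: time_average_def)
  \<comment> \<open>At the right end point the index may already have jumped to the next
    step.\<close>
  have "AE \<tau> in lborel. \<tau> \<noteq> real (Suc i) * h" by (rule AE_lborel_singleton)
  then have "AE \<tau> in lborel. indicator ?I \<tau> *\<^sub>R scheme_velocity \<tau> x =
     (1 - \<theta>) *\<^sub>R (indicator ?I \<tau> *\<^sub>R a \<tau> (node i x)) + \<theta> *\<^sub>R (indicator ?I \<tau> *\<^sub>R a \<tau> (node (Suc i) x))"
  proof eventually_elim
    case (elim \<tau>)
    show ?case
    proof (cases "\<tau> \<in> ?I")
      case True
      then have "index \<tau> = i" using elim i by (intro index_in_interval) auto
      then show ?thesis using True i by (simp add: scheme_velocity_def min_absorb2 del: theta_node.simps)
    qed simp
  qed
  then have "(LINT \<tau>|lborel. indicator ?I \<tau> *\<^sub>R scheme_velocity \<tau> x) = (LINT \<tau>|lborel.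
     (1 - \<theta>) *\<^sub>R (indicator ?I \<tau> *\<^sub>R a \<tau> (node i x)) + \<theta> *\<^sub>R (indicator ?I \<tau> *\<^sub>R a \<tau> (node (Suc i) x)))"
  proof (rule integral_cong_AE[rotated 2])
    show "(\<lambda>\<tau>. indicator ?I \<tau> *\<^sub>R scheme_velocity \<tau> x) \<in> borel_measurable lborel"
      using scheme_velocity_section[of x] by (intro borel_measurable_scaleR borel_measurable_indicator) simp_all
    show "(\<lambda>\<tau>. (1 - \<theta>) *\<^sub>R (indicator ?I \<tau> *\<^sub>R a \<tau> (node i x)) + \<theta> *\<^sub>R (indicator ?I \<tau> *\<^sub>R a \<tau> (node (Suc i) x))) \<in> borel_measurable lborel"
      by (intro borel_measurable_integrable Bochner_Integration.integrable_add integrable_scaleR_right int)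
  qed
  also have "\<dots> = (1 - \<theta>) *\<^sub>R (LINT \<tau>|lborel. indicator ?I \<tau> *\<^sub>R a \<tau> (node i x)) + \<theta> *\<^sub>R (LINT \<tau>|lborel. indicator ?I \<tau> *\<^sub>R a \<tau> (node (Suc i) x))"
    by (subst Bochner_Integration.integral_add)
      (intro integrable_scaleR_right int, intro integrable_scaleR_right int, simp only: integral_scaleR_right)
  also have "\<dots> = (1 - \<theta>) *\<^sub>R (h *\<^sub>R time_average h a i (node i x)) + \<theta> *\<^sub>R (h *\<^sub>R time_average h a i (node (Suc i) x))"
    by (simp only: av)
  finally show ?thesis
    unfolding node_step_average[OF i] by (simp only: scaleR_add_right scaleR_left_commute)
qed

lemma scheme_path_node: "i \<le> N \<Longrightarrow> x + (LINT \<tau>|lborel. indicator {0..real i * h} \<tau> *\<^sub>R scheme_velocity \<tau> x) = node i x"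
proof (induction i)
  case 0
  have "AE \<tau> in lborel. \<tau> \<noteq> (0::real)" by (rule AE_lborel_singleton)
  then have "AE \<tau> in lborel. indicator {0::real..real 0 * h} \<tau> *\<^sub>R scheme_velocity \<tau> x = 0"
    by eventually_elim simp
  then have "(LINT \<tau>|lborel. indicator {0::real..real 0 * h} \<tau> *\<^sub>R scheme_velocity \<tau> x) = 0"
    by (rule integral_eq_zero_AE)
  then show ?case by simp
next
  case (Suc i)
  have le: "0 \<le> real i * h" "real i * h \<le> real (Suc i) * h" using h by simp_all
  have "integrable lborel (\<lambda>\<tau>. indicator {0..real (Suc i) * h} \<tau> *\<^sub>R scheme_velocity \<tau> x)"
    using le by (intro integral_Icc_bounded(1)[OF scheme_velocity_section scheme_velocity_norm]) linarith
  from integral_Icc_split(3)[OF this le] scheme_velocity_step_integral[of i x] Suc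
  show ?case by (simp add: add.assoc[symmetric] del: theta_node.simps of_nat_Suc)
qed

text \<open>The path driven by \<open>scheme_velocity\<close> passes through the nodes without being
  the linear interpolant, since the field varies in time; within a step it departs from the current
  node by at most the speed bound times \<open>h\<close>.\<close>

lemma scheme_path_close:
  assumes s: "s \<in> {0..T}"
  shows "norm (x + (LINT \<tau>|lborel. indicator {0..s} \<tau> *\<^sub>R scheme_velocity \<tau> x) - scheme_position s x) \<le> M * h"
proof -
  define i where "i = index s"
  have i: "i \<le> N" by (simp add: i_def index_def)
  have s0: "0 \<le> s" using s by simp
  have ih: "real i * h \<le> s"
  proof -
    have "real i * h \<le> real (nat \<lfloor>s / h\<rfloor>) * h" using h by (intro mult_right_mono) (simp_all add: i_def index_def)
    then show ?thesis using step_index(1)[OF h s0] by linarith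
  qed
  have sh: "s - real i * h \<le> h"
  proof (cases "nat \<lfloor>s / h\<rfloor> \<le> N")
    case True
    then have "i = nat \<lfloor>s / h\<rfloor>" by (simp add: i_def index_def)
    then show ?thesis using step_index(2)[OF h s0] by (simp add: algebra_simps)
  next
    case False
    then have "i = N" by (simp add: i_def index_def)
    then show ?thesis using s Nh h by simp
  qed
  have le: "0 \<le> real i * h" using h by simp
  have int: "integrable lborel (\<lambda>\<tau>. indicator {0..s} \<tau> *\<^sub>R scheme_velocity \<tau> x)"
    by (rule integral_Icc_bounded(1)[OF scheme_velocity_section scheme_velocity_norm s0])
  have "x + (LINT \<tau>|lborel. indicator {0..s} \<tau> *\<^sub>R scheme_velocity \<tau> x) - scheme_position s x
     = (LINT \<tau>|lborel. indicator {real i * h..s} \<tau> *\<^sub>R scheme_velocity \<tau> x)"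
    using integral_Icc_split(3)[OF int le ih] scheme_path_node[OF i, of x]
    by (simp add: scheme_position_def i_def[symmetric] add.assoc[symmetric])
  also have "norm \<dots> \<le> M * (s - real i * h)"
    by (rule integral_Icc_bounded(2)[OF scheme_velocity_section scheme_velocity_norm ih])
  also have "\<dots> \<le> M * h" using sh M by (intro mult_left_mono)
  finally show ?thesis .
qed

text \<open>The full steps contribute at most \<open>(1 + 4 * \<kappa>) ^ N\<close>, the final
  partial step of the interpolation one factor \<open>det_const\<close>.\<close>

lemma theta_flow_compressible:
  assumes s: "s \<in> {0..T}"
  shows "compressible (det_const TYPE('n) * (1 + 4 * \<kappa>) ^ N) (theta_flow h \<theta> f s)"
    and "norm (theta_flow h \<theta> f s x - scheme_position s x) \<le> M * h"
proof -
  have s0: "0 \<le> s" using s by simp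
  define L where "L = (1 + 4 * \<kappa>) ^ N"
  have L: "1 \<le> L" unfolding L_def using kappa_nonneg by (intro one_le_power) simp
  define i where "i = nat \<lfloor>s / h\<rfloor>"
  define l where "l = (s - real i * h) / h"
  have l: "0 \<le> l" "l \<le> 1"
    using step_index(1,2)[OF h s0] h by (simp_all add: l_def i_def field_simps)
  have flow: "theta_flow h \<theta> f s x = node i x + l *\<^sub>R (node (Suc i) x - node i x)" for x
    by (simp add: theta_flow_def i_def l_def Let_def del: theta_node.simps)
  have "compressible (det_const TYPE('n) * L) (theta_flow h \<theta> f s) \<and> norm (theta_flow h \<theta> f s x - scheme_position s x) \<le> M * h"
  \<comment> \<open>At the final time the partial step would be step \<open>N\<close>, which is
    outside the controlled range, but its weight is 0.\<close>
  proof (cases "s = T")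
    case True
    have "s / h = real N" using Nh h True by (auto simp: field_simps)
    then have iN: "i = N" by (simp add: i_def)
    then have "l = 0" using Nh True by (simp add: l_def)
    then have fl: "theta_flow h \<theta> f s = node N" using iN by (simp add: flow fun_eq_iff)
    have "compressible (det_const TYPE('n) * L) (node N)"
    proof (rule compressible_mono[OF node_compressible])
      show "(1 + 4 * \<kappa>) ^ N \<le> det_const TYPE('n) * L"
        using mult_right_mono[OF det_const_ge_1[where 'n='n], of L] L by (simp add: L_def)
    qed simp
    moreover have "scheme_position s x = node N x" using iN by (simp add: scheme_position_def index_def i_def[symmetric])
    ultimately show ?thesis using fl M h by simp
  next
    case False
    then have i: "i < N" "index s = i" using index_less[of s] s by (auto simp: i_def)
    obtain \<Psi> where \<Psi>: "\<forall>x. node (Suc i) x = \<Psi> (node i x)"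
      "\<forall>l\<in>{0..1}. compressible (det_const TYPE('n)) (\<lambda>x. x + l *\<^sub>R (\<Psi> x - x))"
      using theta_node_step[OF i(1)] by (elim exE conjE)
    have "compressible (L * det_const TYPE('n)) (\<lambda>x. node i x + l *\<^sub>R (\<Psi> (node i x) - node i x))"
    proof (rule compressible_comp[OF _ \<Psi>(2)[rule_format]])
      show "compressible L (node i)" unfolding L_def
        by (rule compressible_mono[OF node_compressible power_increasing]) (use kappa_nonneg i in auto)
    qed (use l L det_const_pos[where 'n='n] in auto)
    then have "compressible (det_const TYPE('n) * L) (theta_flow h \<theta> f s)"
      unfolding flow[abs_def] \<Psi>(1)[rule_format] by (simp only: mult.commute)
    moreover have "norm (theta_flow h \<theta> f s x - scheme_position s x) \<le> 1 * (M * h)"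
      unfolding flow scheme_position_def i(2) add_diff_cancel_left' norm_scaleR
      using l node_step_norm[OF i(1)] by (intro mult_mono) auto
    ultimately show ?thesis by simp
  qed
  then show "compressible (det_const TYPE('n) * (1 + 4 * \<kappa>) ^ N) (theta_flow h \<theta> f s)"
    and "norm (theta_flow h \<theta> f s x - scheme_position s x) \<le> M * h" unfolding L_def by simp_all
qed

text \<open>What the stability estimate has to know of the scheme: \<open>U\<close> is the piecewise
  constant position at which the field is evaluated, \<open>V\<close> a velocity almost equal to the
  field there, and both the path driven by \<open>V\<close> and the interpolated flow stay within
  \<open>M * h\<close> of \<open>U\<close>.\<close>

lemma theta_scheme:
  "\<exists>U V. jointly_borel U \<and> jointly_borel V \<and>
    (\<forall>\<tau>. compressible ((1 + 4 * \<kappa>) ^ N) (U \<tau>)) \<and> (\<forall>\<tau> x. norm (V \<tau> x) \<le> M) \<and>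
    (\<forall>\<tau>\<in>{0..<T}. \<forall>x. norm (V \<tau> x - a \<tau> (U \<tau> x)) \<le> K * (M * h)) \<and>
    (\<forall>s\<in>{0..T}. \<forall>x. norm (x + (LINT \<tau>|lborel. indicator {0..s} \<tau> *\<^sub>R V \<tau> x) - U s x) \<le> M * h) \<and>
    (\<forall>s\<in>{0..T}. compressible (det_const TYPE('n) * (1 + 4 * \<kappa>) ^ N) (theta_flow h \<theta> f s) \<and>
       (\<forall>x. norm (theta_flow h \<theta> f s x - U s x) \<le> M * h))"
  using scheme_position_measurable scheme_velocity_measurable scheme_position_compressible scheme_velocity_norm
    scheme_velocity_close scheme_path_close theta_flow_compressible
  by (intro exI[of _ scheme_position] exI[of _ scheme_velocity]) simp

end

section \<open>The logarithmic stability estimate\<close>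

text \<open>Formally, the derivative of ln(\<delta> + |w|) is at most |v| / (\<delta> + |w|). As
  \<open>w\<close> is only an indefinite integral, differentiation is avoided: on a fine partition
  |w| varies by less than \<epsilon> \<delta>, so by ln x \<le> x - 1 every increment of the
  logarithm is at most 1 + \<epsilon> times the increment of \<open>R\<close>, and \<epsilon> is
  arbitrary.\<close>

lemma log_gronwall:
  fixes v :: "real \<Rightarrow> 'b::euclidean_space"
  assumes v: "integrable lborel (\<lambda>\<tau>. indicator {0..s} \<tau> *\<^sub>R v \<tau>)" and s: "0 \<le> s" and \<delta>: "0 < \<delta>"
    and w: "\<And>r. w r = (LINT \<tau>|lborel. indicator {0..r} \<tau> *\<^sub>R v \<tau>)"
  shows "ennreal (ln (1 + norm (w s) / \<delta>)) \<le> (\<integral>\<^sup>+\<tau>\<in>{0..s}. ennreal (norm (v \<tau>) / (\<delta> + norm (w \<tau>))) \<partial>lborel)"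
proof -
  define \<psi> where "\<psi> r = norm (w r)" for r
  have vI: "set_integrable lborel {0..s} v" using v by (simp add: set_integrable_def)
  have wHK: "w r = integral {0..r} v" if "r \<in> {0..s}" for r
  proof -
    have "set_integrable lborel {0..r} v"
      by (rule set_integrable_subset[OF vI]) (use that in auto)
    from set_borel_integral_eq_integral(2)[OF this] show ?thesis
      by (simp add: w set_lebesgue_integral_def)
  qed
  have "continuous_on {0..s} (\<lambda>r. integral {0..r} v)"
    by (rule indefinite_integral_continuous_1[OF set_borel_integral_eq_integral(1)[OF vI]])
  then have "continuous_on {0..s} w" by (rule continuous_on_eq) (simp add: wHK)
  then have c\<psi>: "continuous_on {0..s} \<psi>" unfolding \<psi>_def[abs_def] by (rule continuous_on_norm)
  have \<psi>0: "0 \<le> \<psi> r" for r by (simp add: \<psi>_def)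
  have pos: "0 < \<delta> + \<psi> r" for r using \<delta> \<psi>0[of r] by linarith
  define f where "f \<tau> = norm (v \<tau>) / (\<delta> + \<psi> \<tau>)" for \<tau>
  have nvI: "integrable lborel (\<lambda>\<tau>. indicator {0..s} \<tau> *\<^sub>R norm (v \<tau>))"
    using integrable_norm[OF v] by simp
  have fI: "integrable lborel (\<lambda>\<tau>. indicator {0..s} \<tau> *\<^sub>R f \<tau>)"
  proof (rule Bochner_Integration.integrable_bound)
    show "integrable lborel (\<lambda>\<tau>. (1 / \<delta>) * (indicator {0..s} \<tau> *\<^sub>R norm (v \<tau>)))"
      by (rule integrable_mult_right[OF nvI])
    have "continuous_on {0..s} (\<lambda>\<tau>. 1 / (\<delta> + \<psi> \<tau>))"
      using pos by (intro continuous_intros c\<psi>) (metis less_irrefl)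
    then have "(\<lambda>\<tau>. indicator {0..s} \<tau> *\<^sub>R (1 / (\<delta> + \<psi> \<tau>))) \<in> borel_measurable borel"
      by (rule borel_measurable_continuous_on_indicator[rotated]) simp
    then have "(\<lambda>\<tau>. (indicator {0..s} \<tau> *\<^sub>R norm (v \<tau>)) * (indicator {0..s} \<tau> *\<^sub>R (1 / (\<delta> + \<psi> \<tau>)))) \<in> borel_measurable lborel"
      by (intro borel_measurable_times borel_measurable_integrable[OF nvI]) simp
    moreover have "(\<lambda>\<tau>. (indicator {0..s} \<tau> *\<^sub>R norm (v \<tau>)) * (indicator {0..s} \<tau> *\<^sub>R (1 / (\<delta> + \<psi> \<tau>)))) = (\<lambda>\<tau>. indicator {0..s} \<tau> *\<^sub>R f \<tau>)"
      by (auto simp: f_def indicator_def)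
    ultimately show "(\<lambda>\<tau>. indicator {0..s} \<tau> *\<^sub>R f \<tau>) \<in> borel_measurable lborel" by simp
    have "norm (v \<tau>) / (\<delta> + \<psi> \<tau>) \<le> norm (v \<tau>) / \<delta>" for \<tau>
      using \<delta> \<psi>0[of \<tau>] by (intro divide_left_mono mult_pos_pos pos) simp_all
    then show "AE \<tau> in lborel. norm (indicator {0..s} \<tau> *\<^sub>R f \<tau>) \<le> norm ((1 / \<delta>) * (indicator {0..s} \<tau> *\<^sub>R norm (v \<tau>)))"
      using \<delta> pos by (intro AE_I2) (simp add: f_def indicator_def abs_of_pos)
  qed
  define R where "R r = (LINT \<tau>|lborel. indicator {0..r} \<tau> *\<^sub>R f \<tau>)" for r
  have f0: "0 \<le> f \<tau>" for \<tau> unfolding f_def using pos[of \<tau>] by simp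
  have R0: "0 \<le> R s" unfolding R_def using f0 by (intro integral_nonneg_AE) simp
  have main: "ln (\<delta> + \<psi> s) - ln \<delta> \<le> (1 + \<epsilon>) * R s" if \<epsilon>: "0 < \<epsilon>" for \<epsilon>
  proof -
    have uc: "uniformly_continuous_on {0..s} \<psi>" by (rule compact_uniformly_continuous[OF c\<psi>]) simp
    have "0 < \<epsilon> * \<delta>" using \<epsilon> \<delta> by simp
    with uc obtain d where d: "0 < d" "\<And>r r'. r \<in> {0..s} \<Longrightarrow> r' \<in> {0..s} \<Longrightarrow> dist r' r < d \<Longrightarrow> dist (\<psi> r') (\<psi> r) < \<epsilon> * \<delta>"
      unfolding uniformly_continuous_on_def by blast
    obtain n :: nat where n: "s / d < real n" using reals_Archimedean2 by blast
    define n' where "n' = Suc n"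
    have n': "s / real n' < d" "0 < n'"
    proof -
      have "s < real n * d" using n d by (simp add: divide_less_eq)
      also have "\<dots> \<le> real n' * d" using d by (simp add: n'_def)
      finally show "s / real n' < d" by (simp add: divide_less_eq n'_def mult.commute)
    qed (simp add: n'_def)
    define r where "r k = real k * (s / real n')" for k :: nat
    have rmono: "r k \<le> r (Suc k)" for k unfolding r_def using s by (intro mult_right_mono) simp_all
    have r0: "0 \<le> r k" for k unfolding r_def using s by simp
    have rs: "r k \<le> s" if "k \<le> n'" for k
    proof -
      have "r k \<le> real n' * (s / real n')" unfolding r_def using that s by (intro mult_right_mono) simp_all
      then show ?thesis using n' by simp
    qed
    have rn: "r n' = s" using n' by (simp add: r_def)
    have step: "ln (\<delta> + \<psi> (r (Suc k))) - ln (\<delta> + \<psi> (r k)) \<le> (1 + \<epsilon>) * (R (r (Suc k)) - R (r k))" if k: "Suc k \<le> n'" for k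
    proof -
      let ?J = "{r k..r (Suc k)}"
      have sub0: "integrable lborel (\<lambda>\<tau>. indicator {0..r (Suc k)} \<tau> *\<^sub>R q \<tau>)" if "integrable lborel (\<lambda>\<tau>. indicator {0..s} \<tau> *\<^sub>R q \<tau>)" for q :: "real \<Rightarrow> 'c::euclidean_space"
        by (rule integral_Icc_split(1)[OF that r0 rs[OF k]])
      note spl = integral_Icc_split(2,3)[OF sub0 r0 rmono]
      have "\<psi> (r (Suc k)) - \<psi> (r k) \<le> norm (w (r (Suc k)) - w (r k))" unfolding \<psi>_def by (rule norm_triangle_ineq2)
      also have "w (r (Suc k)) - w (r k) = (LINT \<tau>|lborel. indicator ?J \<tau> *\<^sub>R v \<tau>)"
        unfolding w using spl(2)[OF v] by simp
      also have "norm \<dots> \<le> (LINT \<tau>|lborel. indicator ?J \<tau> *\<^sub>R norm (v \<tau>))"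
        using integral_norm_bound[of lborel "\<lambda>\<tau>. indicator ?J \<tau> *\<^sub>R v \<tau>"] by simp
      finally have 1: "\<psi> (r (Suc k)) - \<psi> (r k) \<le> (LINT \<tau>|lborel. indicator ?J \<tau> *\<^sub>R norm (v \<tau>))" .
      have pt: "norm (v \<tau>) \<le> ((1 + \<epsilon>) * (\<delta> + \<psi> (r k))) * f \<tau>" if \<tau>: "\<tau> \<in> ?J" for \<tau>
      proof -
        have rk: "r k \<in> {0..s}" and \<tau>s: "\<tau> \<in> {0..s}" using r0[of k] rs[OF k] rmono[of k] \<tau> by auto
        have "dist \<tau> (r k) \<le> r (Suc k) - r k" using \<tau> by (simp add: dist_real_def)
        also have "\<dots> = s / real n'" by (simp add: r_def algebra_simps flip: add_divide_distrib)
        finally have "dist \<tau> (r k) < d" using n' by simp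
        from d(2)[OF rk \<tau>s this] have "\<psi> \<tau> \<le> \<psi> (r k) + \<epsilon> * \<delta>" by (simp add: dist_real_def)
        moreover have "0 \<le> \<epsilon> * \<psi> (r k)" using \<epsilon> \<psi>0 by simp
        ultimately have "\<delta> + \<psi> \<tau> \<le> (1 + \<epsilon>) * (\<delta> + \<psi> (r k))" by (simp add: algebra_simps)
        then have "(\<delta> + \<psi> \<tau>) * f \<tau> \<le> ((1 + \<epsilon>) * (\<delta> + \<psi> (r k))) * f \<tau>" using f0 by (rule mult_right_mono)
        moreover have "(\<delta> + \<psi> \<tau>) * f \<tau> = norm (v \<tau>)" using pos[of \<tau>] by (simp add: f_def)
        ultimately show ?thesis by simp
      qed
      have "(LINT \<tau>|lborel. indicator ?J \<tau> *\<^sub>R norm (v \<tau>)) \<le> (LINT \<tau>|lborel. ((1 + \<epsilon>) * (\<delta> + \<psi> (r k))) * (indicator ?J \<tau> *\<^sub>R f \<tau>))"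
      proof (rule integral_mono)
        show "integrable lborel (\<lambda>\<tau>. indicator ?J \<tau> *\<^sub>R norm (v \<tau>))" by (rule spl(1)[OF nvI])
        show "integrable lborel (\<lambda>\<tau>. ((1 + \<epsilon>) * (\<delta> + \<psi> (r k))) * (indicator ?J \<tau> *\<^sub>R f \<tau>))"
          by (intro integrable_mult_right spl(1)[OF fI])
        show "indicator ?J \<tau> *\<^sub>R norm (v \<tau>) \<le> ((1 + \<epsilon>) * (\<delta> + \<psi> (r k))) * (indicator ?J \<tau> *\<^sub>R f \<tau>)" for \<tau>
          using pt[of \<tau>] by (cases "\<tau> \<in> ?J") simp_all
      qed
      also have "\<dots> = ((1 + \<epsilon>) * (\<delta> + \<psi> (r k))) * (R (r (Suc k)) - R (r k))"
        unfolding R_def using spl(2)[OF fI] by simp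
      finally have 2: "\<psi> (r (Suc k)) - \<psi> (r k) \<le> (\<delta> + \<psi> (r k)) * ((1 + \<epsilon>) * (R (r (Suc k)) - R (r k)))"
        using 1 by (simp add: mult_ac)
      have "ln (\<delta> + \<psi> (r (Suc k))) - ln (\<delta> + \<psi> (r k)) = ln ((\<delta> + \<psi> (r (Suc k))) / (\<delta> + \<psi> (r k)))"
        using pos[of "r (Suc k)"] pos[of "r k"] by (subst ln_div) auto
      also have "\<dots> \<le> (\<delta> + \<psi> (r (Suc k))) / (\<delta> + \<psi> (r k)) - 1"
        using pos by (intro ln_le_minus_one divide_pos_pos)
      also have "\<dots> = (\<psi> (r (Suc k)) - \<psi> (r k)) / (\<delta> + \<psi> (r k))"
        using pos[of "r k"] by (simp add: field_simps)
      also have "\<dots> \<le> (1 + \<epsilon>) * (R (r (Suc k)) - R (r k))"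
        using 2 pos[of "r k"] by (simp add: pos_divide_le_eq mult.commute)
      finally show ?thesis .
    qed
    have z: "(LINT \<tau>|lborel. indicator {0..r 0} \<tau> *\<^sub>R q \<tau>) = 0" for q :: "real \<Rightarrow> 'c::euclidean_space"
    proof (rule integral_eq_zero_AE)
      have "AE \<tau> in lborel. \<tau> \<noteq> (0::real)" by (rule AE_lborel_singleton)
      then show "AE \<tau> in lborel. indicator {0..r 0} \<tau> *\<^sub>R q \<tau> = 0" by eventually_elim (simp add: r_def)
    qed
    have "ln (\<delta> + \<psi> (r k)) - ln \<delta> \<le> (1 + \<epsilon>) * R (r k)" if "k \<le> n'" for k
      using that
    proof (induction k)
      case 0
      have "\<psi> (r 0) = 0" unfolding \<psi>_def w z by simp
      moreover have "R (r 0) = 0" unfolding R_def by (rule z)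
      ultimately show ?case by simp
    next
      case (Suc k)
      then show ?case using step[OF Suc.prems] by (simp add: right_diff_distrib)
    qed
    from this[of n'] show ?thesis by (simp add: rn)
  qed
  have "ln (\<delta> + \<psi> s) - ln \<delta> \<le> R s"
  proof (rule field_le_epsilon)
    fix e :: real assume e: "0 < e"
    have "ln (\<delta> + \<psi> s) - ln \<delta> \<le> (1 + e / (R s + 1)) * R s" using e R0 by (intro main) simp
    also have "\<dots> = R s + e * (R s / (R s + 1))" by (simp add: algebra_simps)
    also have "\<dots> \<le> R s + e * 1" using e R0 by (intro add_left_mono mult_left_mono) simp_all
    finally show "ln (\<delta> + \<psi> s) - ln \<delta> \<le> R s + e" by simp
  qed
  moreover have "ln (1 + \<psi> s / \<delta>) = ln (\<delta> + \<psi> s) - ln \<delta>"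
  proof -
    have "1 + \<psi> s / \<delta> = (\<delta> + \<psi> s) / \<delta>" using \<delta> by (simp add: field_simps)
    then show ?thesis using pos[of s] \<delta> by (simp add: ln_div)
  qed
  ultimately have "ennreal (ln (1 + \<psi> s / \<delta>)) \<le> ennreal (R s)" by (simp add: ennreal_leI)
  also have "\<dots> = (\<integral>\<^sup>+\<tau>. ennreal (indicator {0..s} \<tau> *\<^sub>R f \<tau>) \<partial>lborel)"
    unfolding R_def using f0 by (intro nn_integral_eq_integral[symmetric] fI) simp
  also have "\<dots> = (\<integral>\<^sup>+\<tau>\<in>{0..s}. ennreal (f \<tau>) \<partial>lborel)"
    by (intro nn_integral_cong) (simp add: indicator_def)
  finally show ?thesis unfolding f_def \<psi>_def .
qed

lemma borel_measurable_along:
  assumes f: "jointly_borel f" and U: "jointly_borel U"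
  shows "(\<lambda>z. f (fst z) (U (fst z) (snd z) :: 'a::euclidean_space)) \<in> borel_measurable (borel :: (real \<times> 'a) measure)"
  using measurable_compose[OF borel_measurable_Pair[OF borel_measurable_fst_borel U] f] by simp

text \<open>The velocity difference splits into the scheme error \<open>\<eta>'\<close>, the
  regularisation error of \<open>a\<close> against \<open>c\<close> at \<open>U\<close>, and the
  difference of \<open>c\<close> at \<open>U\<close> and at \<open>W\<close>. The first two are
  divided by \<open>\<delta>\<close>, so \<open>\<delta>\<close> is later taken of at least their
  order. The last is bounded by |U - W| times maximal functions, and |U - W| is at most the
  denominator \<delta> + |Z - W|; what remains is independent of \<open>\<delta>\<close>.\<close>

lemma flow_stability:
  fixes a c U V W :: "real \<Rightarrow> real^'n \<Rightarrow> real^'n" and g :: "real \<Rightarrow> real^'n \<Rightarrow> ennreal"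
  assumes t: "0 \<le> t"
    and am: "jointly_borel a" and cm: "jointly_borel c"
    and Um: "jointly_borel U" and Vm: "jointly_borel V"
    and Wm: "jointly_borel W" and gm: "jointly_borel g"
    and U: "\<And>\<tau>. \<tau> \<in> {0<..<t} \<Longrightarrow> compressible L1 (U \<tau>)" "0 \<le> L1" and W: "\<And>\<tau>. \<tau> \<in> {0<..<t} \<Longrightarrow> compressible L2 (W \<tau>)"
    and V: "\<And>\<tau> x. norm (V \<tau> x) \<le> M" and VU: "\<And>\<tau> x. \<tau> \<in> {0<..<t} \<Longrightarrow> norm (V \<tau> x - a \<tau> (U \<tau> x)) \<le> \<eta>'"
    and Z: "\<And>s x. Z s x = x + (LINT \<tau>|lborel. indicator {0..s} \<tau> *\<^sub>R V \<tau> x)"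
    and ZU: "\<And>s x. s \<in> {0..t} \<Longrightarrow> norm (Z s x - U s x) \<le> \<eta>"
    and flow: "AE x in lborel. \<forall>s\<in>{0..t}. integrable lborel (\<lambda>\<tau>. indicator {0..s} \<tau> *\<^sub>R c \<tau> (W \<tau> x)) \<and>
      W s x = x + (LINT \<tau>|lborel. indicator {0..s} \<tau> *\<^sub>R c \<tau> (W \<tau> x))"
    and err: "(\<integral>\<^sup>+\<tau>\<in>{0<..<t}. (\<integral>\<^sup>+y. ennreal (norm (a \<tau> y - c \<tau> y)) \<partial>lborel) \<partial>lborel) \<le> ennreal E0" "0 \<le> E0"
    and haj: "AE \<tau> in lborel. \<tau> \<in> {0<..<t} \<longrightarrow> hajlasz_bound k (c \<tau>) (g \<tau>)" and k: "0 \<le> k"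
    and E: "E \<in> sets borel" "emeasure lborel E = ennreal e" "0 \<le> e"
    and gU: "(\<integral>\<^sup>+\<tau>\<in>{0<..<t}. (\<integral>\<^sup>+x\<in>E. g \<tau> (U \<tau> x) \<partial>lborel) \<partial>lborel) \<le> ennreal \<Gamma>1" "0 \<le> \<Gamma>1"
    and gW: "(\<integral>\<^sup>+\<tau>\<in>{0<..<t}. (\<integral>\<^sup>+x\<in>E. g \<tau> (W \<tau> x) \<partial>lborel) \<partial>lborel) \<le> ennreal \<Gamma>2" "0 \<le> \<Gamma>2"
    and \<delta>: "0 < \<delta>" "\<eta> \<le> \<delta>" and \<eta>': "0 \<le> \<eta>'" and s: "s \<in> {0..t}"
  shows "(\<integral>\<^sup>+x\<in>E. ennreal (ln (1 + norm (Z s x - W s x) / \<delta>)) \<partial>lborel) \<le>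
     ennreal ((\<eta>' * t * e + L1 * E0) / \<delta> + k * (\<Gamma>1 + \<Gamma>2))"
proof -
  let ?J = "{0<..<t}"
  note cU = borel_measurable_along[OF cm Um] and cW = borel_measurable_along[OF cm Wm] and aU = borel_measurable_along[OF am Um]
    and gUm = borel_measurable_along[OF gm Um] and gWm = borel_measurable_along[OF gm Wm]
  \<comment> \<open>The pointwise inequality fails on null sets that depend on the time. Compression
    keeps almost every point of both flows off them at each time; exchanging quantifiers gives, for
    almost every starting point, validity at almost every time.\<close>
  define P where "P \<tau> x \<longleftrightarrow> (\<tau> \<in> ?J \<longrightarrow> ennreal (norm (c \<tau> (U \<tau> x) - c \<tau> (W \<tau> x))) \<le>
     ennreal (k * norm (U \<tau> x - W \<tau> x)) * (g \<tau> (U \<tau> x) + g \<tau> (W \<tau> x)))" for \<tau> x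
  have jm: "Measurable.pred borel (\<lambda>z :: real \<times> (real^'n). fst z \<in> ?J)"
    using measurable_sets[OF borel_measurable_fst_borel, of ?J] by (simp add: pred_def vimage_def)
  have lm: "(\<lambda>z. ennreal (norm (c (fst z) (U (fst z) (snd z)) - c (fst z) (W (fst z) (snd z))))) \<in> borel_measurable borel"
    using cU cW by simp
  have rm: "(\<lambda>z. ennreal (k * norm (U (fst z) (snd z) - W (fst z) (snd z))) * (g (fst z) (U (fst z) (snd z)) + g (fst z) (W (fst z) (snd z)))) \<in> borel_measurable borel"
    using Um Wm gUm gWm by (intro borel_measurable_times_ennreal borel_measurable_add) simp_all
  have "Measurable.pred borel (\<lambda>z. P (fst z) (snd z))"
    unfolding P_def using jm borel_measurable_le[OF lm rm] by (intro pred_intros_logic) (simp_all add: pred_def)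
  moreover have "AE \<tau> in lborel. AE x in lborel. P \<tau> x"
    using haj
  proof eventually_elim
    case (elim \<tau>)
    show ?case
    proof (cases "\<tau> \<in> ?J")
      case True
      with elim obtain N where N: "N \<in> null_sets lborel" "\<forall>x y. x \<notin> N \<longrightarrow> y \<notin> N \<longrightarrow>
         ennreal (norm (c \<tau> x - c \<tau> y)) \<le> ennreal (k * norm (x - y)) * (g \<tau> x + g \<tau> y)" by blast
      have "AE y in lborel. y \<notin> N" using N(1) by (rule AE_not_in)
      then have "AE x in lborel. U \<tau> x \<notin> N" "AE x in lborel. W \<tau> x \<notin> N"
        using compressible_AE[OF U(1)[OF True]] compressible_AE[OF W[OF True]] by blast+
      then show ?thesis by eventually_elim (use N(2) in \<open>simp add: P_def\<close>)
    next
      case False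
      then have "P \<tau> x" for x unfolding P_def by blast
      then show ?thesis by (intro AE_I2)
    qed
  qed
  ultimately have AEP: "AE x in lborel. AE \<tau> in lborel. P \<tau> x" by (rule AE_lborel_swap)
  \<comment> \<open>The four contributions: scheme error, regularisation error, and the maximal
    functions along \<open>U\<close> and along \<open>W\<close>.\<close>
  define H1 where "H1 \<tau> x = ennreal (\<eta>' / \<delta>)" for \<tau> :: real and x :: "real^'n"
  define H2 where "H2 \<tau> x = ennreal (1 / \<delta>) * ennreal (norm (a \<tau> (U \<tau> x) - c \<tau> (U \<tau> x)))" for \<tau> x
  define H3 where "H3 \<tau> x = ennreal k * g \<tau> (U \<tau> x)" for \<tau> x
  define H4 where "H4 \<tau> x = ennreal k * g \<tau> (W \<tau> x)" for \<tau> x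
  have pt: "AE x in lborel. ennreal (ln (1 + norm (Z s x - W s x) / \<delta>)) \<le> (\<integral>\<^sup>+\<tau>\<in>?J. (H1 \<tau> x + H2 \<tau> x + (H3 \<tau> x + H4 \<tau> x)) \<partial>lborel)"
    using flow AEP
  proof eventually_elim
    case (elim x)
    define v where "v \<tau> = V \<tau> x - c \<tau> (W \<tau> x)" for \<tau>
    define w where "w r = (LINT \<tau>|lborel. indicator {0..r} \<tau> *\<^sub>R v \<tau>)" for r
    have Vs: "(\<lambda>\<tau>. V \<tau> x) \<in> borel_measurable borel" using borel_sections(1)[OF Vm, of x] by simp
    have weq: "w r = Z r x - W r x" "integrable lborel (\<lambda>\<tau>. indicator {0..r} \<tau> *\<^sub>R v \<tau>)" if r: "r \<in> {0..t}" for r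
    proof -
      have i1: "integrable lborel (\<lambda>\<tau>. indicator {0..r} \<tau> *\<^sub>R V \<tau> x)"
        by (rule integral_Icc_bounded(1)[OF Vs V]) (use r in simp)
      have i2: "integrable lborel (\<lambda>\<tau>. indicator {0..r} \<tau> *\<^sub>R c \<tau> (W \<tau> x))"
        and Wr: "W r x = x + (LINT \<tau>|lborel. indicator {0..r} \<tau> *\<^sub>R c \<tau> (W \<tau> x))" using elim(1) r by blast+
      show "integrable lborel (\<lambda>\<tau>. indicator {0..r} \<tau> *\<^sub>R v \<tau>)"
        unfolding v_def scaleR_diff_right by (rule Bochner_Integration.integrable_diff[OF i1 i2])
      have "w r = (LINT \<tau>|lborel. indicator {0..r} \<tau> *\<^sub>R V \<tau> x) - (LINT \<tau>|lborel. indicator {0..r} \<tau> *\<^sub>R c \<tau> (W \<tau> x))"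
        unfolding w_def v_def scaleR_diff_right by (rule Bochner_Integration.integral_diff[OF i1 i2])
      then show "w r = Z r x - W r x" unfolding Z Wr by simp
    qed
    have s0: "0 \<le> s" using s by simp
    have "ennreal (ln (1 + norm (w s) / \<delta>)) \<le> (\<integral>\<^sup>+\<tau>\<in>{0..s}. ennreal (norm (v \<tau>) / (\<delta> + norm (w \<tau>))) \<partial>lborel)"
      by (rule log_gronwall[OF weq(2)[OF s] s0 \<delta>(1) w_def])
    also have "\<dots> \<le> (\<integral>\<^sup>+\<tau>\<in>?J. (H1 \<tau> x + H2 \<tau> x + (H3 \<tau> x + H4 \<tau> x)) \<partial>lborel)"
    proof (rule nn_integral_mono_AE)
      have "AE \<tau> in lborel. \<tau> \<noteq> 0" "AE \<tau> in lborel. \<tau> \<noteq> t" by (rule AE_lborel_singleton)+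
      with elim(2) show "AE \<tau> in lborel. ennreal (norm (v \<tau>) / (\<delta> + norm (w \<tau>))) * indicator {0..s} \<tau> \<le>
        (H1 \<tau> x + H2 \<tau> x + (H3 \<tau> x + H4 \<tau> x)) * indicator ?J \<tau>"
      proof eventually_elim
        case (elim \<tau>)
        show ?case
        proof (cases "\<tau> \<in> {0..s}")
          case True
          then have \<tau>J: "\<tau> \<in> ?J" using elim s by auto
          then have \<tau>t: "\<tau> \<in> {0..t}" by auto
          define D where "D = \<delta> + norm (w \<tau>)"
          have D: "0 < D" "\<delta> \<le> D" using \<delta> by (simp_all add: D_def add_pos_nonneg)
          \<comment> \<open>This is where \<open>\<eta> \<le> \<delta>\<close> enters: the field is
            evaluated at \<open>U\<close>, whereas the functional measures the distance from the
            driven path \<open>Z\<close> to \<open>W\<close>.\<close>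
          have UW: "norm (U \<tau> x - W \<tau> x) \<le> D"
          proof -
            have "U \<tau> x - W \<tau> x = (Z \<tau> x - W \<tau> x) - (Z \<tau> x - U \<tau> x)" by simp
            then have "norm (U \<tau> x - W \<tau> x) \<le> norm (w \<tau>) + norm (Z \<tau> x - U \<tau> x)"
              unfolding weq(1)[OF \<tau>t] by (metis norm_triangle_ineq4)
            then show ?thesis using ZU[OF \<tau>t, of x] \<delta>(2) by (simp add: D_def)
          qed
          define q1 where "q1 = norm (a \<tau> (U \<tau> x) - c \<tau> (U \<tau> x))"
          define q2 where "q2 = norm (c \<tau> (U \<tau> x) - c \<tau> (W \<tau> x))"
          have "v \<tau> = (V \<tau> x - a \<tau> (U \<tau> x)) + ((a \<tau> (U \<tau> x) - c \<tau> (U \<tau> x)) + (c \<tau> (U \<tau> x) - c \<tau> (W \<tau> x)))"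
            by (simp add: v_def)
          then have "norm (v \<tau>) \<le> norm (V \<tau> x - a \<tau> (U \<tau> x)) + norm ((a \<tau> (U \<tau> x) - c \<tau> (U \<tau> x)) + (c \<tau> (U \<tau> x) - c \<tau> (W \<tau> x)))"
            by (metis norm_triangle_ineq)
          also have "\<dots> \<le> \<eta>' + (q1 + q2)"
            unfolding q1_def q2_def by (intro add_mono VU[OF \<tau>J] norm_triangle_ineq)
          finally have "norm (v \<tau>) / D \<le> (\<eta>' + (q1 + q2)) / D" using D by (simp add: divide_right_mono)
          also have "\<dots> = \<eta>' / D + (q1 / D + q2 / D)" by (simp add: add_divide_distrib)
          also have "\<dots> \<le> \<eta>' / \<delta> + (1 / \<delta> * q1 + q2 / D)"
          proof (intro add_mono order_refl)
            show "\<eta>' / D \<le> \<eta>' / \<delta>" using D \<delta> \<eta>' by (intro divide_left_mono mult_pos_pos) simp_all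
            have "q1 / D \<le> q1 / \<delta>" using D \<delta> by (intro divide_left_mono mult_pos_pos) (simp_all add: q1_def)
            then show "q1 / D \<le> 1 / \<delta> * q1" by simp
          qed
          finally have "ennreal (norm (v \<tau>) / D) \<le> ennreal (\<eta>' / \<delta> + (1 / \<delta> * q1 + q2 / D))" by (rule ennreal_leI)
          also have "\<dots> = H1 \<tau> x + (H2 \<tau> x + ennreal (q2 / D))"
          proof -
            have "ennreal (A + (B * q1 + C)) = ennreal A + (ennreal B * ennreal q1 + ennreal C)"
              if "0 \<le> A" "0 \<le> B" "0 \<le> C" for A B C using that by (simp add: ennreal_mult q1_def)
            from this[of "\<eta>' / \<delta>" "1 / \<delta>" "q2 / D"] show ?thesis
              using \<delta> \<eta>' D by (simp add: H1_def H2_def q1_def[symmetric]) (simp add: q2_def)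
          qed
          also have "ennreal (q2 / D) \<le> H3 \<tau> x + H4 \<tau> x"
          proof -
            have "ennreal q2 \<le> ennreal (k * norm (U \<tau> x - W \<tau> x)) * (g \<tau> (U \<tau> x) + g \<tau> (W \<tau> x))"
              using elim(1) \<tau>J unfolding P_def q2_def by simp
            then have "ennreal (1 / D) * ennreal q2 \<le> ennreal (1 / D) * (ennreal (k * norm (U \<tau> x - W \<tau> x)) * (g \<tau> (U \<tau> x) + g \<tau> (W \<tau> x)))"
              by (intro mult_left_mono) simp_all
            also have "\<dots> = ennreal (1 / D * (k * norm (U \<tau> x - W \<tau> x))) * (g \<tau> (U \<tau> x) + g \<tau> (W \<tau> x))"
              using D k by (subst ennreal_mult) (simp_all add: mult.assoc)
            also have "\<dots> \<le> ennreal k * (g \<tau> (U \<tau> x) + g \<tau> (W \<tau> x))"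
            proof (intro mult_right_mono ennreal_leI)
              show "1 / D * (k * norm (U \<tau> x - W \<tau> x)) \<le> k"
                using mult_left_mono[OF UW k] D by (simp add: divide_le_eq)
            qed simp
            also have "\<dots> = H3 \<tau> x + H4 \<tau> x" by (simp add: H3_def H4_def distrib_left)
            also have "ennreal (1 / D) * ennreal q2 = ennreal (q2 / D)"
              using D by (simp add: ennreal_mult[symmetric] q2_def)
            finally show ?thesis .
          qed
          finally have "ennreal (norm (v \<tau>) / D) \<le> H1 \<tau> x + (H2 \<tau> x + (H3 \<tau> x + H4 \<tau> x))" by (simp add: add_left_mono)
          then show ?thesis using True \<tau>J by (simp add: D_def add.assoc)
        qed simp
      qed
    qed
    finally show ?case by (simp only: weq(1)[OF s])
  qed
  define ind where "ind \<tau> x = (indicator ?J \<tau> * indicator E x :: ennreal)" for \<tau> :: real and x :: "real^'n"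
  have indm: "(\<lambda>z :: real \<times> (real^'n). ind (fst z) (snd z)) \<in> borel_measurable borel"
    unfolding ind_def
    by (intro borel_measurable_times_ennreal measurable_compose[OF borel_measurable_fst_borel borel_measurable_indicator]
        measurable_compose[OF borel_measurable_snd_borel borel_measurable_indicator] E(1)) simp
  have H1m: "jointly_borel H1" by (simp add: H1_def)
  have H2m: "jointly_borel H2"
    unfolding H2_def using aU cU by (intro borel_measurable_times_ennreal) simp_all
  have H3m: "jointly_borel H3" unfolding H3_def by (intro borel_measurable_times_ennreal gUm) simp
  have H4m: "jointly_borel H4" unfolding H4_def by (intro borel_measurable_times_ennreal gWm) simp
  have "(\<integral>\<^sup>+x\<in>E. ennreal (ln (1 + norm (Z s x - W s x) / \<delta>)) \<partial>lborel) \<le>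
     (\<integral>\<^sup>+x. (\<integral>\<^sup>+\<tau>. (H1 \<tau> x + H2 \<tau> x + (H3 \<tau> x + H4 \<tau> x)) * ind \<tau> x \<partial>lborel) \<partial>lborel)"
  proof (rule nn_integral_mono_AE)
    show "AE x in lborel. ennreal (ln (1 + norm (Z s x - W s x) / \<delta>)) * indicator E x \<le>
      (\<integral>\<^sup>+\<tau>. (H1 \<tau> x + H2 \<tau> x + (H3 \<tau> x + H4 \<tau> x)) * ind \<tau> x \<partial>lborel)"
      using pt by eventually_elim (simp add: ind_def indicator_def)
  qed
  also have "\<dots> = (\<integral>\<^sup>+\<tau>. (\<integral>\<^sup>+x. (H1 \<tau> x + H2 \<tau> x + (H3 \<tau> x + H4 \<tau> x)) * ind \<tau> x \<partial>lborel) \<partial>lborel)"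
    by (rule nn_integral_lborel_Tonelli(1)) (intro borel_measurable_times_ennreal borel_measurable_add H1m H2m H3m H4m indm)
  also have "\<dots> = (\<integral>\<^sup>+z. (H1 (fst z) (snd z) + H2 (fst z) (snd z) + (H3 (fst z) (snd z) + H4 (fst z) (snd z))) * ind (fst z) (snd z) \<partial>lborel)"
    by (rule nn_integral_lborel_Tonelli(2)) (intro borel_measurable_times_ennreal borel_measurable_add H1m H2m H3m H4m indm)
  also have "\<dots> = (\<integral>\<^sup>+z. H1 (fst z) (snd z) * ind (fst z) (snd z) \<partial>lborel) + (\<integral>\<^sup>+z. H2 (fst z) (snd z) * ind (fst z) (snd z) \<partial>lborel)
     + ((\<integral>\<^sup>+z. H3 (fst z) (snd z) * ind (fst z) (snd z) \<partial>lborel) + (\<integral>\<^sup>+z. H4 (fst z) (snd z) * ind (fst z) (snd z) \<partial>lborel))"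
    using borel_measurable_times_ennreal[OF H1m indm] borel_measurable_times_ennreal[OF H2m indm]
      borel_measurable_times_ennreal[OF H3m indm] borel_measurable_times_ennreal[OF H4m indm]
    by (simp only: distrib_right nn_integral_add borel_measurable_add measurable_lborel2)
  also have "\<dots> \<le> ennreal (\<eta>' * t * e / \<delta>) + ennreal (L1 * E0 / \<delta>) + (ennreal (k * \<Gamma>1) + ennreal (k * \<Gamma>2))"
  proof (intro add_mono)
    note ton = nn_integral_lborel_Tonelli(2)[symmetric]
    have "(\<integral>\<^sup>+z. H1 (fst z) (snd z) * ind (fst z) (snd z) \<partial>lborel) = (\<integral>\<^sup>+\<tau>. (\<integral>\<^sup>+x. H1 \<tau> x * ind \<tau> x \<partial>lborel) \<partial>lborel)"
      by (rule ton[OF borel_measurable_times_ennreal[OF H1m indm]])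
    also have "\<dots> = (\<integral>\<^sup>+\<tau>. ennreal (\<eta>' / \<delta>) * ennreal e * indicator ?J \<tau> \<partial>lborel)"
    proof (rule nn_integral_cong)
      fix \<tau> :: real
      have "(\<integral>\<^sup>+x. H1 \<tau> x * ind \<tau> x \<partial>lborel) = (\<integral>\<^sup>+x. (ennreal (\<eta>' / \<delta>) * indicator ?J \<tau>) * indicator E x \<partial>lborel)"
        by (simp add: H1_def ind_def mult.assoc)
      also have "\<dots> = (ennreal (\<eta>' / \<delta>) * indicator ?J \<tau>) * emeasure lborel E"
        using E by (intro nn_integral_cmult_indicator) simp
      finally show "(\<integral>\<^sup>+x. H1 \<tau> x * ind \<tau> x \<partial>lborel) = ennreal (\<eta>' / \<delta>) * ennreal e * indicator ?J \<tau>"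
        using E(2) by (simp add: mult_ac)
    qed
    also have "\<dots> = ennreal (\<eta>' / \<delta>) * ennreal e * ennreal t"
      using t by (subst nn_integral_cmult_indicator) simp_all
    also have "\<dots> = ennreal (\<eta>' * t * e / \<delta>)"
      using \<eta>' \<delta> E t by (simp add: ennreal_mult[symmetric] mult_ac)
    finally show "(\<integral>\<^sup>+z. H1 (fst z) (snd z) * ind (fst z) (snd z) \<partial>lborel) \<le> ennreal (\<eta>' * t * e / \<delta>)" by simp
    define q where "q \<tau> y = ennreal (norm (a \<tau> y - c \<tau> y))" for \<tau> y
    have qm: "jointly_borel q" unfolding q_def using am cm by simp
    have qUm: "(\<lambda>z. q (fst z) (U (fst z) (snd z))) \<in> borel_measurable borel" by (rule borel_measurable_along[OF qm Um])
    have iJm: "(\<lambda>z :: real \<times> (real^'n). indicator ?J (fst z) :: ennreal) \<in> borel_measurable borel"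
      by (rule measurable_compose[OF borel_measurable_fst_borel borel_measurable_indicator]) simp
    have "(\<integral>\<^sup>+z. H2 (fst z) (snd z) * ind (fst z) (snd z) \<partial>lborel) \<le> (\<integral>\<^sup>+z. ennreal (1 / \<delta>) * (q (fst z) (U (fst z) (snd z)) * indicator ?J (fst z)) \<partial>lborel)"
      by (intro nn_integral_mono) (simp add: H2_def q_def ind_def indicator_def)
    also have "\<dots> = ennreal (1 / \<delta>) * (\<integral>\<^sup>+z. q (fst z) (U (fst z) (snd z)) * indicator ?J (fst z) \<partial>lborel)"
      using borel_measurable_times_ennreal[OF qUm iJm] by (intro nn_integral_cmult) simp
    also have "(\<integral>\<^sup>+z. q (fst z) (U (fst z) (snd z)) * indicator ?J (fst z) \<partial>lborel) = (\<integral>\<^sup>+x. (\<integral>\<^sup>+\<tau>\<in>?J. q \<tau> (U \<tau> x) \<partial>lborel) \<partial>lborel)"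
      using nn_integral_lborel_Tonelli[of "\<lambda>\<tau> x. q \<tau> (U \<tau> x) * indicator ?J \<tau>", OF borel_measurable_times_ennreal[OF qUm iJm]] by simp
    also have "\<dots> \<le> ennreal L1 * (\<integral>\<^sup>+\<tau>\<in>?J. (\<integral>\<^sup>+y. q \<tau> y \<partial>lborel) \<partial>lborel)"
      by (rule nn_integral_along_family[OF Um U(1) qm]) simp_all
    also have "\<dots> \<le> ennreal L1 * ennreal E0" using err(1) unfolding q_def by (intro mult_left_mono) simp_all
    finally have "(\<integral>\<^sup>+z. H2 (fst z) (snd z) * ind (fst z) (snd z) \<partial>lborel) \<le> ennreal (1 / \<delta>) * (ennreal L1 * ennreal E0)"
      by (simp add: mult_left_mono)
    also have "\<dots> = ennreal (L1 * E0 / \<delta>)" using \<delta> U(2) err(2) by (simp add: ennreal_mult[symmetric])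
    finally show "(\<integral>\<^sup>+z. H2 (fst z) (snd z) * ind (fst z) (snd z) \<partial>lborel) \<le> ennreal (L1 * E0 / \<delta>)" .
    have G: "(\<integral>\<^sup>+z. (ennreal k * g (fst z) (X (fst z) (snd z))) * ind (fst z) (snd z) \<partial>lborel) \<le> ennreal (k * \<Gamma>)"
      if Xm: "jointly_borel X"
        and X: "(\<integral>\<^sup>+\<tau>\<in>?J. (\<integral>\<^sup>+x\<in>E. g \<tau> (X \<tau> x) \<partial>lborel) \<partial>lborel) \<le> ennreal \<Gamma>" "0 \<le> \<Gamma>" for X \<Gamma>
    proof -
      note gXm = borel_measurable_along[OF gm Xm]
      note gXi = borel_measurable_times_ennreal[OF gXm indm]
      have "(\<integral>\<^sup>+z. (ennreal k * g (fst z) (X (fst z) (snd z))) * ind (fst z) (snd z) \<partial>lborel)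
         = ennreal k * (\<integral>\<^sup>+z. g (fst z) (X (fst z) (snd z)) * ind (fst z) (snd z) \<partial>lborel)"
        unfolding mult.assoc using gXi by (intro nn_integral_cmult) simp
      also have "(\<integral>\<^sup>+z. g (fst z) (X (fst z) (snd z)) * ind (fst z) (snd z) \<partial>lborel) = (\<integral>\<^sup>+\<tau>. (\<integral>\<^sup>+x. g \<tau> (X \<tau> x) * ind \<tau> x \<partial>lborel) \<partial>lborel)"
        by (rule ton[OF gXi])
      also have "\<dots> = (\<integral>\<^sup>+\<tau>\<in>?J. (\<integral>\<^sup>+x\<in>E. g \<tau> (X \<tau> x) \<partial>lborel) \<partial>lborel)"
        by (intro nn_integral_cong) (simp add: ind_def indicator_def)
      also have "ennreal k * \<dots> \<le> ennreal k * ennreal \<Gamma>" using X by (intro mult_left_mono) simp_all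
      also have "\<dots> = ennreal (k * \<Gamma>)" using k X by (simp add: ennreal_mult)
      finally show ?thesis .
    qed
    show "(\<integral>\<^sup>+z. H3 (fst z) (snd z) * ind (fst z) (snd z) \<partial>lborel) \<le> ennreal (k * \<Gamma>1)"
      unfolding H3_def by (rule G[OF Um gU])
    show "(\<integral>\<^sup>+z. H4 (fst z) (snd z) * ind (fst z) (snd z) \<partial>lborel) \<le> ennreal (k * \<Gamma>2)"
      unfolding H4_def by (rule G[OF Wm gW])
  qed
  also have "\<dots> = ennreal ((\<eta>' * t * e + L1 * E0) / \<delta> + k * (\<Gamma>1 + \<Gamma>2))"
    using \<eta>' t E U(2) err(2) k gU(2) gW(2) \<delta>
    by (simp add: ennreal_plus[symmetric] add_divide_distrib distrib_left del: ennreal_plus)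
  finally show ?thesis .
qed

section \<open>The backward field and its flow\<close>

text \<open>Time reversal preserves Lebesgue measure. It is phrased as compression so that the tool
  that serves the flows also reflects almost-everywhere statements in time.\<close>

lemma compressible_reflect: "compressible 1 (\<lambda>\<tau> :: real. t - \<tau>)"
  unfolding compressible_def
proof (intro conjI allI impI)
  show "(\<lambda>\<tau> :: real. t - \<tau>) \<in> borel_measurable borel" by simp
  fix A :: "real set" assume A: "open A"
  have "emeasure lborel ((\<lambda>\<tau>. t - \<tau>) -` A) = (\<integral>\<^sup>+\<tau>. indicator ((\<lambda>\<tau>. t - \<tau>) -` A) \<tau> \<partial>lborel)"
    using A by (intro nn_integral_indicator[symmetric]) (simp add: open_vimage continuous_on_op_minus borel_open)
  also have "\<dots> = (\<integral>\<^sup>+\<tau>. indicator A (t - \<tau>) \<partial>lborel)" by (simp add: indicator_def)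
  also have "\<dots> = (\<integral>\<^sup>+\<tau>. indicator A \<tau> \<partial>lborel)"
    using A by (intro nn_integral_reflect_translate(2)) simp
  also have "\<dots> = emeasure lborel A" using A by simp
  finally show "emeasure lborel ((\<lambda>\<tau>. t - \<tau>) -` A) \<le> ennreal 1 * emeasure lborel A" by simp
qed

lemma AE_lborel_fst:
  assumes "AE a in lborel. P a"
  shows "AE z in (lborel :: ('a::euclidean_space \<times> 'b::euclidean_space) measure). P (fst z)"
proof -
  obtain N where N: "N \<in> null_sets lborel" "\<forall>x. x \<notin> N \<longrightarrow> P x" using AE_lborel_null_set[OF assms] by (elim bexE)
  have "N \<in> sets borel" using null_setsD2[OF N(1)] by simp
  then have "Measurable.pred borel (\<lambda>z :: 'a \<times> 'b. fst z \<notin> N)"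
    using measurable_sets[OF borel_measurable_fst_borel, of "- N"] by (simp add: pred_def vimage_def)
  moreover have "AE a in lborel. AE b in (lborel :: 'b measure). a \<notin> N"
    using AE_not_in[OF N(1)] by eventually_elim simp
  ultimately have "AE z in (lborel :: ('a \<times> 'b) measure). fst z \<notin> N"
    by (rule AE_lborel_pairI[of "\<lambda>a b. a \<notin> N"])
  then show ?thesis by eventually_elim (use N(2) in blast)
qed

lemma AE_lborel_reflect_time:
  fixes P :: "real \<Rightarrow> 'b::euclidean_space \<Rightarrow> bool"
  assumes "AE z in lborel. P (fst z) (snd z)"
  shows "AE z in lborel. P (t - fst z) (snd z)"
proof -
  obtain N where N: "N \<in> null_sets lborel" "\<forall>z. z \<notin> N \<longrightarrow> P (fst z) (snd z)" using AE_lborel_null_set[OF assms] by (elim bexE)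
  have "AE z in lborel. (fst z, snd z) \<notin> N" using AE_not_in[OF N(1)] by simp
  then have "AE \<tau> in lborel. AE y in lborel. (\<tau>, y) \<notin> N" by (rule AE_lborel_pairD)
  then have ae: "AE \<tau> in lborel. AE y in lborel. (t - \<tau>, y) \<notin> N" by (rule compressible_AE[OF compressible_reflect])
  have Ns: "N \<in> sets borel" using null_setsD2[OF N(1)] by simp
  have m: "(\<lambda>z :: real \<times> 'b. (t - fst z, snd z)) \<in> borel_measurable borel"
    by (intro borel_measurable_continuous_onI continuous_intros)
  have "Measurable.pred borel (\<lambda>z :: real \<times> 'b. (t - fst z, snd z) \<notin> N)"
    using measurable_sets[OF m, of "- N"] Ns by (simp add: pred_def vimage_def)
  from AE_lborel_pairI[of "\<lambda>\<tau> y. (t - \<tau>, y) \<notin> N", OF this ae]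
  show ?thesis by eventually_elim (use N(2) in force)
qed

lemma in_W1p_uminus:
  assumes "in_W1p p f Df"
  shows "in_W1p p (\<lambda>x. - f x) (\<lambda>x. - Df x)"
proof -
  have m: "(\<lambda>x. - h x) \<in> borel_measurable lebesgue" if "h \<in> borel_measurable lebesgue" for h :: "real^'n \<Rightarrow> 'c::euclidean_space"
    using that by simp
  have "in_Lp p (\<lambda>x. - f x)" "in_Lp p (\<lambda>x. - Df x)"
    using assms m unfolding in_W1p_def in_Lp_def norm_minus_cancel by blast+
  then show ?thesis using assms unfolding in_W1p_def by simp
qed

lemma Lp_norm_uminus: "Lp_norm p (\<lambda>x. - f x) = Lp_norm p f"
  by (simp add: Lp_norm_def)

text \<open>The Borel versions are chosen for the forward data on the whole of (0,T) and then
  reflected, as \<open>t - \<tau>\<close> stays in that interval for \<tau> in (0,t).\<close>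

lemma backward_data:
  fixes b :: "real \<Rightarrow> real^'n \<Rightarrow> real^'n"
  assumes b: "in_L1_W1p T p b Db" and G: "L1_Lp_norm T p Db = G" and t: "t \<in> {0..T}"
  shows "\<exists>c D A. jointly_borel c \<and> jointly_borel D \<and>
    A \<in> borel_measurable borel \<and> (\<forall>\<tau>. 0 \<le> A \<tau>) \<and> (\<integral>\<^sup>+\<tau>\<in>{0<..<t}. ennreal (A \<tau>) \<partial>lborel) \<le> ennreal G \<and>
    (AE z in lborel. fst z \<in> {0<..<t} \<longrightarrow> backward_field b t (fst z) (snd z) = c (fst z) (snd z)) \<and>
    (AE \<tau> in lborel. \<tau> \<in> {0<..<t} \<longrightarrow> in_W1p p (backward_field b t \<tau>) (\<lambda>y. - Db (t - \<tau>) y) \<and>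
       (AE y in lborel. - Db (t - \<tau>) y = (D \<tau> y :: real^'n^'n)) \<and> Lp_norm p (\<lambda>y. - Db (t - \<tau>) y) = A \<tau>)"
proof -
  let ?S = "{0<..<T} \<times> (UNIV :: (real^'n) set)"
  have "open ?S" by (intro open_Times) auto
  then have S: "?S \<in> sets lebesgue" by (simp add: borel_open)
  have bm: "(\<lambda>z. b (fst z) (snd z)) \<in> borel_measurable (lebesgue_on ?S)" and Dm: "(\<lambda>z. Db (fst z) (snd z)) \<in> borel_measurable (lebesgue_on ?S)"
    and W: "AE \<tau> in lborel. \<tau> \<in> {0<..<T} \<longrightarrow> in_W1p p (b \<tau>) (Db \<tau>)"
    and int: "integrable (lebesgue_on {0<..<T}) (\<lambda>\<tau>. Lp_norm p (Db \<tau>))"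
    using b unfolding in_L1_W1p_def space_time_def by (simp_all add: AE_lebesgue_on_iff)
  obtain b' where b': "b' \<in> borel_measurable borel" "AE z in lborel. z \<in> ?S \<longrightarrow> b (fst z) (snd z) = b' z"
    using lebesgue_on_ex_borel[OF bm S] by (elim bexE)
  obtain D' where D': "D' \<in> borel_measurable borel" "AE z in lborel. z \<in> ?S \<longrightarrow> Db (fst z) (snd z) = D' z"
    using lebesgue_on_ex_borel[OF Dm S] by (elim bexE)
  obtain A' where A': "A' \<in> borel_measurable borel" "AE \<tau> in lborel. \<tau> \<in> {0<..<T} \<longrightarrow> Lp_norm p (Db \<tau>) = A' \<tau>"
    using lebesgue_on_ex_borel[OF borel_measurable_integrable[OF int]] by auto
  have Lp0: "0 \<le> Lp_norm p f" for f :: "real^'n \<Rightarrow> real^'n^'n" by (simp add: Lp_norm_def)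
  define c where "c \<tau> y = - b' (t - \<tau>, y)" for \<tau> y
  define D where "D \<tau> y = - D' (t - \<tau>, y)" for \<tau> y
  \<comment> \<open>The absolute value makes the representative nonnegative at every time; almost
    everywhere it changes nothing.\<close>
  define A where "A \<tau> = \<bar>A' (t - \<tau>)\<bar>" for \<tau>
  have rm: "(\<lambda>z :: real \<times> (real^'n). (t - fst z, snd z)) \<in> borel_measurable borel"
    by (intro borel_measurable_continuous_onI continuous_intros)
  have tT: "t - \<tau> \<in> {0<..<T}" if "\<tau> \<in> {0<..<t}" for \<tau> using that t by auto
  have "jointly_borel c" "jointly_borel D"
    unfolding c_def D_def using measurable_compose[OF rm b'(1)] measurable_compose[OF rm D'(1)] by simp_all
  moreover have Am: "A \<in> borel_measurable borel" unfolding A_def[abs_def] using A'(1) by simp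
  moreover have "\<forall>\<tau>. 0 \<le> A \<tau>" by (simp add: A_def)
  moreover have "(\<integral>\<^sup>+\<tau>\<in>{0<..<t}. ennreal (A \<tau>) \<partial>lborel) \<le> ennreal G"
  proof -
    have m: "(\<lambda>\<tau>. ennreal \<bar>A' \<tau>\<bar> * indicator {0<..<t} \<tau>) \<in> borel_measurable borel"
      using A'(1) by (intro borel_measurable_times_ennreal borel_measurable_indicator) simp_all
    have "(\<integral>\<^sup>+\<tau>\<in>{0<..<t}. ennreal (A \<tau>) \<partial>lborel) = (\<integral>\<^sup>+\<tau>. ennreal \<bar>A' (t - \<tau>)\<bar> * indicator {0<..<t} (t - \<tau>) \<partial>lborel)"
      by (intro nn_integral_cong) (auto simp: A_def indicator_def)
    also have "\<dots> = (\<integral>\<^sup>+\<tau>. ennreal \<bar>A' \<tau>\<bar> * indicator {0<..<t} \<tau> \<partial>lborel)"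
      by (rule nn_integral_reflect_translate(2)[OF m])
    also have "\<dots> \<le> (\<integral>\<^sup>+\<tau>. ennreal (Lp_norm p (Db \<tau>)) * indicator {0<..<T} \<tau> \<partial>lborel)"
    proof (rule nn_integral_mono_AE)
      show "AE \<tau> in lborel. ennreal \<bar>A' \<tau>\<bar> * indicator {0<..<t} \<tau> \<le> ennreal (Lp_norm p (Db \<tau>)) * indicator {0<..<T} \<tau>"
        using A'(2)
      proof eventually_elim
        case (elim \<tau>)
        then show ?case using Lp0[of "Db \<tau>"] t by (cases "\<tau> \<in> {0<..<t}") auto
      qed
    qed
    also have "\<dots> = (\<integral>\<^sup>+\<tau>. ennreal (Lp_norm p (Db \<tau>)) * indicator {0<..<T} \<tau> \<partial>lebesgue)"
      by (rule nn_integral_completion[symmetric])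
    also have "\<dots> = (\<integral>\<^sup>+\<tau>. ennreal (Lp_norm p (Db \<tau>)) \<partial>lebesgue_on {0<..<T})"
      by (rule nn_integral_restrict_space[symmetric]) simp
    also have "\<dots> = ennreal G"
      using G int Lp0 unfolding L1_Lp_norm_def by (subst nn_integral_eq_integral) simp_all
    finally show ?thesis .
  qed
  moreover have "AE z in lborel. fst z \<in> {0<..<t} \<longrightarrow> backward_field b t (fst z) (snd z) = c (fst z) (snd z)"
  proof -
    have "AE z in lborel. fst z \<in> {0<..<T} \<longrightarrow> b (fst z) (snd z) = b' (fst z, snd z)"
      using b'(2) by (auto elim: eventually_mono simp: mem_Times_iff)
    from AE_lborel_reflect_time[of "\<lambda>\<tau> y. \<tau> \<in> {0<..<T} \<longrightarrow> b \<tau> y = b' (\<tau>, y)", OF this, of t]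
    show ?thesis
    proof eventually_elim
      case (elim z)
      then show ?case using tT[of "fst z"] by (simp add: backward_field_def c_def)
    qed
  qed
  moreover have "AE \<tau> in lborel. \<tau> \<in> {0<..<t} \<longrightarrow> in_W1p p (backward_field b t \<tau>) (\<lambda>y. - Db (t - \<tau>) y) \<and>
       (AE y in lborel. - Db (t - \<tau>) y = D \<tau> y) \<and> Lp_norm p (\<lambda>y. - Db (t - \<tau>) y) = A \<tau>"
  proof -
    have "AE z in lborel. fst z \<in> {0<..<T} \<longrightarrow> Db (fst z) (snd z) = D' (fst z, snd z)"
      using D'(2) by (auto elim: eventually_mono simp: mem_Times_iff)
    then have "AE \<tau> in lborel. AE y in lborel. \<tau> \<in> {0<..<T} \<longrightarrow> Db \<tau> y = D' (\<tau>, y)"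
      by (rule AE_lborel_pairD[of "\<lambda>\<tau> y. \<tau> \<in> {0<..<T} \<longrightarrow> Db \<tau> y = D' (\<tau>, y)"])
    from compressible_AE[OF compressible_reflect this, of t] compressible_AE[OF compressible_reflect W, of t]
      compressible_AE[OF compressible_reflect A'(2), of t]
    show ?thesis
    proof eventually_elim
      case (elim \<tau>)
      show ?case
      proof
        assume \<tau>: "\<tau> \<in> {0<..<t}"
        note tT[OF \<tau>]
        have "backward_field b t \<tau> = (\<lambda>y. - b (t - \<tau>) y)" using \<tau> by (simp add: backward_field_def fun_eq_iff)
        moreover have "in_W1p p (\<lambda>y. - b (t - \<tau>) y) (\<lambda>y. - Db (t - \<tau>) y)"
          using elim(2) tT[OF \<tau>] by (intro in_W1p_uminus) simp
        moreover have "AE y in lborel. - Db (t - \<tau>) y = D \<tau> y"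
          using elim(1) by (rule eventually_mono) (use tT[OF \<tau>] in \<open>simp add: D_def\<close>)
        moreover have "Lp_norm p (\<lambda>y. - Db (t - \<tau>) y) = A \<tau>"
          using elim(3) tT[OF \<tau>] Lp0[of "Db (t - \<tau>)"] by (simp add: Lp_norm_uminus A_def)
        ultimately show "in_W1p p (backward_field b t \<tau>) (\<lambda>y. - Db (t - \<tau>) y) \<and>
          (AE y in lborel. - Db (t - \<tau>) y = D \<tau> y) \<and> Lp_norm p (\<lambda>y. - Db (t - \<tau>) y) = A \<tau>" by simp
      qed
    qed
  qed
  ultimately show ?thesis by blast
qed

text \<open>The constant of \<open>maximal_function_transport\<close> with compression and level
  factored out; the denominator comes from the geometric series.\<close>

definition maximal_const :: "'n::finite itself \<Rightarrow> real \<Rightarrow> real" where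
  "maximal_const _ p = 5 ^ CARD('n) * 2 powr p / (1 - 2 powr (1 - p))"

lemma maximal_const_nonneg: "1 < p \<Longrightarrow> 0 \<le> maximal_const TYPE('n::finite) p"
  unfolding maximal_const_def using powr_mono[of "1 - p" 0 2] by (intro divide_nonneg_nonneg) simp_all

text \<open>The level at time \<tau> is \<open>l = 1 + A \<tau>\<close>. Then
  \<open>l powr (1 - p) * A \<tau> powr p \<le> l\<close>, so the bound is linear in the Lp norm of
  the gradient and can be integrated although this norm is only integrable in time. The summand 1
  keeps the level positive and produces the \<open>t\<close> next to \<open>G\<close>.\<close>

lemma maximal_gradient_along_flow:
  fixes D :: "real \<Rightarrow> real^'n \<Rightarrow> real^'n^'n" and X :: "real \<Rightarrow> real^'n \<Rightarrow> real^'n"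
  assumes Dm: "jointly_borel D" and p: "1 < p" and t: "0 \<le> t"
    and A: "A \<in> borel_measurable borel" "\<And>\<tau>. 0 \<le> A \<tau>" "(\<integral>\<^sup>+\<tau>\<in>{0<..<t}. ennreal (A \<tau>) \<partial>lborel) \<le> ennreal G" "0 \<le> G"
    and W: "AE \<tau> in lborel. \<tau> \<in> {0<..<t} \<longrightarrow> in_W1p p (f \<tau>) (Df \<tau>) \<and> (AE y in lborel. Df \<tau> y = D \<tau> y) \<and> Lp_norm p (Df \<tau>) = A \<tau>"
    and X: "\<And>\<tau>. \<tau> \<in> {0<..<t} \<Longrightarrow> compressible L (X \<tau>)" "0 \<le> L" and E: "E \<in> sets borel" "emeasure lborel E = ennreal e" "0 \<le> e"
  shows "(\<integral>\<^sup>+\<tau>\<in>{0<..<t}. (\<integral>\<^sup>+x\<in>E. maximal_norm (D \<tau>) (X \<tau> x) \<partial>lborel) \<partial>lborel) \<le>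
     ennreal ((t + G) * (e + L * maximal_const TYPE('n) p))"
proof -
  let ?J = "{0<..<t}"
  define m where "m = maximal_const TYPE('n) p"
  have m0: "0 \<le> m" unfolding m_def by (rule maximal_const_nonneg[OF p])
  define B where "B = e + L * m"
  have B0: "0 \<le> B" using E X m0 by (simp add: B_def)
  have "(\<integral>\<^sup>+\<tau>\<in>?J. (\<integral>\<^sup>+x\<in>E. maximal_norm (D \<tau>) (X \<tau> x) \<partial>lborel) \<partial>lborel) \<le>
     (\<integral>\<^sup>+\<tau>. ennreal B * (indicator ?J \<tau> + ennreal (A \<tau>) * indicator ?J \<tau>) \<partial>lborel)"
  proof (rule nn_integral_mono_AE)
    show "AE \<tau> in lborel. (\<integral>\<^sup>+x\<in>E. maximal_norm (D \<tau>) (X \<tau> x) \<partial>lborel) * indicator ?J \<tau> \<le>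
      ennreal B * (indicator ?J \<tau> + ennreal (A \<tau>) * indicator ?J \<tau>)"
      using W
    proof eventually_elim
      case (elim \<tau>)
      show ?case
      proof (cases "\<tau> \<in> ?J")
        case True
        with elim have Wt: "in_W1p p (f \<tau>) (Df \<tau>)" "AE y in lborel. Df \<tau> y = D \<tau> y" "Lp_norm p (Df \<tau>) = A \<tau>" by simp_all
        have Ds: "D \<tau> \<in> borel_measurable borel" using borel_sections(2)[OF Dm, of \<tau>] by simp
        define I where "I = (LINT x|lebesgue. norm (Df \<tau> x) powr p)"
        have I0: "0 \<le> I" unfolding I_def by (rule Bochner_Integration.integral_nonneg) simp
        have nnI: "(\<integral>\<^sup>+y. ennreal (norm (D \<tau> y) powr p) \<partial>lborel) = ennreal I"
          unfolding I_def using Wt by (intro in_Lp_locally_integrable(2)[OF _ p Ds]) (simp_all add: in_W1p_def)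
        have "A \<tau> powr p = I" using Wt(3)[symmetric] p I0 by (simp add: Lp_norm_def I_def[symmetric] powr_powr)
        define l where "l = 1 + A \<tau>"
        have l: "0 < l" using A(2)[of \<tau>] by (simp add: l_def)
        have "(\<integral>\<^sup>+x\<in>E. maximal_norm (D \<tau>) (X \<tau> x) \<partial>lborel) \<le>
           ennreal l * emeasure lborel E +
           ennreal (L * 5 ^ DIM(real^'n) * 2 powr p * l powr (1 - p) / (1 - 2 powr (1 - p))) * (\<integral>\<^sup>+y. ennreal (norm (D \<tau> y) powr p) \<partial>lborel)"
          by (rule maximal_function_transport[OF X(1)[OF True] X(2) _ _ l p _ E(1)]) (use Ds nnI in simp_all)
        also have "\<dots> = ennreal l * ennreal e + ennreal (L * m * l powr (1 - p)) * ennreal I"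
        proof -
          have "L * 5 ^ DIM(real^'n) * 2 powr p * l powr (1 - p) / (1 - 2 powr (1 - p)) = L * m * l powr (1 - p)"
            unfolding m_def maximal_const_def by simp
          then show ?thesis unfolding nnI E(2) by (simp only:)
        qed
        also have "\<dots> = ennreal (l * e + L * m * l powr (1 - p) * I)"
          using l E(3) X(2) m0 I0 by (simp add: ennreal_mult)
        also have "\<dots> \<le> ennreal (B * l)"
        proof (rule ennreal_leI)
          have "l powr (1 - p) * I \<le> l powr (1 - p) * l powr p"
            unfolding \<open>A \<tau> powr p = I\<close>[symmetric] l_def using A(2)[of \<tau>] p by (intro mult_left_mono powr_mono2) simp_all
          also have "\<dots> = l" using l by (simp flip: powr_add)
          finally have "(L * m) * (l powr (1 - p) * I) \<le> (L * m) * l" using X(2) m0 by (intro mult_left_mono) simp_all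
          then show "l * e + L * m * l powr (1 - p) * I \<le> B * l" by (simp add: B_def algebra_simps)
        qed
        also have "\<dots> = ennreal B * (1 + ennreal (A \<tau>))"
          using B0 A(2)[of \<tau>] l by (simp add: ennreal_mult l_def)
        finally show ?thesis using True by simp
      qed simp
    qed
  qed
  also have "\<dots> = ennreal B * (ennreal t + (\<integral>\<^sup>+\<tau>\<in>?J. ennreal (A \<tau>) \<partial>lborel))"
  proof -
    have Am: "(\<lambda>\<tau>. ennreal (A \<tau>) * indicator ?J \<tau>) \<in> borel_measurable lborel"
      unfolding measurable_lborel2 using A(1) by (intro borel_measurable_times_ennreal borel_measurable_indicator) simp_all
    then show ?thesis using t by (simp add: nn_integral_cmult nn_integral_add)
  qed
  also have "\<dots> \<le> ennreal B * (ennreal t + ennreal G)" by (intro mult_left_mono add_left_mono A(3)) simp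
  also have "\<dots> = ennreal ((t + G) * B)" using t A(4) B0 by (simp add: ennreal_mult[symmetric] mult.commute flip: ennreal_plus)
  finally show ?thesis unfolding B_def m_def .
qed

lemma absolutely_continuous_imp_continuous:
  fixes f :: "real \<Rightarrow> 'b::metric_space"
  assumes "absolutely_continuous_on a b f"
  shows "continuous_on {a..b} f"
  unfolding continuous_on_iff
proof (intro ballI allI impI)
  fix x e :: real assume x: "x \<in> {a..b}" and e: "0 < e"
  obtain d where d: "d > 0" "\<And>I :: (real \<times> real) set. finite I \<and> (\<forall>(u, v) \<in> I. a \<le> u \<and> u \<le> v \<and> v \<le> b) \<and>
        pairwise (\<lambda>P Q. {fst P<..<snd P} \<inter> {fst Q<..<snd Q} = {}) I \<and>
        (\<Sum>(u, v) \<in> I. v - u) < d \<Longrightarrow> (\<Sum>(u, v) \<in> I. dist (f u) (f v)) < e"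
    using assms e unfolding absolutely_continuous_on_def by blast
  have key: "dist (f u) (f v) < e" if "a \<le> u" "u \<le> v" "v \<le> b" "v - u < d" for u v
    using d(2)[of "{(u, v)}"] that by simp
  show "\<exists>d>0. \<forall>x'\<in>{a..b}. dist x' x < d \<longrightarrow> dist (f x') (f x) < e"
  proof (intro exI[of _ d] conjI ballI impI d(1))
    fix y assume y: "y \<in> {a..b}" "dist y x < d"
    show "dist (f y) (f x) < e"
    proof (cases "y \<le> x")
      case True then show ?thesis using key[of y x] x y by (simp add: dist_real_def)
    next
      case False then show ?thesis using key[of x y] x y by (simp add: dist_real_def dist_commute)
    qed
  qed
qed

text \<open>Almost every trajectory is continuous, so here \<open>x\<close> is the measurable
  parameter and time the continuous variable. Clamping time to the interval from 0 to
  \<open>t\<close> gives a map that is compressible at every real time. The integral equation passes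
  from \<open>f\<close> to the Borel field \<open>c\<close> because compression keeps almost every
  trajectory, at almost every time, off the null set where the two differ.\<close>

lemma flow_representative:
  fixes f c Y :: "real \<Rightarrow> real^'n \<Rightarrow> real^'n"
  assumes flow: "regular_lagrangian_flow t f Y" and t: "0 \<le> t"
    and cm: "jointly_borel c"
    and eq: "AE z in lborel. fst z \<in> {0<..<t} \<longrightarrow> f (fst z) (snd z) = c (fst z) (snd z)"
  shows "\<exists>W L. jointly_borel W \<and> 0 < L \<and> (\<forall>\<tau>. compressible L (W \<tau>)) \<and>
    (AE x in lborel. \<forall>s\<in>{0..t}. W s x = Y s x) \<and>
    (AE x in lborel. \<forall>s\<in>{0..t}. integrable lborel (\<lambda>\<tau>. indicator {0..s} \<tau> *\<^sub>R c \<tau> (W \<tau> x)) \<and>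
      W s x = x + (LINT \<tau>|lborel. indicator {0..s} \<tau> *\<^sub>R c \<tau> (W \<tau> x)))"
proof -
  have ode: "AE x in lborel. absolutely_continuous_on 0 t (\<lambda>s. Y s x) \<and>
        (\<forall>s\<in>{0..t}. integrable (lebesgue_on {0..s}) (\<lambda>\<tau>. f \<tau> (Y \<tau> x)) \<and>
           Y s x = x + (LINT \<tau>|lebesgue_on {0..s}. f \<tau> (Y \<tau> x)))"
    and Ym: "\<And>s. s \<in> {0..t} \<Longrightarrow> Y s \<in> borel_measurable lebesgue"
    using flow unfolding regular_lagrangian_flow_def by (auto simp: AE_completion_iff)
  obtain L where L: "0 < L" "\<And>s A. s \<in> {0..t} \<Longrightarrow> open A \<Longrightarrow> emeasure lebesgue (Y s -` A) \<le> ennreal L * emeasure lebesgue A"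
    using flow unfolding regular_lagrangian_flow_def by blast
  define cl where "cl s = max 0 (min t s)" for s
  have cl: "cl s \<in> {0..t}" for s using t by (simp add: cl_def)
  have cl_id: "cl s = s" if "s \<in> {0..t}" for s using that by (simp add: cl_def)
  define F where "F x s = Y (cl s) x" for x s
  have Fm: "(\<lambda>x. F x s) \<in> borel_measurable lebesgue" for s unfolding F_def using Ym[OF cl] by simp
  have Fc: "AE x in lborel. continuous_on UNIV (F x)"
    using ode
  proof eventually_elim
    case (elim x)
    then have "continuous_on {0..t} (\<lambda>s. Y s x)" by (blast intro: absolutely_continuous_imp_continuous)
    moreover have "continuous_on UNIV cl" unfolding cl_def[abs_def] by (intro continuous_intros)
    ultimately show ?case unfolding F_def[abs_def] by (rule continuous_on_compose2) (use cl in auto)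
  qed
  obtain N where N: "N \<in> null_sets lborel" "(\<lambda>z. if fst z \<in> N then 0 else F (fst z) (snd z)) \<in> borel_measurable borel"
    using caratheodory_representative[of UNIV F, OF Fm closure_UNIV Fc] by blast
  define W where "W s x = (if x \<in> N then 0 else Y (cl s) x)" for s x
  have Wm: "jointly_borel W"
  proof -
    have "(\<lambda>z :: real \<times> (real^'n). (snd z, fst z)) \<in> borel_measurable borel"
      by (intro borel_measurable_continuous_onI continuous_intros)
    from measurable_compose[OF this N(2)] show ?thesis unfolding W_def F_def fst_conv snd_conv .
  qed
  have Ws: "W s \<in> borel_measurable borel" for s using borel_sections(2)[OF Wm, of s] by simp
  have comp: "compressible L (W s)" for s
    unfolding compressible_def
  proof (intro conjI allI impI Ws)
    fix A :: "(real^'n) set" assume A: "open A"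
    have NL: "N \<in> null_sets lebesgue" by (rule null_sets_completionI[OF N(1)])
    have WA: "W s -` A \<in> sets borel" using measurable_sets[OF Ws, of A s] A by simp
    have YA: "Y (cl s) -` A \<in> sets lebesgue" using measurable_sets[OF Ym[OF cl], of A s] A by simp
    have "emeasure lborel (W s -` A) = emeasure lebesgue (W s -` A)" using WA by simp
    also have "\<dots> \<le> emeasure lebesgue (Y (cl s) -` A \<union> N)"
      using YA null_setsD2[OF NL] by (intro emeasure_mono) (auto simp: W_def)
    also have "\<dots> = emeasure lebesgue (Y (cl s) -` A)" using YA NL by (rule emeasure_Un_null_set)
    also have "\<dots> \<le> ennreal L * emeasure lebesgue A" by (rule L(2)[OF cl A])
    also have "emeasure lebesgue A = emeasure lborel A" using A by simp
    finally show "emeasure lborel (W s -` A) \<le> ennreal L * emeasure lborel A" .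
  qed
  have nN: "AE x in lborel. x \<notin> N" by (rule AE_not_in[OF N(1)])
  have WY: "W s x = Y s x" if "x \<notin> N" "s \<in> {0..t}" for s x using that by (simp add: W_def cl_id)
  obtain Q where Q: "Q \<in> null_sets lborel" "\<forall>z. z \<notin> Q \<longrightarrow> fst z \<in> {0<..<t} \<longrightarrow> f (fst z) (snd z) = c (fst z) (snd z)"
    using AE_lborel_null_set[OF eq] by (elim bexE)
  have Qs: "Q \<in> sets borel" using null_setsD2[OF Q(1)] by simp
  have "AE z in lborel. (fst z, snd z) \<notin> Q" using AE_not_in[OF Q(1)] by simp
  then have "AE \<tau> in lborel. AE y in lborel. (\<tau>, y) \<notin> Q" by (rule AE_lborel_pairD)
  then have "AE \<tau> in lborel. AE x in lborel. (\<tau>, W \<tau> x) \<notin> Q"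
    by eventually_elim (rule compressible_AE[OF comp])
  moreover have "Measurable.pred borel (\<lambda>z. (fst z, W (fst z) (snd z)) \<notin> Q)"
    using measurable_sets[OF borel_measurable_Pair[OF borel_measurable_fst_borel Wm], of "- Q"] Qs by (simp add: pred_def vimage_def)
  ultimately have QW: "AE x in lborel. AE \<tau> in lborel. (\<tau>, W \<tau> x) \<notin> Q"
    by (intro AE_lborel_swap[of "\<lambda>\<tau> x. (\<tau>, W \<tau> x) \<notin> Q"])
  have cW: "(\<lambda>z. c (fst z) (W (fst z) (snd z))) \<in> borel_measurable borel" by (rule borel_measurable_along[OF cm Wm])
  have "AE x in lborel. \<forall>s\<in>{0..t}. integrable lborel (\<lambda>\<tau>. indicator {0..s} \<tau> *\<^sub>R c \<tau> (W \<tau> x)) \<and>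
      W s x = x + (LINT \<tau>|lborel. indicator {0..s} \<tau> *\<^sub>R c \<tau> (W \<tau> x))"
    using ode nN QW
  proof eventually_elim
    case (elim x)
    show ?case
    proof
      fix s assume s: "s \<in> {0..t}"
      define f1 where "f1 \<tau> = indicator {0..s} \<tau> *\<^sub>R f \<tau> (Y \<tau> x)" for \<tau>
      define f2 where "f2 \<tau> = indicator {0..s} \<tau> *\<^sub>R c \<tau> (W \<tau> x)" for \<tau>
      have f2m: "f2 \<in> borel_measurable borel"
        unfolding f2_def[abs_def] using borel_sections(1)[OF cW, of x]
        by (intro borel_measurable_scaleR borel_measurable_indicator) simp_all
      have i: "integrable (lebesgue_on {0..s}) (\<lambda>\<tau>. f \<tau> (Y \<tau> x))" and Ys: "Y s x = x + (LINT \<tau>|lebesgue_on {0..s}. f \<tau> (Y \<tau> x))"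
        using elim(1) s by blast+
      have f1i: "integrable lebesgue f1"
        unfolding f1_def[abs_def] using i by (subst (asm) integrable_restrict_space) simp_all
      have f1I: "(LINT \<tau>|lebesgue_on {0..s}. f \<tau> (Y \<tau> x)) = (LINT \<tau>|lebesgue. f1 \<tau>)"
        unfolding f1_def by (rule integral_restrict_space) simp
      have "AE \<tau> in lborel. \<tau> \<noteq> 0" "AE \<tau> in lborel. \<tau> \<noteq> t" by (rule AE_lborel_singleton)+
      with elim(3) have "AE \<tau> in lborel. f1 \<tau> = f2 \<tau>"
      proof eventually_elim
        case (elim \<tau>)
        show ?case
        proof (cases "\<tau> \<in> {0..s}")
          case True
          then have "\<tau> \<in> {0<..<t}" "\<tau> \<in> {0..t}" using elim s by auto
          then have "f \<tau> (W \<tau> x) = c \<tau> (W \<tau> x)" using Q(2) elim(1) by force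
          then show ?thesis using WY[OF \<open>x \<notin> N\<close> \<open>\<tau> \<in> {0..t}\<close>] by (simp add: f1_def f2_def)
        qed (simp add: f1_def f2_def)
      qed
      then have ae: "AE \<tau> in lebesgue. f1 \<tau> = f2 \<tau>" by (simp add: AE_completion_iff)
      have f2l: "f2 \<in> borel_measurable lebesgue" by (rule measurable_completion) (use f2m in simp)
      have "integrable lebesgue f2"
        using integrable_cong_AE[OF borel_measurable_integrable[OF f1i] f2l ae] f1i by simp
      then have 1: "integrable lborel f2" using f2m by (simp add: integrable_completion)
      have "(LINT \<tau>|lebesgue. f1 \<tau>) = (LINT \<tau>|lebesgue. f2 \<tau>)"
        by (rule integral_cong_AE[OF borel_measurable_integrable[OF f1i] f2l ae])
      also have "\<dots> = (LINT \<tau>|lborel. f2 \<tau>)" using f2m by (intro integral_completion) simp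
      finally have "W s x = x + (LINT \<tau>|lborel. f2 \<tau>)" using Ys f1I WY[OF elim(2) s] by simp
      with 1 show "integrable lborel (\<lambda>\<tau>. indicator {0..s} \<tau> *\<^sub>R c \<tau> (W \<tau> x)) \<and>
        W s x = x + (LINT \<tau>|lborel. indicator {0..s} \<tau> *\<^sub>R c \<tau> (W \<tau> x))" unfolding f2_def by simp
    qed
  qed
  moreover have "AE x in lborel. \<forall>s\<in>{0..t}. W s x = Y s x" using nN by eventually_elim (use WY in blast)
  ultimately show ?thesis using Wm L(1) comp by blast
qed

lemma approximating_sequence_representative:
  fixes f c :: "real \<Rightarrow> real^'n \<Rightarrow> real^'n"
  assumes ap: "approximating_sequence T f be C0 C1 C2 C3 \<alpha> \<beta>" and C: "0 \<le> C1" "0 \<le> C2" "0 \<le> C3" and t: "t \<le> T"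
    and cm: "jointly_borel c"
    and eq: "AE z in lborel. fst z \<in> {0<..<t} \<longrightarrow> f (fst z) (snd z) = c (fst z) (snd z)" and \<epsilon>: "0 < \<epsilon>"
  shows "\<exists>a. nice_field (C1 / \<epsilon> powr \<beta>) C3 C2 a \<and> (AE \<tau> in lborel. \<tau> \<in> {0<..<T} \<longrightarrow> (\<forall>y. be \<epsilon> \<tau> y = a \<tau> y)) \<and>
    (\<integral>\<^sup>+\<tau>\<in>{0<..<t}. (\<integral>\<^sup>+y. ennreal (norm (a \<tau> y - c \<tau> y)) \<partial>lborel) \<partial>lborel) \<le> ennreal (C0 * \<epsilon> powr \<alpha>)"
proof -
  have m: "(\<lambda>z. be \<epsilon> (fst z) (snd z)) \<in> borel_measurable (space_time T)"
    and sm: "AE s in lebesgue_on {0<..<T}. smooth (be \<epsilon> s)"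
    and e: "L1L1_norm T (\<lambda>s x. be \<epsilon> s x - f s x) \<le> ennreal (C0 * \<epsilon> powr \<alpha>)"
    and K: "Linf_norm T (\<lambda>s. jacobian (be \<epsilon> s)) \<le> ennreal (C1 / \<epsilon> powr \<beta>)"
    and d: "Linf_norm T (\<lambda>s. divergence (be \<epsilon> s)) \<le> ennreal C2"
    and M: "Linf_norm T (be \<epsilon>) \<le> ennreal C3"
    using ap \<epsilon> unfolding approximating_sequence_def by simp_all
  have "0 \<le> C1 / \<epsilon> powr \<beta>" using C by simp
  from nice_representative[OF m sm K this d C(2) M C(3)]
  obtain a where a: "nice_field (C1 / \<epsilon> powr \<beta>) C3 C2 a" "AE \<tau> in lborel. \<tau> \<in> {0<..<T} \<longrightarrow> (\<forall>y. be \<epsilon> \<tau> y = a \<tau> y)"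
    by (elim exE conjE)
  have am: "jointly_borel a" using a(1) by (simp add: nice_field_def)
  define r where "r \<tau> y = ennreal (norm (a \<tau> y - c \<tau> y)) * indicator {0<..<t} \<tau>" for \<tau> y
  have rm: "jointly_borel r"
    unfolding r_def
  proof (rule borel_measurable_times_ennreal)
    have "(\<lambda>z. norm (a (fst z) (snd z) - c (fst z) (snd z))) \<in> borel_measurable (borel :: (real \<times> (real^'n)) measure)"
      by (rule measurable_compose[OF borel_measurable_diff[OF am cm] borel_measurable_norm])
    then show "(\<lambda>z. ennreal (norm (a (fst z) (snd z) - c (fst z) (snd z)))) \<in> borel_measurable borel"
      by (rule measurable_compose[OF _ measurable_ennreal])
    show "(\<lambda>z :: real \<times> (real^'n). indicator {0<..<t} (fst z) :: ennreal) \<in> borel_measurable borel"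
      by (rule measurable_compose[OF borel_measurable_fst_borel borel_measurable_indicator]) simp
  qed
  have "(\<integral>\<^sup>+\<tau>\<in>{0<..<t}. (\<integral>\<^sup>+y. ennreal (norm (a \<tau> y - c \<tau> y)) \<partial>lborel) \<partial>lborel) = (\<integral>\<^sup>+\<tau>. (\<integral>\<^sup>+y. r \<tau> y \<partial>lborel) \<partial>lborel)"
    by (intro nn_integral_cong) (simp add: r_def indicator_def)
  also have "\<dots> = (\<integral>\<^sup>+z. r (fst z) (snd z) \<partial>lborel)" by (rule nn_integral_lborel_Tonelli(2)[OF rm])
  also have "\<dots> \<le> (\<integral>\<^sup>+z. ennreal (norm (be \<epsilon> (fst z) (snd z) - f (fst z) (snd z))) * indicator ({0<..<T} \<times> UNIV) z \<partial>lborel)"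
  proof (rule nn_integral_mono_AE)
    show "AE z in lborel. r (fst z) (snd z) \<le> ennreal (norm (be \<epsilon> (fst z) (snd z) - f (fst z) (snd z))) * indicator ({0<..<T} \<times> UNIV) z"
      using AE_lborel_fst[OF a(2)] eq
    proof eventually_elim
      case (elim z)
      show ?case
      proof (cases "fst z \<in> {0<..<t}")
        case True
        then have "fst z \<in> {0<..<T}" using t by auto
        then show ?thesis using elim True by (simp add: r_def indicator_def mem_Times_iff)
      qed (simp add: r_def)
    qed
  qed
  also have "\<dots> = (\<integral>\<^sup>+z. ennreal (norm (be \<epsilon> (fst z) (snd z) - f (fst z) (snd z))) * indicator ({0<..<T} \<times> UNIV) z \<partial>lebesgue)"
    by (rule nn_integral_completion[symmetric])
  also have "\<dots> = L1L1_norm T (\<lambda>s x. be \<epsilon> s x - f s x)"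
  proof -
    have "open ({0<..<T} \<times> (UNIV :: (real^'n) set))" by (intro open_Times) auto
    then show ?thesis unfolding L1L1_norm_def space_time_def
      by (intro nn_integral_restrict_space[symmetric]) (simp add: borel_open)
  qed
  also note e
  finally show ?thesis using a by (intro exI[of _ a] conjI)
qed

text \<open>The space-time L1 error of the regularisations tends to 0, so by Fatou the spatial error
  has lower limit 0 at almost every time. At such a time some regularised field, which is Lipschitz,
  is as close in L1 as desired, and this is the approximation that the pointwise inequality asks
  for.\<close>

lemma hajlasz_along_time:
  fixes f c :: "real \<Rightarrow> real^'n \<Rightarrow> real^'n" and D Df :: "real \<Rightarrow> real^'n \<Rightarrow> real^'n^'n"
  assumes haj: "\<And>(f :: real^'n \<Rightarrow> real^'n) Df. in_W1p p f Df \<Longrightarrow>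
    lipschitz_L1_limit f \<Longrightarrow> hajlasz_bound k f (maximal_norm Df)"
    and cm: "jointly_borel c"
    and eq: "AE z in lborel. fst z \<in> {0<..<t} \<longrightarrow> f (fst z) (snd z) = c (fst z) (snd z)"
    and W: "AE \<tau> in lborel. \<tau> \<in> {0<..<t} \<longrightarrow> in_W1p p (f \<tau>) (Df \<tau>) \<and> (AE y in lborel. Df \<tau> y = D \<tau> y) \<and> Lp_norm p (Df \<tau>) = A \<tau>"
    and approx: "\<And>\<epsilon> :: real. 0 < \<epsilon> \<Longrightarrow> \<exists>a. nice_field (C1 / \<epsilon> powr \<beta>) C3 C2 a \<and>
      (\<integral>\<^sup>+\<tau>\<in>{0<..<t}. (\<integral>\<^sup>+y. ennreal (norm (a \<tau> y - c \<tau> y)) \<partial>lborel) \<partial>lborel) \<le> ennreal (C0 * \<epsilon> powr \<alpha>)"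
    and C: "0 \<le> C1" "0 < \<alpha>"
  shows "AE \<tau> in lborel. \<tau> \<in> {0<..<t} \<longrightarrow> hajlasz_bound k (c \<tau>) (maximal_norm (D \<tau>))"
proof -
  let ?J = "{0<..<t}"
  define \<epsilon> where "\<epsilon> n = inverse (real (Suc n))" for n
  have \<epsilon>0: "0 < \<epsilon> n" for n by (simp add: \<epsilon>_def)
  have "\<forall>n. \<exists>a. nice_field (C1 / \<epsilon> n powr \<beta>) C3 C2 a \<and>
      (\<integral>\<^sup>+\<tau>\<in>?J. (\<integral>\<^sup>+y. ennreal (norm (a \<tau> y - c \<tau> y)) \<partial>lborel) \<partial>lborel) \<le> ennreal (C0 * \<epsilon> n powr \<alpha>)"
    using approx[OF \<epsilon>0] by (rule allI)
  from choice[OF this] obtain a where a': "\<forall>n. nice_field (C1 / \<epsilon> n powr \<beta>) C3 C2 (a n) \<and>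
    (\<integral>\<^sup>+\<tau>\<in>?J. (\<integral>\<^sup>+y. ennreal (norm (a n \<tau> y - c \<tau> y)) \<partial>lborel) \<partial>lborel) \<le> ennreal (C0 * \<epsilon> n powr \<alpha>)" by (elim exE)
  note a = a'[rule_format, THEN conjunct1] a'[rule_format, THEN conjunct2]
  have am: "jointly_borel (a n)" for n using a(1)[of n] by (simp add: nice_field_def)
  define \<rho> where "\<rho> n \<tau> = (\<integral>\<^sup>+y. ennreal (norm (a n \<tau> y - c \<tau> y)) \<partial>lborel) * indicator ?J \<tau>" for n \<tau>
  have rm: "\<rho> n \<in> borel_measurable borel" for n
  proof -
    have "(\<lambda>z. ennreal (norm (a n (fst z) (snd z) - c (fst z) (snd z)))) \<in> borel_measurable (borel :: (real \<times> (real^'n)) measure)"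
      by (rule measurable_compose[OF measurable_compose[OF borel_measurable_diff[OF am[of n] cm] borel_measurable_norm] measurable_ennreal])
    then have "(\<lambda>(\<tau>, y). ennreal (norm (a n \<tau> y - c \<tau> y))) \<in> borel_measurable (borel \<Otimes>\<^sub>M (lborel :: (real^'n) measure))"
      unfolding borel_prod measurable_cong_sets[OF sets_pair_measure_cong[OF refl sets_lborel] refl]
      by (simp add: case_prod_beta' borel_prod)
    then have "(\<lambda>\<tau>. (\<integral>\<^sup>+y. ennreal (norm (a n \<tau> y - c \<tau> y)) \<partial>lborel)) \<in> borel_measurable borel"
      by (rule lborel.borel_measurable_nn_integral)
    then show ?thesis unfolding \<rho>_def[abs_def] by (intro borel_measurable_times_ennreal borel_measurable_indicator) simp_all
  qed
  have lim: "AE \<tau> in lborel. liminf (\<lambda>n. \<rho> n \<tau>) = 0"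
  proof -
    have "(\<lambda>n. C0 * \<epsilon> n powr \<alpha>) \<longlonglongrightarrow> C0 * 0"
    proof (intro tendsto_mult tendsto_const)
      have "\<epsilon> \<longlonglongrightarrow> 0" unfolding \<epsilon>_def[abs_def] by (rule LIMSEQ_inverse_real_of_nat)
      from tendsto_powr2[OF this tendsto_const[of \<alpha>]] C show "(\<lambda>n. \<epsilon> n powr \<alpha>) \<longlonglongrightarrow> 0"
        using \<epsilon>0 by (simp add: less_imp_le)
    qed
    then have z: "(\<lambda>n. ennreal (C0 * \<epsilon> n powr \<alpha>)) \<longlonglongrightarrow> 0" using tendsto_ennrealI by fastforce
    have "(\<integral>\<^sup>+\<tau>. liminf (\<lambda>n. \<rho> n \<tau>) \<partial>lborel) \<le> liminf (\<lambda>n. \<integral>\<^sup>+\<tau>. \<rho> n \<tau> \<partial>lborel)"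
      using rm by (intro nn_integral_liminf) simp
    also have "\<dots> \<le> liminf (\<lambda>n. ennreal (C0 * \<epsilon> n powr \<alpha>))"
      using a(2) by (intro Liminf_mono always_eventually allI) (simp add: \<rho>_def)
    also have "\<dots> = 0" by (rule lim_imp_Liminf[OF _ z]) simp
    finally have "(\<integral>\<^sup>+\<tau>. liminf (\<lambda>n. \<rho> n \<tau>) \<partial>lborel) = 0" by simp
    then show ?thesis using rm by (subst (asm) nn_integral_0_iff_AE) simp_all
  qed
  have "AE \<tau> in lborel. AE y in lborel. \<tau> \<in> ?J \<longrightarrow> f \<tau> y = c \<tau> y"
    by (rule AE_lborel_pairD[of "\<lambda>\<tau> y. \<tau> \<in> ?J \<longrightarrow> f \<tau> y = c \<tau> y"]) (rule eq)
  with lim W show ?thesis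
  proof eventually_elim
    case (elim \<tau>)
    show ?case
    proof
      assume \<tau>: "\<tau> \<in> ?J"
      have fc: "AE y in lborel. f \<tau> y = c \<tau> y" using elim(3) \<tau> by simp
      have Wt: "in_W1p p (f \<tau>) (Df \<tau>)" "AE y in lborel. Df \<tau> y = D \<tau> y" using elim(2) \<tau> by simp_all
      have ap: "lipschitz_L1_limit (f \<tau>)"
      proof (intro allI impI)
        fix e :: real assume e: "0 < e"
        have "\<exists>n. \<rho> n \<tau> < ennreal e"
        proof (rule ccontr)
          assume "\<not> (\<exists>n. \<rho> n \<tau> < ennreal e)"
          then have "ennreal e \<le> liminf (\<lambda>n. \<rho> n \<tau>)" by (intro Liminf_bounded always_eventually) (simp add: not_less)
          then show False using elim(1) e by simp
        qed
        then obtain n where n: "\<rho> n \<tau> < ennreal e" ..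
        have "(\<integral>\<^sup>+x. ennreal (norm (f \<tau> x - a n \<tau> x)) \<partial>lborel) = (\<integral>\<^sup>+x. ennreal (norm (a n \<tau> x - c \<tau> x)) \<partial>lborel)"
          by (rule nn_integral_cong_AE) (use fc in \<open>auto elim!: eventually_mono simp: norm_minus_commute\<close>)
        also have "\<dots> \<le> ennreal e" using n \<tau> by (simp add: \<rho>_def)
        finally have "(\<integral>\<^sup>+x. ennreal (norm (f \<tau> x - a n \<tau> x)) \<partial>lborel) \<le> ennreal e" .
        moreover have "a n \<tau> \<in> borel_measurable borel" using borel_sections(2)[OF am, of n \<tau>] by simp
        moreover have "\<forall>x y. norm (a n \<tau> x - a n \<tau> y) \<le> C1 / \<epsilon> n powr \<beta> * norm (x - y)"
          using a(1)[of n] by (simp add: nice_field_def)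
        moreover have "0 \<le> C1 / \<epsilon> n powr \<beta>" using C by simp
        ultimately show "\<exists>\<phi> M. 0 \<le> M \<and> (\<forall>x y. norm (\<phi> x - \<phi> y) \<le> M * norm (x - y)) \<and>
          \<phi> \<in> borel_measurable borel \<and> (\<integral>\<^sup>+x. ennreal (norm (f \<tau> x - \<phi> x)) \<partial>lborel) \<le> ennreal e"
          by (intro exI conjI)
      qed
      have mf: "maximal_norm (Df \<tau>) x = maximal_norm (D \<tau>) x" for x
        by (rule maximal_function_cong_AE) (use Wt(2) in \<open>auto elim: eventually_mono\<close>)
      obtain N1 where N1: "N1 \<in> null_sets lborel" "\<forall>x y. x \<notin> N1 \<longrightarrow> y \<notin> N1 \<longrightarrow> ennreal (norm (f \<tau> x - f \<tau> y)) \<le>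
        ennreal (k * norm (x - y)) * (maximal_norm (D \<tau>) x + maximal_norm (D \<tau>) y)"
        using haj[OF Wt(1) ap] unfolding mf by (elim bexE)
      obtain N2 where N2: "N2 \<in> null_sets lborel" "\<forall>y. y \<notin> N2 \<longrightarrow> f \<tau> y = c \<tau> y" using AE_lborel_null_set[OF fc] by (elim bexE)
      show "hajlasz_bound k (c \<tau>) (maximal_norm (D \<tau>))"
      proof (intro bexI[of _ "N1 \<union> N2"] allI impI)
        show "N1 \<union> N2 \<in> null_sets lborel" using N1(1) N2(1) by (rule null_sets.Un)
        fix x y assume "x \<notin> N1 \<union> N2" "y \<notin> N1 \<union> N2"
        then show "ennreal (norm (c \<tau> x - c \<tau> y)) \<le> ennreal (k * norm (x - y)) *
           (maximal_norm (D \<tau>) x + maximal_norm (D \<tau>) y)"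
          using N1(2)[rule_format, of x y] N2(2)[rule_format, of x] N2(2)[rule_format, of y] by simp
      qed
    qed
  qed
qed

text \<open>If the ball of radius 1 / (j + 1) about \<open>W x\<close> lies in \<open>A\<close>,
  then \<open>Y n x\<close> is in \<open>A\<close> too unless it is at least that far from
  \<open>W x\<close>. By Markov's inequality for the logarithmic functional the second event has
  measure at most \<open>q r / l n\<close> in the ball of radius \<open>r\<close>, and
  \<open>l n\<close> tends to infinity as \<open>\<delta> n\<close> tends to 0. The closed sets
  \<open>B j\<close>, cut to balls, exhaust the preimage.\<close>

lemma compressible_limit:
  fixes Y :: "nat \<Rightarrow> 'a::euclidean_space \<Rightarrow> 'a"
  assumes Y: "\<And>n. compressible L (Y n)" and W: "W \<in> borel_measurable borel"
    and \<delta>: "\<And>n. 0 < \<delta> n" "\<delta> \<longlonglongrightarrow> 0"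
    and le: "\<And>n r. (\<integral>\<^sup>+x\<in>cball 0 r. ennreal (ln (1 + norm (Y n x - W x) / \<delta> n)) \<partial>lborel) \<le> ennreal (q r)"
  shows "compressible L W"
  unfolding compressible_def
proof (intro conjI allI impI W)
  fix A :: "'a set" assume A: "open A"
  have Ym: "Y n \<in> borel_measurable borel" for n by (rule compressible_measurable[OF Y])
  define B where "B j = {y. ball y (1 / real (Suc j)) \<subseteq> A}" for j
  have cB: "closed (B j)" for j
  proof -
    have "B j = (\<Inter>z\<in>- A. {y. 1 / real (Suc j) \<le> dist y z})" by (force simp: B_def subset_eq not_less)
    moreover have "closed {y. 1 / real (Suc j) \<le> dist y z}" for z by (intro closed_Collect_le continuous_intros)
    ultimately show ?thesis by (simp only:) (intro closed_INT ballI)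
  qed
  define S where "S j = W -` B j \<inter> cball 0 (real j)" for j
  have Sm: "S j \<in> sets lborel" for j
    using measurable_sets[OF W borel_closed[OF cB], of j] by (simp add: S_def)
  have bound: "emeasure lborel (S j) \<le> ennreal L * emeasure lborel A" for j
  proof -
    define l where "l n = ln (1 + 1 / (real (Suc j) * \<delta> n))" for n
    have l0: "0 < l n" for n unfolding l_def using \<delta>(1)[of n] by (intro ln_gt_zero) (simp del: of_nat_Suc)
    have "filterlim \<delta> (at_right 0) sequentially" by (rule tendsto_imp_filterlim_at_right[OF \<delta>(2)]) (simp add: \<delta>(1))
    moreover have "filterlim (\<lambda>d. ln (1 + 1 / (real (Suc j) * d))) at_top (at_right 0)" by real_asymp
    ultimately have "filterlim l at_top sequentially" unfolding l_def[abs_def] by (rule filterlim_compose[rotated])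
    then have "(\<lambda>n. q (real j) / l n) \<longlonglongrightarrow> 0" by (intro tendsto_divide_0[OF tendsto_const] filterlim_at_top_imp_at_infinity)
    then have "(\<lambda>n. ennreal L * emeasure lborel A + ennreal (q (real j) / l n)) \<longlonglongrightarrow> ennreal L * emeasure lborel A + ennreal 0"
      by (intro tendsto_add tendsto_const tendsto_ennrealI)
    moreover have "emeasure lborel (S j) \<le> ennreal L * emeasure lborel A + ennreal (q (real j) / l n)" for n
    proof -
      define R where "R = {x \<in> cball 0 (real j). 1 \<le> ennreal (1 / l n) * ennreal (ln (1 + norm (Y n x - W x) / \<delta> n))}"
      have m: "(\<lambda>x. ennreal (ln (1 + norm (Y n x - W x) / \<delta> n))) \<in> borel_measurable borel"
        using Ym[of n] W by simp
      have mm: "(\<lambda>x. ennreal (ln (1 + norm (Y n x - W x) / \<delta> n)) * indicator (cball 0 (real j)) x) \<in> borel_measurable lborel"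
        unfolding measurable_lborel2 using m by (intro borel_measurable_times_ennreal borel_measurable_indicator) simp_all
      have Rm: "R \<in> sets lborel"
      proof -
        have "(\<lambda>x. ennreal (1 / l n) * ennreal (ln (1 + norm (Y n x - W x) / \<delta> n))) \<in> borel_measurable borel"
          by (rule borel_measurable_times_ennreal[OF borel_measurable_const m])
        then have "{x \<in> space borel. 1 \<le> ennreal (1 / l n) * ennreal (ln (1 + norm (Y n x - W x) / \<delta> n))} \<in> sets borel"
          by (intro borel_measurable_le) simp_all
        moreover have "R = {x \<in> space borel. 1 \<le> ennreal (1 / l n) * ennreal (ln (1 + norm (Y n x - W x) / \<delta> n))} \<inter> cball 0 (real j)"
          by (auto simp: R_def)
        ultimately show ?thesis by simp
      qed
      have YA: "Y n -` A \<in> sets lborel" using measurable_sets[OF Ym, of A n] A by simp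
      have "S j \<subseteq> Y n -` A \<union> R"
      proof
        fix x assume x: "x \<in> S j"
        show "x \<in> Y n -` A \<union> R"
        proof (cases "Y n x \<in> A")
          case False
          then have "1 / real (Suc j) \<le> norm (Y n x - W x)"
            using x by (force simp: S_def B_def subset_eq not_less dist_norm norm_minus_commute)
          then have "1 / (real (Suc j) * \<delta> n) \<le> norm (Y n x - W x) / \<delta> n"
            using divide_right_mono[of "1 / real (Suc j)" "norm (Y n x - W x)" "\<delta> n"] \<delta>(1)[of n]
            by (simp only: divide_divide_eq_left less_imp_le)
          then have "l n \<le> ln (1 + norm (Y n x - W x) / \<delta> n)" unfolding l_def using \<delta>(1)[of n] by (subst ln_le_cancel_iff) (simp_all add: add_pos_nonneg)
          then have "1 \<le> 1 / l n * ln (1 + norm (Y n x - W x) / \<delta> n)" using l0[of n] by (simp add: field_simps)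
          then have "1 \<le> ennreal (1 / l n) * ennreal (ln (1 + norm (Y n x - W x) / \<delta> n))"
            using l0[of n] by (subst ennreal_mult'[symmetric]) (simp_all only: ennreal_1[symmetric] ennreal_leI divide_nonneg_nonneg zero_le_one less_imp_le)
          then show ?thesis using x by (simp add: R_def S_def)
        qed simp
      qed
      then have "emeasure lborel (S j) \<le> emeasure lborel (Y n -` A \<union> R)" using YA Rm by (intro emeasure_mono) auto
      also have "\<dots> \<le> emeasure lborel (Y n -` A) + emeasure lborel R" using YA Rm by (rule emeasure_subadditive)
      also have "emeasure lborel R \<le> ennreal (1 / l n) * (\<integral>\<^sup>+x\<in>cball 0 (real j). ennreal (ln (1 + norm (Y n x - W x) / \<delta> n)) \<partial>lborel)"
        using nn_integral_Markov_inequality[OF mm, of "ennreal (1 / l n)"] by (simp add: R_def)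
      also have "\<dots> \<le> ennreal (1 / l n) * ennreal (q (real j))" by (intro mult_left_mono le) simp
      also have "\<dots> = ennreal (q (real j) / l n)" using l0[of n] by (subst ennreal_mult'[symmetric]) simp_all
      also have "emeasure lborel (Y n -` A) \<le> ennreal L * emeasure lborel A" using Y[of n] A by (simp add: compressible_def)
      finally show ?thesis by (simp add: add_right_mono add_left_mono)
    qed
    ultimately show ?thesis by (auto intro: LIMSEQ_le_const)
  qed
  have inc: "incseq S"
  proof (rule incseq_SucI, rule subsetI)
    fix j x assume "x \<in> S j"
    moreover have "ball (W x) (1 / real (Suc (Suc j))) \<subseteq> ball (W x) (1 / real (Suc j))" by (rule subset_ball) (simp add: frac_le)
    ultimately show "x \<in> S (Suc j)" by (auto simp: S_def B_def)
  qed
  have "W -` A = (\<Union>j. S j)"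
  proof
    show "(\<Union>j. S j) \<subseteq> W -` A" by (auto simp: S_def B_def subset_eq)
    show "W -` A \<subseteq> (\<Union>j. S j)"
    proof
      fix x assume "x \<in> W -` A"
      then obtain e where e: "0 < e" "ball (W x) e \<subseteq> A" using A by (auto simp: open_contains_ball)
      obtain j where j: "max (1 / e) (norm x) < real j" using reals_Archimedean2 by blast
      have "1 / real (Suc j) \<le> e" using e(1) j by (simp add: field_simps)
      then have "ball (W x) (1 / real (Suc j)) \<subseteq> A" using e(2) subset_ball by blast
      then show "x \<in> (\<Union>j. S j)" using j by (auto simp: S_def B_def)
    qed
  qed
  also have "emeasure lborel (\<Union>j. S j) = (SUP j. emeasure lborel (S j))"
    using Sm inc by (intro SUP_emeasure_incseq[symmetric]) auto
  also have "\<dots> \<le> ennreal L * emeasure lborel A" by (intro SUP_least bound)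
  finally show "emeasure lborel (W -` A) \<le> ennreal L * emeasure lborel A" .
qed

text \<open>These data are all that the rate sees of a test function. Function and derivative vanish
  outside a ball, so continuity on that ball bounds both globally.\<close>

lemma test_function_lipschitz_bounded:
  fixes \<phi> :: "real^'n \<Rightarrow> real"
  assumes "test_function \<phi>"
  shows "\<exists>l m S \<sigma>. 0 \<le> l \<and> (\<forall>x y. \<bar>\<phi> x - \<phi> y\<bar> \<le> l * norm (x - y)) \<and> 0 \<le> m \<and> (\<forall>x. \<bar>\<phi> x\<bar> \<le> m) \<and>
    \<phi> \<in> borel_measurable borel \<and> S \<in> sets borel \<and> (\<forall>x. x \<notin> S \<longrightarrow> \<phi> x = 0) \<and> 0 \<le> \<sigma> \<and> emeasure lborel S \<le> ennreal \<sigma>"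
proof -
  define S where "S = closure {x. \<phi> x \<noteq> 0}"
  have sm: "smooth \<phi>" and S: "compact S" using assms by (simp_all add: test_function_def S_def)
  have off: "\<phi> x = 0" if "x \<notin> S" for x using that closure_subset[of "{x. \<phi> x \<noteq> 0}"] by (auto simp: S_def)
  have cont: "continuous_on UNIV \<phi>" by (rule smooth_continuous[OF sm])
  obtain r where r: "0 < r" "S \<subseteq> ball 0 r" using compact_imp_bounded[OF S] bounded_subset_ballD by metis
  have global: "\<exists>C\<ge>0. \<forall>x. \<bar>g x\<bar> \<le> C" if g: "continuous_on UNIV g" "\<And>x. x \<notin> cball 0 r \<Longrightarrow> g x = 0" for g :: "real^'n \<Rightarrow> real"
  proof -
    have "bounded (g ` cball 0 r)"
      by (intro compact_imp_bounded compact_continuous_image continuous_on_subset[OF g(1)]) auto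
    then obtain C where C: "0 < C" "\<And>x. x \<in> cball 0 r \<Longrightarrow> \<bar>g x\<bar> \<le> C" by (auto simp: bounded_pos)
    have "\<bar>g x\<bar> \<le> C" for x using C g(2) by (cases "x \<in> cball 0 r") auto
    then show ?thesis using C(1) less_imp_le by blast
  qed
  obtain m where m: "0 \<le> m" "\<forall>x. \<bar>\<phi> x\<bar> \<le> m" using global[OF cont] off r(2) by force
  have dz: "frechet_derivative \<phi> (at x) v = 0" if x: "x \<notin> cball 0 r" for x v
  proof -
    have "(\<phi> has_derivative (\<lambda>_. 0)) (at x)"
    proof (rule has_derivative_transform_within_open)
      show "((\<lambda>_ :: real^'n. 0 :: real) has_derivative (\<lambda>_. 0)) (at x)" by simp
      show "open (- cball 0 r)" "x \<in> - cball 0 r" using x by auto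
      show "\<And>y. y \<in> - cball 0 r \<Longrightarrow> 0 = \<phi> y" using off r(2) by force
    qed
    from frechet_derivative_at[OF this] show ?thesis by metis
  qed
  have "\<forall>b. \<exists>C\<ge>0. \<forall>x. \<bar>frechet_derivative \<phi> (at x) b\<bar> \<le> C"
    using global[OF smooth_frechet_continuous[OF sm]] dz by blast
  from choice[OF this] obtain C where "\<forall>b. 0 \<le> C b \<and> (\<forall>x. \<bar>frechet_derivative \<phi> (at x) b\<bar> \<le> C b)" by (elim exE)
  then have C: "0 \<le> C b" "\<bar>frechet_derivative \<phi> (at x) b\<bar> \<le> C b" for b x by simp_all
  define l where "l = (\<Sum>b\<in>Basis. C b)"
  have D: "(\<phi> has_derivative frechet_derivative \<phi> (at x)) (at x)" for x
    using smooth_differentiable[OF sm] by (simp add: frechet_derivative_works)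
  have on: "onorm (frechet_derivative \<phi> (at x)) \<le> l" for x
  proof (rule onorm_le)
    fix v :: "real^'n"
    have lin: "linear (frechet_derivative \<phi> (at x))" by (rule has_derivative_linear[OF D])
    have "frechet_derivative \<phi> (at x) v = frechet_derivative \<phi> (at x) (\<Sum>b\<in>Basis. (v \<bullet> b) *\<^sub>R b)" by (simp add: euclidean_representation)
    also have "\<dots> = (\<Sum>b\<in>Basis. (v \<bullet> b) * frechet_derivative \<phi> (at x) b)" by (simp add: linear_sum[OF lin] linear_cmul[OF lin])
    finally have "norm (frechet_derivative \<phi> (at x) v) \<le> (\<Sum>b\<in>Basis. \<bar>(v \<bullet> b) * frechet_derivative \<phi> (at x) b\<bar>)" by simp
    also have "\<dots> \<le> (\<Sum>b\<in>Basis. norm v * C b)"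
      unfolding abs_mult by (intro sum_mono mult_mono C Basis_le_norm) auto
    also have "\<dots> = l * norm v" by (simp add: l_def sum_distrib_left mult.commute)
    finally show "norm (frechet_derivative \<phi> (at x) v) \<le> l * norm v" .
  qed
  have lip: "\<bar>\<phi> x - \<phi> y\<bar> \<le> l * norm (x - y)" for x y
    using differentiable_bound[OF convex_UNIV D on, of x y] by simp
  have "emeasure lborel S < \<infinity>" using S by (intro emeasure_bounded_finite compact_imp_bounded)
  then have "emeasure lborel S \<le> ennreal (measure lborel S)" by (simp add: emeasure_eq_ennreal_measure less_top)
  moreover have "0 \<le> l" unfolding l_def by (intro sum_nonneg C)
  moreover have "\<phi> \<in> borel_measurable borel" by (rule borel_measurable_continuous_onI[OF cont])
  moreover have "S \<in> sets borel" using S by (simp add: borel_compact)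
  ultimately show ?thesis using lip m off
    by (intro exI[of _ l] exI[of _ m] exI[of _ S] exI[of _ "measure lborel S"]) simp
qed

section \<open>Convergence rate\<close>

text \<open>The split is at distance g = h^(\<omega>/2), the square root of the scale of the
  functional. For closer points the Lipschitz bound gives l g, and g \<omega> |ln h| is at most 2.
  For farther points the logarithm is at least ln(1/g) = \<omega> |ln h| / 2, which pays for the
  crude bound 2 m. A bound on the functional thereby becomes a rate in |ln h|.\<close>

lemma test_function_log_bound:
  fixes \<phi> :: "'a::real_normed_vector \<Rightarrow> real"
  assumes \<phi>: "\<bar>\<phi> a - \<phi> b\<bar> \<le> l * norm (a - b)" "\<bar>\<phi> a\<bar> \<le> m" "\<bar>\<phi> b\<bar> \<le> m" "0 \<le> l" and h: "0 < h" "h < 1" and \<omega>: "0 < \<omega>"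
  shows "\<bar>\<phi> a - \<phi> b\<bar> \<le> (l + 4 * m) / (\<omega> * \<bar>ln h\<bar>) * (ln (1 + norm (a - b) / h powr \<omega>) + 2)"
proof -
  define r where "r = norm (a - b)"
  define g where "g = h powr (\<omega> / 2)"
  define y where "y = \<omega> * \<bar>ln h\<bar>"
  have lh: "ln h < 0" using h by simp
  have y: "0 < y" unfolding y_def using lh by (intro mult_pos_pos \<omega>) simp
  have g: "0 < g" "h powr \<omega> = g * g" using h by (simp_all add: g_def flip: powr_add)
  have lng: "ln (1 / g) = y / 2" using h lh by (simp add: g_def y_def ln_div ln_powr)
  have r0: "0 \<le> r" by (simp add: r_def)
  have m0: "0 \<le> m" using \<phi>(2) by linarith
  have l0: "0 \<le> ln (1 + r / (g * g))" using r0 g(1) by simp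
  have "\<bar>\<phi> a - \<phi> b\<bar> * y \<le> (l + 4 * m) * (ln (1 + r / (g * g)) + 2)"
  proof (cases "r \<le> g")
    case True
    have "g * y \<le> 2"
    proof -
      have "ln (1 / g) \<le> 1 / g" using g(1) ln_le_minus_one[of "1 / g"] by simp
      then have "g * (y / 2) \<le> g * (1 / g)" unfolding lng using g(1) by (intro mult_left_mono) simp_all
      then show ?thesis using g(1) by simp
    qed
    have "\<bar>\<phi> a - \<phi> b\<bar> * y \<le> (l * g) * y"
      using \<phi>(1,4) True y mult_left_mono[OF True \<phi>(4)] by (intro mult_right_mono) (simp_all add: r_def)
    also have "\<dots> = l * (g * y)" by simp
    also have "\<dots> \<le> l * 2" using \<open>g * y \<le> 2\<close> \<phi>(4) by (rule mult_left_mono)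
    also have "\<dots> \<le> (l + 4 * m) * (ln (1 + r / (g * g)) + 2)" using l0 m0 \<phi>(4) by (intro mult_mono) simp_all
    finally show ?thesis .
  next
    case False
    then have "1 / g \<le> r / (g * g)" using g(1) by (simp add: field_simps)
    then have "ln (1 / g) \<le> ln (1 + r / (g * g))" using g(1) r0 by (subst ln_le_cancel_iff) (simp_all add: add_pos_nonneg)
    then have "y \<le> 2 * (ln (1 + r / (g * g)) + 2)" using lng by simp
    then have "\<bar>\<phi> a - \<phi> b\<bar> * y \<le> (2 * m) * (2 * (ln (1 + r / (g * g)) + 2))"
      using \<phi>(2,3) y m0 by (intro mult_mono) simp_all
    also have "\<dots> = (4 * m) * (ln (1 + r / (g * g)) + 2)" by simp
    also have "\<dots> \<le> (l + 4 * m) * (ln (1 + r / (g * g)) + 2)" using l0 \<phi>(4) by (intro mult_right_mono) simp_all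
    finally show ?thesis .
  qed
  then show ?thesis using y unfolding g(2) r_def[symmetric] y_def[symmetric] by (simp add: pos_le_divide_eq)
qed

text \<open>Everything at one fixed time \<open>t\<close>, in Borel form; of \<open>W\<close> only
  some compression constant is known. The exponents 1/2 and \<alpha>/(2\<beta>) are the powers of h
  in the velocity error and in the regularisation error. \<open>\<omega>\<close> is half of the
  smaller one, so that a spare factor \<open>h powr \<omega>\<close> can absorb \<open>C3\<close>.
  The last three bounds on \<open>h0\<close> give, in this order, h K \<le> 1/8, \<kappa> \<le> 1/2
  and \<open>C3 * h powr \<omega> \<le> 1\<close>. \<open>Q e l\<close> bounds the functional over a
  set of measure at most \<open>e\<close> when the flow has compression constant
  \<open>l\<close>.\<close>

locale backward_problem =
  fixes T t p G C0 C1 C2 C3 \<alpha> \<beta> \<theta> k \<omega> L h0 :: real and Q :: "real \<Rightarrow> real \<Rightarrow> real"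
    and be :: "real \<Rightarrow> real \<Rightarrow> real^'n \<Rightarrow> real^'n" and c W F :: "real \<Rightarrow> real^'n \<Rightarrow> real^'n"
    and D Df :: "real \<Rightarrow> real^'n \<Rightarrow> real^'n^'n" and A :: "real \<Rightarrow> real"
  assumes pos: "0 < T" "1 < p" "0 \<le> G" "0 < C0" "0 < C1" "0 < C2" "0 < C3" "0 < \<alpha>" "0 < \<beta>" "0 \<le> \<theta>" "\<theta> \<le> 1" "0 \<le> k"
    and t: "0 \<le> t" "t \<le> T"
    and omega: "\<omega> = min (1 / 2) (\<alpha> / (2 * \<beta>)) / 2"
    and L: "L = det_const TYPE('n) * exp (4 * T * (C2 + det_const TYPE('n) * C1\<^sup>2))"
    and h0: "0 < h0" "h0 < 1" "h0 \<le> 1 / (8 * C1)\<^sup>2" "h0 \<le> 1 / (2 * (C2 + det_const TYPE('n) * C1\<^sup>2))" "h0 \<le> max 1 C3 powr (- 1 / \<omega>)"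
    and Q: "\<And>e l. Q e l = 2 * e + (C1 * T * e + L * C0) +
      k * ((T + G) * (e + L * maximal_const TYPE('n) p) + (T + G) * (e + l * maximal_const TYPE('n) p))"
    and cm: "jointly_borel c" and Dm: "jointly_borel D"
    and A: "A \<in> borel_measurable borel" "\<And>\<tau>. 0 \<le> A \<tau>" "(\<integral>\<^sup>+\<tau>\<in>{0<..<t}. ennreal (A \<tau>) \<partial>lborel) \<le> ennreal G"
    and sobolev: "AE \<tau> in lborel. \<tau> \<in> {0<..<t} \<longrightarrow>
      in_W1p p (F \<tau>) (Df \<tau>) \<and> (AE y in lborel. Df \<tau> y = D \<tau> y) \<and> Lp_norm p (Df \<tau>) = A \<tau>"
    and haj: "AE \<tau> in lborel. \<tau> \<in> {0<..<t} \<longrightarrow> hajlasz_bound k (c \<tau>) (maximal_norm (D \<tau>))"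
    and approx: "\<And>\<epsilon>. 0 < \<epsilon> \<Longrightarrow> \<exists>a. nice_field (C1 / \<epsilon> powr \<beta>) C3 C2 a \<and>
      (AE \<tau> in lborel. \<tau> \<in> {0<..<T} \<longrightarrow> (\<forall>y. be \<epsilon> \<tau> y = a \<tau> y)) \<and>
      (\<integral>\<^sup>+\<tau>\<in>{0<..<t}. (\<integral>\<^sup>+y. ennreal (norm (a \<tau> y - c \<tau> y)) \<partial>lborel) \<partial>lborel) \<le> ennreal (C0 * \<epsilon> powr \<alpha>)"
    and Wm: "jointly_borel W" and Wc: "\<exists>l>0. \<forall>\<tau>. compressible l (W \<tau>)"
    and flow: "AE x in lborel. \<forall>s\<in>{0..t}. integrable lborel (\<lambda>\<tau>. indicator {0..s} \<tau> *\<^sub>R c \<tau> (W \<tau> x)) \<and>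
      W s x = x + (LINT \<tau>|lborel. indicator {0..s} \<tau> *\<^sub>R c \<tau> (W \<tau> x))"
begin

lemma omega_pos: "0 < \<omega>" "2 * \<omega> \<le> 1 / 2" "2 * \<omega> \<le> \<alpha> / (2 * \<beta>)"
  unfolding omega using pos by simp_all

lemma L_pos: "0 < L"
  unfolding L using det_const_pos[where 'n='n] by simp

lemma W_sections: "W s \<in> borel_measurable borel"
  using borel_sections(2)[OF Wm, of s] by simp

lemma step_size_bounds:
  assumes h: "0 < h" "h \<le> h0"
  shows "C3 * sqrt h \<le> h powr \<omega>" "C3 * h \<le> h powr \<omega>" "C0 * (h powr (1 / (2 * \<beta>))) powr \<alpha> \<le> C0 * h powr \<omega>"
    "(h powr (1 / (2 * \<beta>))) powr \<beta> = sqrt h"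
    "h * (C1 / sqrt h) = C1 * sqrt h" "C1 * sqrt h \<le> 1 / 8" "h * (C2 + det_const TYPE('n) * C1\<^sup>2) \<le> 1 / 2"
proof -
  have h1: "h < 1" using h h0(2) by linarith
  define s where "s = sqrt h"
  have s: "0 < s" "h = s * s" using h(1) by (simp_all add: s_def)
  have "h powr \<omega> \<le> (max 1 C3 powr (- 1 / \<omega>)) powr \<omega>" using h h0(5) omega_pos by (intro powr_mono2) simp_all
  also have "\<dots> = max 1 C3 powr (- 1)" unfolding powr_powr using omega_pos by simp
  also have "\<dots> = 1 / max 1 C3" by (simp add: powr_minus_divide)
  also have "\<dots> \<le> 1 / C3" using pos by (intro divide_left_mono) simp_all
  finally have C3w: "C3 * h powr \<omega> \<le> 1" using pos by (simp add: field_simps)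
  \<comment> \<open>One factor \<open>h powr \<omega>\<close> is spent on \<open>C3\<close>, the
    other is kept.\<close>
  have "C3 * h powr (2 * \<omega>) = (C3 * h powr \<omega>) * h powr \<omega>" by (simp flip: powr_add)
  also have "\<dots> \<le> 1 * h powr \<omega>" by (intro mult_right_mono C3w) simp
  finally have C32: "C3 * h powr (2 * \<omega>) \<le> h powr \<omega>" by simp
  have "sqrt h = h powr (1 / 2)" using h(1) by (simp add: powr_half_sqrt)
  also have "\<dots> \<le> h powr (2 * \<omega>)" using omega_pos h h1 by (intro powr_mono') simp_all
  finally have "C3 * sqrt h \<le> C3 * h powr (2 * \<omega>)" using pos by (intro mult_left_mono) simp_all
  with C32 show 1: "C3 * sqrt h \<le> h powr \<omega>" by linarith
  have "s \<le> 1" using h1 by (simp add: s_def)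
  then have "h \<le> sqrt h" using s mult_left_mono[of s 1 s] by (simp add: s_def[symmetric])
  then have "C3 * h \<le> C3 * sqrt h" using pos by (intro mult_left_mono) simp_all
  with 1 show "C3 * h \<le> h powr \<omega>" by linarith
  have "(h powr (1 / (2 * \<beta>))) powr \<alpha> = h powr (\<alpha> / (2 * \<beta>))" by (simp add: powr_powr)
  also have "\<dots> \<le> h powr \<omega>" using omega_pos h h1 by (intro powr_mono') simp_all
  finally show "C0 * (h powr (1 / (2 * \<beta>))) powr \<alpha> \<le> C0 * h powr \<omega>" using pos by (intro mult_left_mono) simp_all
  show "(h powr (1 / (2 * \<beta>))) powr \<beta> = sqrt h" using pos h(1) by (simp add: powr_powr powr_half_sqrt)
  show "h * (C1 / sqrt h) = C1 * sqrt h" using s unfolding s_def[symmetric] by (simp add: field_simps)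
  have "sqrt h \<le> sqrt (1 / (8 * C1)\<^sup>2)" using h h0(3) by (intro real_sqrt_le_mono) linarith
  also have "\<dots> = 1 / (8 * C1)" using pos by (simp add: real_sqrt_divide real_sqrt_mult)
  finally show "C1 * sqrt h \<le> 1 / 8" using pos by (simp add: field_simps)
  have "h \<le> 1 / (2 * (C2 + det_const TYPE('n) * C1\<^sup>2))" using h h0(4) by linarith
  moreover have "0 < C2 + det_const TYPE('n) * C1\<^sup>2" using pos det_const_pos[where 'n='n] by (intro add_pos_nonneg) simp_all
  ultimately show "h * (C2 + det_const TYPE('n) * C1\<^sup>2) \<le> 1 / 2" by (simp add: field_simps)
qed

text \<open>The compression constant \<open>l\<close> of \<open>W\<close> is a parameter because the
  estimate serves twice: with the unspecified constant of the flow it shows convergence in measure,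
  and once \<open>flow_compressible\<close> is available it is applied with
  \<open>L\<close>.\<close>

lemma theta_flow_estimate:
  assumes N: "0 < N" and h: "h = T / real N" "h \<le> h0" and s: "s \<in> {0..t}"
    and l: "\<And>\<tau>. \<tau> \<in> {0<..<t} \<Longrightarrow> compressible l (W \<tau>)" "0 \<le> l"
  shows "compressible L (theta_flow h \<theta> (be (h powr (1 / (2 * \<beta>)))) s)"
    and "E \<in> sets borel \<Longrightarrow> emeasure lborel E \<le> ennreal e \<Longrightarrow> 0 \<le> e \<Longrightarrow>
      (\<integral>\<^sup>+x\<in>E. ennreal (ln (1 + norm (theta_flow h \<theta> (be (h powr (1 / (2 * \<beta>)))) s x - W s x) / h powr \<omega>)) \<partial>lborel) \<le> ennreal (Q e l)"
proof -
  define \<epsilon> where "\<epsilon> = h powr (1 / (2 * \<beta>))"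
  define K where "K = C1 / \<epsilon> powr \<beta>"
  define \<mu> where "\<mu> = C2 + det_const TYPE('n) * C1\<^sup>2"
  define \<kappa> where "\<kappa> = h * C2 + det_const TYPE('n) * (h * K)\<^sup>2"
  define Y where "Y = theta_flow h \<theta> (be \<epsilon>)"
  have hp: "0 < h" using N h(1) pos by simp
  note b = step_size_bounds[OF hp h(2), folded \<epsilon>_def]
  have Nh: "real N * h = T" using N h(1) by simp
  have Ks: "K = C1 / sqrt h" by (simp add: K_def b(4))
  have K: "0 \<le> K" "h * K \<le> 1 / 8" "h * K = C1 * sqrt h" using b(5,6) pos hp by (simp_all add: Ks)
  have \<kappa>: "\<kappa> = h * \<mu>" unfolding \<kappa>_def \<mu>_def K(3) using hp by (simp add: power_mult_distrib algebra_simps)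
  have \<kappa>2: "\<kappa> \<le> 1 / 2" unfolding \<kappa> \<mu>_def by (rule b(7))
  have \<mu>0: "0 < \<mu>" unfolding \<mu>_def using pos det_const_pos[where 'n='n] by (intro add_pos_nonneg) simp_all
  have \<epsilon>0: "0 < \<epsilon>" using hp by (simp add: \<epsilon>_def)
  obtain a where a: "nice_field K C3 C2 a" "AE \<tau> in lborel. \<tau> \<in> {0<..<T} \<longrightarrow> (\<forall>y. be \<epsilon> \<tau> y = a \<tau> y)"
    "(\<integral>\<^sup>+\<tau>\<in>{0<..<t}. (\<integral>\<^sup>+y. ennreal (norm (a \<tau> y - c \<tau> y)) \<partial>lborel) \<partial>lborel) \<le> ennreal (C0 * \<epsilon> powr \<alpha>)"
    using approx[OF \<epsilon>0] unfolding K_def[symmetric] by (elim exE conjE)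
  have am: "jointly_borel a" using a(1) by (simp add: nice_field_def)
  obtain U V where Um: "jointly_borel U" and Vm: "jointly_borel V"
    and Uc: "\<forall>\<tau>. compressible ((1 + 4 * \<kappa>) ^ N) (U \<tau>)" and VM: "\<forall>\<tau> x. norm (V \<tau> x) \<le> C3"
    and VU: "\<forall>\<tau>\<in>{0..<T}. \<forall>x. norm (V \<tau> x - a \<tau> (U \<tau> x)) \<le> K * (C3 * h)"
    and ZU: "\<forall>s\<in>{0..T}. \<forall>x. norm (x + (LINT \<tau>|lborel. indicator {0..s} \<tau> *\<^sub>R V \<tau> x) - U s x) \<le> C3 * h"
    and Yc: "\<forall>s\<in>{0..T}. compressible (det_const TYPE('n) * (1 + 4 * \<kappa>) ^ N) (Y s) \<and> (\<forall>x. norm (Y s x - U s x) \<le> C3 * h)"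
    using theta_scheme[OF a(1) hp Nh K(1,2) less_imp_le[OF pos(7)] pos(10,11) a(2) \<kappa>_def \<kappa>2]
    unfolding Y_def by (elim exE conjE)
  define Z where "Z s x = x + (LINT \<tau>|lborel. indicator {0..s} \<tau> *\<^sub>R V \<tau> x)" for s x
  \<comment> \<open>One step costs 1 + 4 h \<mu> and there are T / h of them, so the product stays
    below an exponential free of h.\<close>
  have grow: "(1 + 4 * \<kappa>) ^ N \<le> exp (4 * T * \<mu>)"
  proof -
    have "(1 + 4 * \<kappa>) ^ N \<le> exp (4 * \<kappa>) ^ N"
      using hp \<mu>0 exp_ge_add_one_self[of "4 * \<kappa>"] by (intro power_mono) (simp_all add: \<kappa>)
    also have "\<dots> = exp (4 * (real N * h) * \<mu>)" by (simp add: \<kappa> flip: exp_of_nat_mult)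
    finally show ?thesis unfolding Nh .
  qed
  have LL: "det_const TYPE('n) * (1 + 4 * \<kappa>) ^ N \<le> L"
    unfolding L \<mu>_def[symmetric] using grow det_const_pos[where 'n='n] by (intro mult_left_mono) simp_all
  have "1 * (1 + 4 * \<kappa>) ^ N \<le> det_const TYPE('n) * (1 + 4 * \<kappa>) ^ N"
    using hp \<mu>0 by (intro mult_right_mono det_const_ge_1) (simp add: \<kappa>)
  then have LU: "(1 + 4 * \<kappa>) ^ N \<le> L" using LL by simp
  have sT: "s \<in> {0..T}" using s t by auto
  have YL: "compressible L (Y s)" using Yc sT LL compressible_mono by blast
  then show "compressible L (theta_flow h \<theta> (be (h powr (1 / (2 * \<beta>)))) s)" unfolding Y_def \<epsilon>_def .
  assume E: "E \<in> sets borel" "emeasure lborel E \<le> ennreal e" "0 \<le> e"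
  \<comment> \<open>The exact measure of \<open>E\<close> is kept until the end, where everything is
    monotone in it, and is then replaced by its bound \<open>e\<close>.\<close>
  define e' where "e' = measure lborel E"
  have Ee: "emeasure lborel E = ennreal e'"
    using E(2) unfolding e'_def by (intro emeasure_eq_ennreal_measure) (auto simp: top_unique)
  have e': "0 \<le> e'" "e' \<le> e" using E(2,3) by (simp_all add: e'_def Ee[unfolded e'_def])
  define \<delta> where "\<delta> = h powr \<omega>"
  have \<delta>: "0 < \<delta>" using hp by (simp add: \<delta>_def)
  define m where "m = maximal_const TYPE('n) p"
  have m0: "0 \<le> m" unfolding m_def by (rule maximal_const_nonneg[OF pos(2)])
  let ?g = "\<lambda>\<tau>. maximal_norm (D \<tau>)"
  have gm: "(\<lambda>z. ?g (fst z) (snd z)) \<in> borel_measurable borel"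
    by (rule maximal_function_measurable_family) (rule measurable_compose[OF measurable_compose[OF Dm borel_measurable_norm] measurable_ennreal])
  have UL: "compressible L (U \<tau>)" for \<tau> using Uc LU compressible_mono by blast
  have gU: "(\<integral>\<^sup>+\<tau>\<in>{0<..<t}. (\<integral>\<^sup>+x\<in>E. ?g \<tau> (U \<tau> x) \<partial>lborel) \<partial>lborel) \<le> ennreal ((t + G) * (e' + L * m))"
    unfolding m_def
    by (rule maximal_gradient_along_flow[OF Dm pos(2) t(1) A pos(3) sobolev UL less_imp_le[OF L_pos] E(1) Ee e'(1)])
  have gW: "(\<integral>\<^sup>+\<tau>\<in>{0<..<t}. (\<integral>\<^sup>+x\<in>E. ?g \<tau> (W \<tau> x) \<partial>lborel) \<partial>lborel) \<le> ennreal ((t + G) * (e' + l * m))"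
    unfolding m_def
    by (rule maximal_gradient_along_flow[OF Dm pos(2) t(1) A pos(3) sobolev l E(1) Ee e'(1)])
  have "(\<integral>\<^sup>+x\<in>E. ennreal (ln (1 + norm (Z s x - W s x) / \<delta>)) \<partial>lborel) \<le>
     ennreal ((K * (C3 * h) * t * e' + L * (C0 * \<epsilon> powr \<alpha>)) / \<delta> + k * ((t + G) * (e' + L * m) + (t + G) * (e' + l * m)))"
  proof (rule flow_stability[OF t(1) am cm Um Vm Wm gm UL less_imp_le[OF L_pos] l(1) VM[rule_format] _ Z_def _ flow a(3) _ haj pos(12)
        E(1) Ee e'(1) gU _ gW _ \<delta> _ _ s])
    show "norm (V \<tau> x - a \<tau> (U \<tau> x)) \<le> K * (C3 * h)" if "\<tau> \<in> {0<..<t}" for \<tau> x using VU that t by auto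
    show "norm (Z s x - U s x) \<le> C3 * h" if "s \<in> {0..t}" for s x using ZU that t unfolding Z_def by auto
    show "0 \<le> C0 * \<epsilon> powr \<alpha>" "0 \<le> K * (C3 * h)" using pos K hp by simp_all
    show "C3 * h \<le> \<delta>" unfolding \<delta>_def by (rule b(2))
    show "0 \<le> (t + G) * (e' + L * m)" "0 \<le> (t + G) * (e' + l * m)" using t pos e' L_pos m0 l by simp_all
  qed
  also have "\<dots> \<le> ennreal (Q e l - 2 * e)"
  proof (rule ennreal_leI)
    have "K * (C3 * h) = C1 * (C3 * sqrt h)" using K(3) by (simp add: algebra_simps)
    also have "\<dots> \<le> C1 * \<delta>" using b(1) pos unfolding \<delta>_def by (intro mult_left_mono) simp_all
    finally have 1: "K * (C3 * h) \<le> C1 * \<delta>" .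
    have te: "t * e' \<le> T * e" using t e' pos by (intro mult_mono) simp_all
    have "K * (C3 * h) * (t * e') \<le> C1 * \<delta> * (T * e)"
      using \<delta> pos t e' by (intro mult_mono[OF 1 te]) simp_all
    moreover have "L * (C0 * \<epsilon> powr \<alpha>) \<le> L * (C0 * \<delta>)" using mult_left_mono[OF b(3), of L] L_pos unfolding \<delta>_def by simp
    ultimately have "K * (C3 * h) * t * e' + L * (C0 * \<epsilon> powr \<alpha>) \<le> (C1 * T * e + L * C0) * \<delta>" by (simp add: algebra_simps)
    then have "(K * (C3 * h) * t * e' + L * (C0 * \<epsilon> powr \<alpha>)) / \<delta> \<le> C1 * T * e + L * C0" using \<delta> by (simp add: pos_divide_le_eq)
    moreover have "k * ((t + G) * (e' + L * m) + (t + G) * (e' + l * m)) \<le> k * ((T + G) * (e + L * m) + (T + G) * (e + l * m))"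
      using t pos e' m0 l L_pos by (intro mult_left_mono add_mono mult_mono) simp_all
    ultimately show "(K * (C3 * h) * t * e' + L * (C0 * \<epsilon> powr \<alpha>)) / \<delta> + k * ((t + G) * (e' + L * m) + (t + G) * (e' + l * m)) \<le> Q e l - 2 * e"
      unfolding Q m_def[symmetric] by linarith
  qed
  finally have Zs: "(\<integral>\<^sup>+x\<in>E. ennreal (ln (1 + norm (Z s x - W s x) / \<delta>)) \<partial>lborel) \<le> ennreal (Q e l - 2 * e)" .
  have Zm: "Z s \<in> borel_measurable borel"
  proof -
    have "(\<lambda>z :: (real^'n) \<times> real. indicator {0..s} (snd z) *\<^sub>R V (snd z) (fst z)) \<in> borel_measurable borel"
    proof (intro borel_measurable_scaleR)
      show "(\<lambda>z :: (real^'n) \<times> real. indicator {0..s} (snd z) :: real) \<in> borel_measurable borel"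
        by (rule measurable_compose[OF borel_measurable_snd_borel borel_measurable_indicator]) simp
      have "(\<lambda>z :: (real^'n) \<times> real. (snd z, fst z)) \<in> borel_measurable borel"
        by (intro borel_measurable_continuous_onI continuous_intros)
      from measurable_compose[OF this Vm] show "(\<lambda>z. V (snd z) (fst z)) \<in> borel_measurable borel" by simp
    qed
    then have "(\<lambda>(x, \<tau>). indicator {0..s} \<tau> *\<^sub>R V \<tau> x) \<in> borel_measurable ((borel :: (real^'n) measure) \<Otimes>\<^sub>M (lborel :: real measure))"
      unfolding measurable_cong_sets[OF sets_pair_measure_cong[OF refl sets_lborel] refl]
      by (simp add: case_prod_beta' borel_prod)
    from lborel.borel_measurable_lebesgue_integral[OF this] show ?thesis unfolding Z_def[abs_def] by simp
  qed
  \<comment> \<open>The interpolated flow and the driven path are both within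
    \<open>\<delta>\<close> of \<open>U\<close>. Passing from one to the other changes the argument
    of the logarithm from 1 + r to at most 3 (1 + r), and ln 3 \<le> 2 accounts for the term
    \<open>2 * e\<close> in \<open>Q\<close>.\<close>
  have le: "ln (1 + norm (Y s x - W s x) / \<delta>) \<le> 2 + ln (1 + norm (Z s x - W s x) / \<delta>)" for x
  proof -
    define r where "r = norm (Z s x - W s x) / \<delta>"
    have r0: "0 \<le> r" using \<delta> by (simp add: r_def)
    have "norm (Y s x - W s x) \<le> norm (Y s x - U s x) + norm (Z s x - U s x) + norm (Z s x - W s x)"
      using norm_triangle_ineq4[of "Y s x - U s x" "Z s x - U s x"] norm_triangle_ineq[of "Y s x - Z s x" "Z s x - W s x"] by simp
    also have "\<dots> \<le> 2 * \<delta> + norm (Z s x - W s x)"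
    proof -
      have "norm (Y s x - U s x) \<le> C3 * h" using Yc sT by blast
      moreover have "norm (Z s x - U s x) \<le> C3 * h" using ZU sT unfolding Z_def by blast
      moreover have "C3 * h \<le> \<delta>" unfolding \<delta>_def by (rule b(2))
      ultimately show ?thesis by linarith
    qed
    finally have "norm (Y s x - W s x) / \<delta> \<le> (2 * \<delta> + norm (Z s x - W s x)) / \<delta>" using \<delta> by (intro divide_right_mono) simp_all
    also have "\<dots> = 2 + r" using \<delta> by (simp add: r_def add_divide_distrib)
    finally have "1 + norm (Y s x - W s x) / \<delta> \<le> 1 + (2 + r)" by (rule add_left_mono)
    also have "\<dots> \<le> 3 * (1 + r)" using r0 by simp
    finally have "1 + norm (Y s x - W s x) / \<delta> \<le> 3 * (1 + r)" .
    then have "ln (1 + norm (Y s x - W s x) / \<delta>) \<le> ln (3 * (1 + r))"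
      using \<delta> r0 by (subst ln_le_cancel_iff) (simp_all add: add_pos_nonneg)
    also have "\<dots> = ln 3 + ln (1 + r)" using r0 by (intro ln_mult_pos) simp_all
    finally show ?thesis using ln_le_minus_one[of 3] by (simp add: r_def)
  qed
  have "(\<integral>\<^sup>+x\<in>E. ennreal (ln (1 + norm (Y s x - W s x) / \<delta>)) \<partial>lborel) \<le>
    (\<integral>\<^sup>+x. ennreal 2 * indicator E x + ennreal (ln (1 + norm (Z s x - W s x) / \<delta>)) * indicator E x \<partial>lborel)"
  proof (rule nn_integral_mono)
    fix x
    have "0 \<le> ln (1 + norm (Z s x - W s x) / \<delta>)" using \<delta> by simp
    then have "ennreal (ln (1 + norm (Y s x - W s x) / \<delta>)) \<le> ennreal 2 + ennreal (ln (1 + norm (Z s x - W s x) / \<delta>))"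
      using ennreal_leI[OF le[of x]] by (simp only: ennreal_plus[symmetric] zero_le_numeral)
    then show "ennreal (ln (1 + norm (Y s x - W s x) / \<delta>)) * indicator E x \<le>
      ennreal 2 * indicator E x + ennreal (ln (1 + norm (Z s x - W s x) / \<delta>)) * indicator E x"
      by (simp add: indicator_def)
  qed
  also have "\<dots> = ennreal 2 * emeasure lborel E + (\<integral>\<^sup>+x\<in>E. ennreal (ln (1 + norm (Z s x - W s x) / \<delta>)) \<partial>lborel)"
  proof -
    have "(\<lambda>x. ennreal (ln (1 + norm (Z s x - W s x) / \<delta>)) * indicator E x) \<in> borel_measurable lborel"
      unfolding measurable_lborel2 using Zm W_sections[of s] E(1) by (intro borel_measurable_times_ennreal borel_measurable_indicator) simp_all
    then show ?thesis using E(1) by (subst nn_integral_add) (simp_all add: nn_integral_cmult_indicator)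
  qed
  also have "\<dots> \<le> ennreal 2 * ennreal e + ennreal (Q e l - 2 * e)" by (intro add_mono mult_left_mono E(2) Zs) simp
  also have "\<dots> = ennreal (Q e l)"
  proof -
    have "0 \<le> Q e l - 2 * e" unfolding Q m_def[symmetric] using pos E(3) L_pos m0 l by simp
    then have "ennreal (2 * e) + ennreal (Q e l - 2 * e) = ennreal (2 * e + (Q e l - 2 * e))"
      using E(3) by (intro ennreal_plus[symmetric]) simp_all
    then show ?thesis using E(3) by (simp add: ennreal_mult')
  qed
  finally show "(\<integral>\<^sup>+x\<in>E. ennreal (ln (1 + norm (theta_flow h \<theta> (be (h powr (1 / (2 * \<beta>)))) s x - W s x) / h powr \<omega>)) \<partial>lborel) \<le> ennreal (Q e l)"
    unfolding Y_def \<epsilon>_def \<delta>_def .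
qed

text \<open>The compression constant \<open>L\<close> of the scheme does not depend on the step
  size. The unknown constant \<open>l\<close> sits inside the bound \<open>Q\<close> on the
  functional, where it is harmless: that bound stays fixed on each ball while the scale
  \<open>h powr \<omega>\<close> tends to 0.\<close>

lemma flow_compressible:
  assumes s: "s \<in> {0..t}"
  shows "compressible L (W s)"
proof -
  obtain l where l: "0 < l" "\<forall>\<tau>. compressible l (W \<tau>)" using Wc by (elim exE conjE)
  obtain N0 where N0: "T / h0 < real N0" using reals_Archimedean2 by blast
  \<comment> \<open>The offset \<open>N0\<close> makes every step size of the sequence
    admissible.\<close>
  define h where "h n = T / real (Suc (N0 + n))" for n
  have hp: "0 < h n" for n using pos by (simp add: h_def)
  have hh: "h n \<le> h0" for n
  proof -
    have "T < real N0 * h0" using N0 h0(1) by (simp add: pos_divide_less_eq)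
    also have "\<dots> \<le> real (Suc (N0 + n)) * h0" using h0(1) by (intro mult_right_mono) simp_all
    finally show ?thesis unfolding h_def by (simp add: divide_le_eq mult.commute del: of_nat_Suc)
  qed
  note est = theta_flow_estimate[OF _ h_def hh s, of _ l]
  show ?thesis
  proof (rule compressible_limit)
    show "compressible L (theta_flow (h n) \<theta> (be (h n powr (1 / (2 * \<beta>)))) s)" for n
      using l by (intro est(1)) simp_all
    show "W s \<in> borel_measurable borel" by (rule W_sections)
    show "0 < h n powr \<omega>" for n using hp[of n] by simp
    have "h \<longlonglongrightarrow> 0" unfolding h_def[abs_def] by real_asymp
    from tendsto_powr2[OF this tendsto_const[of \<omega>]] show "(\<lambda>n. h n powr \<omega>) \<longlonglongrightarrow> 0"
      using hp omega_pos(1) by (simp add: less_imp_le)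
    fix n r
    show "(\<integral>\<^sup>+x\<in>cball 0 r. ennreal (ln (1 + norm (theta_flow (h n) \<theta> (be (h n powr (1 / (2 * \<beta>)))) s x - W s x) / h n powr \<omega>)) \<partial>lborel)
      \<le> ennreal (Q (measure lborel (cball 0 r :: (real^'n) set)) l)"
    proof (rule est(2))
      show "emeasure lborel (cball 0 r :: (real^'n) set) \<le> ennreal (measure lborel (cball 0 r :: (real^'n) set))"
        by (rule eq_refl, rule emeasure_eq_ennreal_measure) (use emeasure_lborel_cball_finite[of "0 :: real^'n" r] in auto)
    qed (use l in simp_all)
  qed
qed

text \<open>With \<open>\<phi>\<close> in place of \<open>u\<close> the difference vanishes outside
  \<open>E\<close>, the set of points that one of the two flows sends into \<open>S\<close>, and
  compression bounds its measure by 2 L \<sigma>. This localisation lets the functional, which lives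
  on sets of finite measure, control an integral over the whole space. Replacing \<open>u\<close> by
  \<open>\<phi>\<close> costs the L1 error once along each flow.\<close>

lemma solution_estimate:
  assumes N: "0 < N" and h: "h = T / real N" "h \<le> h0"
    and \<phi>: "\<And>x y. \<bar>\<phi> x - \<phi> y\<bar> \<le> q * norm (x - y)" "0 \<le> q" "\<And>x. \<bar>\<phi> x\<bar> \<le> m" "0 \<le> m" "\<phi> \<in> borel_measurable borel"
    and S: "S \<in> sets borel" "\<And>x. x \<notin> S \<Longrightarrow> \<phi> x = 0" "0 \<le> \<sigma>" "emeasure lborel S \<le> ennreal \<sigma>" and u: "u \<in> borel_measurable borel"
  shows "(\<integral>\<^sup>+x. ennreal \<bar>u (theta_flow h \<theta> (be (h powr (1 / (2 * \<beta>)))) t x) - u (W t x)\<bar> \<partial>lborel) \<le>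
    ennreal (2 * L) * (\<integral>\<^sup>+x. ennreal \<bar>\<phi> x - u x\<bar> \<partial>lborel) +
    ennreal ((q + 4 * m) * (Q (2 * L * \<sigma>) L + 4 * L * \<sigma>) / \<omega> / \<bar>ln h\<bar>)"
proof -
  define Y where "Y = theta_flow h \<theta> (be (h powr (1 / (2 * \<beta>)))) t"
  have tt: "t \<in> {0..t}" using t by simp
  have WL: "compressible L (W \<tau>)" if "\<tau> \<in> {0<..<t}" for \<tau> using that by (intro flow_compressible) simp
  note est = theta_flow_estimate[OF N h tt WL less_imp_le[OF L_pos], folded Y_def]
  have Wc: "compressible L (W t)" by (rule flow_compressible[OF tt])
  have Ym: "Y \<in> borel_measurable borel" and Wtm: "W t \<in> borel_measurable borel"
    using compressible_measurable[OF est(1)] compressible_measurable[OF Wc] by simp_all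
  have hp: "0 < h" "h < 1" using N h(1) pos order_le_less_trans[OF h(2) h0(2)] by simp_all
  define y where "y = \<omega> * \<bar>ln h\<bar>"
  have y: "0 < y" unfolding y_def using hp by (intro mult_pos_pos omega_pos) simp
  define E where "E = Y -` S \<union> W t -` S"
  have YS: "Y -` S \<in> sets lborel" "W t -` S \<in> sets lborel"
    using measurable_sets[OF Ym S(1)] measurable_sets[OF Wtm S(1)] by simp_all
  define e where "e = 2 * L * \<sigma>"
  have e0: "0 \<le> e" using L_pos S(3) by (simp add: e_def)
  have E: "E \<in> sets borel" using YS by (simp add: E_def)
  have Ee: "emeasure lborel E \<le> ennreal e"
  proof -
    have le: "emeasure lborel (X -` S) \<le> ennreal (L * \<sigma>)" if "compressible L X" for X
    proof -
      have "emeasure lborel (X -` S) \<le> ennreal L * emeasure lborel S" by (rule compressible_emeasure[OF that S(1)])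
      also have "\<dots> \<le> ennreal L * ennreal \<sigma>" by (intro mult_left_mono S(4)) simp
      finally show ?thesis using L_pos by (simp add: ennreal_mult' less_imp_le)
    qed
    have "emeasure lborel E \<le> emeasure lborel (Y -` S) + emeasure lborel (W t -` S)"
      unfolding E_def using YS by (rule emeasure_subadditive)
    also have "\<dots> \<le> ennreal (L * \<sigma>) + ennreal (L * \<sigma>)" by (intro add_mono le est(1) Wc)
    also have "\<dots> = ennreal e" using L_pos S(3) by (simp add: e_def flip: ennreal_plus)
    finally show ?thesis .
  qed
  define B where "B = (q + 4 * m) / y"
  have B0: "0 \<le> B" using \<phi>(2,4) y by (simp add: B_def)
  have QL: "0 \<le> Q e L"
    unfolding Q using pos e0 L_pos maximal_const_nonneg[OF pos(2), where 'n='n] by simp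
  define g where "g x = ennreal (ln (1 + norm (Y x - W t x) / h powr \<omega>))" for x
  have gm: "(\<lambda>x. g x * indicator E x) \<in> borel_measurable lborel"
    unfolding measurable_lborel2 g_def using Ym Wtm E by (intro borel_measurable_times_ennreal borel_measurable_indicator) simp_all
  have mid: "(\<integral>\<^sup>+x. ennreal \<bar>\<phi> (Y x) - \<phi> (W t x)\<bar> \<partial>lborel) \<le> ennreal (B * (Q e L + 2 * e))"
  proof -
    have "(\<integral>\<^sup>+x. ennreal \<bar>\<phi> (Y x) - \<phi> (W t x)\<bar> \<partial>lborel) \<le> (\<integral>\<^sup>+x. ennreal B * (g x * indicator E x + ennreal 2 * indicator E x) \<partial>lborel)"
    proof (rule nn_integral_mono)
      fix x
      show "ennreal \<bar>\<phi> (Y x) - \<phi> (W t x)\<bar> \<le> ennreal B * (g x * indicator E x + ennreal 2 * indicator E x)"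
      proof (cases "x \<in> E")
        case True
        have "\<bar>\<phi> (Y x) - \<phi> (W t x)\<bar> \<le> B * (ln (1 + norm (Y x - W t x) / h powr \<omega>) + 2)"
          unfolding B_def y_def using \<phi> hp omega_pos by (intro test_function_log_bound) simp_all
        from ennreal_leI[OF this] B0 show ?thesis using True by (simp add: g_def ennreal_mult' ennreal_plus)
      next
        case False
        then show ?thesis using S(2)[of "Y x"] S(2)[of "W t x"] by (simp add: E_def)
      qed
    qed
    also have "\<dots> = ennreal B * ((\<integral>\<^sup>+x. g x * indicator E x \<partial>lborel) + ennreal 2 * emeasure lborel E)"
      using gm E by (subst nn_integral_cmult) (simp_all add: nn_integral_add nn_integral_cmult_indicator)
    also have "\<dots> \<le> ennreal B * (ennreal (Q e L) + ennreal 2 * ennreal e)"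
      using est(2)[OF _ E Ee e0] unfolding g_def by (intro mult_left_mono add_mono Ee) simp_all
    also have "\<dots> = ennreal (B * (Q e L + 2 * e))"
      using B0 QL e0 by (simp add: ennreal_mult' ennreal_plus)
    finally show ?thesis .
  qed
  have out: "(\<integral>\<^sup>+x. ennreal \<bar>\<phi> (X x) - u (X x)\<bar> \<partial>lborel) \<le> ennreal L * (\<integral>\<^sup>+x. ennreal \<bar>\<phi> x - u x\<bar> \<partial>lborel)"
    if "compressible L X" for X
    using \<phi>(5) u by (intro compressible_nn_integral[OF that, of "\<lambda>x. ennreal \<bar>\<phi> x - u x\<bar>"]) simp
  define I where "I = (\<integral>\<^sup>+x. ennreal \<bar>\<phi> x - u x\<bar> \<partial>lborel)"
  have cm: "(\<lambda>x. w (X x)) \<in> borel_measurable lborel" if "X \<in> borel_measurable borel" "w \<in> borel_measurable borel"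
    for X :: "real^'n \<Rightarrow> real^'n" and w :: "real^'n \<Rightarrow> real"
    unfolding measurable_lborel2 using that by (rule measurable_compose)
  have "(\<integral>\<^sup>+x. ennreal \<bar>u (Y x) - u (W t x)\<bar> \<partial>lborel) \<le>
    (\<integral>\<^sup>+x. ennreal \<bar>\<phi> (Y x) - u (Y x)\<bar> + ennreal \<bar>\<phi> (W t x) - u (W t x)\<bar> + ennreal \<bar>\<phi> (Y x) - \<phi> (W t x)\<bar> \<partial>lborel)"
  proof (rule nn_integral_mono)
    fix x
    have "\<bar>u (Y x) - u (W t x)\<bar> \<le> \<bar>\<phi> (Y x) - u (Y x)\<bar> + \<bar>\<phi> (W t x) - u (W t x)\<bar> + \<bar>\<phi> (Y x) - \<phi> (W t x)\<bar>" by linarith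
    from ennreal_leI[OF this] show "ennreal \<bar>u (Y x) - u (W t x)\<bar> \<le>
      ennreal \<bar>\<phi> (Y x) - u (Y x)\<bar> + ennreal \<bar>\<phi> (W t x) - u (W t x)\<bar> + ennreal \<bar>\<phi> (Y x) - \<phi> (W t x)\<bar>"
      by (simp add: ennreal_plus)
  qed
  also have "\<dots> = (\<integral>\<^sup>+x. ennreal \<bar>\<phi> (Y x) - u (Y x)\<bar> \<partial>lborel) + (\<integral>\<^sup>+x. ennreal \<bar>\<phi> (W t x) - u (W t x)\<bar> \<partial>lborel) +
     (\<integral>\<^sup>+x. ennreal \<bar>\<phi> (Y x) - \<phi> (W t x)\<bar> \<partial>lborel)"
    using cm[OF Ym u] cm[OF Ym \<phi>(5)] cm[OF Wtm u] cm[OF Wtm \<phi>(5)] by (simp add: nn_integral_add)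
  also have "\<dots> \<le> ennreal L * I + ennreal L * I + ennreal (B * (Q e L + 2 * e))"
    unfolding I_def by (intro add_mono out mid est(1) Wc)
  also have "ennreal L * I + ennreal L * I = ennreal (2 * L) * I"
    using L_pos by (simp only: mult_2 ennreal_plus less_imp_le distrib_right)
  also have "B * (Q e L + 2 * e) = (q + 4 * m) * (Q (2 * L * \<sigma>) L + 4 * L * \<sigma>) / \<omega> / \<bar>ln h\<bar>"
    by (simp add: B_def y_def e_def)
  finally show ?thesis unfolding Y_def I_def .
qed

end

text \<open>Composing a Lebesgue measurable function with a Borel map may destroy measurability.
  Here the null set on which \<open>u\<close> differs from a Borel function has a null
  preimage.\<close>

lemma compressible_integrable:
  fixes u :: "real^'n \<Rightarrow> real"
  assumes u: "integrable lebesgue u" and X: "compressible L X" and Z: "AE x in lborel. Z x = X x"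
  shows "integrable lebesgue (\<lambda>x. u (Z x))"
proof -
  obtain v where v: "v \<in> borel_measurable borel" "AE x in lborel. u x = v x"
    using lebesgue_ex_borel[OF borel_measurable_integrable[OF u]] by (elim bexE)
  have vl: "v \<in> borel_measurable lebesgue" by (rule measurable_completion) (use v(1) in simp)
  have "AE x in lebesgue. u x = v x" using v(2) by (simp add: AE_completion_iff)
  from integrable_cong_AE[OF borel_measurable_integrable[OF u] vl this]
  have "integrable lborel v" using u v(1) by (simp add: integrable_completion)
  then have fin: "(\<integral>\<^sup>+x. ennreal (norm (v x)) \<partial>lborel) < \<infinity>" by (simp add: integrable_iff_bounded)
  have Xm: "X \<in> borel_measurable borel" by (rule compressible_measurable[OF X])
  have vX: "(\<lambda>x. v (X x)) \<in> borel_measurable borel" by (rule measurable_compose[OF Xm v(1)])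
  have "(\<integral>\<^sup>+x. ennreal (norm (v (X x))) \<partial>lborel) \<le> ennreal L * (\<integral>\<^sup>+x. ennreal (norm (v x)) \<partial>lborel)"
    using v(1) by (intro compressible_nn_integral[OF X, of "\<lambda>x. ennreal (norm (v x))"]) simp
  also have "\<dots> < \<infinity>" using fin by (simp add: ennreal_mult_less_top)
  finally have "integrable lborel (\<lambda>x. v (X x))" using vX by (intro integrableI_bounded) simp_all
  then have int: "integrable lebesgue (\<lambda>x. v (X x))" using vX by (simp add: integrable_completion)
  have ae: "AE x in lborel. u (Z x) = v (X x)" using compressible_AE[OF X v(2)] Z by eventually_elim simp
  have uZ: "(\<lambda>x. u (Z x)) \<in> borel_measurable lebesgue" by (rule borel_measurable_lebesgue_AE[OF vX ae])
  have "AE x in lebesgue. u (Z x) = v (X x)" using ae by (simp add: AE_completion_iff)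
  from integrable_cong_AE[OF uZ borel_measurable_integrable[OF int] this] int show ?thesis by simp
qed

context backward_problem
begin

text \<open>Because both flows pull null sets back to null sets, \<open>u\<close> may be exchanged
  for a Borel representative on either side.\<close>

lemma solution_L1_estimate:
  assumes N: "0 < N" and h: "h = T / real N" "h \<le> h0"
    and \<phi>: "\<And>x y. \<bar>\<phi> x - \<phi> y\<bar> \<le> q * norm (x - y)" "0 \<le> q" "\<And>x. \<bar>\<phi> x\<bar> \<le> m" "0 \<le> m" "\<phi> \<in> borel_measurable borel"
    and S: "S \<in> sets borel" "\<And>x. x \<notin> S \<Longrightarrow> \<phi> x = 0" "0 \<le> \<sigma>" "emeasure lborel S \<le> ennreal \<sigma>"
    and u: "integrable lebesgue u" and Z: "AE x in lborel. Z x = W t x"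
  shows "L1_norm (\<lambda>x. u (theta_flow h \<theta> (be (h powr (1 / (2 * \<beta>)))) t x) - u (Z x)) \<le>
    ennreal (2 * L) * L1_norm (\<lambda>x. \<phi> x - u x) + ennreal ((q + 4 * m) * (Q (2 * L * \<sigma>) L + 4 * L * \<sigma>) / \<omega> / \<bar>ln h\<bar>)"
proof -
  define X where "X = theta_flow h \<theta> (be (h powr (1 / (2 * \<beta>)))) t"
  have tt: "t \<in> {0..t}" using t by simp
  have XL: "compressible L X" unfolding X_def
    by (rule theta_flow_estimate(1)[OF N h tt flow_compressible less_imp_le[OF L_pos]]) simp
  obtain v where v: "v \<in> borel_measurable borel" "AE x in lborel. u x = v x"
    using lebesgue_ex_borel[OF borel_measurable_integrable[OF u]] by (elim bexE)
  have "L1_norm (\<lambda>x. u (X x) - u (Z x)) = (\<integral>\<^sup>+x. ennreal (norm (u (X x) - u (Z x))) \<partial>lborel)"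
    unfolding L1_norm_def by (rule nn_integral_completion)
  also have "\<dots> = (\<integral>\<^sup>+x. ennreal \<bar>v (X x) - v (W t x)\<bar> \<partial>lborel)"
  proof (rule nn_integral_cong_AE)
    show "AE x in lborel. ennreal (norm (u (X x) - u (Z x))) = ennreal \<bar>v (X x) - v (W t x)\<bar>"
      using compressible_AE[OF XL v(2)] compressible_AE[OF flow_compressible[OF tt] v(2)] Z by eventually_elim simp
  qed
  also have "\<dots> \<le> ennreal (2 * L) * (\<integral>\<^sup>+x. ennreal \<bar>\<phi> x - v x\<bar> \<partial>lborel) +
    ennreal ((q + 4 * m) * (Q (2 * L * \<sigma>) L + 4 * L * \<sigma>) / \<omega> / \<bar>ln h\<bar>)"
    unfolding X_def by (rule solution_estimate[OF N h \<phi> S v(1)])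
  also have "(\<integral>\<^sup>+x. ennreal \<bar>\<phi> x - v x\<bar> \<partial>lborel) = (\<integral>\<^sup>+x. ennreal (norm (\<phi> x - u x)) \<partial>lborel)"
    by (rule nn_integral_cong_AE) (use v(2) in \<open>auto elim: eventually_mono\<close>)
  also have "\<dots> = L1_norm (\<lambda>x. \<phi> x - u x)" unfolding L1_norm_def by (rule nn_integral_completion[symmetric])
  finally show ?thesis unfolding X_def .
qed

lemma solution_integrable:
  fixes u :: "real^'n \<Rightarrow> real"
  assumes N: "0 < N" and h: "h = T / real N" "h \<le> h0" and u: "integrable lebesgue u" and Z: "AE x in lborel. Z x = W t x"
  shows "integrable lebesgue (\<lambda>x. u (theta_flow h \<theta> (be (h powr (1 / (2 * \<beta>)))) t x))" "integrable lebesgue (\<lambda>x. u (Z x))"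
proof -
  have tt: "t \<in> {0..t}" using t by simp
  have "compressible L (theta_flow h \<theta> (be (h powr (1 / (2 * \<beta>)))) t)"
    by (rule theta_flow_estimate(1)[OF N h tt flow_compressible less_imp_le[OF L_pos]]) simp
  then show "integrable lebesgue (\<lambda>x. u (theta_flow h \<theta> (be (h powr (1 / (2 * \<beta>)))) t x))"
    by (rule compressible_integrable[OF u]) simp
  show "integrable lebesgue (\<lambda>x. u (Z x))" by (rule compressible_integrable[OF u flow_compressible[OF tt] Z])
qed

end

text \<open>The constants are given before the data that depend on \<open>t\<close>, so the same
  \<open>L\<close>, \<open>Q\<close> and \<open>h0\<close> serve every \<open>t\<close>; this
  uniformity later permits the supremum over \<open>t\<close>.\<close>

lemma backward_problem_exists:
  fixes b :: "real \<Rightarrow> real^'n \<Rightarrow> real^'n"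
  assumes haj: "\<And>(f :: real^'n \<Rightarrow> real^'n) Df. in_W1p p f Df \<Longrightarrow>
    lipschitz_L1_limit f \<Longrightarrow> hajlasz_bound k f (maximal_norm Df)"
    and pos: "0 < T" "1 < p" "0 \<le> G" "0 < C0" "0 < C1" "0 < C2" "0 < C3" "0 < \<alpha>" "0 < \<beta>" "0 \<le> \<theta>" "\<theta> \<le> 1" "0 \<le> k"
    and t: "t \<in> {0..T}"
    and omega: "\<omega> = min (1 / 2) (\<alpha> / (2 * \<beta>)) / 2"
    and L: "L = det_const TYPE('n) * exp (4 * T * (C2 + det_const TYPE('n) * C1\<^sup>2))"
    and h0: "0 < h0" "h0 < 1" "h0 \<le> 1 / (8 * C1)\<^sup>2" "h0 \<le> 1 / (2 * (C2 + det_const TYPE('n) * C1\<^sup>2))" "h0 \<le> max 1 C3 powr (- 1 / \<omega>)"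
    and Q: "\<And>e l. Q e l = 2 * e + (C1 * T * e + L * C0) +
      k * ((T + G) * (e + L * maximal_const TYPE('n) p) + (T + G) * (e + l * maximal_const TYPE('n) p))"
    and b: "in_L1_W1p T p b Db" "L1_Lp_norm T p Db = G"
    and Y: "regular_lagrangian_flow t (backward_field b t) Y"
    and ap: "approximating_sequence T (backward_field b t) be C0 C1 C2 C3 \<alpha> \<beta>"
  shows "\<exists>c W F D Df A. backward_problem T t p G C0 C1 C2 C3 \<alpha> \<beta> \<theta> k \<omega> L h0 Q be c W F D Df A \<and> (AE x in lborel. Y t x = W t x)"
proof -
  have t0: "0 \<le> t" "t \<le> T" using t by simp_all
  obtain c D A where cm: "jointly_borel c"
    and Dm: "(\<lambda>z. D (fst z) (snd z) :: real^'n^'n) \<in> borel_measurable borel"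
    and A: "A \<in> borel_measurable borel" "\<forall>\<tau>. 0 \<le> A \<tau>" "(\<integral>\<^sup>+\<tau>\<in>{0<..<t}. ennreal (A \<tau>) \<partial>lborel) \<le> ennreal G"
    and eq: "AE z in lborel. fst z \<in> {0<..<t} \<longrightarrow> backward_field b t (fst z) (snd z) = c (fst z) (snd z)"
    and W: "AE \<tau> in lborel. \<tau> \<in> {0<..<t} \<longrightarrow> in_W1p p (backward_field b t \<tau>) (\<lambda>y. - Db (t - \<tau>) y) \<and>
       (AE y in lborel. - Db (t - \<tau>) y = D \<tau> y) \<and> Lp_norm p (\<lambda>y. - Db (t - \<tau>) y) = A \<tau>"
    using backward_data[OF b t] by (elim exE conjE)
  have approx: "\<exists>a. nice_field (C1 / \<epsilon> powr \<beta>) C3 C2 a \<and> (AE \<tau> in lborel. \<tau> \<in> {0<..<T} \<longrightarrow> (\<forall>y. be \<epsilon> \<tau> y = a \<tau> y)) \<and>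
    (\<integral>\<^sup>+\<tau>\<in>{0<..<t}. (\<integral>\<^sup>+y. ennreal (norm (a \<tau> y - c \<tau> y)) \<partial>lborel) \<partial>lborel) \<le> ennreal (C0 * \<epsilon> powr \<alpha>)" if "0 < \<epsilon>" for \<epsilon>
    using pos by (intro approximating_sequence_representative[OF ap _ _ _ t0(2) cm eq that]) simp_all
  obtain X l where Xm: "jointly_borel X" and l: "0 < l" "\<forall>\<tau>. compressible l (X \<tau>)"
    and XY: "AE x in lborel. \<forall>s\<in>{0..t}. X s x = Y s x"
    and flow: "AE x in lborel. \<forall>s\<in>{0..t}. integrable lborel (\<lambda>\<tau>. indicator {0..s} \<tau> *\<^sub>R c \<tau> (X \<tau> x)) \<and>
      X s x = x + (LINT \<tau>|lborel. indicator {0..s} \<tau> *\<^sub>R c \<tau> (X \<tau> x))"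
    using flow_representative[OF Y t0(1) cm eq] by (elim exE conjE)
  have "AE \<tau> in lborel. \<tau> \<in> {0<..<t} \<longrightarrow> hajlasz_bound k (c \<tau>) (maximal_norm (D \<tau>))"
  proof (rule hajlasz_along_time[OF haj cm eq W _ less_imp_le[OF pos(5)] pos(8)])
    fix \<epsilon> :: real assume "0 < \<epsilon>"
    from approx[OF this] show "\<exists>a. nice_field (C1 / \<epsilon> powr \<beta>) C3 C2 a \<and>
      (\<integral>\<^sup>+\<tau>\<in>{0<..<t}. (\<integral>\<^sup>+y. ennreal (norm (a \<tau> y - c \<tau> y)) \<partial>lborel) \<partial>lborel) \<le> ennreal (C0 * \<epsilon> powr \<alpha>)"
      by (elim exE conjE) (intro exI conjI)
  qed
  then have "backward_problem T t p G C0 C1 C2 C3 \<alpha> \<beta> \<theta> k \<omega> L h0 Q be c X (backward_field b t) D (\<lambda>\<tau> y. - Db (t - \<tau>) y) A"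
    by (intro backward_problem.intro pos t0 omega L h0 Q cm Dm A(1,3) A(2)[rule_format] W approx Xm flow exI[of _ l] conjI l)
  moreover have "AE x in lborel. Y t x = X t x" using XY by eventually_elim (use t0 in simp)
  ultimately show ?thesis by (intro exI conjI)
qed

theorem theorem2:
  fixes T p B G C1 C2 :: real
  assumes "0 < T" and "1 < p" and "0 \<le> B" and "0 \<le> G" and "0 < C1" and "0 < C2"
  shows "\<exists>C>0.
    \<forall>(b :: real \<Rightarrow> real^'n \<Rightarrow> real^'n) Db \<theta> Y be C0 C3 \<alpha> \<beta>.
      in_L1_W1p T p b Db \<and> L1_Lp_norm T p Db = G \<and> Linf_norm T b = ennreal B \<and>
      divergence_free T Db \<and>
      0 \<le> \<theta> \<and> \<theta> \<le> 1 \<and>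
      backward_flow T b Y \<and>
      0 < C0 \<and> 0 < C3 \<and> 0 < \<alpha> \<and> 0 < \<beta> \<and>
      (\<forall>t\<in>{0..T}. approximating_sequence T (backward_field b t) (be t) C0 C1 C2 C3 \<alpha> \<beta>)
      \<longrightarrow>
      (\<exists>h0. 0 < h0 \<and> h0 < 1 \<and>
        (\<forall>(u0 :: real^'n \<Rightarrow> real) (u0d :: real \<Rightarrow> real^'n \<Rightarrow> real).
          integrable lebesgue u0 \<and>
          (\<forall>\<delta>>0. test_function (u0d \<delta>)) \<and>
          ((\<lambda>\<delta>. L1_norm (\<lambda>x. u0d \<delta> x - u0 x)) \<longlongrightarrow> 0) (at_right 0)
          \<longrightarrow>
          (\<forall>N>0. T / real N \<le> h0 \<longrightarrow>
            (\<forall>t\<in>{0..T}. integrable lebesgue (approx_solution \<theta> \<beta> be u0 (T / real N) t) \<and>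
                        integrable lebesgue (lagrangian_solution Y u0 t))) \<and>
          (\<forall>\<delta>>0. \<exists>C\<delta>>0. \<forall>N>0. T / real N \<le> h0 \<longrightarrow>
            (SUP t\<in>{0..T}. L1_norm (\<lambda>x. approx_solution \<theta> \<beta> be u0 (T / real N) t x
                                          - lagrangian_solution Y u0 t x))
              \<le> ennreal C * (L1_norm (\<lambda>x. u0d \<delta> x - u0 x)
                             + ennreal (C\<delta> / \<bar>ln (T / real N)\<bar>))) \<and>
          (\<lambda>N. LinfL1_norm T (\<lambda>t x. approx_solution \<theta> \<beta> be u0 (T / real N) t x
                                     - lagrangian_solution Y u0 t x)) \<longlonglongrightarrow> 0))"
proof -
  define \<mu> where "\<mu> = C2 + det_const TYPE('n) * C1\<^sup>2"
  define L where "L = det_const TYPE('n) * exp (4 * T * \<mu>)"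
  \<comment> \<open>The error of the test function is transported along both flows, which gives 2 L.
    The summand 1 makes \<open>C\<close> at least 1, so that it may also stand in front of the
    logarithmic term.\<close>
  define C where "C = 2 * L + 1"
  have \<mu>0: "0 < \<mu>" unfolding \<mu>_def using assms det_const_pos[where 'n='n] by (intro add_pos_nonneg) simp_all
  have L0: "0 < L" using det_const_pos[where 'n='n] by (simp add: L_def)
  then have C0: "0 < C" by (simp add: C_def)
  obtain k where k: "0 < k" "\<forall>p (f :: real^'n \<Rightarrow> real^'n) Df. 1 < p \<longrightarrow> in_W1p p f Df \<longrightarrow>
    lipschitz_L1_limit f \<longrightarrow> hajlasz_bound k f (maximal_norm Df)"
    using hajlasz by (elim exE conjE)
  show ?thesis
  proof (rule exI[of _ C], intro conjI C0 allI impI, elim conjE, goal_cases)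
    case (1 b Db \<theta> Y be C0' C3 \<alpha> \<beta>)
    note H = this
    define \<omega> where "\<omega> = min (1 / 2) (\<alpha> / (2 * \<beta>)) / 2"
    \<comment> \<open>The bound 1/2 keeps h below 1, where ln h is negative; the other entries are
      the smallness conditions of \<open>backward_problem\<close>. The constants \<open>C0'\<close>,
      \<open>C3\<close>, \<alpha> and \<beta>, unknown when \<open>C\<close> is fixed, are absorbed
      here and in the constant that depends on \<delta>.\<close>
    define h0 where "h0 = Min {1 / 2, 1 / (8 * C1)\<^sup>2, 1 / (2 * \<mu>), max 1 C3 powr (- 1 / \<omega>)}"
    define Q where "Q e l = 2 * e + (C1 * T * e + L * C0') +
      k * ((T + G) * (e + L * maximal_const TYPE('n) p) + (T + G) * (e + l * maximal_const TYPE('n) p))" for e l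
    have h0: "0 < h0" "h0 < 1" "h0 \<le> 1 / (8 * C1)\<^sup>2" "h0 \<le> 1 / (2 * \<mu>)" "h0 \<le> max 1 C3 powr (- 1 / \<omega>)"
      using assms \<mu>0 by (simp_all add: h0_def)
    have \<omega>0: "0 < \<omega>" using H by (simp add: \<omega>_def)
    have ex: "\<exists>c W F D Df A. backward_problem T t p G C0' C1 C2 C3 \<alpha> \<beta> \<theta> k \<omega> L h0 Q (be t) c W F D Df A \<and>
      (AE x in lborel. Y t t x = W t x)" if t: "t \<in> {0..T}" for t
    proof (rule backward_problem_exists[where Y = "Y t" and b = b and Db = Db])
      show "regular_lagrangian_flow t (backward_field b t) (Y t)" using H t by (simp add: backward_flow_def)
      show "approximating_sequence T (backward_field b t) (be t) C0' C1 C2 C3 \<alpha> \<beta>" using H t by blast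
      show "hajlasz_bound k f (maximal_norm Df)"
        if "in_W1p p f Df" "lipschitz_L1_limit f" for f :: "real^'n \<Rightarrow> real^'n" and Df
        by (rule k(2)[THEN spec, THEN spec, THEN spec, THEN mp, THEN mp, THEN mp, OF assms(2) that])
    qed (use H assms k(1) t h0 in \<open>simp_all add: \<omega>_def L_def \<mu>_def[symmetric] Q_def less_imp_le\<close>)
    have rate: "\<exists>R>0. \<forall>N>0. T / real N \<le> h0 \<longrightarrow>
      (SUP t\<in>{0..T}. L1_norm (\<lambda>x. approx_solution \<theta> \<beta> be u0 (T / real N) t x - lagrangian_solution Y u0 t x))
        \<le> ennreal C * (L1_norm (\<lambda>x. u0d \<delta> x - u0 x) + ennreal (R / \<bar>ln (T / real N)\<bar>))"
      if "integrable lebesgue u0 \<and> (\<forall>\<delta>>0. test_function (u0d \<delta>)) \<and> ((\<lambda>\<delta>. L1_norm (\<lambda>x. u0d \<delta> x - u0 x)) \<longlongrightarrow> 0) (at_right 0)"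
        "0 < \<delta>" for u0 :: "real^'n \<Rightarrow> real" and u0d :: "real \<Rightarrow> real^'n \<Rightarrow> real" and \<delta>
    proof -
      from that have u: "integrable lebesgue u0" and "test_function (u0d \<delta>)" by simp_all
      from test_function_lipschitz_bounded[OF this(2)]
      obtain q m S \<sigma> where \<phi>: "0 \<le> q" "\<forall>x y. \<bar>u0d \<delta> x - u0d \<delta> y\<bar> \<le> q * norm (x - y)" "0 \<le> m" "\<forall>x. \<bar>u0d \<delta> x\<bar> \<le> m"
        "u0d \<delta> \<in> borel_measurable borel" "S \<in> sets borel" "\<forall>x. x \<notin> S \<longrightarrow> u0d \<delta> x = 0" "0 \<le> \<sigma>" "emeasure lborel S \<le> ennreal \<sigma>"
        by (elim exE conjE)
      \<comment> \<open>Depends on the Lipschitz constant, the bound and the support of the test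
        function at \<delta>, hence may blow up as \<delta> tends to 0, but involves neither
        \<open>N\<close> nor \<open>t\<close>.\<close>
      define R where "R = (q + 4 * m) * (Q (2 * L * \<sigma>) L + 4 * L * \<sigma>) / \<omega>"
      have "0 \<le> Q (2 * L * \<sigma>) L" unfolding Q_def
        using H assms L0 k(1) \<phi>(8) maximal_const_nonneg[OF assms(2), where 'n='n] by simp
      then have R0: "0 \<le> R" unfolding R_def using \<phi>(1,3,8) L0 \<omega>0 by simp
      show ?thesis
      proof (intro exI[of _ "R + 1"] conjI allI impI SUP_least)
        \<comment> \<open>\<open>R\<close> vanishes for the zero test function, whereas the constant
          has to be positive.\<close>
        show "0 < R + 1" using R0 by simp
        fix N t assume N: "0 < N" "T / real N \<le> h0" and t: "t \<in> {0..T}"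
        define h where "h = T / real N"
        obtain c W F D Df A where bp: "backward_problem T t p G C0' C1 C2 C3 \<alpha> \<beta> \<theta> k \<omega> L h0 Q (be t) c W F D Df A"
          and YW: "AE x in lborel. Y t t x = W t x" using ex[OF t] by (elim exE conjE)
        define I where "I = L1_norm (\<lambda>x. u0d \<delta> x - u0 x)"
        have "L1_norm (\<lambda>x. approx_solution \<theta> \<beta> be u0 h t x - lagrangian_solution Y u0 t x) \<le> ennreal (2 * L) * I + ennreal (R / \<bar>ln h\<bar>)"
          unfolding approx_solution_def lagrangian_solution_def R_def I_def
          by (rule backward_problem.solution_L1_estimate[OF bp N(1) h_def N(2)[folded h_def] \<phi>(2)[rule_format] \<phi>(1) \<phi>(4)[rule_format] \<phi>(3,5,6)
            \<phi>(7)[rule_format] \<phi>(8,9) u YW])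
        also have "\<dots> \<le> ennreal C * I + ennreal C * ennreal ((R + 1) / \<bar>ln h\<bar>)"
        proof (intro add_mono mult_right_mono)
          show "ennreal (2 * L) \<le> ennreal C" by (simp add: C_def ennreal_leI)
          have "R / \<bar>ln h\<bar> \<le> 1 * ((R + 1) / \<bar>ln h\<bar>)" by (simp add: divide_right_mono)
          also have "\<dots> \<le> C * ((R + 1) / \<bar>ln h\<bar>)" using L0 R0 by (intro mult_right_mono) (simp_all add: C_def)
          finally show "ennreal (R / \<bar>ln h\<bar>) \<le> ennreal C * ennreal ((R + 1) / \<bar>ln h\<bar>)"
            using C0 by (simp add: ennreal_leI flip: ennreal_mult')
        qed simp
        also have "\<dots> = ennreal C * (I + ennreal ((R + 1) / \<bar>ln h\<bar>))" by (simp add: distrib_left)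
        finally show "L1_norm (\<lambda>x. approx_solution \<theta> \<beta> be u0 (T / real N) t x - lagrangian_solution Y u0 t x)
          \<le> ennreal C * (L1_norm (\<lambda>x. u0d \<delta> x - u0 x) + ennreal ((R + 1) / \<bar>ln (T / real N)\<bar>))"
          unfolding h_def I_def .
      qed
    qed
    show ?case
    proof (rule exI[of _ h0], intro conjI allI impI h0(1,2), goal_cases)
      case (1 u0 u0d N)
      then have u: "integrable lebesgue u0" and N: "0 < N" "T / real N \<le> h0" by simp_all
      show ?case
      proof (intro ballI conjI)
        fix t assume t: "t \<in> {0..T}"
        obtain c W F D Df A where bp: "backward_problem T t p G C0' C1 C2 C3 \<alpha> \<beta> \<theta> k \<omega> L h0 Q (be t) c W F D Df A"
          and YW: "AE x in lborel. Y t t x = W t x" using ex[OF t] by (elim exE conjE)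
        note int = backward_problem.solution_integrable[OF bp N(1) refl N(2) u YW]
        show "integrable lebesgue (approx_solution \<theta> \<beta> be u0 (T / real N) t)"
          unfolding approx_solution_def[abs_def] by (rule int(1))
        show "integrable lebesgue (lagrangian_solution Y u0 t)"
          unfolding lagrangian_solution_def[abs_def] by (rule int(2))
      qed
    next
      case (2 u0 u0d \<delta>)
      then show ?case by (rule rate)
    next
      case (3 u0 u0d)
      define X where "X N = LinfL1_norm T (\<lambda>t x. approx_solution \<theta> \<beta> be u0 (T / real N) t x - lagrangian_solution Y u0 t x)" for N
      show ?case
        unfolding X_def[symmetric]
      proof (rule order_tendstoI)
        fix a :: ennreal assume "0 < a"
        then obtain y where y: "0 < y" "y < a" using dense by blast
        have "y < top" using order_less_le_trans[OF y(2) top_greatest] .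
        with y(1) obtain e where e: "0 < e" "y = ennreal e" by (cases y) auto
        \<comment> \<open>Two terms below e', multiplied by \<open>C\<close>, add up to at most
          \<open>e\<close>. First \<delta> is chosen to make the L1 error of the test function
          small, and only then \<open>N\<close>, because \<open>R\<close> depends on
          \<delta>.\<close>
        define e' where "e' = e / (2 * C)"
        have e': "0 < e'" using e C0 by (simp add: e'_def)
        have "\<forall>\<^sub>F \<delta> in at_right 0. L1_norm (\<lambda>x. u0d \<delta> x - u0 x) < ennreal e'"
          using e' by (intro order_tendstoD(2)[OF 3[THEN conjunct2, THEN conjunct2]]) simp
        then have "\<forall>\<^sub>F \<delta> in at_right 0. L1_norm (\<lambda>x. u0d \<delta> x - u0 x) < ennreal e' \<and> 0 < \<delta>"
          using eventually_at_right_less by (rule eventually_conj)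
        then obtain \<delta> where \<delta>: "L1_norm (\<lambda>x. u0d \<delta> x - u0 x) < ennreal e'" "0 < \<delta>"
          using eventually_happens'[OF trivial_limit_at_right_real] by blast
        obtain R where R: "0 < R" "\<And>N. 0 < N \<Longrightarrow> T / real N \<le> h0 \<Longrightarrow>
          (SUP t\<in>{0..T}. L1_norm (\<lambda>x. approx_solution \<theta> \<beta> be u0 (T / real N) t x - lagrangian_solution Y u0 t x))
            \<le> ennreal C * (L1_norm (\<lambda>x. u0d \<delta> x - u0 x) + ennreal (R / \<bar>ln (T / real N)\<bar>))"
          using rate[OF 3 \<delta>(2)] by blast
        have "(\<lambda>N. T / real N) \<longlonglongrightarrow> 0" by real_asymp
        then have "\<forall>\<^sub>F N in sequentially. T / real N < h0" using h0(1) by (rule order_tendstoD(2))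
        moreover have "(\<lambda>N. R / \<bar>ln (T / real N)\<bar>) \<longlonglongrightarrow> 0" using assms(1) by real_asymp
        then have "\<forall>\<^sub>F N in sequentially. R / \<bar>ln (T / real N)\<bar> < e'" using e' by (rule order_tendstoD(2))
        ultimately show "\<forall>\<^sub>F N in sequentially. X N < a"
          using eventually_gt_at_top[of "0 :: nat"]
        proof eventually_elim
          case (elim N)
          \<comment> \<open>A bound valid at every \<open>t\<close> bounds the essential limit
            superior, with no measurability in \<open>t\<close> involved.\<close>
          have "X N \<le> (SUP t\<in>{0..T}. L1_norm (\<lambda>x. approx_solution \<theta> \<beta> be u0 (T / real N) t x - lagrangian_solution Y u0 t x))"
            unfolding X_def LinfL1_norm_def
          proof (rule Limsup_bounded)
            show "AE t in lebesgue_on {0<..<T}. L1_norm (\<lambda>x. approx_solution \<theta> \<beta> be u0 (T / real N) t x - lagrangian_solution Y u0 t x)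
              \<le> (SUP t\<in>{0..T}. L1_norm (\<lambda>x. approx_solution \<theta> \<beta> be u0 (T / real N) t x - lagrangian_solution Y u0 t x))"
              using AE_space by eventually_elim (intro SUP_upper, simp)
          qed
          also have "\<dots> \<le> ennreal C * (L1_norm (\<lambda>x. u0d \<delta> x - u0 x) + ennreal (R / \<bar>ln (T / real N)\<bar>))"
            using elim by (intro R(2)) simp_all
          also have "\<dots> \<le> ennreal C * (ennreal e' + ennreal e')"
            using \<delta>(1) elim by (intro mult_left_mono add_mono ennreal_leI) (simp_all add: less_imp_le)
          also have "\<dots> = ennreal C * ennreal (e' + e')" using e' by (subst ennreal_plus) simp_all
          also have "\<dots> = ennreal e" using C0 e' by (simp add: e'_def flip: ennreal_mult')
          also have "\<dots> < a" using y(2) e(2) by simp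
          finally show ?case .
        qed
      qed simp
    qed
  qed
qed

end
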